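(* Let $T>0$, $\alpha\in(0,1)$, let $\Omega\subset\mathbf{R}^d$ be a bounded domain, and let $F:(0,T]\times\Omega\times\mathbf{R}\times\mathbf{R}^d\times\mathbf{S}^d\to\mathbf{R}$ be continuous and such that for all $(t,x,p,X)\in(0,T]\times\Omega\times\mathbf{R}^d\times\mathbf{S}^d$, $F(t,x,w_1,p,X)\ge F(t,x,w_2,p,X)$ if $w_1\ge w_2$. Let $u,v:[0,T]\times\Omega\to\mathbf{R}$ be a bounded upper semicontinuous viscosity subsolution and a bounded lower semicontinuous viscosity supersolution, respectively, of $$\partial_t^\alpha u+F(t,x,u,\nabla u,\nabla^2u)=0\quad\text{in }(0,T]\times\Omega.$$ Let $\varphi\in C^2([0,T]\times\Omega\times\Omega)$, $\varepsilon>0$, and set $\Omega_\varepsilon:=\{x\in\Omega\mid\operatorname{dist}(x,\partial\Omega)>M\varepsilon^{1/2}\}$ with $M:=\max\{(2\sup_{[0,T]\times\Omega}|u|)^{1/2},(2\sup_{[0,T]\times\Omega}|v|)^{1/2}\}$. For $(t,x)\in[0,T]\times\Omega$ let $$u^\varepsilon(t,x)=\sup_{x'\in\Omega}\{u(t,x')-\varepsilon^{-1}|x-x'|^2\},\qquad v_\varepsilon(t,x)=\inf_{x'\in\Omega}\{v(t,x')+\varepsilon^{-1}|x-x'|^2\}.$$ Let $(\bar t,\bar x,\bar y)\in(0,T]\times\Omega_\varepsilon\times\Omega_\varepsilon$ be such that $$\max_{(t,x,y)\in[0,T]\times\overline{\Omega_\varepsilon}\times\overline{\Omega_\varepsilon}}(u^\varepsilon(t,x)-v_\varepsilon(t,y)-\varphi(t,x,y))=u^\varepsilon(\bar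 t,\bar x)-v_\varepsilon(\bar t,\bar y)-\varphi(\bar t,\bar x,\bar y).$$ Then there exist two matrices $X,Y\in\mathbf{S}^d$ satisfying $$-\frac{2}{\varepsilon}\begin{pmatrix}I&O\\O&I\end{pmatrix}\le\begin{pmatrix}X&O\\O&Y\end{pmatrix}\le\nabla^2_{x,y}\varphi(\bar t,\bar x,\bar y)$$ such that $K_{(0,\bar t)}[u^\varepsilon](\bar t,\bar x)-K_{(0,\bar t)}[v_\varepsilon](\bar t,\bar y)$ exists and $$\begin{aligned}&J[u^\varepsilon](\bar t,\bar x)-J[v_\varepsilon](\bar t,\bar y)+K_{(0,\bar t)}[u^\varepsilon](\bar t,\bar x)-K_{(0,\bar t)}[v_\varepsilon](\bar t,\bar y)\\&+F_\varepsilon(\bar t,\bar x,u^\varepsilon(\bar t,\bar x),\nabla_x\varphi(\bar t,\bar x,\bar y),X)-F^\varepsilon(\bar t,\bar y,v_\varepsilon(\bar t,\bar y),-\nabla_y\varphi(\bar t,\bar x,\bar y),-Y)\le0,\end{aligned}$$ where $$F_\varepsilon(t,x,w,p,X)=\min\{F(t,x',w,p,X)\mid x'\in\overline{B(x,M\varepsilon^{1/2})}\},\quad F^\varepsilon(t,x,w,p,X)=\max\{F(t,x',w,p,X)\mid x'\in\overline{B(x,M\varepsilon^{1/2})}\}.$$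
   Context: $\mathbf{S}^d$ is the space of real symmetric $d\times d$ matrices with the usual order; $I$ is the $d\times d$ identity matrix; $\nabla^2_{x,y}\varphi$ is the Hessian of $\varphi$ in $(x,y)$. $\operatorname{dist}(x,\partial\Omega)=\inf_{y\in\partial\Omega}|x-y|$. $\partial_t^\alpha$ denotes the Caputo time fractional derivative of order $\alpha$, $(\partial_t^\alpha u)(t,x)=\frac{1}{\Gamma(1-\alpha)}\int_0^t\frac{\partial_tu(s,x)}{(t-s)^\alpha}ds$; viscosity solutions are defined through the following operators. For a function $f$ on $[0,T]$ and $t\in(0,T]$, $$J[f](t)=\frac{f(t)-f(0)}{t^\alpha\Gamma(1-\alpha)},\qquad K_{(a,b)}[f](t)=\frac{\alpha}{\Gamma(1-\alpha)}\int_a^b(f(t)-f(t-\tau))\frac{d\tau}{\tau^{\alpha+1}}\quad(0\le a<b\le t).$$ For semicontinuous $f$ and $a>0$ the integral is a Lebesgue integral; $K_{(0,t)}[f](t)$ means $\lim_{a\searrow0}K_{(a,t)}[f](t)$, and one says that $K_{(0,t)}[f](t)$ exists if $K_{(a,t)}[f^\pm](t)$ are finite for each $a\in(0,t)$ and $\lim_{a\searrow0}K_{(a,t)}[f^\pm](t)$ exist as finite numbers, where $f^\pm=\max\{\pm f,0\}$. For functions of $(t,x)$, $J[u](t,x)=J[u(\cdot,x)](t)$ and $K_{(a,b)}[u](t,x)=K_{(a,b)}[u(\cdot,x)](t)$. The expression $K_{(0,\bar t)}[u^\varepsilon](\bar t,\bar x)-K_{(0,\bar t)}[v_\varepsilon](\bar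 t,\bar y)$ is understood as the single quantity $K_{(0,\bar t)}[f](\bar t)$ for the function $f(t)=u^\varepsilon(t,\bar x)-v_\varepsilon(t,\bar y)$. $C^{1,2}((0,T]\times\Omega)$ is the space of functions $\psi$ such that $\psi,\partial_t\psi,\nabla\psi,\nabla^2\psi$ are continuous in $(0,T)\times\Omega$ and in some neighborhood of $\{T\}\times\Omega$. An upper semicontinuous $u$ is a viscosity subsolution of the equation in $(0,T]\times\Omega$ if $$J[\psi](\hat t,\hat x)+K_{(0,\hat t)}[\psi](\hat t,\hat x)+F(\hat t,\hat x,u(\hat t,\hat x),\nabla\psi(\hat t,\hat x),\nabla^2\psi(\hat t,\hat x))\le0$$ whenever $(\hat t,\hat x)\in(0,T]\times\Omega$ and $\psi\in C^{1,2}((0,T]\times\Omega)\cap C([0,T]\times\Omega)$ satisfy $\max_{[0,T]\times\Omega}(u-\psi)=(u-\psi)(\hat t,\hat x)$. A lower semicontinuous $v$ is a viscosity supersolution if the reverse inequality $\ge0$ (with $v(\hat t,\hat x)$ in place of $u(\hat t,\hat x)$) holds whenever $\min_{[0,T]\times\Omega}(v-\psi)=(v-\psi)(\hat t,\hat x)$. *)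

theory Defs
  imports "HOL-Analysis.Analysis"
begin

section \<open>Symmetric matrices\<close>

definition sym_mats :: "(real^'m^'m) set" where
  "sym_mats = {X. transpose X = X}"

definition loewner_le :: "real^'m^'m \<Rightarrow> real^'m^'m \<Rightarrow> bool" (infix "\<preceq>" 50) where
  "A \<preceq> B \<longleftrightarrow> (\<forall>\<xi>. \<xi> \<bullet> (A *v \<xi>) \<le> \<xi> \<bullet> (B *v \<xi>))"

text \<open>The index type \<open>'n + 'n\<close> makes \<open>real^('n + 'n)\<close> the space of pairs of vectors
  \<open>(x, y)\<close>, with \<open>x\<close> stored at the \<open>Inl\<close> and \<open>y\<close> at the \<open>Inr\<close> indices.\<close>

definition join :: "real^'n \<Rightarrow> real^'n \<Rightarrow> real^('n + 'n)" where
  "join x y = (\<chi> k. case k of Inl i \<Rightarrow> x $ i | Inr i \<Rightarrow> y $ i)"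

definition left :: "real^('n + 'n) \<Rightarrow> real^'n" where
  "left w = (\<chi> i. w $ Inl i)"

definition right :: "real^('n + 'n) \<Rightarrow> real^'n" where
  "right w = (\<chi> i. w $ Inr i)"

definition block_diag :: "real^'n^'n \<Rightarrow> real^'n^'n \<Rightarrow> real^('n + 'n)^('n + 'n)" where
  "block_diag X Y = (\<chi> k l. case (k, l) of
      (Inl i, Inl j) \<Rightarrow> X $ i $ j
    | (Inr i, Inr j) \<Rightarrow> Y $ i $ j
    | _ \<Rightarrow> 0)"

section \<open>Derivatives and regularity\<close>

definition grad :: "(real^'m \<Rightarrow> real) \<Rightarrow> real^'m \<Rightarrow> real^'m" where
  "grad f x = (THE D. GDERIV f x :> D)"

definition hessian :: "(real^'m \<Rightarrow> real) \<Rightarrow> real^'m \<Rightarrow> real^'m^'m" where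
  "hessian f x = jacobian (grad f) (at x)"

definition hessian_xy ::
  "(real^'n \<Rightarrow> real^'n \<Rightarrow> real) \<Rightarrow> real^'n \<Rightarrow> real^'n \<Rightarrow> real^('n + 'n)^('n + 'n)" where
  "hessian_xy f x y = hessian (\<lambda>w. f (left w) (right w)) (join x y)"

text \<open>Derivatives are taken relative to \<open>S\<close>. At points of \<open>[0, T] \<times> \<Omega> \<times> \<Omega>\<close> with \<open>\<Omega>\<close> open
  these are uniquely determined: ordinary derivatives for \<open>0 < t < T\<close>, one-sided in time at
  \<open>t = 0\<close> and \<open>t = T\<close>.\<close>

definition C2_on :: "'e::real_normed_vector set \<Rightarrow> ('e \<Rightarrow> real) \<Rightarrow> bool" where
  "C2_on S f \<longleftrightarrow> (\<exists>(f' :: 'e \<Rightarrow> 'e \<Rightarrow>\<^sub>L real) (f'' :: 'e \<Rightarrow> 'e \<Rightarrow>\<^sub>L 'e \<Rightarrow>\<^sub>L real).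
     (\<forall>z\<in>S. (f has_derivative blinfun_apply (f' z)) (at z within S)) \<and>
     (\<forall>z\<in>S. (f' has_derivative blinfun_apply (f'' z)) (at z within S)) \<and>
     continuous_on S f'')"

text \<open>The class \<open>C\<^sup>1\<^sup>,\<^sup>2((0, T] \<times> \<Omega>)\<close>. The time derivative at \<open>t = T\<close> is one-sided. Continuity
  in \<open>(0, T) \<times> \<Omega>\<close> and in a relative neighbourhood of \<open>{T} \<times> \<Omega>\<close> is the same as continuity
  on \<open>(0, T] \<times> \<Omega>\<close>, since both sets are relatively open and together they cover it.\<close>

definition C12 :: "real \<Rightarrow> (real^'n) set \<Rightarrow> (real \<Rightarrow> real^'n \<Rightarrow> real) \<Rightarrow> bool" where
  "C12 T \<Omega> \<psi> \<longleftrightarrow> (\<exists>\<psi>\<^sub>t.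
     (\<forall>t\<in>{0<..T}. \<forall>x\<in>\<Omega>.
        ((\<lambda>s. \<psi> s x) has_real_derivative \<psi>\<^sub>t t x) (at t within {0<..T}) \<and>
        \<psi> t differentiable at x \<and>
        grad (\<psi> t) differentiable at x) \<and>
     continuous_on ({0<..T} \<times> \<Omega>) (\<lambda>(t, x). \<psi> t x) \<and>
     continuous_on ({0<..T} \<times> \<Omega>) (\<lambda>(t, x). \<psi>\<^sub>t t x) \<and>
     continuous_on ({0<..T} \<times> \<Omega>) (\<lambda>(t, x). grad (\<psi> t) x) \<and>
     continuous_on ({0<..T} \<times> \<Omega>) (\<lambda>(t, x). hessian (\<psi> t) x))"

definition usc_on :: "'e::topological_space set \<Rightarrow> ('e \<Rightarrow> real) \<Rightarrow> bool" where
  "usc_on S f \<longleftrightarrow> (\<forall>c. openin (top_of_set S) {z \<in> S. f z < c})"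

definition lsc_on :: "'e::topological_space set \<Rightarrow> ('e \<Rightarrow> real) \<Rightarrow> bool" where
  "lsc_on S f \<longleftrightarrow> (\<forall>c. openin (top_of_set S) {z \<in> S. c < f z})"

section \<open>The operators associated with the Caputo derivative\<close>

definition J_op :: "real \<Rightarrow> (real \<Rightarrow> real) \<Rightarrow> real \<Rightarrow> real" where
  "J_op \<alpha> f t = (f t - f 0) / (t powr \<alpha> * Gamma (1 - \<alpha>))"

definition K_integrand :: "real \<Rightarrow> (real \<Rightarrow> real) \<Rightarrow> real \<Rightarrow> real \<Rightarrow> real" where
  "K_integrand \<alpha> f t \<tau> = (f t - f (t - \<tau>)) / \<tau> powr (\<alpha> + 1)"

definition K_op :: "real \<Rightarrow> real \<Rightarrow> real \<Rightarrow> (real \<Rightarrow> real) \<Rightarrow> real \<Rightarrow> real" where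
  "K_op \<alpha> a b f t = \<alpha> / Gamma (1 - \<alpha>) * (LINT \<tau>:{a<..<b}|lborel. K_integrand \<alpha> f t \<tau>)"

definition K0 :: "real \<Rightarrow> (real \<Rightarrow> real) \<Rightarrow> real \<Rightarrow> real" where
  "K0 \<alpha> f t = Lim (at_right 0) (\<lambda>a. K_op \<alpha> a t f t)"

text \<open>In \<open>K0_exists\<close> the positive and negative parts are those of \<open>f\<close> itself, not of the
  integrand. \<open>K_op\<close> is a total function, so finiteness of the integrals has to be required
  as integrability.\<close>

definition K_lim_finite :: "real \<Rightarrow> (real \<Rightarrow> real) \<Rightarrow> real \<Rightarrow> bool" where
  "K_lim_finite \<alpha> f t \<longleftrightarrow>
     (\<forall>a\<in>{0<..<t}. set_integrable lborel {a<..<t} (K_integrand \<alpha> f t)) \<and>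
     (\<exists>l. ((\<lambda>a. K_op \<alpha> a t f t) \<longlongrightarrow> l) (at_right 0))"

definition K0_exists :: "real \<Rightarrow> (real \<Rightarrow> real) \<Rightarrow> real \<Rightarrow> bool" where
  "K0_exists \<alpha> f t \<longleftrightarrow>
     K_lim_finite \<alpha> (\<lambda>s. max (f s) 0) t \<and> K_lim_finite \<alpha> (\<lambda>s. max (- f s) 0) t"

section \<open>Viscosity solutions\<close>

text \<open>The nonlinearity \<open>F\<close> takes its arguments in the order \<open>t\<close>, \<open>x\<close>, \<open>w\<close>, \<open>p\<close>, \<open>X\<close>.\<close>

definition viscosity_subsolution ::
  "real \<Rightarrow> real \<Rightarrow> (real^'n) set \<Rightarrow> (real \<Rightarrow> real^'n \<Rightarrow> real \<Rightarrow> real^'n \<Rightarrow> real^'n^'n \<Rightarrow> real)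
    \<Rightarrow> (real \<Rightarrow> real^'n \<Rightarrow> real) \<Rightarrow> bool" where
  "viscosity_subsolution \<alpha> T \<Omega> F u \<longleftrightarrow>
     usc_on ({0..T} \<times> \<Omega>) (\<lambda>(t, x). u t x) \<and>
     (\<forall>t\<in>{0<..T}. \<forall>x\<in>\<Omega>. \<forall>\<psi>.
        C12 T \<Omega> \<psi> \<and> continuous_on ({0..T} \<times> \<Omega>) (\<lambda>(s, z). \<psi> s z) \<and>
        (\<forall>s\<in>{0..T}. \<forall>z\<in>\<Omega>. u s z - \<psi> s z \<le> u t x - \<psi> t x)
        \<longrightarrow> J_op \<alpha> (\<lambda>s. \<psi> s x) t + K0 \<alpha> (\<lambda>s. \<psi> s x) t
              + F t x (u t x) (grad (\<psi> t) x) (hessian (\<psi> t) x) \<le> 0)"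

definition viscosity_supersolution ::
  "real \<Rightarrow> real \<Rightarrow> (real^'n) set \<Rightarrow> (real \<Rightarrow> real^'n \<Rightarrow> real \<Rightarrow> real^'n \<Rightarrow> real^'n^'n \<Rightarrow> real)
    \<Rightarrow> (real \<Rightarrow> real^'n \<Rightarrow> real) \<Rightarrow> bool" where
  "viscosity_supersolution \<alpha> T \<Omega> F v \<longleftrightarrow>
     lsc_on ({0..T} \<times> \<Omega>) (\<lambda>(t, x). v t x) \<and>
     (\<forall>t\<in>{0<..T}. \<forall>x\<in>\<Omega>. \<forall>\<psi>.
        C12 T \<Omega> \<psi> \<and> continuous_on ({0..T} \<times> \<Omega>) (\<lambda>(s, z). \<psi> s z) \<and>
        (\<forall>s\<in>{0..T}. \<forall>z\<in>\<Omega>. v s z - \<psi> s z \<ge> v t x - \<psi> t x)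
        \<longrightarrow> J_op \<alpha> (\<lambda>s. \<psi> s x) t + K0 \<alpha> (\<lambda>s. \<psi> s x) t
              + F t x (v t x) (grad (\<psi> t) x) (hessian (\<psi> t) x) \<ge> 0)"

section \<open>Sup- and inf-convolutions\<close>

definition sup_conv ::
  "real \<Rightarrow> (real^'n) set \<Rightarrow> (real \<Rightarrow> real^'n \<Rightarrow> real) \<Rightarrow> real \<Rightarrow> real^'n \<Rightarrow> real" where
  "sup_conv \<epsilon> \<Omega> u t x = (SUP x'\<in>\<Omega>. u t x' - inverse \<epsilon> * (norm (x - x'))\<^sup>2)"

definition inf_conv ::
  "real \<Rightarrow> (real^'n) set \<Rightarrow> (real \<Rightarrow> real^'n \<Rightarrow> real) \<Rightarrow> real \<Rightarrow> real^'n \<Rightarrow> real" where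
  "inf_conv \<epsilon> \<Omega> v t x = (INF x'\<in>\<Omega>. v t x' + inverse \<epsilon> * (norm (x - x'))\<^sup>2)"

text \<open>Minimum and maximum of \<open>F\<close> over the closed ball of radius \<open>r\<close> in the space variable. They
  are attained when the ball lies in the open set on which \<open>F\<close> is continuous.\<close>

definition F_min ::
  "(real \<Rightarrow> real^'n \<Rightarrow> real \<Rightarrow> real^'n \<Rightarrow> real^'n^'n \<Rightarrow> real) \<Rightarrow> real
    \<Rightarrow> real \<Rightarrow> real^'n \<Rightarrow> real \<Rightarrow> real^'n \<Rightarrow> real^'n^'n \<Rightarrow> real" where
  "F_min F r t x w p X = (LEAST m. m \<in> (\<lambda>x'. F t x' w p X) ` cball x r)"

definition F_max ::
  "(real \<Rightarrow> real^'n \<Rightarrow> real \<Rightarrow> real^'n \<Rightarrow> real^'n^'n \<Rightarrow> real) \<Rightarrow> real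
    \<Rightarrow> real \<Rightarrow> real^'n \<Rightarrow> real \<Rightarrow> real^'n \<Rightarrow> real^'n^'n \<Rightarrow> real" where
  "F_max F r t x w p X = (GREATEST m. m \<in> (\<lambda>x'. F t x' w p X) ` cball x r)"

end

theory Submission
  imports Defs "HOL-Complex_Analysis.Great_Picard"
begin

text \<open>
  Besides the sup-convolution in space one takes the sup-convolution in time, with parameter
  \<open>\<kappa>\<close>, and doubles the time variable. The regularised functions are then semiconvex in all
  variables. Instead of Alexandrov's theorem, a telescoping argument for second difference quotients
  shows that a semiconvex function has approximate second-order expansions along a subsequence of
  dyadic scales at almost every point. A slightly tilted maximum can be moved to such a point, which
  yields quadratic test functions for \<open>u\<close> and \<open>- v\<close>, and the maximality splits the nonlocal terms.

  As \<open>\<kappa> \<rightarrow> 0\<close>, the increments of the two functions in time have a common lower bound coming from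
  the maximum condition, so Fatou's lemma passes to the limit in the nonlocal terms once
  \<open>J + K\<close> is written as one integral over the half-line with \<open>f\<close> extended by \<open>f 0\<close>. This proves the
  inequality for a strict maximum and a quadratic \<open>\<phi>\<close>. A general \<open>\<phi>\<close> is replaced by its Taylor
  polynomial plus \<open>\<eta>\<close> times a square, and compactness of the matrices allows \<open>\<eta> \<rightarrow> 0\<close>.
\<close>

section \<open>Approximate second-order expansions of convex functions\<close>

text \<open>Neither the time slopes nor the time curvatures of the two test functions stay bounded
  as \<open>\<kappa> \<rightarrow> 0\<close>: each contains terms with the factor
  \<open>1 / \<kappa>\<close>. Only their sums are controlled, since the penalty does not change
  when both times move together. Hence the two nonlocal terms cannot be estimated separately, and
  everything is phrased through the sum \<open>d\<close> of the increments. Because the expansions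
  are only approximate, each test function touches at a point that lies within a distance of order
  \<open>r\<close> of the perturbed maximum, not at the maximum itself. For \<open>\<tau>\<close>
  above a multiple of \<open>r\<close> this costs an error \<open>E\<close> of order
  \<open>r\<close> in the lower bound of the increments; its share of the integral is of order
  \<open>r powr (1 - \<alpha>)\<close>, which is small because \<open>\<alpha> < 1\<close>. Below
  that scale the increments are those of explicit parabolas and carry no error. Touching on one
  small ball is all that the definition of viscosity solutions asks for, so an expansion along a
  single sequence of scales is enough.\<close>

definition second_diff :: "('a::real_vector \<Rightarrow> real) \<Rightarrow> 'a \<Rightarrow> 'a \<Rightarrow> real" where
  "second_diff h e x = h (x + e) + h (x - e) - 2 * h x"

text \<open>The factor is the inverse square of the scale: for a quadratic function this is the
  second derivative in direction \<open>e\<close>, the same at all scales and all points.\<close>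

definition dyadic_quot :: "('a::real_vector \<Rightarrow> real) \<Rightarrow> 'a \<Rightarrow> nat \<Rightarrow> 'a \<Rightarrow> real" where
  "dyadic_quot h e j x = 4 ^ j * second_diff h ((1 / 2 ^ j) *\<^sub>R e) x"

text \<open>The Jensen gap of the convex function \<open>s \<mapsto> 1 / (1 + s)\<close> in the average of \<open>dyadic_quot_average\<close>.\<close>

definition defect :: "('a::real_vector \<Rightarrow> real) \<Rightarrow> 'a \<Rightarrow> nat \<Rightarrow> 'a \<Rightarrow> real" where
  "defect h e j x =
     (inverse (1 + dyadic_quot h e (Suc j) (x + (1 / 2 ^ Suc j) *\<^sub>R e))
      + 2 * inverse (1 + dyadic_quot h e (Suc j) x)
      + inverse (1 + dyadic_quot h e (Suc j) (x - (1 / 2 ^ Suc j) *\<^sub>R e))) / 4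
     - inverse (1 + dyadic_quot h e j x)"

lemma second_diff_double:
  "second_diff h (2 *\<^sub>R e) x
     = second_diff h e (x + e) + 2 * second_diff h e x + second_diff h e (x - e)"
proof -
  have *: "x + 2 *\<^sub>R e = x + e + e" "x - 2 *\<^sub>R e = x - e - e"
    by (simp_all add: scaleR_2)
  show ?thesis unfolding second_diff_def *  by simp
qed

text \<open>A martingale-like identity: passing to the finer scale replaces a quotient by three
  quotients with weights 1/4, 1/2, 1/4. Composition with a strictly convex function turns it into
  monotonicity, with a gap that measures how far the three finer quotients lie apart.\<close>

lemma dyadic_quot_average:
  "dyadic_quot h e j x =
    (dyadic_quot h e (Suc j) (x + (1 / 2 ^ Suc j) *\<^sub>R e) + 2 * dyadic_quot h e (Suc j) x
      + dyadic_quot h e (Suc j) (x - (1 / 2 ^ Suc j) *\<^sub>R e)) / 4"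
proof -
  have "(1 / 2 ^ j) *\<^sub>R e = 2 *\<^sub>R ((1 / 2 ^ Suc j) *\<^sub>R e)"
    by simp
  then show ?thesis
    unfolding dyadic_quot_def by (simp only: second_diff_double) (simp add: algebra_simps)
qed

lemma convex_second_diff_nonneg:
  assumes "convex_on UNIV h"
  shows "0 \<le> second_diff h e x"
proof -
  have "h ((1/2) *\<^sub>R (x + e) + (1/2) *\<^sub>R (x - e)) \<le> (1/2) * h (x + e) + (1/2) * h (x - e)"
    using assms unfolding convex_on_def by (metis UNIV_I field_sum_of_halves zero_le_divide_1_iff zero_le_numeral)
  moreover have "(1/2) *\<^sub>R (x + e) + (1/2) *\<^sub>R (x - e) = x"
    by (simp flip: scaleR_add_right add: scaleR_2[symmetric] del: scaleR_half_double)
  ultimately show ?thesis by (simp add: second_diff_def)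
qed

lemma dyadic_quot_nonneg: "convex_on UNIV h \<Longrightarrow> 0 \<le> dyadic_quot h e j x"
  by (simp add: dyadic_quot_def convex_second_diff_nonneg)

text \<open>The first-order Taylor remainder of \<open>1 / (1 + s)\<close> at \<open>m\<close> is
  explicit, and the linear terms cancel in the weighted mean. This function is taken because it is
  strictly convex and lies between 0 and 1 on the half-line, so its integrals over balls are bounded
  without any upper bound on the quotients.\<close>

lemma inverse_average_defect:
  fixes a b c :: real
  assumes "0 \<le> a" "0 \<le> b" "0 \<le> c" and m: "m = (a + 2 * b + c) / 4"
  shows "(inverse (1 + a) + 2 * inverse (1 + b) + inverse (1 + c)) / 4 - inverse (1 + m)
    = ((a - m)\<^sup>2 / ((1 + a) * (1 + m)\<^sup>2) + 2 * ((b - m)\<^sup>2 / ((1 + b) * (1 + m)\<^sup>2))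
       + (c - m)\<^sup>2 / ((1 + c) * (1 + m)\<^sup>2)) / 4"
proof -
  have expand: "inverse (1 + d) = inverse (1 + m) - (d - m) * (inverse (1 + m))\<^sup>2
      + (d - m)\<^sup>2 / ((1 + d) * (1 + m)\<^sup>2)" if "0 \<le> d" for d
  proof -
    have "1 + d \<noteq> 0" "1 + m \<noteq> 0" using that assms by auto
    then show ?thesis by (simp add: divide_simps power2_eq_square) algebra
  qed
  have "(a - m) + 2 * (b - m) + (c - m) = 0" using m by simp
  then have "(a - m) * (inverse (1 + m))\<^sup>2 + 2 * ((b - m) * (inverse (1 + m))\<^sup>2)
      + (c - m) * (inverse (1 + m))\<^sup>2 = 0"
    by algebra
  then show ?thesis
    using expand[OF assms(1)] expand[OF assms(2)] expand[OF assms(3)] by argo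
qed

lemma inverse_average_defect_nonneg:
  fixes a b c :: real
  assumes "0 \<le> a" "0 \<le> b" "0 \<le> c" and m: "m = (a + 2 * b + c) / 4"
  shows "0 \<le> (inverse (1 + a) + 2 * inverse (1 + b) + inverse (1 + c)) / 4 - inverse (1 + m)"
  unfolding inverse_average_defect[OF assms] using assms by simp

text \<open>A small gap forces neighbouring quotients together only while they stay in a bounded
  range, because the curvature of \<open>1 / (1 + s)\<close> decays; this is the origin of the
  factor depending on \<open>C\<close>.\<close>

lemma inverse_average_defect_bound:
  fixes a b c :: real
  assumes "0 \<le> a" "0 \<le> b" "0 \<le> c" and m: "m = (a + 2 * b + c) / 4"
    and C: "a \<le> C" "b \<le> C" "c \<le> C"
  shows "(a - b)\<^sup>2 \<le> 16 * (1 + C) ^ 3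
    * ((inverse (1 + a) + 2 * inverse (1 + b) + inverse (1 + c)) / 4 - inverse (1 + m))" (is "_ \<le> _ * ?D")
proof -
  have m0: "0 \<le> m" "m \<le> C" using assms by auto
  have C0: "0 \<le> C" using assms by simp
  have le: "(d - m)\<^sup>2 / (1 + C) ^ 3 \<le> (d - m)\<^sup>2 / ((1 + d) * (1 + m)\<^sup>2)" if "0 \<le> d" "d \<le> C" for d
  proof -
    have "(1 + d) * (1 + m)\<^sup>2 \<le> (1 + C) * (1 + C)\<^sup>2"
      using that m0 by (intro mult_mono power_mono) auto
    also have "\<dots> = (1 + C) ^ 3" by (simp add: power2_eq_square power3_eq_cube)
    finally have "(1 + d) * (1 + m)\<^sup>2 \<le> (1 + C) ^ 3" .
    moreover have "0 < (1 + d) * (1 + m)\<^sup>2" using that m0 by (intro mult_pos_pos zero_less_power) auto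
    ultimately show ?thesis using C0 that by (intro divide_left_mono mult_pos_pos) auto
  qed
  have "((a - m)\<^sup>2 + 2 * (b - m)\<^sup>2 + (c - m)\<^sup>2) / (1 + C) ^ 3 \<le> 4 * ?D"
    unfolding inverse_average_defect[OF assms(1-4)]
    using le[of a] le[of b] le[of c] assms by (simp add: add_divide_distrib)
  then have "(a - m)\<^sup>2 + 2 * (b - m)\<^sup>2 + (c - m)\<^sup>2 \<le> 4 * ?D * (1 + C) ^ 3"
    using C0 by (subst (asm) pos_divide_le_eq) auto
  moreover have "(a - b)\<^sup>2 \<le> 2 * (a - m)\<^sup>2 + 2 * (b - m)\<^sup>2"
    using zero_le_power2[of "a - m + (b - m)"] by (simp add: power2_eq_square algebra_simps)
  moreover have "0 \<le> (c - m)\<^sup>2" "0 \<le> (b - m)\<^sup>2" "0 \<le> (a - m)\<^sup>2" by auto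
  ultimately have "(a - b)\<^sup>2 \<le> 4 * (4 * ?D * (1 + C) ^ 3)" by linarith
  then show ?thesis by (simp add: algebra_simps)
qed

lemma defect_nonneg: "convex_on UNIV h \<Longrightarrow> 0 \<le> defect h e j x"
  unfolding defect_def
  by (intro inverse_average_defect_nonneg dyadic_quot_nonneg dyadic_quot_average)

lemma continuous_dyadic_quot:
  fixes h :: "'a::euclidean_space \<Rightarrow> real"
  assumes "convex_on UNIV h"
  shows "continuous_on UNIV (dyadic_quot h e j)"
proof -
  have "continuous_on UNIV h" using assms by (intro convex_on_continuous) auto
  then have c: "continuous_on UNIV (\<lambda>x. h (f x))" if "continuous_on UNIV f" for f :: "'a \<Rightarrow> 'a"
    using continuous_on_compose2[OF _ that] by auto
  show ?thesis unfolding dyadic_quot_def second_diff_def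
    by (intro continuous_intros c)
qed

lemma nn_integral_ball_shift_le:
  fixes g :: "'a::euclidean_space \<Rightarrow> ennreal"
  assumes [measurable]: "g \<in> borel_measurable borel" and "norm c \<le> s"
  shows "(\<integral>\<^sup>+x\<in>ball 0 R. g (x + c) \<partial>lborel) \<le> (\<integral>\<^sup>+x\<in>ball 0 (R + s). g x \<partial>lborel)"
proof -
  have "(\<integral>\<^sup>+x\<in>ball 0 (R + s). g x \<partial>lborel)
      = (\<integral>\<^sup>+x. g x * indicator (ball 0 (R + s)) x \<partial>distr lborel borel ((+) c))"
    by (simp add: lborel_distr_plus)
  also have "\<dots> = (\<integral>\<^sup>+x. g (c + x) * indicator (ball 0 (R + s)) (c + x) \<partial>lborel)"
    by (subst nn_integral_distr) (auto intro!: borel_measurable_times_ennreal borel_measurable_indicator assms)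
  also have "\<dots> \<ge> (\<integral>\<^sup>+x\<in>ball 0 R. g (x + c) \<partial>lborel)"
  proof (intro nn_integral_mono)
    fix x :: 'a
    have "norm (c + x) < R + s" if "norm x < R"
      using norm_triangle_ineq[of c x] that assms(2) by linarith
    then show "g (x + c) * indicator (ball 0 R) x \<le> g (c + x) * indicator (ball 0 (R + s)) (c + x)"
      by (auto simp: indicator_def add.commute)
  qed
  finally show ?thesis .
qed

text \<open>The integrals of \<open>1 / (1 + D\<^sub>j)\<close> over balls of suitably growing radius increase with \<open>j\<close>
  and stay bounded, and their increments dominate the integrals of the defects.\<close>

lemma AE_defect_tendsto_zero:
  fixes h :: "'a::euclidean_space \<Rightarrow> real"
  assumes h: "convex_on UNIV h"
  shows "AE x in lborel. (\<lambda>j. defect h e j (x + (1 / 2 ^ Suc j) *\<^sub>R w)) \<longlonglongrightarrow> 0"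
proof -
  note [measurable] = borel_measurable_continuous_onI[OF continuous_dyadic_quot[OF h]]
  have [measurable]: "ball (0::'a) R \<in> sets borel" for R by simp
  have [measurable]: "defect h e j \<in> borel_measurable borel" for j
    unfolding defect_def[abs_def] by measurable
  define \<omega> where "\<omega> j x = ennreal (inverse (1 + dyadic_quot h e j x))" for j x
  have [measurable]: "\<omega> j \<in> borel_measurable borel" for j
    unfolding \<omega>_def[abs_def] by measurable
  have \<omega>1: "\<omega> j x \<le> 1" for j x
    using dyadic_quot_nonneg[OF h, of e j x] by (simp add: \<omega>_def inverse_le_1_iff)
  \<comment> \<open>The relation between the defect and the weights is kept in additive form, since
    subtraction in \<open>ennreal\<close> is truncated.\<close>
  have sum_eq: "4 * ennreal (defect h e j x) + 4 * \<omega> j x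
      = \<omega> (Suc j) (x + (1 / 2 ^ Suc j) *\<^sub>R e) + 2 * \<omega> (Suc j) x
        + \<omega> (Suc j) (x + (- ((1 / 2 ^ Suc j) *\<^sub>R e)))" for j x
    using defect_nonneg[OF h, of e j x] dyadic_quot_nonneg[OF h, of e]
    unfolding \<omega>_def
    apply (simp add: ennreal_mult''[symmetric] ennreal_plus[symmetric] ennreal_numeral[symmetric]
        del: ennreal_plus ennreal_numeral)
    apply (simp add: defect_def)
    done
  have main: "AE x in lborel. x \<in> ball 0 R \<longrightarrow> (\<lambda>j. defect h e j (x + (1 / 2 ^ Suc j) *\<^sub>R w)) \<longlonglongrightarrow> 0" for R
  proof -
    \<comment> \<open>The radius grows at each scale by exactly the length of the shift, so that the
      shifted balls of one scale fit into the ball of the next. The increments form a geometric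
      series with sum \<open>norm e\<close>. The summand \<open>norm w\<close> makes room for the
      shift by \<open>w\<close> in the claim.\<close>
    define \<rho> where "\<rho> j = R + norm w + (1 - 1 / 2 ^ j) * norm e" for j :: nat
    have \<rho>_Suc: "\<rho> (Suc j) = \<rho> j + norm ((1 / 2 ^ Suc j) *\<^sub>R e) " for j
      by (simp add: \<rho>_def field_simps)
    have \<rho>_ge: "R + norm w \<le> \<rho> j" for j
      using mult_left_mono[OF one_le_power[of "2::real" j], of "norm e"] by (simp add: \<rho>_def field_simps)
    have \<rho>_le: "\<rho> j \<le> R + norm w + norm e" for j
      by (simp add: \<rho>_def algebra_simps)
    define a where "a j = (\<integral>\<^sup>+x\<in>ball 0 (\<rho> j). \<omega> j x \<partial>lborel)" for j
    define d where "d j = (\<integral>\<^sup>+x\<in>ball 0 (\<rho> j). ennreal (defect h e j x) \<partial>lborel)" for j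
    have step: "d j + a j \<le> a (Suc j)" for j
    proof -
      have "4 * d j + 4 * a j
        = (\<integral>\<^sup>+x\<in>ball 0 (\<rho> j). (4 * ennreal (defect h e j x) + 4 * \<omega> j x) \<partial>lborel)"
        unfolding d_def a_def
        by (simp add: distrib_right mult.assoc nn_integral_add nn_integral_cmult)
      also have "\<dots> = (\<integral>\<^sup>+x\<in>ball 0 (\<rho> j). \<omega> (Suc j) (x + (1 / 2 ^ Suc j) *\<^sub>R e) \<partial>lborel)
          + 2 * (\<integral>\<^sup>+x\<in>ball 0 (\<rho> j). \<omega> (Suc j) (x + 0) \<partial>lborel)
          + (\<integral>\<^sup>+x\<in>ball 0 (\<rho> j). \<omega> (Suc j) (x + (- ((1 / 2 ^ Suc j) *\<^sub>R e))) \<partial>lborel)"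
        unfolding sum_eq
        by (simp add: distrib_right mult.assoc nn_integral_add nn_integral_cmult)
      also have "\<dots> \<le> a (Suc j) + 2 * a (Suc j) + a (Suc j)"
        unfolding a_def \<rho>_Suc
        by (intro add_mono mult_left_mono nn_integral_ball_shift_le) auto
      also have "\<dots> = 4 * a (Suc j)"
        by (metis (no_types, opaque_lifting) distrib_right mult_1 one_add_one add.commute numeral_Bit0 add.assoc)
      finally have "4 * (d j + a j) \<le> 4 * a (Suc j)" by (simp add: distrib_left)
      then show ?thesis by (subst (asm) ennreal_mult_le_mult_iff) auto
    qed
    have sum_le: "(\<Sum>j<n. d j) + a 0 \<le> a n" for n
    proof (induction n)
      case (Suc n)
      have "(\<Sum>j<Suc n. d j) + a 0 = d n + ((\<Sum>j<n. d j) + a 0)" by (simp add: algebra_simps)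
      also have "\<dots> \<le> d n + a n" using Suc by (intro add_mono) auto
      finally show ?case using step[of n] by (rule order_trans)
    qed simp
    define V where "V = emeasure lborel (ball (0::'a) (R + norm w + norm e))"
    have a_le: "a n \<le> V" for n
    proof -
      have "a n \<le> (\<integral>\<^sup>+x. indicator (ball (0::'a) (R + norm w + norm e)) x \<partial>lborel)"
        unfolding a_def using \<rho>_le[of n] \<omega>1
        by (intro nn_integral_mono) (auto simp: indicator_def)
      then show ?thesis by (simp add: V_def)
    qed
    have V: "V < \<infinity>" unfolding V_def by (rule emeasure_bounded_finite) (rule bounded_ball)
    have shift: "(\<integral>\<^sup>+x\<in>ball 0 R. ennreal (defect h e j (x + (1 / 2 ^ Suc j) *\<^sub>R w)) \<partial>lborel) \<le> d j" for j
    proof -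
      have "norm ((1 / 2 ^ Suc j) *\<^sub>R w) \<le> norm w"
        using one_le_power[of "2::real" "Suc j"]
        by (simp add: field_simps mult_le_cancel_left1 del: power_Suc)
      then have "(\<integral>\<^sup>+x\<in>ball 0 R. ennreal (defect h e j (x + (1 / 2 ^ Suc j) *\<^sub>R w)) \<partial>lborel)
          \<le> (\<integral>\<^sup>+x\<in>ball 0 (R + norm w). ennreal (defect h e j x) \<partial>lborel)"
        by (intro nn_integral_ball_shift_le) auto
      also have "\<dots> \<le> d j"
        unfolding d_def using \<rho>_ge[of j] by (intro nn_integral_mono) (auto simp: indicator_def)
      finally show ?thesis .
    qed
    let ?g = "\<lambda>j x. ennreal (defect h e j (x + (1 / 2 ^ Suc j) *\<^sub>R w)) * indicator (ball 0 R) x"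
    have "(\<integral>\<^sup>+x. (\<Sum>j. ?g j x) \<partial>lborel) = (\<Sum>j. \<integral>\<^sup>+x. ?g j x \<partial>lborel)"
      by (rule nn_integral_suminf) measurable
    also have "\<dots> \<le> V"
    proof (rule suminf_le_const)
      fix n
      have "(\<Sum>j<n. \<integral>\<^sup>+x. ?g j x \<partial>lborel) \<le> (\<Sum>j<n. d j)" by (intro sum_mono shift)
      also have "\<dots> \<le> (\<Sum>j<n. d j) + a 0" by simp
      finally show "(\<Sum>j<n. \<integral>\<^sup>+x. ?g j x \<partial>lborel) \<le> V"
        using sum_le[of n] a_le[of n] by (meson order_trans)
    qed simp
    finally have "(\<integral>\<^sup>+x. (\<Sum>j. ?g j x) \<partial>lborel) \<noteq> \<infinity>" using V by auto
    then have "AE x in lborel. (\<Sum>j. ?g j x) \<noteq> \<infinity>"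
      by (intro nn_integral_PInf_AE) measurable
    then show ?thesis
    proof eventually_elim
      case (elim x)
      show ?case
      proof
        assume "x \<in> ball 0 R"
        then have "(\<Sum>j. ennreal (defect h e j (x + (1 / 2 ^ Suc j) *\<^sub>R w))) \<noteq> \<infinity>"
          using elim by simp
        then have "summable (\<lambda>j. defect h e j (x + (1 / 2 ^ Suc j) *\<^sub>R w))"
          by (intro summable_suminf_not_top defect_nonneg[OF h]) auto
        then show "(\<lambda>j. defect h e j (x + (1 / 2 ^ Suc j) *\<^sub>R w)) \<longlonglongrightarrow> 0"
          by (rule summable_LIMSEQ_zero)
      qed
    qed
  qed
  have "AE x in lborel. \<forall>R::nat. x \<in> ball 0 (real R) \<longrightarrow>
      (\<lambda>j. defect h e j (x + (1 / 2 ^ Suc j) *\<^sub>R w)) \<longlonglongrightarrow> 0"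
    unfolding AE_all_countable using main by blast
  then show ?thesis
  proof eventually_elim
    case (elim x)
    obtain R :: nat where "norm x < real R" using reals_Archimedean2 by blast
    with elim show ?case by auto
  qed
qed

section \<open>From invariant second differences to a quadratic form\<close>

text \<open>Cauchy's functional equation: additivity yields homogeneity over the rationals, and
  continuity extends it to real factors by density.\<close>

lemma additive_continuous_imp_linear:
  fixes f :: "'a::real_normed_vector \<Rightarrow> real"
  assumes add: "\<And>x y. f (x + y) = f x + f y" and cont: "continuous_on UNIV f"
  shows "linear f"
proof (rule linearI)
  fix r :: real and x :: 'a
  have nat: "f (real n *\<^sub>R x) = real n * f x" for n x
  proof (induction n)
    case 0
    show ?case using add[of 0 0] by simp
  next
    case (Suc n)
    then show ?case using add[of x "real n *\<^sub>R x"] by (simp add: algebra_simps)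
  qed
  have neg: "f (- x) = - f x" for x using add[of x "- x"] add[of 0 0] by simp
  have int: "f (of_int i *\<^sub>R x) = of_int i * f x" for i x
    using nat[of "nat i" x] nat[of "nat (- i)" x] neg[of "of_int (- i) *\<^sub>R x"]
    by (cases "0 \<le> i") (auto simp: neg)
  have rat: "f (q *\<^sub>R x) - q * f x = 0" if qQ: "q \<in> \<rat>" for q
  proof -
    obtain i j where q: "q = of_int i / of_int j" "j \<noteq> 0"
      using qQ by (cases rule: Rats_cases') auto
    have "of_int j * f (q *\<^sub>R x) = f (of_int i *\<^sub>R x)"
      using int[of j "q *\<^sub>R x"] q by simp
    then have "of_int j * (f (q *\<^sub>R x) - q * f x) = 0" using q int[of i x] by (simp add: right_diff_distrib)
    then show ?thesis using q(2) by simp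
  qed
  have "continuous_on (closure \<rat>) (\<lambda>q. f (q *\<^sub>R x) - q * f x)"
    by (intro continuous_intros continuous_on_compose2[OF cont]) auto
  moreover have "r \<in> closure \<rat>" by (simp add: Rats_closure_real)
  ultimately show "f (r *\<^sub>R x) = r *\<^sub>R f x"
    using continuous_constant_on_closure[of \<rat> "\<lambda>q. f (q *\<^sub>R x) - q * f x" 0 r] rat by simp
qed (rule add)

lemma continuous_on_second_diff:
  fixes g :: "'a::real_normed_vector \<Rightarrow> real"
  assumes "continuous_on UNIV g"
  shows "continuous_on UNIV (\<lambda>z. second_diff g (fst z) (snd z))"
proof -
  have c: "continuous_on UNIV (\<lambda>x. g (f x))" if "continuous_on UNIV f" for f :: "'a \<times> 'a \<Rightarrow> 'a"
    using continuous_on_compose2[OF assms that] by auto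
  show ?thesis unfolding second_diff_def
    by (intro continuous_intros c)
qed

lemma tendsto_half_pow: "(\<lambda>m. (1 / 2 ^ m) *\<^sub>R (e::'a::real_normed_vector)) \<longlonglongrightarrow> 0"
proof -
  have "(\<lambda>m. (1 / 2 ^ m) *\<^sub>R e) \<longlonglongrightarrow> 0 *\<^sub>R e"
    by (intro tendsto_intros LIMSEQ_divide_realpow_zero) auto
  then show ?thesis by simp
qed

text \<open>The hypothesis makes a second difference in direction \<open>e\<close> invariant only
  under the shift by \<open>e\<close> itself. Scaling by 2 together with continuity at 0 upgrades
  this to the parallelogram law, after which polarisation works as in the Jordan-von Neumann
  theorem.\<close>

lemma quadratic_form_of_third_difference:
  fixes g :: "'a::real_normed_vector \<Rightarrow> real"
  assumes cont: "continuous_on UNIV g"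
    and bnd: "\<And>y. norm y \<le> 1 \<Longrightarrow> \<bar>g y\<bar> \<le> C * (norm y)\<^sup>2"
    and third: "\<And>w e. second_diff g e (w + e) = second_diff g e w"
  obtains b where "bilinear b" "\<And>x y. b x y = b y x" "\<And>y. g y = b y y / 2"
proof -
  have g0: "g 0 = 0" using bnd[of 0] by simp
  have third': "second_diff g e (w - e) = second_diff g e w" for w e
    using third[of e "w - e"] by simp
  have s2: "second_diff g (2 *\<^sub>R e) w = 4 * second_diff g e w" for e w
    unfolding second_diff_double third third' by simp
  \<comment> \<open>This is the odd part of \<open>g\<close>. It doubles when its argument doubles,
    while \<open>bnd\<close> makes it quadratically small near 0; both together force it to
    vanish.\<close>
  define d where "d e = g e - second_diff g e 0 / 2" for e
  have d2: "d (2 *\<^sub>R e) = 2 * d e" for e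
    unfolding d_def s2 using third[of e 0] g0 by (simp add: second_diff_def scaleR_2 field_simps)
  have d2m: "d ((2 ^ m) *\<^sub>R e) = 2 ^ m * d e" for m e
    by (induction m) (simp_all add: d2 flip: scaleR_scaleR)
  have dbnd: "\<bar>d e\<bar> \<le> 2 * C * (norm e)\<^sup>2" if "norm e \<le> 1" for e
  proof -
    have "d e = (g e - g (- e)) / 2" using g0 by (simp add: d_def second_diff_def field_simps)
    then show ?thesis using bnd[of e] bnd[of "- e"] that by simp
  qed
  have d0: "d e = 0" for e
  proof -
    have "eventually (\<lambda>m. norm ((1 / 2 ^ m) *\<^sub>R e) < 1) sequentially"
      using tendstoD[OF tendsto_half_pow, of 1 e] by (simp only: dist_norm diff_zero zero_less_one simp_thms)
    then have "eventually (\<lambda>m. norm (d e) \<le> 2 * C * (norm e)\<^sup>2 / 2 ^ m) sequentially"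
    proof eventually_elim
      case (elim m)
      have "\<bar>d e\<bar> = 2 ^ m * \<bar>d ((1 / 2 ^ m) *\<^sub>R e)\<bar>"
        using d2m[of m "(1 / 2 ^ m) *\<^sub>R e"] by (simp add: abs_mult)
      also have "\<dots> \<le> 2 ^ m * (2 * C * (norm ((1 / 2 ^ m) *\<^sub>R e))\<^sup>2)"
        using elim by (intro mult_left_mono dbnd) auto
      also have "\<dots> = 2 * C * (norm e)\<^sup>2 / 2 ^ m"
        by (simp add: power_mult_distrib power2_eq_square)
      finally show ?case by simp
    qed
    then have "(\<lambda>m::nat. d e) \<longlonglongrightarrow> 0"
      by (rule Lim_null_comparison) (intro LIMSEQ_divide_realpow_zero, simp)
    then show ?thesis by (simp add: LIMSEQ_const_iff)
  qed
  have sym0: "second_diff g e 0 = 2 * g e" for e using d0[of e] by (simp add: d_def)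
  have g2: "g (2 *\<^sub>R e) = 4 * g e" for e
    using sym0[of e] sym0[of "2 *\<^sub>R e"] s2[of e 0] by simp
  \<comment> \<open>Both \<open>g\<close> and its second differences now scale by 4 under doubling,
    so the base point of a second difference may be halved freely and sent to 0, where the value is
    \<open>2 * g e\<close>.\<close>
  have inv2: "second_diff g e (2 *\<^sub>R w) = second_diff g e w" for e w
  proof -
    have "second_diff g (2 *\<^sub>R e) (2 *\<^sub>R w) = 4 * second_diff g e w"
      unfolding second_diff_def scaleR_add_right[symmetric] scaleR_diff_right[symmetric] g2 by simp
    then show ?thesis using s2[of e "2 *\<^sub>R w"] by simp
  qed
  have inv2m: "second_diff g e ((1 / 2 ^ m) *\<^sub>R w) = second_diff g e w" for e w m
  proof (induction m)
    case (Suc m)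
    have eq: "2 *\<^sub>R ((1 / 2 ^ Suc m) *\<^sub>R w) = (1 / 2 ^ m) *\<^sub>R w" by simp
    show ?case using Suc inv2[of e "(1 / 2 ^ Suc m) *\<^sub>R w"] unfolding eq by (simp only:)
  qed simp
  have par: "second_diff g e w = 2 * g e" for e w
  proof -
    have "continuous_on UNIV (\<lambda>z. second_diff g e z)"
      using continuous_on_compose2[OF continuous_on_second_diff[OF cont], of UNIV "\<lambda>z. (e, z)"]
      by (simp add: continuous_intros)
    then have "(\<lambda>m. second_diff g e ((1 / 2 ^ m) *\<^sub>R w)) \<longlonglongrightarrow> second_diff g e 0"
      by (rule continuous_on_tendsto_compose[OF _ tendsto_half_pow]) auto
    then show ?thesis unfolding inv2m sym0 by (simp only: LIMSEQ_const_iff)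
  qed
  have P: "g (w + e) + g (w - e) = 2 * g w + 2 * g e" for w e
    using par[of e w] by (simp add: second_diff_def)
  \<comment> \<open>Polarisation. Its additivity is obtained by combining four instances of the
    parallelogram law.\<close>
  define b where "b x y = g (x + y) - g x - g y" for x y
  have bsym: "b x y = b y x" for x y by (simp add: b_def add.commute)
  have badd: "b (x + z) y = b x y + b z y" for x y z
  proof -
    have eq: "x + (y + z) = x + z + y" "x + y + z = x + z + y" "x - z + y = x + y - z" "x - z - y = x - (y + z)"
      "z + y = y + z"
      by (simp_all add: algebra_simps)
    have "g (x + z + y) + g (x + y - z) = 2 * g (x + y) + 2 * g z" using P[of "x + y" z] unfolding eq .
    moreover have "g (x + y - z) + g (x - (y + z)) = 2 * g (x - z) + 2 * g y" using P[of "x - z" y] unfolding eq .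
    moreover have "g (x + z + y) + g (x - (y + z)) = 2 * g x + 2 * g (y + z)" using P[of x "y + z"] unfolding eq .
    moreover have "g (x + z) + g (x - z) = 2 * g x + 2 * g z" by (rule P)
    moreover have "g (z + y) = g (y + z)" by (simp add: add.commute)
    ultimately show ?thesis unfolding b_def by linarith
  qed
  have cont_b: "continuous_on UNIV (\<lambda>x. b x y)" for y
    unfolding b_def by (intro continuous_intros continuous_on_compose2[OF cont]) auto
  have lin: "linear (\<lambda>x. b x y)" for y
    by (rule additive_continuous_imp_linear) (auto simp: badd cont_b)
  have bl: "bilinear b"
  proof -
    have "(\<lambda>y. b x y) = (\<lambda>y. b y x)" for x by (simp add: bsym[of x])
    then show ?thesis unfolding bilinear_def using lin by metis
  qed
  have "g y = b y y / 2" for y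
    unfolding b_def using g2[of y] by (simp add: scaleR_2)
  then show ?thesis by (rule that[OF bl bsym])
qed

section \<open>Blow-ups of a convex function and touching paraboloids\<close>

text \<open>The segment from \<open>y\<close> to \<open>z\<close> is prolonged beyond
  \<open>z\<close> by the length \<open>R\<close>. Its end stays in the ball of radius
  \<open>2 * R\<close>, and convexity on the longer segment bounds the slope by the oscillation
  \<open>K\<close> over \<open>R\<close>.\<close>

lemma convex_bounded_imp_lipschitz:
  fixes g :: "'a::real_normed_vector \<Rightarrow> real"
  assumes conv: "convex_on UNIV g" and "0 < R"
    and bnd: "\<And>y. norm y \<le> 2 * R \<Longrightarrow> 0 \<le> g y \<and> g y \<le> K"
    and "norm y \<le> R" "norm z \<le> R"
  shows "\<bar>g y - g z\<bar> \<le> K / R * norm (y - z)"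
proof -
  have le: "g z - g y \<le> K / R * norm (y - z)" if y: "norm y \<le> R" and z: "norm z \<le> R" for y z
  proof (cases "y = z")
    case False
    define d where "d = norm (z - y)"
    have d: "0 < d" using False by (simp add: d_def)
    define w where "w = z + (R / d) *\<^sub>R (z - y)"
    have "norm w \<le> norm z + norm ((R / d) *\<^sub>R (z - y))" unfolding w_def by (rule norm_triangle_ineq)
    also have "norm ((R / d) *\<^sub>R (z - y)) = R" using d \<open>0 < R\<close> by (simp add: d_def)
    finally have w: "norm w \<le> 2 * R" using z by simp
    define \<theta> where "\<theta> = d / (R + d)"
    have th: "0 \<le> \<theta>" "\<theta> \<le> 1" using d \<open>0 < R\<close> by (auto simp: \<theta>_def)
    have th1: "\<theta> * (1 + R / d) = 1" "\<theta> * (R / d) = 1 - \<theta>"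
      using d \<open>0 < R\<close> by (auto simp: \<theta>_def divide_simps)
    have "(1 - \<theta>) *\<^sub>R y + \<theta> *\<^sub>R w = (\<theta> * (1 + R / d)) *\<^sub>R z + (1 - \<theta> - \<theta> * (R / d)) *\<^sub>R y"
      unfolding w_def by (simp add: algebra_simps)
    also have "\<dots> = z" unfolding th1 by simp
    finally have zeq: "(1 - \<theta>) *\<^sub>R y + \<theta> *\<^sub>R w = z" .
    have "g ((1 - \<theta>) *\<^sub>R y + \<theta> *\<^sub>R w) \<le> (1 - \<theta>) * g y + \<theta> * g w"
      using th by (intro convex_onD[OF conv]) auto
    then have "g z - g y \<le> \<theta> * (g w - g y)" unfolding zeq by (simp add: algebra_simps)
    also have "\<dots> \<le> \<theta> * K"
      using bnd[OF w] bnd[of y] y \<open>0 < R\<close> th by (intro mult_left_mono) auto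
    also have "\<dots> \<le> d / R * K"
      using d \<open>0 < R\<close> bnd[of 0] unfolding \<theta>_def
      by (intro mult_right_mono divide_left_mono) auto
    finally show ?thesis by (simp add: d_def norm_minus_commute mult.commute)
  qed simp
  show ?thesis using le[of y z] le[of z y] assms by (auto simp: norm_minus_commute abs_le_iff)
qed

text \<open>The tangent plane below and the paraboloid above squeeze the rescaled functions between
  0 and \<open>C * (norm y)\<^sup>2\<close>; convexity then makes them equi-Lipschitz on balls, and
  a subsequence converges. Vanishing defects make the limit satisfy the third-difference identity,
  first for directions and points in the dense set, then everywhere. The form \<open>b\<close> comes
  from the chosen subsequence and is not claimed to be the same for another one.\<close>

lemma blow_up_quadratic:
  fixes h :: "'a::euclidean_space \<Rightarrow> real"
  assumes conv: "convex_on UNIV h" and C: "0 \<le> C" and \<rho>: "0 < \<rho>"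
    and lower: "\<And>y. h x + p \<bullet> y \<le> h (x + y)"
    and upper: "\<And>y. norm y < \<rho> \<Longrightarrow> h (x + y) \<le> h x + p \<bullet> y + C * (norm y)\<^sup>2"
    and D: "countable D" "closure D = UNIV"
    and defect: "\<And>e w. e \<in> D \<Longrightarrow> w \<in> D \<Longrightarrow> (\<lambda>j. defect h e j (x + (1 / 2 ^ Suc j) *\<^sub>R w)) \<longlonglongrightarrow> 0"
  obtains b and k :: "nat \<Rightarrow> nat" where "bilinear b" "\<And>y z. b y z = b z y" "strict_mono k"
    "\<And>y. (\<lambda>n. 4 ^ k n * (h (x + (1 / 2 ^ k n) *\<^sub>R y) - h x - p \<bullet> ((1 / 2 ^ k n) *\<^sub>R y))) \<longlonglongrightarrow> b y y / 2"
    "\<And>\<eta>. 0 < \<eta> \<Longrightarrow> eventually (\<lambda>n. \<forall>y\<in>cball 0 1.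
       \<bar>4 ^ k n * (h (x + (1 / 2 ^ k n) *\<^sub>R y) - h x - p \<bullet> ((1 / 2 ^ k n) *\<^sub>R y)) - b y y / 2\<bar> \<le> \<eta>) sequentially"
proof -
  define G where "G j y = 4 ^ j * (h (x + (1 / 2 ^ j) *\<^sub>R y) - h x - p \<bullet> ((1 / 2 ^ j) *\<^sub>R y))" for j y
  have G0: "0 \<le> G j y" for j y unfolding G_def using lower[of "(1 / 2 ^ j) *\<^sub>R y"] by simp
  have GC: "G j y \<le> C * (norm y)\<^sup>2" if "norm ((1 / 2 ^ j) *\<^sub>R y) < \<rho>" for j y
  proof -
    have "G j y \<le> 4 ^ j * (C * (norm ((1 / 2 ^ j) *\<^sub>R y))\<^sup>2)"
      unfolding G_def using upper[OF that] by (intro mult_left_mono) auto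
    also have "\<dots> = C * (norm y)\<^sup>2"
    proof -
      have "(2::real) ^ j * 2 ^ j = 4 ^ j" by (simp flip: power_mult_distrib)
      then show ?thesis by (simp add: power2_eq_square field_simps)
    qed
    finally show ?thesis .
  qed
  have GCev: "eventually (\<lambda>j. \<forall>y. norm y \<le> R \<longrightarrow> G j y \<le> C * (norm y)\<^sup>2) sequentially" for R
  proof -
    have "(\<lambda>j. R / 2 ^ j) \<longlonglongrightarrow> 0" by (intro LIMSEQ_divide_realpow_zero) auto
    then have "eventually (\<lambda>j. R / 2 ^ j < \<rho>) sequentially" using \<rho> by (rule order_tendstoD)
    then show ?thesis
    proof eventually_elim
      case (elim j)
      have "norm ((1 / 2 ^ j) *\<^sub>R y) < \<rho>" if "norm y \<le> R" for y
        using that elim divide_right_mono[OF that, of "2 ^ j"] by simp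
      then show ?case using GC by blast
    qed
  qed
  have convG: "convex_on UNIV (G j)" for j
  proof (rule convex_onI)
    fix t :: real and y z :: 'a assume t: "0 < t" "t < 1"
    have eq: "x + s *\<^sub>R ((1 - t) *\<^sub>R y + t *\<^sub>R z)
      = (1 - t) *\<^sub>R (x + s *\<^sub>R y) + t *\<^sub>R (x + s *\<^sub>R z)" for s :: real
      by (simp add: algebra_simps)
    have "h (x + (1 / 2 ^ j) *\<^sub>R ((1 - t) *\<^sub>R y + t *\<^sub>R z))
       \<le> (1 - t) * h (x + (1 / 2 ^ j) *\<^sub>R y) + t * h (x + (1 / 2 ^ j) *\<^sub>R z)"
      unfolding eq using t by (intro convex_onD[OF conv]) auto
    then have "G j ((1 - t) *\<^sub>R y + t *\<^sub>R z) \<le> 4 ^ j *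
      ((1 - t) * h (x + (1 / 2 ^ j) *\<^sub>R y) + t * h (x + (1 / 2 ^ j) *\<^sub>R z) - h x
        - p \<bullet> ((1 / 2 ^ j) *\<^sub>R ((1 - t) *\<^sub>R y + t *\<^sub>R z)))"
      unfolding G_def by (intro mult_left_mono) auto
    also have "\<dots> = (1 - t) * G j y + t * G j z"
    proof -
      have "p \<bullet> (s *\<^sub>R ((1 - t) *\<^sub>R y + t *\<^sub>R z)) = (1 - t) * (p \<bullet> (s *\<^sub>R y)) + t * (p \<bullet> (s *\<^sub>R z))"
        for s :: real by (simp add: inner_add_right algebra_simps)
      then show ?thesis unfolding G_def by (simp only:) (simp only: algebra_simps)
    qed
    finally show "G j ((1 - t) *\<^sub>R y + t *\<^sub>R z) \<le> (1 - t) * G j y + t * G j z" .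
  qed simp
  have sdG: "second_diff (G j) e w = dyadic_quot h e j (x + (1 / 2 ^ j) *\<^sub>R w)" for j e w
    unfolding second_diff_def G_def dyadic_quot_def
    by (simp add: algebra_simps inner_add_right inner_diff_right)
  have lip: "eventually (\<lambda>j. \<forall>y z. norm y \<le> R \<longrightarrow> norm z \<le> R \<longrightarrow>
      \<bar>G j y - G j z\<bar> \<le> 4 * C * R * norm (y - z)) sequentially" if R: "0 < R" for R
    using GCev[of "2 * R"]
  proof eventually_elim
    case (elim j)
    have "0 \<le> G j y \<and> G j y \<le> C * (2 * R)\<^sup>2" if "norm y \<le> 2 * R" for y
    proof -
      have "G j y \<le> C * (norm y)\<^sup>2" using elim that by blast
      also have "\<dots> \<le> C * (2 * R)\<^sup>2" using that C by (intro mult_left_mono power_mono) auto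
      finally show ?thesis using G0 by blast
    qed
    then have "\<bar>G j y - G j z\<bar> \<le> C * (2 * R)\<^sup>2 / R * norm (y - z)" if "norm y \<le> R" "norm z \<le> R" for y z
      using convex_bounded_imp_lipschitz[OF convG[of j] R _ that] by blast
    moreover have "C * (2 * R)\<^sup>2 / R = 4 * C * R" using R by (simp add: power2_eq_square)
    ultimately show ?case by metis
  qed
  \<comment> \<open>The extraction of a subsequence needs one bound for all indices and points.
    Truncation at the paraboloid and the normalising denominator provide the bound 1; at a fixed
    point the truncation is inactive for large indices.\<close>
  define F where "F n y = min (G (Suc n) y) (C * (norm y)\<^sup>2) / (1 + C * (norm y)\<^sup>2)" for n y
  have "norm (F n y) \<le> 1" for n y
  proof -
    have "0 \<le> C * (norm y)\<^sup>2" using C by simp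
    then show ?thesis using G0[of "Suc n" y] unfolding F_def by (auto simp: divide_simps min_def)
  qed
  then obtain k0 where k0: "strict_mono k0" and k0lim: "\<And>y. y \<in> D \<Longrightarrow> \<exists>l. (\<lambda>n. F (k0 n) y) \<longlonglongrightarrow> l"
    using function_convergent_subsequence[OF D(1), of F 1] by blast
  \<comment> \<open>\<open>defect h e j\<close> compares quotients at scale \<open>Suc j\<close>, so
    the blow-up at scale \<open>k n\<close> belongs to the defect with index
    \<open>k0 n\<close>.\<close>
  define k where "k n = Suc (k0 n)" for n
  have kmono: "strict_mono k" using k0 by (simp add: k_def strict_mono_def)
  have evk: "eventually (\<lambda>n. P (k n)) sequentially" if "eventually P sequentially" for P
    using filterlim_subseq[OF kmono] that by (simp add: filterlim_iff)
  have limD: "convergent (\<lambda>n. G (k n) y)" if yD: "y \<in> D" for y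
  proof -
    obtain l where "(\<lambda>n. F (k0 n) y) \<longlonglongrightarrow> l" using k0lim[OF yD] by blast
    then have lim: "(\<lambda>n. F (k0 n) y * (1 + C * (norm y)\<^sup>2)) \<longlonglongrightarrow> l * (1 + C * (norm y)\<^sup>2)"
      by (rule tendsto_mult_right)
    have pos: "1 + C * (norm y)\<^sup>2 \<noteq> 0" using C by (smt (verit) mult_nonneg_nonneg zero_le_power2)
    have "eventually (\<lambda>n. G (k n) y \<le> C * (norm y)\<^sup>2) sequentially"
      using evk[OF GCev[of "norm y"]] by (auto elim: eventually_mono)
    then have "eventually (\<lambda>n. F (k0 n) y * (1 + C * (norm y)\<^sup>2) = G (k n) y) sequentially"
      by eventually_elim (use pos in \<open>auto simp: F_def k_def\<close>)
    then show ?thesis using lim by (auto simp: convergent_def elim: Lim_transform_eventually)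
  qed
  have conv_all: "convergent (\<lambda>n. G (k n) y)" for y
  proof -
    define R where "R = norm y + 1"
    have R: "0 < R" by (simp add: R_def add_nonneg_pos)
    have "Cauchy (\<lambda>n. G (k n) y)"
    proof (rule metric_CauchyI)
      fix \<epsilon> :: real assume \<epsilon>: "0 < \<epsilon>"
      define \<delta> where "\<delta> = min 1 (\<epsilon> / (3 * (4 * C * R + 1)))"
      have L: "0 < 4 * C * R + 1" using C R by (simp add: add_nonneg_pos)
      have \<delta>: "0 < \<delta>" using \<epsilon> L by (simp add: \<delta>_def)
      obtain d where d: "d \<in> D" "dist d y < \<delta>"
        using D(2) \<delta> by (metis UNIV_I closure_approachable)
      have dR: "norm d \<le> R" "norm y \<le> R"
        using d(2) norm_triangle_ineq2[of d y] by (auto simp: R_def \<delta>_def dist_norm)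
      have Ld: "4 * C * R * norm (y - d) \<le> \<epsilon> / 3"
      proof -
        have "4 * C * R * norm (y - d) \<le> (4 * C * R + 1) * (\<epsilon> / (3 * (4 * C * R + 1)))"
          using d(2) L C R by (intro mult_mono) (auto simp: \<delta>_def dist_norm norm_minus_commute)
        also have "\<dots> = \<epsilon> / 3" if "4 * C * R + 1 = l" "0 < l" for l using that(2) unfolding that(1) by simp
        finally show ?thesis using L by blast
      qed
      obtain N1 where N1: "\<And>n. n \<ge> N1 \<Longrightarrow> \<bar>G (k n) y - G (k n) d\<bar> \<le> 4 * C * R * norm (y - d)"
        using evk[OF lip[OF R]] dR unfolding eventually_sequentially by meson
      have "Cauchy (\<lambda>n. G (k n) d)" using limD[OF d(1)] by (rule convergent_Cauchy)
      then obtain N2 where N2: "\<And>m n. m \<ge> N2 \<Longrightarrow> n \<ge> N2 \<Longrightarrow> dist (G (k m) d) (G (k n) d) < \<epsilon> / 3"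
        using \<epsilon> by (meson metric_CauchyD divide_pos_pos zero_less_numeral)
      show "\<exists>N. \<forall>m\<ge>N. \<forall>n\<ge>N. dist (G (k m) y) (G (k n) y) < \<epsilon>"
      proof (intro exI allI impI)
        fix m n assume "max N1 N2 \<le> m" "max N1 N2 \<le> n"
        then show "dist (G (k m) y) (G (k n) y) < \<epsilon>"
          using N1[of m] N1[of n] N2[of m n] Ld unfolding dist_real_def by linarith
      qed
    qed
    then show ?thesis by (rule Cauchy_convergent)
  qed
  define g where "g y = lim (\<lambda>n. G (k n) y)" for y
  have glim: "(\<lambda>n. G (k n) y) \<longlonglongrightarrow> g y" for y
    using conv_all[of y] by (simp add: g_def convergent_LIMSEQ_iff)
  have glip: "\<bar>g y - g z\<bar> \<le> 4 * C * R * norm (y - z)" if "0 < R" "norm y \<le> R" "norm z \<le> R" for R y z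
  proof (rule tendsto_upperbound)
    show "(\<lambda>n. \<bar>G (k n) y - G (k n) z\<bar>) \<longlonglongrightarrow> \<bar>g y - g z\<bar>" by (intro tendsto_intros glim)
    show "eventually (\<lambda>n. \<bar>G (k n) y - G (k n) z\<bar> \<le> 4 * C * R * norm (y - z)) sequentially"
      using evk[OF lip[OF that(1)]] that by (auto elim: eventually_mono)
  qed simp
  have gcont: "continuous_on UNIV g"
  proof (rule continuous_at_imp_continuous_on, rule ballI)
    fix y :: 'a
    have "((\<lambda>z. 4 * C * (norm y + 1) * norm (z - y)) \<longlongrightarrow> 4 * C * (norm y + 1) * norm (y - y)) (at y)"
      by (intro tendsto_intros)
    then have "((\<lambda>z. 4 * C * (norm y + 1) * norm (z - y)) \<longlongrightarrow> 0) (at y)" by simp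
    moreover have "eventually (\<lambda>z. norm (g z - g y) \<le> 4 * C * (norm y + 1) * norm (z - y)) (at y)"
      unfolding eventually_at
    proof (intro exI[of _ 1] conjI ballI impI)
      fix z assume "z \<noteq> y \<and> dist z y < 1"
      then have "norm z \<le> norm y + 1" using norm_triangle_ineq2[of z y] by (simp add: dist_norm)
      then show "norm (g z - g y) \<le> 4 * C * (norm y + 1) * norm (z - y)"
        using glip[of "norm y + 1" z y] by (simp add: add_nonneg_pos)
    qed simp
    ultimately have "((\<lambda>z. g z - g y) \<longlongrightarrow> 0) (at y)" by (rule Lim_null_comparison[rotated])
    then show "isCont g y" by (simp add: isCont_def Lim_null[symmetric])
  qed
  have gbnd: "\<bar>g y\<bar> \<le> C * (norm y)\<^sup>2" for y
  proof (rule tendsto_upperbound)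
    show "(\<lambda>n. \<bar>G (k n) y\<bar>) \<longlonglongrightarrow> \<bar>g y\<bar>" by (intro tendsto_intros glim)
    show "eventually (\<lambda>n. \<bar>G (k n) y\<bar> \<le> C * (norm y)\<^sup>2) sequentially"
      using evk[OF GCev[of "norm y"]] G0 by (auto elim!: eventually_mono)
  qed simp
  have sdlim: "(\<lambda>n. second_diff (G (k n)) e w) \<longlonglongrightarrow> second_diff g e w" for e w
    unfolding second_diff_def by (intro tendsto_intros glim)
  \<comment> \<open>By \<open>sdG\<close>, the second differences of the blow-up at
    \<open>w + e\<close>, \<open>w\<close> and \<open>w - e\<close> are precisely the three finer
    quotients in one defect. They are bounded by \<open>K\<close>, so the vanishing of the defect
    forces neighbouring ones to agree in the limit.\<close>
  have thirdD: "second_diff g e (w + e) = second_diff g e w" if "e \<in> D" "w \<in> D" for e w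
  proof -
    define K where "K = 4 * C * (norm w + 2 * norm e)\<^sup>2"
    have bnd: "eventually (\<lambda>n. \<forall>v. norm v \<le> norm w + norm e \<longrightarrow> second_diff (G (k n)) e v \<le> K) sequentially"
      using evk[OF GCev[of "norm w + 2 * norm e"]]
    proof eventually_elim
      case (elim n)
      have G1: "G (k n) y \<le> C * (norm w + 2 * norm e)\<^sup>2" if "norm y \<le> norm w + 2 * norm e" for y
      proof -
        have "G (k n) y \<le> C * (norm y)\<^sup>2" using elim that by blast
        also have "\<dots> \<le> C * (norm w + 2 * norm e)\<^sup>2" using that C by (intro mult_left_mono power_mono) auto
        finally show ?thesis .
      qed
      show ?case
      proof (intro allI impI)
        fix v :: 'a assume v: "norm v \<le> norm w + norm e"
        have "norm (v + e) \<le> norm w + 2 * norm e" "norm (v - e) \<le> norm w + 2 * norm e"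
          using v norm_triangle_ineq[of v e] norm_triangle_ineq4[of v e] by auto
        then show "second_diff (G (k n)) e v \<le> K"
          unfolding second_diff_def K_def using G1[of "v + e"] G1[of "v - e"] G0[of "k n" v]
            zero_le_power2[of "norm w + 2 * norm e"] mult_nonneg_nonneg[OF C zero_le_power2[of "norm w + 2 * norm e"]] by linarith
      qed
    qed
    have "eventually (\<lambda>n. (second_diff (G (k n)) e (w + e) - second_diff (G (k n)) e w)\<^sup>2
        \<le> 16 * (1 + K) ^ 3 * defect h e (k0 n) (x + (1 / 2 ^ Suc (k0 n)) *\<^sub>R w)) sequentially"
      using bnd
    proof eventually_elim
      case (elim n)
      define z where "z = x + (1 / 2 ^ Suc (k0 n)) *\<^sub>R w"
      have sd: "second_diff (G (k n)) e (w + e) = dyadic_quot h e (Suc (k0 n)) (z + (1 / 2 ^ Suc (k0 n)) *\<^sub>R e)"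
        "second_diff (G (k n)) e w = dyadic_quot h e (Suc (k0 n)) z"
        "second_diff (G (k n)) e (w - e) = dyadic_quot h e (Suc (k0 n)) (z - (1 / 2 ^ Suc (k0 n)) *\<^sub>R e)"
        unfolding sdG k_def z_def by (simp_all add: algebra_simps)
      have n3: "norm (w + e) \<le> norm w + norm e" "norm (w - e) \<le> norm w + norm e"
        by (rule norm_triangle_ineq norm_triangle_ineq4)+
      have "norm w \<le> norm w + norm e" by simp
      then have B: "second_diff (G (k n)) e (w + e) \<le> K" "second_diff (G (k n)) e w \<le> K"
          "second_diff (G (k n)) e (w - e) \<le> K"
        using elim n3 by blast+
      show ?case
        unfolding sd defect_def z_def[symmetric]
        by (intro inverse_average_defect_bound dyadic_quot_nonneg[OF conv] dyadic_quot_average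
            B(1)[unfolded sd] B(2)[unfolded sd] B(3)[unfolded sd])
    qed
    moreover have "(\<lambda>n. 16 * (1 + K) ^ 3 * defect h e (k0 n) (x + (1 / 2 ^ Suc (k0 n)) *\<^sub>R w)) \<longlonglongrightarrow> 16 * (1 + K) ^ 3 * 0"
      using LIMSEQ_subseq_LIMSEQ[OF defect[OF that] k0] by (intro tendsto_intros) (simp add: o_def)
    moreover have "(\<lambda>n. (second_diff (G (k n)) e (w + e) - second_diff (G (k n)) e w)\<^sup>2)
        \<longlonglongrightarrow> (second_diff g e (w + e) - second_diff g e w)\<^sup>2"
      by (intro tendsto_intros sdlim)
    ultimately have "(second_diff g e (w + e) - second_diff g e w)\<^sup>2 \<le> 16 * (1 + K) ^ 3 * 0"
      by (intro tendsto_le[OF _ _ _ , where F = sequentially]) auto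
    then show ?thesis by simp
  qed
  have third: "second_diff g e (w + e) = second_diff g e w" for e w
  proof -
    have c: "continuous_on UNIV (\<lambda>z. second_diff g (e' z) (w' z))"
      if "continuous_on UNIV e'" "continuous_on UNIV w'" for e' w' :: "'a \<Rightarrow> 'a"
      using continuous_on_compose2[OF continuous_on_second_diff[OF gcont], of UNIV "\<lambda>z. (e' z, w' z)"] that
      by (simp add: continuous_intros)
    have 1: "second_diff g e (w + e) - second_diff g e w = 0" if "w \<in> D" for w
      using continuous_constant_on_closure[of D "\<lambda>e. second_diff g e (w + e) - second_diff g e w" 0 e] D(2) that
      by (simp add: thirdD c continuous_intros)
    then show ?thesis
      using continuous_constant_on_closure[of D "\<lambda>w. second_diff g e (w + e) - second_diff g e w" 0 w] D(2)
      by (simp add: c continuous_intros)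
  qed
  obtain b where b: "bilinear b" "\<And>x y. b x y = b y x" "\<And>y. g y = b y y / 2"
    using quadratic_form_of_third_difference[OF gcont gbnd third] by blast
  \<comment> \<open>The common Lipschitz constant \<open>4 * C\<close> on the unit ball turns
    convergence on a finite net into uniform convergence; three errors of size
    \<open>\<eta> / 3\<close> add up.\<close>
  have unif: "eventually (\<lambda>n. \<forall>y\<in>cball 0 1. \<bar>G (k n) y - g y\<bar> \<le> \<eta>) sequentially" if \<eta>: "0 < \<eta>" for \<eta>
  proof -
    have pos: "0 < 4 * C + 1" using C by simp
    define \<delta> where "\<delta> = \<eta> / (3 * (4 * C + 1))"
    have \<delta>: "0 < \<delta>" using \<eta> pos by (simp add: \<delta>_def)
    have scale: "l * (\<eta> / (3 * l)) = \<eta> / 3" if "0 < l" for l :: real using that by simp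
    have cov: "cball 0 1 \<subseteq> (\<Union>z\<in>cball (0::'a) 1. ball z \<delta>)"
      using \<delta> by (meson UN_I centre_in_ball subsetI)
    obtain Z where Z: "Z \<subseteq> cball (0::'a) 1" "finite Z" "cball 0 1 \<subseteq> (\<Union>z\<in>Z. ball z \<delta>)"
      by (rule compactE_image[OF compact_cball _ cov]) auto
    have "eventually (\<lambda>n. \<forall>z\<in>Z. dist (G (k n) z) (g z) < \<eta> / 3) sequentially"
      using Z(2) \<eta> by (intro eventually_ball_finite ballI tendstoD[OF glim]) auto
    moreover have "eventually (\<lambda>n. \<forall>y z. norm y \<le> 1 \<longrightarrow> norm z \<le> 1 \<longrightarrow>
      \<bar>G (k n) y - G (k n) z\<bar> \<le> 4 * C * 1 * norm (y - z)) sequentially"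
      by (rule evk[OF lip]) simp
    ultimately show ?thesis
    proof eventually_elim
      case (elim n)
      show ?case
      proof
        fix y :: 'a assume y: "y \<in> cball 0 1"
        then obtain z where z: "z \<in> Z" "dist z y < \<delta>" using Z(3) by auto
        then have ny: "norm z \<le> 1" "norm y \<le> 1" using y z(1) Z(1) by auto
        have "4 * C * 1 * norm (y - z) \<le> (4 * C + 1) * \<delta>"
          using z(2) C by (intro mult_mono) (auto simp: dist_norm norm_minus_commute)
        also have "\<dots> = \<eta> / 3" unfolding \<delta>_def by (rule scale[OF pos])
        finally have small: "4 * C * 1 * norm (y - z) \<le> \<eta> / 3" .
        have "\<bar>G (k n) y - G (k n) z\<bar> \<le> 4 * C * 1 * norm (y - z)" using elim(2) ny by blast
        moreover have "\<bar>g y - g z\<bar> \<le> 4 * C * 1 * norm (y - z)" by (rule glip) (use ny in auto)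
        moreover have "\<bar>G (k n) z - g z\<bar> < \<eta> / 3" using elim(1) z(1) by (auto simp: dist_real_def)
        ultimately show "\<bar>G (k n) y - g y\<bar> \<le> \<eta>" using small by linarith
      qed
    qed
  qed
  show ?thesis
    by (rule that[OF b(1,2) kmono]) (use glim unif b(3) in \<open>auto simp: G_def\<close>)
qed


text \<open>The expansion only holds up to \<open>\<eta> * r\<^sup>2\<close>, so the paraboloid is
  made steeper by \<open>8 * \<eta> * (norm y)\<^sup>2\<close>. At distance at least
  \<open>r / 2\<close> this gains \<open>2 * \<eta> * r\<^sup>2\<close>, twice the error, and the
  maximum of the difference must lie within \<open>r / 2\<close>. The conclusion is the same
  paraboloid expanded around the new point; the gradient of the added square explains the
  coefficient 16.\<close>

lemma approx_quadratic_imp_touching: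
  fixes f :: "'a::euclidean_space \<Rightarrow> real"
  assumes cont: "continuous_on UNIV f" and b: "bilinear b" "\<And>y z. b y z = b z y"
    and r: "0 < r" and \<eta>: "0 < \<eta>"
    and approx: "\<And>y. norm y \<le> r \<Longrightarrow> \<bar>f (zs + y) - f zs - p \<bullet> y - b y y / 2\<bar> \<le> \<eta> * r\<^sup>2"
  obtains z where "dist zs z < r / 2"
    "\<And>y. y \<in> ball zs r \<Longrightarrow> f y \<le> f z + (p \<bullet> (y - z) + b (z - zs) (y - z) + 16 * \<eta> * ((z - zs) \<bullet> (y - z)))
        + b (y - z) (y - z) / 2 + 8 * \<eta> * (norm (y - z))\<^sup>2"
proof -
  interpret bb: bounded_bilinear b using b(1) by (simp add: bilinear_conv_bounded_bilinear)
  define P where "P y = p \<bullet> y + b y y / 2 + 8 * \<eta> * (norm y)\<^sup>2" for y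
  have "continuous_on (cball zs r) (\<lambda>y. f y - P (y - zs))"
    unfolding P_def by (intro continuous_intros bb.continuous_on continuous_on_subset[OF cont]) auto
  then obtain z where z: "z \<in> cball zs r" and zmax: "\<And>y. y \<in> cball zs r \<Longrightarrow> f y - P (y - zs) \<le> f z - P (z - zs)"
    using continuous_attains_sup[of "cball zs r" "\<lambda>y. f y - P (y - zs)"] r by force
  have "dist zs z < r / 2"
  proof (rule ccontr)
    assume "\<not> dist zs z < r / 2"
    then have far: "r / 2 \<le> norm (z - zs)" "norm (z - zs) \<le> r"
      using z by (auto simp: dist_norm norm_minus_commute)
    then have "(r / 2)\<^sup>2 \<le> (norm (z - zs))\<^sup>2" using r by (intro power_mono) auto
    then have "8 * \<eta> * (r / 2)\<^sup>2 \<le> 8 * \<eta> * (norm (z - zs))\<^sup>2" using \<eta> by (intro mult_left_mono) auto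
    then have "2 * \<eta> * r\<^sup>2 \<le> 8 * \<eta> * (norm (z - zs))\<^sup>2" by (simp add: power_divide)
    moreover have "f zs \<le> f z - P (z - zs)"
      using zmax[of zs] r by (simp add: P_def bb.zero_left)
    moreover have "f z - f zs - p \<bullet> (z - zs) - b (z - zs) (z - zs) / 2 \<le> \<eta> * r\<^sup>2"
      using approx[of "z - zs"] far by auto
    moreover have "0 < \<eta> * r\<^sup>2" using \<eta> r by simp
    ultimately show False unfolding P_def by argo
  qed
  moreover have "f y \<le> f z + (p \<bullet> (y - z) + b (z - zs) (y - z) + 16 * \<eta> * ((z - zs) \<bullet> (y - z)))
        + b (y - z) (y - z) / 2 + 8 * \<eta> * (norm (y - z))\<^sup>2" if "y \<in> ball zs r" for y
  proof -
    have "P (y - zs) = P (z - zs) + (p \<bullet> (y - z) + b (z - zs) (y - z) + 16 * \<eta> * ((z - zs) \<bullet> (y - z)))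
        + b (y - z) (y - z) / 2 + 8 * \<eta> * (norm (y - z))\<^sup>2"
    proof -
      define s t where "s = z - zs" and "t = y - z"
      have "y - zs = s + t" by (simp add: s_def t_def)
      moreover have "b (s + t) (s + t) = b s s + 2 * b s t + b t t"
        by (simp add: bb.add_left bb.add_right b(2)[of t s])
      moreover have "(norm (s + t))\<^sup>2 = (norm s)\<^sup>2 + 2 * (s \<bullet> t) + (norm t)\<^sup>2"
        by (simp add: power2_norm_eq_inner inner_add_left inner_add_right inner_commute)
      ultimately show ?thesis unfolding P_def s_def[symmetric] t_def[symmetric]
        by (simp add: inner_add_right algebra_simps)
    qed
    then show ?thesis using zmax[of y] that by auto
  qed
  ultimately show ?thesis by (rule that)
qed

text \<open>Perturbed maxima of \<open>h - \<Theta>\<close>: since a convex function lies above its tangent planes, the slope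
  depends Lipschitz continuously on the contact point. As every small slope occurs, the contact set
  is not negligible, so it meets the set of full measure of \<open>AE_defect_tendsto_zero\<close>.\<close>

lemma contact_point:
  fixes h :: "'a::euclidean_space \<Rightarrow> real"
  assumes conv: "convex_on UNIV h" and S: "bilinear S" "\<And>y z. S y z = S z y"
    and \<Theta>: "\<And>z. \<Theta> z = l \<bullet> (z - zc) + S (z - zc) (z - zc) / 2"
    and R: "0 < R" and sphere: "\<And>z. dist zc z = R \<Longrightarrow> h z - \<Theta> z < h zc - \<Theta> zc"
    and \<eta>: "0 < \<eta>"
  obtains zs q p b and k :: "nat \<Rightarrow> nat" where
    "dist zc zs < R" "norm q \<le> \<eta>"
    "\<And>z. z \<in> cball zc R \<Longrightarrow> h z - \<Theta> z + q \<bullet> z \<le> h zs - \<Theta> zs + q \<bullet> zs"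
    "\<And>y. p \<bullet> y = l \<bullet> y + S (zs - zc) y - q \<bullet> y"
    "bilinear b" "\<And>y z. b y z = b z y" "\<And>y. b y y \<le> S y y" "strict_mono k"
    "\<And>y. (\<lambda>n. 4 ^ k n * (h (zs + (1 / 2 ^ k n) *\<^sub>R y) - h zs - p \<bullet> ((1 / 2 ^ k n) *\<^sub>R y))) \<longlonglongrightarrow> b y y / 2"
    "\<And>\<eta>. 0 < \<eta> \<Longrightarrow> eventually (\<lambda>n. \<forall>y\<in>cball 0 1.
       \<bar>4 ^ k n * (h (zs + (1 / 2 ^ k n) *\<^sub>R y) - h zs - p \<bullet> ((1 / 2 ^ k n) *\<^sub>R y)) - b y y / 2\<bar> \<le> \<eta>) sequentially"
proof -
  interpret bS: bounded_bilinear S using S(1) by (simp add: bilinear_conv_bounded_bilinear)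
  have conth: "continuous_on A h" for A
    using convex_on_continuous[OF open_UNIV conv] continuous_on_subset by blast
  have cont\<Theta>: "continuous_on A \<Theta>" for A
    unfolding \<Theta> by (intro continuous_intros bS.continuous_on) auto
  define gr where "gr z = (\<Sum>i\<in>Basis. S z i *\<^sub>R i)" for z
  have gr: "gr z \<bullet> y = S z y" for z y
  proof -
    have "gr z \<bullet> y = (\<Sum>i\<in>Basis. (y \<bullet> i) * S z i)"
      by (simp add: gr_def inner_sum_left inner_commute[of y] mult.commute)
    also have "\<dots> = S z (\<Sum>i\<in>Basis. (y \<bullet> i) *\<^sub>R i)" by (simp add: bS.sum_right bS.scaleR_right)
    finally show ?thesis by (simp add: euclidean_representation)
  qed
  have "linear gr" unfolding gr_def
    by (rule linearI) (simp_all add: bS.add_left bS.scaleR_left scaleR_add_left sum.distrib scaleR_sum_right)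
  then obtain B where B: "B > 0" "\<And>z. norm (gr z) \<le> B * norm z" using linear_bounded_pos by blast
  have grd: "gr x - gr y = gr (x - y)" for x y using \<open>linear gr\<close> by (simp add: linear_diff)
  obtain C0 where C0: "\<And>y z. norm (S y z) \<le> norm y * norm z * C0" "C0 > 0" using bS.pos_bounded by blast
  define C where "C = C0 / 2"
  have C: "0 < C" "S y y / 2 \<le> C * (norm y)\<^sup>2" for y
    using C0(1)[of y y] C0(2) by (auto simp: C_def power2_eq_square mult.commute)
  define w where "w z = h z - \<Theta> z" for z
  define contact where "contact z q \<longleftrightarrow> z \<in> ball zc R \<and> (\<forall>z'\<in>cball zc R. w z' + q \<bullet> z' \<le> w z + q \<bullet> z)" for z q
  define p where "p z q = l + gr (z - zc) - q" for z q
  have upper: "h z' \<le> h z + p z q \<bullet> (z' - z) + S (z' - z) (z' - z) / 2" if "contact z q" "z' \<in> cball zc R" for z z' q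
  proof -
    have "\<Theta> (z + y) = \<Theta> z + (l + gr (z - zc)) \<bullet> y + S y y / 2" for y
    proof -
      define v where "v = z - zc"
      have "z + y - zc = v + y" by (simp add: v_def)
      then show ?thesis
        unfolding \<Theta> v_def[symmetric]
        by (simp add: inner_add_left inner_add_right gr bS.add_left bS.add_right S(2)[of y v] field_simps)
    qed
    from this[of "z' - z"] show ?thesis
      using that unfolding contact_def w_def p_def
      by (auto simp: inner_diff_left inner_diff_right inner_add_left dest!: bspec[of _ _ z'])
  qed
  \<comment> \<open>The paraboloid bounds \<open>h\<close> from above at
    \<open>z - s *\<^sub>R y\<close>. Since \<open>z\<close> lies between this point and
    \<open>z + y\<close>, convexity gives a lower bound at \<open>z + y\<close>, and the quadratic
    error disappears as \<open>s\<close> tends to 0.\<close>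
  have lower: "h z + p z q \<bullet> y \<le> h (z + y)" if c: "contact z q" for z q y
  proof -
    have "((\<lambda>s. h z + p z q \<bullet> y - s * (C * (norm y)\<^sup>2)) \<longlongrightarrow> h z + p z q \<bullet> y - 0 * (C * (norm y)\<^sup>2)) (at_right 0)"
      by (intro tendsto_intros)
    moreover have "eventually (\<lambda>s. h z + p z q \<bullet> y - s * (C * (norm y)\<^sup>2) \<le> h (z + y)) (at_right (0::real))"
    proof -
      have "((\<lambda>s. s * norm y) \<longlongrightarrow> 0 * norm y) (at_right (0::real))" by (intro tendsto_intros)
      then have "eventually (\<lambda>s. s * norm y < R - dist zc z) (at_right 0)"
        using c by (intro order_tendstoD(2)[where y = "0 * norm y"]) (auto simp: contact_def)
      moreover have "eventually (\<lambda>s::real. 0 < s) (at_right 0)" by (simp add: eventually_at_right_less)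
      ultimately show ?thesis
      proof eventually_elim
        case (elim s)
        have "z - s *\<^sub>R y \<in> cball zc R"
          using elim norm_triangle_ineq4[of "zc - z" "- (s *\<^sub>R y)"]
          by (simp add: dist_norm algebra_simps)
        then have "h (z - s *\<^sub>R y) \<le> h z + p z q \<bullet> (- (s *\<^sub>R y)) + S (s *\<^sub>R y) (s *\<^sub>R y) / 2"
          using upper[OF c, of "z - s *\<^sub>R y"] by (simp add: bS.minus_left bS.minus_right)
        also have "\<dots> \<le> h z - s * (p z q \<bullet> y) + s * (s * (C * (norm y)\<^sup>2))"
          using C(2)[of "s *\<^sub>R y"] by (simp add: power_mult_distrib power2_eq_square algebra_simps)
        finally have le1: "h (z - s *\<^sub>R y) \<le> h z - s * (p z q \<bullet> y) + s * (s * (C * (norm y)\<^sup>2))" .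
        define t where "t = s / (1 + s)"
        have t: "0 \<le> t" "t \<le> 1" "t * (1 + s) = s" using elim by (auto simp: t_def)
        have "(1 - t) *\<^sub>R (z - s *\<^sub>R y) + t *\<^sub>R (z + y) = z + (t * (1 + s) - s) *\<^sub>R y"
          by (simp add: algebra_simps)
        then have "(1 - t) *\<^sub>R (z - s *\<^sub>R y) + t *\<^sub>R (z + y) = z" by (simp add: t)
        then have "h z \<le> (1 - t) * h (z - s *\<^sub>R y) + t * h (z + y)"
          using convex_onD[OF conv t(1,2), of "z - s *\<^sub>R y" "z + y"] by simp
        then have "(1 + s) * h z \<le> (1 + s) * ((1 - t) * h (z - s *\<^sub>R y) + t * h (z + y))"
          using elim by (intro mult_left_mono) auto
        also have "\<dots> = (1 + s - t * (1 + s)) * h (z - s *\<^sub>R y) + t * (1 + s) * h (z + y)"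
          by (simp add: algebra_simps)
        also have "\<dots> = h (z - s *\<^sub>R y) + s * h (z + y)" unfolding t(3) by simp
        finally have "s * (h z + p z q \<bullet> y - s * (C * (norm y)\<^sup>2)) \<le> s * h (z + y)"
          using le1 by (simp add: algebra_simps)
        then show ?case using elim by simp
      qed
    qed
    ultimately show ?thesis by (intro tendsto_upperbound) (auto simp: trivial_limit_at_right_real)
  qed
  \<comment> \<open>The difference of the slopes is tested in its own direction with length
    \<open>d\<close>: at \<open>z2 + y\<close> the function lies above the tangent plane at
    \<open>z1\<close> and below the paraboloid at \<open>z2\<close>. Each of the two uses of a
    paraboloid contributes \<open>C * d\<^sup>2\<close>.\<close>
  have lip: "norm (p z1 q1 - p z2 q2) \<le> 2 * C * d"
    if c: "contact z1 q1" "contact z2 q2" and d: "norm (z1 - z2) \<le> d" "0 < d" "d < R - dist zc z2"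
    for z1 z2 q1 q2 d
  proof (cases "p z1 q1 = p z2 q2")
    case False
    define v where "v = p z1 q1 - p z2 q2"
    define y where "y = (d / norm v) *\<^sub>R v"
    have v: "norm v > 0" using False by (simp add: v_def)
    have ny: "norm y = d" using v d by (simp add: y_def)
    have "z2 + y \<in> cball zc R" using d ny norm_triangle_ineq[of "z2 - zc" y]
      by (simp add: dist_norm norm_minus_commute algebra_simps)
    then have 1: "h (z2 + y) \<le> h z2 + p z2 q2 \<bullet> y + C * d\<^sup>2"
      using upper[OF c(2), of "z2 + y"] C(2)[of y] ny by simp
    have 2: "h z1 + p z1 q1 \<bullet> (z2 + y - z1) \<le> h (z2 + y)"
      using lower[OF c(1), of "z2 + y - z1"] by simp
    have "z2 \<in> cball zc R" using c(2) by (auto simp: contact_def)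
    then have "h z2 \<le> h z1 + p z1 q1 \<bullet> (z2 - z1) + C * (norm (z2 - z1))\<^sup>2"
      using upper[OF c(1), of z2] C(2)[of "z2 - z1"] by simp
    also have "\<dots> \<le> h z1 + p z1 q1 \<bullet> (z2 - z1) + C * d\<^sup>2"
      using C(1) d by (intro add_left_mono mult_left_mono power_mono) (auto simp: norm_minus_commute)
    finally have 3: "h z2 \<le> h z1 + p z1 q1 \<bullet> (z2 - z1) + C * d\<^sup>2" .
    have "v \<bullet> y \<le> 2 * C * d\<^sup>2"
      using 1 2 3 unfolding v_def by (simp add: inner_diff_left inner_diff_right inner_add_right algebra_simps)
    moreover have "v \<bullet> y = d * norm v"
      using v by (simp add: y_def dot_square_norm power2_eq_square)
    ultimately have "d * norm v \<le> d * (2 * C * d)" by (simp add: power2_eq_square algebra_simps)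
    then show ?thesis using d by (simp add: v_def)
  qed (use C d in auto)
  \<comment> \<open>At a single point \<open>lip\<close> holds for every small \<open>d\<close>, so
    a contact point determines its tilt. Therefore the choice function \<open>Q\<close> below takes
    every small tilt as a value.\<close>
  have unique: "q1 = q2" if c: "contact z q1" "contact z q2" for z q1 q2
  proof -
    have "norm (p z q1 - p z q2) \<le> 2 * C * d" if "0 < d" "d < R - dist zc z" for d
      using lip[OF c, of d] that by simp
    moreover have "0 < R - dist zc z" using c by (auto simp: contact_def)
    ultimately have "eventually (\<lambda>d. norm (p z q1 - p z q2) \<le> 2 * C * d) (at_right 0)"
      unfolding eventually_at_right_field by blast
    moreover have "((\<lambda>d. 2 * C * d) \<longlongrightarrow> 2 * C * 0) (at_right 0)" by (intro tendsto_intros)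
    ultimately have "norm (p z q1 - p z q2) \<le> 2 * C * 0"
      by (intro tendsto_lowerbound) (auto simp: trivial_limit_at_right_real)
    then show ?thesis by (simp add: p_def)
  qed
  obtain \<gamma> where \<gamma>: "0 < \<gamma>" "\<And>z. dist zc z = R \<Longrightarrow> w z \<le> w zc - \<gamma>"
  proof (cases "sphere zc R = {}")
    case True
    then have "dist zc z \<noteq> R" for z by auto
    then show ?thesis using that[of 1] by auto
  next
    case False
    have "continuous_on (sphere zc R) w" unfolding w_def by (intro continuous_intros conth cont\<Theta>)
    then obtain z0 where "z0 \<in> sphere zc R" "\<And>z. z \<in> sphere zc R \<Longrightarrow> w z \<le> w z0"
      using continuous_attains_sup[of "sphere zc R" w] False by auto
    then show ?thesis using that[of "w zc - w z0"] sphere[of z0] by (auto simp: w_def)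
  qed
  \<comment> \<open>On the sphere the values lie at least \<open>\<gamma>\<close> below the value at
    the centre. A tilt of norm less than \<open>\<gamma> / (2 * R)\<close> changes the comparison by
    less than that, so it cannot move the maximum to the boundary.\<close>
  define \<delta> where "\<delta> = min \<eta> (\<gamma> / (2 * R))"
  have \<delta>: "0 < \<delta>" "\<delta> \<le> \<eta>" "\<delta> * R < \<gamma>"
  proof -
    have "\<delta> * R \<le> \<gamma> / (2 * R) * R" using R by (intro mult_right_mono) (auto simp: \<delta>_def)
    then show "\<delta> * R < \<gamma>" using R \<gamma>(1) by simp
  qed (use \<eta> \<gamma> R in \<open>auto simp: \<delta>_def\<close>)
  have exists: "\<exists>z. contact z q" if q: "norm q < \<delta>" for q
  proof -
    have "continuous_on (cball zc R) (\<lambda>z. w z + q \<bullet> z)"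
      unfolding w_def by (intro continuous_intros conth cont\<Theta>)
    then obtain z where z: "z \<in> cball zc R" "\<And>z'. z' \<in> cball zc R \<Longrightarrow> w z' + q \<bullet> z' \<le> w z + q \<bullet> z"
      using continuous_attains_sup[of "cball zc R" "\<lambda>z. w z + q \<bullet> z"] R by force
    have "dist zc z \<noteq> R"
    proof
      assume eq: "dist zc z = R"
      have "w zc + q \<bullet> zc \<le> w z + q \<bullet> z" using z(2)[of zc] R by simp
      then have "\<gamma> \<le> q \<bullet> (z - zc)" using \<gamma>(2)[OF eq] by (simp add: inner_diff_right)
      also have "\<dots> \<le> norm q * norm (z - zc)" by (rule norm_cauchy_schwarz)
      also have "\<dots> \<le> \<delta> * R" using q eq R by (intro mult_mono) (use \<delta>(1) in \<open>auto simp: dist_norm norm_minus_commute\<close>)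
      finally show False using \<delta>(3) by simp
    qed
    then have "contact z q" using z unfolding contact_def by simp
    then show ?thesis by blast
  qed
  define K where "K = {z. \<exists>q. norm q < \<delta> \<and> contact z q}"
  define Q where "Q z = (SOME q. norm q < \<delta> \<and> contact z q)" for z
  have Q: "contact z (Q z)" if "z \<in> K" for z
    using that someI_ex[of "\<lambda>q. norm q < \<delta> \<and> contact z q"] unfolding K_def Q_def by blast
  have "\<not> negligible K"
  proof
    assume "negligible K"
    then have "negligible (Q ` K)"
    proof (rule negligible_locally_Lipschitz_image[OF order_refl])
      fix x assume x: "x \<in> K"
      have pos: "0 < R - dist zc x" using Q[OF x] by (auto simp: contact_def)
      have "norm (Q y - Q x) \<le> (B + 2 * C) * norm (y - x)" if y: "y \<in> K" "y \<in> ball x (R - dist zc x)" for y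
      proof (cases "y = x")
        case False
        have "Q y - Q x = gr (y - x) - (p y (Q y) - p x (Q x))" unfolding p_def grd[symmetric] by simp
        then have "norm (Q y - Q x) \<le> norm (gr (y - x)) + norm (p y (Q y) - p x (Q x))"
          by (metis norm_triangle_ineq4)
        also have "\<dots> \<le> B * norm (y - x) + 2 * C * norm (y - x)"
          by (intro add_mono B lip Q x y) (use False y in \<open>auto simp: dist_norm norm_minus_commute\<close>)
        finally show ?thesis by (simp add: algebra_simps)
      qed simp
      then show "\<exists>T B. open T \<and> x \<in> T \<and> (\<forall>y\<in>K \<inter> T. norm (Q y - Q x) \<le> B * norm (y - x))"
        using pos by (intro exI[of _ "ball x (R - dist zc x)"] exI[of _ "B + 2 * C"]) auto
    qed
    moreover have "ball 0 \<delta> \<subseteq> Q ` K"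
    proof
      fix q :: 'a assume "q \<in> ball 0 \<delta>"
      then have q: "norm q < \<delta>" by simp
      obtain z where z: "contact z q" using exists[OF q] by blast
      then have "z \<in> K" using q by (auto simp: K_def)
      then show "q \<in> Q ` K" using unique[OF z Q] by blast
    qed
    ultimately have "negligible (ball (0::'a) \<delta>)" by (rule negligible_subset)
    then show False using open_not_negligible[of "ball (0::'a) \<delta>"] \<delta>(1) by simp
  qed
  obtain D :: "'a set" where D: "countable D" "closure D = UNIV"
    using separable[of "UNIV :: 'a set"] by (metis top.extremum_unique)
  have "AE x in lborel. \<forall>e\<in>D. \<forall>v\<in>D. (\<lambda>j. defect h e j (x + (1 / 2 ^ Suc j) *\<^sub>R v)) \<longlonglongrightarrow> 0"
    by (intro AE_ball_countable' D(1) AE_defect_tendsto_zero conv)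
  then obtain N where N: "{x. \<not> (\<forall>e\<in>D. \<forall>v\<in>D. (\<lambda>j. defect h e j (x + (1 / 2 ^ Suc j) *\<^sub>R v)) \<longlonglongrightarrow> 0)} \<subseteq> N"
      "N \<in> null_sets lborel"
    unfolding eventually_ae_filter by auto
  have "negligible N" using N(2) by (simp add: negligible_iff_null_sets null_sets_completionI)
  then have "\<not> K \<subseteq> N" using \<open>\<not> negligible K\<close> negligible_subset by blast
  then obtain zs where zs: "zs \<in> K" "\<And>e v. e \<in> D \<Longrightarrow> v \<in> D \<Longrightarrow> (\<lambda>j. defect h e j (zs + (1 / 2 ^ Suc j) *\<^sub>R v)) \<longlonglongrightarrow> 0"
    using N(1) by blast
  then obtain q where q: "norm q < \<delta>" "contact zs q" by (auto simp: K_def)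
  define ps where "ps = p zs q"
  have pos: "0 < R - dist zc zs" using q(2) by (auto simp: contact_def)
  have near: "zs + y \<in> cball zc R" if "norm y < R - dist zc zs" for y
    using that norm_triangle_ineq[of "zs - zc" y] by (simp add: dist_norm norm_minus_commute algebra_simps)
  have up: "h (zs + y) \<le> h zs + ps \<bullet> y + S y y / 2" if "norm y < R - dist zc zs" for y
    using upper[OF q(2) near[OF that]] by (simp add: ps_def)
  have up2: "h (zs + y) \<le> h zs + ps \<bullet> y + C * (norm y)\<^sup>2" if "norm y < R - dist zc zs" for y
    using up[OF that] C(2)[of y] by simp
  have low: "h zs + ps \<bullet> y \<le> h (zs + y)" for y unfolding ps_def by (rule lower[OF q(2)])
  obtain b and k :: "nat \<Rightarrow> nat" where b: "bilinear b" "\<And>y z. b y z = b z y" and k: "strict_mono k"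
    and lim: "\<And>y. (\<lambda>n. 4 ^ k n * (h (zs + (1 / 2 ^ k n) *\<^sub>R y) - h zs - ps \<bullet> ((1 / 2 ^ k n) *\<^sub>R y))) \<longlonglongrightarrow> b y y / 2"
    and unif: "\<And>\<eta>. 0 < \<eta> \<Longrightarrow> eventually (\<lambda>n. \<forall>y\<in>cball 0 1.
       \<bar>4 ^ k n * (h (zs + (1 / 2 ^ k n) *\<^sub>R y) - h zs - ps \<bullet> ((1 / 2 ^ k n) *\<^sub>R y)) - b y y / 2\<bar> \<le> \<eta>) sequentially"
    using blow_up_quadratic[OF conv less_imp_le[OF C(1)] pos low up2 D zs(2)] by blast
  have bS': "b y y \<le> S y y" for y
  proof -
    have "eventually (\<lambda>n. norm ((1 / 2 ^ k n) *\<^sub>R y) < R - dist zc zs) sequentially"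
    proof -
      have "(\<lambda>n. (1 / 2 ^ k n) *\<^sub>R y) \<longlonglongrightarrow> 0"
        using LIMSEQ_subseq_LIMSEQ[OF tendsto_half_pow k] by (simp add: o_def)
      from tendstoD[OF this pos] show ?thesis by (simp only: dist_norm diff_zero)
    qed
    then have "eventually (\<lambda>n. 4 ^ k n * (h (zs + (1 / 2 ^ k n) *\<^sub>R y) - h zs - ps \<bullet> ((1 / 2 ^ k n) *\<^sub>R y)) \<le> S y y / 2) sequentially"
    proof eventually_elim
      case (elim n)
      have "4 ^ k n * (h (zs + (1 / 2 ^ k n) *\<^sub>R y) - h zs - ps \<bullet> ((1 / 2 ^ k n) *\<^sub>R y))
          \<le> 4 ^ k n * (S ((1 / 2 ^ k n) *\<^sub>R y) ((1 / 2 ^ k n) *\<^sub>R y) / 2)"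
        using up[OF elim] by (intro mult_left_mono) auto
      also have "\<dots> = S y y / 2"
      proof -
        have "(2::real) ^ k n * 2 ^ k n = 4 ^ k n" by (simp flip: power_mult_distrib)
        then show ?thesis by (simp add: bS.scaleR_left bS.scaleR_right field_simps)
      qed
      finally show ?case .
    qed
    then have "b y y / 2 \<le> S y y / 2" by (intro tendsto_upperbound[OF lim]) auto
    then show ?thesis by simp
  qed
  have slope: "ps \<bullet> y = l \<bullet> y + S (zs - zc) y - q \<bullet> y" for y
    by (simp add: ps_def p_def gr inner_diff_left inner_add_left)
  have top: "h z - \<Theta> z + q \<bullet> z \<le> h zs - \<Theta> zs + q \<bullet> zs" if "z \<in> cball zc R" for z
    using q(2) that unfolding contact_def w_def by blast
  show ?thesis
    by (rule that[OF _ _ top slope b bS' k lim unif]) (use pos q(1) \<delta>(2) in auto)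
qed

text \<open>In separated variables every blow-up is the sum of its restrictions to the two groups,
  hence the limit form has no mixed part. At one common scale \<open>r\<close> each summand then has
  its own touching paraboloid. The points \<open>z1\<close> and \<open>z2\<close> are found
  independently, so the pair need not be the contact point \<open>zs\<close>.\<close>

lemma contact_touching_split:
  fixes h1 :: "'a::euclidean_space \<Rightarrow> real" and h2 :: "'b::euclidean_space \<Rightarrow> real"
  assumes conv1: "convex_on UNIV h1" and conv2: "convex_on UNIV h2"
    and S: "bilinear S" "\<And>y z. S y z = S z y"
    and \<Theta>: "\<And>z. \<Theta> z = l \<bullet> (z - zc) + S (z - zc) (z - zc) / 2"
    and R: "0 < R"
    and sphere: "\<And>z. dist zc z = R \<Longrightarrow> h1 (fst z) + h2 (snd z) - \<Theta> z < h1 (fst zc) + h2 (snd zc) - \<Theta> zc"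
    and \<eta>: "0 < \<eta>"
  obtains zs q p b1 b2 where
    "dist zc zs < R" "norm q \<le> \<eta>"
    "\<And>z. z \<in> cball zc R \<Longrightarrow> h1 (fst z) + h2 (snd z) - \<Theta> z + q \<bullet> z \<le> h1 (fst zs) + h2 (snd zs) - \<Theta> zs + q \<bullet> zs"
    "\<And>y. p \<bullet> y = l \<bullet> y + S (zs - zc) y - q \<bullet> y"
    "bilinear b1" "\<And>y z. b1 y z = b1 z y" "bilinear b2" "\<And>y z. b2 y z = b2 z y"
    "\<And>y. b1 (fst y) (fst y) + b2 (snd y) (snd y) \<le> S y y"
    "\<And>\<eta>' r0. 0 < \<eta>' \<Longrightarrow> 0 < r0 \<Longrightarrow> \<exists>r z1 z2. 0 < r \<and> r < r0 \<and>
      dist (fst zs) z1 < r / 2 \<and> dist (snd zs) z2 < r / 2 \<and>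
      (\<forall>y\<in>ball (fst zs) r. h1 y \<le> h1 z1 + (fst p \<bullet> (y - z1) + b1 (z1 - fst zs) (y - z1)
          + 16 * \<eta>' * ((z1 - fst zs) \<bullet> (y - z1))) + b1 (y - z1) (y - z1) / 2 + 8 * \<eta>' * (norm (y - z1))\<^sup>2) \<and>
      (\<forall>y\<in>ball (snd zs) r. h2 y \<le> h2 z2 + (snd p \<bullet> (y - z2) + b2 (z2 - snd zs) (y - z2)
          + 16 * \<eta>' * ((z2 - snd zs) \<bullet> (y - z2))) + b2 (y - z2) (y - z2) / 2 + 8 * \<eta>' * (norm (y - z2))\<^sup>2)"
proof -
  define h where "h z = h1 (fst z) + h2 (snd z)" for z
  have conv: "convex_on UNIV h"
  proof (rule convex_onI)
    fix t :: real and x y :: "'a \<times> 'b" assume t: "0 < t" "t < 1"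
    have "h1 ((1 - t) *\<^sub>R fst x + t *\<^sub>R fst y) \<le> (1 - t) * h1 (fst x) + t * h1 (fst y)"
      "h2 ((1 - t) *\<^sub>R snd x + t *\<^sub>R snd y) \<le> (1 - t) * h2 (snd x) + t * h2 (snd y)"
      using t by (auto intro!: convex_onD[OF conv1] convex_onD[OF conv2])
    then show "h ((1 - t) *\<^sub>R x + t *\<^sub>R y) \<le> (1 - t) * h x + t * h y"
      by (simp add: h_def algebra_simps)
  qed simp
  have sphere': "h z - \<Theta> z < h zc - \<Theta> zc" if "dist zc z = R" for z
    using sphere[OF that] by (simp add: h_def)
  obtain zs q p b and k :: "nat \<Rightarrow> nat" where zs: "dist zc zs < R" "norm q \<le> \<eta>"
    and top: "\<And>z. z \<in> cball zc R \<Longrightarrow> h z - \<Theta> z + q \<bullet> z \<le> h zs - \<Theta> zs + q \<bullet> zs"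
    and slope: "\<And>y. p \<bullet> y = l \<bullet> y + S (zs - zc) y - q \<bullet> y"
    and b: "bilinear b" "\<And>y z. b y z = b z y" and bS: "\<And>y. b y y \<le> S y y" and k: "strict_mono k"
    and lim: "\<And>y. (\<lambda>n. 4 ^ k n * (h (zs + (1 / 2 ^ k n) *\<^sub>R y) - h zs - p \<bullet> ((1 / 2 ^ k n) *\<^sub>R y))) \<longlonglongrightarrow> b y y / 2"
    and unif: "\<And>\<eta>. 0 < \<eta> \<Longrightarrow> eventually (\<lambda>n. \<forall>y\<in>cball 0 1.
       \<bar>4 ^ k n * (h (zs + (1 / 2 ^ k n) *\<^sub>R y) - h zs - p \<bullet> ((1 / 2 ^ k n) *\<^sub>R y)) - b y y / 2\<bar> \<le> \<eta>) sequentially"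
    by (rule contact_point[OF conv S \<Theta> R sphere' \<eta>], assumption, rule that, assumption+)
  interpret bb: bounded_bilinear b using b(1) by (simp add: bilinear_conv_bounded_bilinear)
  define b1 where "b1 y z = b (y, 0) (z, 0)" for y z :: 'a
  define b2 where "b2 y z = b (0, y) (0, z)" for y z :: 'b
  have pair1: "(y + z, 0) = (y, 0) + (z, 0::'b)" "(c *\<^sub>R y, 0) = c *\<^sub>R (y, 0::'b)" for y z :: 'a and c
    by simp_all
  have pair2: "(0, y + z) = (0::'a, y) + (0, z)" "(0, c *\<^sub>R y) = c *\<^sub>R (0::'a, y)" for y z :: 'b and c
    by simp_all
  have bil1: "bilinear b1" unfolding bilinear_def b1_def
    by (auto intro!: linearI simp: pair1 bb.add_left bb.add_right bb.scaleR_left bb.scaleR_right simp del: add_Pair scaleR_Pair)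
  have bil2: "bilinear b2" unfolding bilinear_def b2_def
    by (auto intro!: linearI simp: pair2 bb.add_left bb.add_right bb.scaleR_left bb.scaleR_right simp del: add_Pair scaleR_Pair)
  have sym: "b1 y z = b1 z y" "b2 y' z' = b2 z' y'" for y z y' z'
    unfolding b1_def b2_def by (rule b(2))+
  have split: "b y y = b1 (fst y) (fst y) + b2 (snd y) (snd y)" for y
  proof -
    let ?G = "\<lambda>n y. 4 ^ k n * (h (zs + (1 / 2 ^ k n) *\<^sub>R y) - h zs - p \<bullet> ((1 / 2 ^ k n) *\<^sub>R y))"
    have "?G n y = ?G n (fst y, 0) + ?G n (0, snd y)" for n
      by (cases y) (simp add: h_def inner_prod_def algebra_simps)
    then have "(\<lambda>n. ?G n (fst y, 0) + ?G n (0, snd y)) \<longlonglongrightarrow> b y y / 2"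
      using lim[of y] by simp
    moreover have "(\<lambda>n. ?G n (fst y, 0) + ?G n (0, snd y)) \<longlonglongrightarrow> b (fst y, 0) (fst y, 0) / 2 + b (0, snd y) (0, snd y) / 2"
      by (intro tendsto_intros lim)
    ultimately have "b y y / 2 = b (fst y, 0) (fst y, 0) / 2 + b (0, snd y) (0, snd y) / 2"
      by (rule LIMSEQ_unique)
    then show ?thesis by (simp add: b1_def b2_def)
  qed
  have touch: "\<exists>r z1 z2. 0 < r \<and> r < r0 \<and>
      dist (fst zs) z1 < r / 2 \<and> dist (snd zs) z2 < r / 2 \<and>
      (\<forall>y\<in>ball (fst zs) r. h1 y \<le> h1 z1 + (fst p \<bullet> (y - z1) + b1 (z1 - fst zs) (y - z1)
          + 16 * \<eta>' * ((z1 - fst zs) \<bullet> (y - z1))) + b1 (y - z1) (y - z1) / 2 + 8 * \<eta>' * (norm (y - z1))\<^sup>2) \<and>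
      (\<forall>y\<in>ball (snd zs) r. h2 y \<le> h2 z2 + (snd p \<bullet> (y - z2) + b2 (z2 - snd zs) (y - z2)
          + 16 * \<eta>' * ((z2 - snd zs) \<bullet> (y - z2))) + b2 (y - z2) (y - z2) / 2 + 8 * \<eta>' * (norm (y - z2))\<^sup>2)"
    if \<eta>': "0 < \<eta>'" and r0: "0 < r0" for \<eta>' r0
  proof -
    have "(\<lambda>n. (1 / 2 ^ k n :: real) *\<^sub>R (1::real)) \<longlonglongrightarrow> 0"
      using LIMSEQ_subseq_LIMSEQ[OF tendsto_half_pow[of "1::real"] k] by (simp add: o_def)
    then have "eventually (\<lambda>n. (1 / 2 ^ k n :: real) *\<^sub>R (1::real) < r0) sequentially"
      using r0 by (rule order_tendstoD)
    then have "eventually (\<lambda>n. 1 / 2 ^ k n < r0 \<and> (\<forall>y\<in>cball 0 1.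
       \<bar>4 ^ k n * (h (zs + (1 / 2 ^ k n) *\<^sub>R y) - h zs - p \<bullet> ((1 / 2 ^ k n) *\<^sub>R y)) - b y y / 2\<bar> \<le> \<eta>')) sequentially"
      using unif[OF \<eta>'] by eventually_elim simp
    then obtain n where n: "1 / 2 ^ k n < r0" and "\<And>y. y\<in>cball 0 1 \<Longrightarrow>
       \<bar>4 ^ k n * (h (zs + (1 / 2 ^ k n) *\<^sub>R y) - h zs - p \<bullet> ((1 / 2 ^ k n) *\<^sub>R y)) - b y y / 2\<bar> \<le> \<eta>'"
      unfolding eventually_sequentially by blast
    note approx0 = this(2)
    define r :: real where "r = 1 / 2 ^ k n"
    have r: "0 < r" "r < r0" using n by (auto simp: r_def)
    have pow: "4 ^ k n = 1 / r\<^sup>2"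
      by (simp add: r_def power_divide power2_eq_square flip: power_mult_distrib)
    have approx: "\<bar>h (zs + y) - h zs - p \<bullet> y - b y y / 2\<bar> \<le> \<eta>' * r\<^sup>2" if "norm y \<le> r" for y
    proof -
      have "norm ((1 / r) *\<^sub>R y) \<le> 1" using that r by simp
      then have "\<bar>(1 / r\<^sup>2) * (h (zs + y) - h zs - p \<bullet> y) - b ((1 / r) *\<^sub>R y) ((1 / r) *\<^sub>R y) / 2\<bar> \<le> \<eta>'"
        using approx0[of "(1 / r) *\<^sub>R y"] r(1) unfolding pow r_def[symmetric] by simp
      also have "(1 / r\<^sup>2) * (h (zs + y) - h zs - p \<bullet> y) - b ((1 / r) *\<^sub>R y) ((1 / r) *\<^sub>R y) / 2
        = (1 / r\<^sup>2) * (h (zs + y) - h zs - p \<bullet> y - b y y / 2)"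
        using r(1) by (simp add: bb.scaleR_left bb.scaleR_right power2_eq_square divide_simps)
      finally show ?thesis using r(1) by (simp add: abs_mult field_simps)
    qed
    have a1: "\<bar>h1 (fst zs + y) - h1 (fst zs) - fst p \<bullet> y - b1 y y / 2\<bar> \<le> \<eta>' * r\<^sup>2" if "norm y \<le> r" for y
      using approx[of "(y, 0)"] that by (simp add: h_def b1_def inner_prod_def)
    have a2: "\<bar>h2 (snd zs + y) - h2 (snd zs) - snd p \<bullet> y - b2 y y / 2\<bar> \<le> \<eta>' * r\<^sup>2" if "norm y \<le> r" for y
      using approx[of "(0, y)"] that by (simp add: h_def b2_def inner_prod_def)
    have c1: "continuous_on UNIV h1" using convex_on_continuous[OF open_UNIV conv1] .
    have c2: "continuous_on UNIV h2" using convex_on_continuous[OF open_UNIV conv2] .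
    obtain z1 where "dist (fst zs) z1 < r / 2" "\<And>y. y \<in> ball (fst zs) r \<Longrightarrow> h1 y \<le> h1 z1
        + (fst p \<bullet> (y - z1) + b1 (z1 - fst zs) (y - z1) + 16 * \<eta>' * ((z1 - fst zs) \<bullet> (y - z1)))
        + b1 (y - z1) (y - z1) / 2 + 8 * \<eta>' * (norm (y - z1))\<^sup>2"
      by (rule approx_quadratic_imp_touching[OF c1 bil1 sym(1) r(1) \<eta>' a1], assumption, rule that, assumption+)
    moreover obtain z2 where "dist (snd zs) z2 < r / 2" "\<And>y. y \<in> ball (snd zs) r \<Longrightarrow> h2 y \<le> h2 z2
        + (snd p \<bullet> (y - z2) + b2 (z2 - snd zs) (y - z2) + 16 * \<eta>' * ((z2 - snd zs) \<bullet> (y - z2)))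
        + b2 (y - z2) (y - z2) / 2 + 8 * \<eta>' * (norm (y - z2))\<^sup>2"
      by (rule approx_quadratic_imp_touching[OF c2 bil2 sym(2) r(1) \<eta>' a2], assumption, rule that, assumption+)
    ultimately show ?thesis using r by blast
  qed
  show ?thesis
    by (rule that[OF zs(1,2) _ slope bil1 sym(1) bil2 sym(2) _ touch])
      (use top bS split in \<open>auto simp: h_def\<close>)
qed

section \<open>Gradients, Hessians and quartic test functions\<close>

lemma grad_eqI:
  fixes f :: "real^'m \<Rightarrow> real"
  assumes "GDERIV f x :> D"
  shows "grad f x = D"
  unfolding grad_def
proof (rule the_equality)
  fix D' assume "GDERIV f x :> D'"
  with assms have "(\<lambda>h. h \<bullet> D) = (\<lambda>h. h \<bullet> D')"
    unfolding gderiv_def by (rule has_derivative_unique)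
  then have "(D' - D) \<bullet> D = (D' - D) \<bullet> D'" by meson
  then have "(D' - D) \<bullet> (D' - D) = 0" by (simp add: inner_diff_right)
  then show "D' = D" by simp
qed (rule assms)

lemma differentiable_imp_GDERIV:
  fixes f :: "real^'m \<Rightarrow> real"
  assumes "f differentiable at x"
  shows "GDERIV f x :> grad f x"
proof -
  obtain f' where f': "(f has_derivative f') (at x)" using assms by (auto simp: differentiable_def)
  have "f' = (\<lambda>h. h \<bullet> adjoint f' 1)"
    using adjoint_works[OF has_derivative_linear[OF f'], of _ 1] by (simp add: fun_eq_iff)
  then have "GDERIV f x :> adjoint f' 1" using f' unfolding gderiv_def by simp
  then show ?thesis using grad_eqI by metis
qed

lemma hessian_eqI:
  fixes f :: "real^'m \<Rightarrow> real"
  assumes "(grad f has_derivative (\<lambda>h. H *v h)) (at x)"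
  shows "hessian f x = H"
  by (simp add: hessian_def jacobian_def flip: frechet_derivative_at[OF assms])

lemma differentiable_imp_hessian:
  fixes f :: "real^'m \<Rightarrow> real"
  assumes "grad f differentiable at x"
  shows "(grad f has_derivative (\<lambda>h. hessian f x *v h)) (at x)"
  using assms unfolding hessian_def by (simp add: jacobian_works)

text \<open>This allows a test function touching \<open>- v\<close> from above to be used as one
  touching \<open>v\<close> from below.\<close>

lemma C12_uminus:
  fixes \<Omega> :: "(real^'m) set"
  assumes \<Omega>: "open \<Omega>" and \<psi>: "C12 T \<Omega> \<psi>"
  shows "C12 T \<Omega> (\<lambda>t x. - \<psi> t x)"
    "\<And>t x. t \<in> {0<..T} \<Longrightarrow> x \<in> \<Omega> \<Longrightarrow> grad (\<lambda>x. - \<psi> t x) x = - grad (\<psi> t) x"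
    "\<And>t x. t \<in> {0<..T} \<Longrightarrow> x \<in> \<Omega> \<Longrightarrow> hessian (\<lambda>x. - \<psi> t x) x = - hessian (\<psi> t) x"
proof -
  obtain \<psi>t where d: "\<And>t x. t \<in> {0<..T} \<Longrightarrow> x \<in> \<Omega> \<Longrightarrow>
        ((\<lambda>s. \<psi> s x) has_real_derivative \<psi>t t x) (at t within {0<..T}) \<and>
        \<psi> t differentiable at x \<and> grad (\<psi> t) differentiable at x"
     and c: "continuous_on ({0<..T} \<times> \<Omega>) (\<lambda>(t, x). \<psi> t x)"
       "continuous_on ({0<..T} \<times> \<Omega>) (\<lambda>(t, x). \<psi>t t x)"
       "continuous_on ({0<..T} \<times> \<Omega>) (\<lambda>(t, x). grad (\<psi> t) x)"
       "continuous_on ({0<..T} \<times> \<Omega>) (\<lambda>(t, x). hessian (\<psi> t) x)"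
    using \<psi> unfolding C12_def by blast
  have g: "grad (\<lambda>x. - \<psi> t x) x = - grad (\<psi> t) x" if "t \<in> {0<..T}" "x \<in> \<Omega>" for t x
  proof (rule grad_eqI)
    have "GDERIV (\<psi> t) x :> grad (\<psi> t) x" using d[OF that] differentiable_imp_GDERIV by blast
    then show "GDERIV (\<lambda>x. - \<psi> t x) x :> - grad (\<psi> t) x"
      unfolding gderiv_def by (auto dest: has_derivative_minus)
  qed
  have hd: "(grad (\<lambda>x. - \<psi> t x) has_derivative (\<lambda>h. (- hessian (\<psi> t) x) *v h)) (at x)"
    if t: "t \<in> {0<..T}" and x: "x \<in> \<Omega>" for t x
  proof (rule has_derivative_transform_within_open[OF _ \<Omega> x])
    have "grad (\<psi> t) differentiable at x" using d[OF t x] by blast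
    from has_derivative_minus[OF differentiable_imp_hessian[OF this]]
    show "((\<lambda>x. - grad (\<psi> t) x) has_derivative (\<lambda>h. (- hessian (\<psi> t) x) *v h)) (at x)"
      by (simp add: scaleR_matrix_vector_assoc[of "-1", simplified])
  qed (use t in \<open>auto simp: g\<close>)
  have h: "hessian (\<lambda>x. - \<psi> t x) x = - hessian (\<psi> t) x" if "t \<in> {0<..T}" "x \<in> \<Omega>" for t x
    by (rule hessian_eqI[OF hd[OF that]])
  show "C12 T \<Omega> (\<lambda>t x. - \<psi> t x)"
    unfolding C12_def
  proof (intro exI[of _ "\<lambda>t x. - \<psi>t t x"] conjI ballI)
    fix t x assume tx: "t \<in> {0<..T}" "x \<in> \<Omega>"
    show "((\<lambda>s. - \<psi> s x) has_real_derivative - \<psi>t t x) (at t within {0<..T})"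
      using d[OF tx] by (intro DERIV_minus) blast
    show "(\<lambda>x. - \<psi> t x) differentiable at x"
      using d[OF tx] by (simp add: differentiable_minus)
    show "grad (\<lambda>x. - \<psi> t x) differentiable at x"
      using hd[OF tx] by (auto simp: differentiable_def)
  next
    show "continuous_on ({0<..T} \<times> \<Omega>) (\<lambda>(t, x). - \<psi> t x)"
      using continuous_on_minus[OF c(1)] by (simp add: case_prod_unfold)
    show "continuous_on ({0<..T} \<times> \<Omega>) (\<lambda>(t, x). - \<psi>t t x)"
      using continuous_on_minus[OF c(2)] by (simp add: case_prod_unfold)
    show "continuous_on ({0<..T} \<times> \<Omega>) (\<lambda>(t, x). grad (\<lambda>x. - \<psi> t x) x)"
      using continuous_on_minus[OF c(3)]
      by (rule continuous_on_eq) (auto simp: g)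
    show "continuous_on ({0<..T} \<times> \<Omega>) (\<lambda>(t, x). hessian (\<lambda>x. - \<psi> t x) x)"
      using continuous_on_minus[OF c(4)]
      by (rule continuous_on_eq) (auto simp: h)
  qed
  show "\<And>t x. t \<in> {0<..T} \<Longrightarrow> x \<in> \<Omega> \<Longrightarrow> grad (\<lambda>x. - \<psi> t x) x = - grad (\<psi> t) x" by (rule g)
  show "\<And>t x. t \<in> {0<..T} \<Longrightarrow> x \<in> \<Omega> \<Longrightarrow> hessian (\<lambda>x. - \<psi> t x) x = - hessian (\<psi> t) x" by (rule h)
qed

lemma sym_dot:
  fixes X :: "real^'m^'m"
  assumes "transpose X = X"
  shows "x \<bullet> (X *v y) = y \<bullet> (X *v x)"
  by (metis assms dot_lmul_matrix inner_commute transpose_matrix_vector)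

text \<open>The rank-one part in the Hessian of the fourth power of the norm.\<close>

definition outer :: "real^'m \<Rightarrow> real^'m^'m" where
  "outer y = (\<chi> i j. y $ i * y $ j)"

lemma outer_mult: "outer y *v h = (y \<bullet> h) *\<^sub>R y"
  by (simp add: outer_def matrix_vector_mult_def vec_eq_iff inner_vec_def sum_distrib_right sum_distrib_left mult_ac)

lemma scaleR_mat_mult: "(c *\<^sub>R mat 1) *v (h :: real^'m) = c *\<^sub>R h"
  by (simp flip: scaleR_matrix_vector_assoc)

text \<open>This is the shape of all test functions of the proof. The quartic term dominates away
  from \<open>xh\<close> but leaves gradient and Hessian at \<open>xh\<close> untouched, the factor
  \<open>c t\<close> allows a square to be switched off in time, and the term with \<open>m\<close>
  carries the mixed time-space derivative of a touching quadratic polynomial.\<close>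

lemma C12_quartic:
  fixes X :: "real^'m^'m" and \<psi> :: "real \<Rightarrow> real^'m \<Rightarrow> real"
  assumes X: "transpose X = X"
    and \<psi>: "\<And>t x. \<psi> t x = A t + (\<tau> t *\<^sub>R m + p) \<bullet> (x - xh) + (x - xh) \<bullet> (X *v (x - xh)) / 2
              + c t * (norm (x - xh))\<^sup>2 + C * (norm (x - xh)) ^ 4"
    and A: "\<And>t. (A has_real_derivative A' t) (at t)" "continuous_on UNIV A'"
    and c: "\<And>t. (c has_real_derivative c' t) (at t)" "continuous_on UNIV c'"
    and \<tau>: "\<And>t. (\<tau> has_real_derivative 1) (at t)"
  shows "C12 T \<Omega> \<psi>" "continuous_on UNIV (\<lambda>(t, x). \<psi> t x)"
    "grad (\<psi> t) x = \<tau> t *\<^sub>R m + p + X *v (x - xh) + (2 * c t) *\<^sub>R (x - xh) + (4 * C * (norm (x - xh))\<^sup>2) *\<^sub>R (x - xh)"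
    "hessian (\<psi> t) x = X + (2 * c t + 4 * C * (norm (x - xh))\<^sup>2) *\<^sub>R mat 1 + (8 * C) *\<^sub>R outer (x - xh)"
proof -
  have n4: "(norm y) ^ 4 = (y \<bullet> y)\<^sup>2" for y :: "real^'m"
  proof -
    have "(norm y) ^ 4 = ((norm y)\<^sup>2)\<^sup>2" by simp
    then show ?thesis by (simp only: power2_norm_eq_inner)
  qed
  have bl: "bounded_linear (\<lambda>x. X *v x)" by (rule matrix_vector_mul_bounded_linear)
  have gd: "GDERIV (\<psi> t) x :> (\<tau> t *\<^sub>R m + p + X *v (x - xh) + (2 * c t) *\<^sub>R (x - xh) + (4 * C * (norm (x - xh))\<^sup>2) *\<^sub>R (x - xh))" for t x
    unfolding gderiv_def \<psi> n4 power2_norm_eq_inner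
    apply (rule has_derivative_eq_rhs)
     apply (auto intro!: derivative_eq_intros bounded_linear.has_derivative[OF bl])[1]
    apply (rule ext)
    subgoal for h
      using sym_dot[OF X, of "x - xh" h]
      by (simp add: inner_add_right inner_add_left inner_commute algebra_simps power2_eq_square) (simp add: field_simps)
    done
  have geq: "grad (\<psi> t) x = \<tau> t *\<^sub>R m + p + X *v (x - xh) + (2 * c t) *\<^sub>R (x - xh) + (4 * C * (norm (x - xh))\<^sup>2) *\<^sub>R (x - xh)" for t x
    by (rule grad_eqI[OF gd])
  then show "grad (\<psi> t) x = \<tau> t *\<^sub>R m + p + X *v (x - xh) + (2 * c t) *\<^sub>R (x - xh) + (4 * C * (norm (x - xh))\<^sup>2) *\<^sub>R (x - xh)" .
  have hd: "(grad (\<psi> t) has_derivative (\<lambda>h. (X + (2 * c t + 4 * C * (norm (x - xh))\<^sup>2) *\<^sub>R mat 1 + (8 * C) *\<^sub>R outer (x - xh)) *v h)) (at x)" for t x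
    unfolding geq[abs_def] power2_norm_eq_inner
    apply (rule has_derivative_eq_rhs)
     apply (auto intro!: derivative_eq_intros bounded_linear.has_derivative[OF bl])[1]
    apply (rule ext)
    apply (simp add: matrix_vector_mult_add_rdistrib scaleR_mat_mult outer_mult algebra_simps inner_commute
         flip: scaleR_matrix_vector_assoc)
    done
  have heq: "hessian (\<psi> t) x = X + (2 * c t + 4 * C * (norm (x - xh))\<^sup>2) *\<^sub>R mat 1 + (8 * C) *\<^sub>R outer (x - xh)" for t x
    by (rule hessian_eqI[OF hd])
  then show "hessian (\<psi> t) x = X + (2 * c t + 4 * C * (norm (x - xh))\<^sup>2) *\<^sub>R mat 1 + (8 * C) *\<^sub>R outer (x - xh)" .
  have base: "continuous_on UNIV A" "continuous_on UNIV c" "continuous_on UNIV \<tau>"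
    by (rule DERIV_continuous_on, rule has_field_derivative_at_within, rule A c \<tau>)+
  have cA: "continuous_on S (\<lambda>z. A (f z))" "continuous_on S (\<lambda>z. c (f z))" "continuous_on S (\<lambda>z. \<tau> (f z))"
      "continuous_on S (\<lambda>z. A' (f z))" "continuous_on S (\<lambda>z. c' (f z))"
    if "continuous_on S f" for S and f :: "real \<times> (real^'m) \<Rightarrow> real"
    using A(2) c(2) base by (auto intro!: continuous_on_compose2[OF _ that, of UNIV])
  have cX: "continuous_on S (\<lambda>z. X *v f z)" if "continuous_on S f" for S and f :: "real \<times> (real^'m) \<Rightarrow> real^'m"
    by (rule bounded_linear.continuous_on[OF bl that])
  have cO: "continuous_on S (\<lambda>z. outer (f z))" if "continuous_on S f" for S and f :: "real \<times> (real^'m) \<Rightarrow> real^'m"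
    unfolding outer_def using that by (intro continuous_intros)
  have cont: "continuous_on S (\<lambda>(t, x). \<psi> t x)" for S
    unfolding \<psi> case_prod_unfold by (auto intro!: continuous_intros cA cX)
  then show "continuous_on UNIV (\<lambda>(t, x). \<psi> t x)" .
  show "C12 T \<Omega> \<psi>"
    unfolding C12_def
  proof (intro exI[of _ "\<lambda>t x. A' t + m \<bullet> (x - xh) + c' t * (norm (x - xh))\<^sup>2"] conjI ballI cont)
    fix t x assume "t \<in> {0<..T}" "x \<in> \<Omega>"
    show "((\<lambda>s. \<psi> s x) has_real_derivative A' t + m \<bullet> (x - xh) + c' t * (norm (x - xh))\<^sup>2) (at t within {0<..T})"
      unfolding \<psi> inner_add_left inner_scaleR_left
      by (rule DERIV_subset[OF _ subset_UNIV]) (auto intro!: derivative_eq_intros A c \<tau>)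
    show "\<psi> t differentiable at x" using gd[of t x] unfolding gderiv_def differentiable_def by blast
    show "grad (\<psi> t) differentiable at x" using hd[of t x] unfolding differentiable_def by blast
  next
    show "continuous_on ({0<..T} \<times> \<Omega>) (\<lambda>(t, x). A' t + m \<bullet> (x - xh) + c' t * (norm (x - xh))\<^sup>2)"
      unfolding case_prod_unfold by (auto intro!: continuous_intros cA)
    show "continuous_on ({0<..T} \<times> \<Omega>) (\<lambda>(t, x). grad (\<psi> t) x)"
      unfolding geq case_prod_unfold by (auto intro!: continuous_intros cA cX)
    show "continuous_on ({0<..T} \<times> \<Omega>) (\<lambda>(t, x). hessian (\<psi> t) x)"
      unfolding heq case_prod_unfold by (auto intro!: continuous_intros cA cO)
  qed
qed

section \<open>The Caputo operators\<close>

lemma set_integrable_powr_near_0: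
  fixes \<alpha> t :: real
  assumes "\<alpha> < 1" "0 < t"
  shows "set_integrable lborel {0<..<t} (\<lambda>\<tau>. \<tau> powr (- \<alpha>))"
    and "(LINT \<tau>:{0<..<t}|lborel. \<tau> powr (- \<alpha>)) = t powr (1 - \<alpha>) / (1 - \<alpha>)"
proof -
  define F where "F \<tau> = \<tau> powr (1 - \<alpha>) / (1 - \<alpha>)" for \<tau> :: real
  have F: "DERIV F x :> x powr (- \<alpha>)" if "0 < x" for x
    unfolding F_def using DERIV_cdivide[OF has_real_derivative_powr[OF that, of "1 - \<alpha>"], of "1 - \<alpha>"] assms by simp
  have F0: "((F \<circ> real_of_ereal) \<longlongrightarrow> 0) (at_right (ereal 0))"
  proof -
    have "((\<lambda>\<tau>. \<tau> powr (1 - \<alpha>) / (1 - \<alpha>)) \<longlongrightarrow> 0 powr (1 - \<alpha>) / (1 - \<alpha>)) (at_right (0::real))"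
      using assms by (intro tendsto_intros) (auto simp: eventually_at_right_less eventually_at_filter)
    then show ?thesis
      unfolding ereal_tendsto_simps F_def using assms by (simp add: o_def)
  qed
  have Ft: "((F \<circ> real_of_ereal) \<longlongrightarrow> F t) (at_left (ereal t))"
  proof -
    have "isCont F t" using F[OF assms(2)] by (rule DERIV_isCont)
    then have "(F \<longlongrightarrow> F t) (at_left t)" by (simp add: isCont_def filterlim_at_split)
    then show ?thesis unfolding ereal_tendsto_simps by (simp add: o_def)
  qed
  have cont: "isCont (\<lambda>\<tau>. \<tau> powr (- \<alpha>)) x" if "0 < x" for x :: real
    using that by (intro continuous_intros) auto
  note FTC = interval_integral_FTC_nonneg[of "ereal 0" "ereal t" F "\<lambda>\<tau>. \<tau> powr (- \<alpha>)", OF _ _ _ _ F0 Ft]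
  show "set_integrable lborel {0<..<t} (\<lambda>\<tau>. \<tau> powr (- \<alpha>))"
    using FTC(1) assms F cont by (simp add: einterval_eq zero_ereal_def)
  have "(LBINT x=ereal 0..ereal t. x powr (- \<alpha>)) = F t - 0"
    by (rule FTC(2)) (use assms F cont in auto)
  then show "(LINT \<tau>:{0<..<t}|lborel. \<tau> powr (- \<alpha>)) = t powr (1 - \<alpha>) / (1 - \<alpha>)"
    using assms by (simp add: interval_lebesgue_integral_def F_def)
qed

lemma set_integrable_powr_tail:
  fixes \<alpha> t :: real
  assumes "0 < \<alpha>" "0 < t"
  shows "set_integrable lborel {t<..} (\<lambda>\<tau>. 1 / \<tau> powr (\<alpha> + 1))"
    and "(LINT \<tau>:{t<..}|lborel. 1 / \<tau> powr (\<alpha> + 1)) = t powr (- \<alpha>) / \<alpha>"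
proof -
  define F where "F \<tau> = - (\<tau> powr (- \<alpha>)) / \<alpha>" for \<tau> :: real
  have F: "DERIV F x :> 1 / x powr (\<alpha> + 1)" if "0 < x" for x
    unfolding F_def using DERIV_cdivide[OF DERIV_minus[OF has_real_derivative_powr[OF that, of "- \<alpha>"]], of \<alpha>] assms
    by (simp add: powr_minus_divide[symmetric])
  have Ft: "((F \<circ> real_of_ereal) \<longlongrightarrow> F t) (at_right (ereal t))"
  proof -
    have "isCont F t" using F[OF assms(2)] by (rule DERIV_isCont)
    then have "(F \<longlongrightarrow> F t) (at_right t)" by (simp add: isCont_def filterlim_at_split)
    then show ?thesis unfolding ereal_tendsto_simps by (simp add: o_def)
  qed
  have Finf: "((F \<circ> real_of_ereal) \<longlongrightarrow> 0) (at_left \<infinity>)"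
  proof -
    have "((\<lambda>\<tau>. - (\<tau> powr (- \<alpha>)) / \<alpha>) \<longlongrightarrow> - 0 / \<alpha>) at_top"
      using assms by (intro tendsto_intros tendsto_neg_powr) (auto simp: filterlim_ident)
    then show ?thesis unfolding ereal_tendsto_simps F_def by (simp add: o_def)
  qed
  have cont: "isCont (\<lambda>\<tau>. 1 / \<tau> powr (\<alpha> + 1)) x" if "0 < x" for x :: real
    using that by (intro continuous_intros) auto
  have pos: "0 < x" if "ereal t < ereal x" for x using that assms by simp
  note FTC = interval_integral_FTC_nonneg[of "ereal t" \<infinity> F "\<lambda>\<tau>. 1 / \<tau> powr (\<alpha> + 1)", OF _ F[OF pos] cont[OF pos] _ Ft Finf]
  have ei: "einterval (ereal t) \<infinity> = {t<..}" by (auto simp: einterval_def)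
  show "set_integrable lborel {t<..} (\<lambda>\<tau>. 1 / \<tau> powr (\<alpha> + 1))"
    using FTC(1) unfolding ei by simp
  have "(LBINT x=ereal t..\<infinity>. 1 / x powr (\<alpha> + 1)) = 0 - F t"
    by (rule FTC(2)) auto
  then show "(LINT \<tau>:{t<..}|lborel. 1 / \<tau> powr (\<alpha> + 1)) = t powr (- \<alpha>) / \<alpha>"
    by (simp add: interval_lebesgue_integral_def ei F_def)
qed

text \<open>Dominated convergence, with the absolute value of the integrand on all of
  \<open>(0, t)\<close> as majorant. It reduces the limits in \<open>K0\<close> and
  \<open>K_lim_finite\<close> to a single integrability condition.\<close>

lemma K_op_tendsto_at_right_0:
  assumes int: "set_integrable lborel {0<..<t} (K_integrand \<alpha> f t)"
  shows "((\<lambda>a. K_op \<alpha> a t f t) \<longlongrightarrow> K_op \<alpha> 0 t f t) (at_right 0)"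
proof -
  have "((\<lambda>a. LINT \<tau>|lborel. indicator {a<..<t} \<tau> *\<^sub>R K_integrand \<alpha> f t \<tau>)
      \<longlongrightarrow> (LINT \<tau>|lborel. indicator {0<..<t} \<tau> *\<^sub>R K_integrand \<alpha> f t \<tau>)) (at_right 0)"
  proof (rule tendsto_at_right_sequentially[of 0 1])
    fix a :: "nat \<Rightarrow> real" assume a: "\<And>n. 0 < a n" "\<And>n. a n < 1" "decseq a" "a \<longlonglongrightarrow> 0"
    let ?w = "\<lambda>\<tau>. norm (indicator {0<..<t} \<tau> *\<^sub>R K_integrand \<alpha> f t \<tau>)"
    have meas: "(\<lambda>\<tau>. indicator {0<..<t} \<tau> *\<^sub>R K_integrand \<alpha> f t \<tau>) \<in> borel_measurable lborel"
      using int unfolding set_integrable_def by (rule borel_measurable_integrable)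
    have eq: "indicator {a n<..<t} \<tau> *\<^sub>R K_integrand \<alpha> f t \<tau>
        = indicator {a n<..<t} \<tau> *\<^sub>R (indicator {0<..<t} \<tau> *\<^sub>R K_integrand \<alpha> f t \<tau>)" for n \<tau>
      using a(1)[of n] by (auto simp: indicator_def)
    show "(\<lambda>n. LINT \<tau>|lborel. indicator {a n<..<t} \<tau> *\<^sub>R K_integrand \<alpha> f t \<tau>)
        \<longlonglongrightarrow> (LINT \<tau>|lborel. indicator {0<..<t} \<tau> *\<^sub>R K_integrand \<alpha> f t \<tau>)"
    proof (rule integral_dominated_convergence[where w = ?w])
      show "integrable lborel ?w" using int unfolding set_integrable_def by (rule integrable_norm)
      show "(\<lambda>\<tau>. indicator {a n<..<t} \<tau> *\<^sub>R K_integrand \<alpha> f t \<tau>) \<in> borel_measurable lborel" for n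
        unfolding eq using meas by measurable
      show "AE \<tau> in lborel. (\<lambda>n. indicator {a n<..<t} \<tau> *\<^sub>R K_integrand \<alpha> f t \<tau>)
          \<longlonglongrightarrow> indicator {0<..<t} \<tau> *\<^sub>R K_integrand \<alpha> f t \<tau>"
      proof (rule AE_I2)
        fix \<tau> :: real
        have "eventually (\<lambda>n. indicator {a n<..<t} \<tau> *\<^sub>R K_integrand \<alpha> f t \<tau> = indicator {0<..<t} \<tau> *\<^sub>R K_integrand \<alpha> f t \<tau>) sequentially"
        proof (cases "0 < \<tau>")
          case True
          with a(4) have "eventually (\<lambda>n. a n < \<tau>) sequentially" by (rule order_tendstoD)
          then show ?thesis by eventually_elim (use True in \<open>auto simp: indicator_def\<close>)
        next
          case False
          have "\<not> a n < \<tau>" for n using a(1)[of n] False by simp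
          then show ?thesis using False by (simp add: indicator_def)
        qed
        then show "(\<lambda>n. indicator {a n<..<t} \<tau> *\<^sub>R K_integrand \<alpha> f t \<tau>)
          \<longlonglongrightarrow> indicator {0<..<t} \<tau> *\<^sub>R K_integrand \<alpha> f t \<tau>"
          by (rule tendsto_eventually)
      qed
      show "AE \<tau> in lborel. norm (indicator {a n<..<t} \<tau> *\<^sub>R K_integrand \<alpha> f t \<tau>) \<le> ?w \<tau>" for n
        using a(1)[of n] by (intro AE_I2) (auto simp: indicator_def)
    qed (use meas in simp)
  qed simp
  then show ?thesis unfolding K_op_def set_lebesgue_integral_def by (intro tendsto_intros)
qed

lemma K0_eq:
  assumes "set_integrable lborel {0<..<t} (K_integrand \<alpha> f t)"
  shows "K0 \<alpha> f t = K_op \<alpha> 0 t f t"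
  unfolding K0_def by (rule tendsto_Lim[OF _ K_op_tendsto_at_right_0[OF assms]]) (simp add: trivial_limit_at_right_real)

lemma K_lim_finiteI:
  assumes "set_integrable lborel {0<..<t} (K_integrand \<alpha> f t)"
  shows "K_lim_finite \<alpha> f t"
  unfolding K_lim_finite_def
  using K_op_tendsto_at_right_0[OF assms] by (auto intro!: set_integrable_subset[OF assms])

lemma K_integrand_uminus: "K_integrand \<alpha> (\<lambda>s. - f s) t = (\<lambda>\<tau>. - K_integrand \<alpha> f t \<tau>)"
  by (rule ext) (simp add: K_integrand_def minus_divide_left)

lemma J_op_uminus: "J_op \<alpha> (\<lambda>s. - f s) t = - J_op \<alpha> f t"
  by (simp add: J_op_def minus_divide_left)

lemma K_op_uminus: "K_op \<alpha> a b (\<lambda>s. - f s) t = - K_op \<alpha> a b f t"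
  by (simp add: K_op_def K_integrand_uminus set_lebesgue_integral_def)

text \<open>The positive and negative parts are 1-Lipschitz functions of \<open>f\<close>.\<close>

lemma K0_existsI:
  assumes int: "set_integrable lborel {0<..<t} (K_integrand \<alpha> f t)"
    and meas: "f \<in> borel_measurable (restrict_space borel {0..t})"
  shows "K0_exists \<alpha> f t"
proof -
  have lip: "set_integrable lborel {0<..<t} (K_integrand \<alpha> (\<lambda>s. \<phi> (f s)) t)"
    if \<phi>: "\<And>x y. \<bar>\<phi> x - \<phi> y\<bar> \<le> \<bar>x - y\<bar>" and [measurable]: "\<phi> \<in> borel_measurable borel" for \<phi> :: "real \<Rightarrow> real"
    unfolding set_integrable_def
  proof (rule Bochner_Integration.integrable_bound[OF int[unfolded set_integrable_def]])
    have [measurable]: "(\<lambda>s. indicator {0..t} s *\<^sub>R f s) \<in> borel_measurable borel"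
      using meas by (subst (asm) borel_measurable_restrict_space_iff) auto
    have "(\<lambda>\<tau>. indicator {0<..<t} \<tau> *\<^sub>R ((\<phi> (f t) - \<phi> (indicator {0..t} (t - \<tau>) *\<^sub>R f (t - \<tau>))) / \<tau> powr (\<alpha> + 1)))
        \<in> borel_measurable lborel" by measurable
    also have "(\<lambda>\<tau>. indicator {0<..<t} \<tau> *\<^sub>R ((\<phi> (f t) - \<phi> (indicator {0..t} (t - \<tau>) *\<^sub>R f (t - \<tau>))) / \<tau> powr (\<alpha> + 1)))
       = (\<lambda>\<tau>. indicator {0<..<t} \<tau> *\<^sub>R K_integrand \<alpha> (\<lambda>s. \<phi> (f s)) t \<tau>)"
      by (auto simp: fun_eq_iff K_integrand_def indicator_def)
    finally show "(\<lambda>\<tau>. indicator {0<..<t} \<tau> *\<^sub>R K_integrand \<alpha> (\<lambda>s. \<phi> (f s)) t \<tau>) \<in> borel_measurable lborel" .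
    show "AE \<tau> in lborel. norm (indicator {0<..<t} \<tau> *\<^sub>R K_integrand \<alpha> (\<lambda>s. \<phi> (f s)) t \<tau>)
        \<le> norm (indicator {0<..<t} \<tau> *\<^sub>R K_integrand \<alpha> f t \<tau>)"
      using \<phi> by (intro AE_I2) (auto simp: indicator_def K_integrand_def abs_divide intro!: divide_right_mono)
  qed
  show ?thesis unfolding K0_exists_def
    by (intro conjI K_lim_finiteI lip) (auto simp: max_def)
qed

text \<open>Only increments ending at \<open>t\<close> enter the operators, so a Lipschitz bound
  against the one point \<open>t\<close>, uniform in \<open>k\<close>, gives the majorant
  \<open>L * \<tau> powr (- \<alpha>)\<close>. It is integrable near 0 because
  \<open>\<alpha> < 1\<close>.\<close>

lemma J_K_op_tendsto:
  assumes \<alpha>: "0 < \<alpha>" "\<alpha> < 1" and t: "0 < t"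
    and cont: "\<And>k. continuous_on {0..t} (g k)"
    and lip: "\<And>k s. s \<in> {0..t} \<Longrightarrow> \<bar>g k t - g k s\<bar> \<le> L * (t - s)"
    and lim: "\<And>s. s \<in> {0..t} \<Longrightarrow> (\<lambda>k. g k s) \<longlonglongrightarrow> f s"
  shows "\<And>k. set_integrable lborel {0<..<t} (K_integrand \<alpha> (g k) t)"
    and "set_integrable lborel {0<..<t} (K_integrand \<alpha> f t)"
    and "(\<lambda>k. J_op \<alpha> (g k) t + K_op \<alpha> 0 t (g k) t) \<longlonglongrightarrow> J_op \<alpha> f t + K_op \<alpha> 0 t f t"
proof -
  let ?w = "\<lambda>\<tau>. indicator {0<..<t} \<tau> *\<^sub>R (L * \<tau> powr (- \<alpha>))"
  have w: "integrable lborel ?w"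
    using set_integrable_powr_near_0(1)[OF \<alpha>(2) t] unfolding set_integrable_def[symmetric] by simp
  have meas: "(\<lambda>\<tau>. indicator {0<..<t} \<tau> *\<^sub>R K_integrand \<alpha> (g k) t \<tau>) \<in> borel_measurable lborel" for k
  proof -
    have c: "continuous_on {0<..<t} (\<lambda>\<tau>. K_integrand \<alpha> (g k) t \<tau>)"
      unfolding K_integrand_def by (intro continuous_intros continuous_on_compose2[OF cont]) auto
    show ?thesis
      using borel_measurable_continuous_on_indicator[OF _ c] by (simp del: real_scaleR_def)
  qed
  have bnd: "norm (indicator {0<..<t} \<tau> *\<^sub>R K_integrand \<alpha> (g k) t \<tau>) \<le> ?w \<tau>" for k \<tau>
  proof (cases "\<tau> \<in> {0<..<t}")
    case True
    have "\<bar>K_integrand \<alpha> (g k) t \<tau>\<bar> \<le> L * \<tau> / \<tau> powr (\<alpha> + 1)"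
      unfolding K_integrand_def abs_divide using lip[of "t - \<tau>" k] True by (intro frac_le) auto
    also have "\<dots> = L * \<tau> powr (- \<alpha>)" using True by (simp add: powr_add powr_minus_divide)
    finally show ?thesis using True by simp
  qed simp
  have conv: "(\<lambda>k. indicator {0<..<t} \<tau> *\<^sub>R K_integrand \<alpha> (g k) t \<tau>) \<longlonglongrightarrow> indicator {0<..<t} \<tau> *\<^sub>R K_integrand \<alpha> f t \<tau>" for \<tau>
  proof (cases "\<tau> \<in> {0<..<t}")
    case True
    then show ?thesis unfolding K_integrand_def using t by (intro tendsto_intros lim) auto
  qed simp
  have measf: "(\<lambda>\<tau>. indicator {0<..<t} \<tau> *\<^sub>R K_integrand \<alpha> f t \<tau>) \<in> borel_measurable lborel"
    by (rule borel_measurable_LIMSEQ_real[OF conv meas])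
  show "set_integrable lborel {0<..<t} (K_integrand \<alpha> (g k) t)" for k
    unfolding set_integrable_def by (rule Bochner_Integration.integrable_bound[OF w meas])
      (intro AE_I2 order_trans[OF bnd], simp)
  show "set_integrable lborel {0<..<t} (K_integrand \<alpha> f t)"
    unfolding set_integrable_def
    by (rule integrable_dominated_convergence[OF measf meas w AE_I2[OF conv] AE_I2[OF bnd]])
  have "(\<lambda>k. LINT \<tau>:{0<..<t}|lborel. K_integrand \<alpha> (g k) t \<tau>) \<longlonglongrightarrow> (LINT \<tau>:{0<..<t}|lborel. K_integrand \<alpha> f t \<tau>)"
    unfolding set_lebesgue_integral_def
    by (rule integral_dominated_convergence[OF measf meas w AE_I2[OF conv] AE_I2[OF bnd]])
  then show "(\<lambda>k. J_op \<alpha> (g k) t + K_op \<alpha> 0 t (g k) t) \<longlonglongrightarrow> J_op \<alpha> f t + K_op \<alpha> 0 t f t"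
    unfolding J_op_def K_op_def divide_inverse using t by (intro tendsto_intros lim) auto
qed

section \<open>Quadratic test functions\<close>

lemma usc_onD:
  fixes f :: "'a::metric_space \<Rightarrow> real"
  assumes "usc_on S f" "z \<in> S" "f z < c"
  obtains d where "0 < d" "\<And>z'. z' \<in> S \<Longrightarrow> dist z' z < d \<Longrightarrow> f z' < c"
proof -
  have "openin (top_of_set S) {z \<in> S. f z < c}" using assms(1) by (simp add: usc_on_def)
  then have "\<exists>d>0. \<forall>x'\<in>S. dist x' z < d \<longrightarrow> x' \<in> {z \<in> S. f z < c}"
    using assms(2,3) unfolding openin_euclidean_subtopology_iff by blast
  then show ?thesis using that by blast
qed

section \<open>A cut-off in time and smooth majorants of semicontinuous functions\<close>

lemma DERIV_ramp_square: "((\<lambda>x. (max 0 x)\<^sup>2) has_real_derivative 2 * max 0 x) (at (x::real))"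
proof -
  consider "x < 0" | "x = 0" | "0 < x" by linarith
  then show ?thesis
  proof cases
    case 1
    have "((\<lambda>x. 0 :: real) has_real_derivative 2 * max 0 x) (at x)" using 1 by simp
    then show ?thesis
      by (rule has_field_derivative_transform_within_open[where S = "{..<0}"]) (use 1 in auto)
  next
    case 2
    have "((\<lambda>h. max 0 h) \<longlongrightarrow> max 0 0) (at (0::real))" by (intro tendsto_intros)
    then have "((\<lambda>h. max 0 h) \<longlongrightarrow> 0) (at (0::real))" by simp
    then have "((\<lambda>h. (max 0 h)\<^sup>2 / h) \<longlongrightarrow> 0) (at (0::real))"
      by (rule Lim_transform_eventually) (auto simp: eventually_at_filter max_def power2_eq_square)
    then show ?thesis using 2 by (simp add: DERIV_def)
  next
    case 3
    have "((\<lambda>x. x\<^sup>2) has_real_derivative 2 * max 0 x) (at x)"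
      using 3 by (auto intro!: derivative_eq_intros)
    then show ?thesis
      by (rule has_field_derivative_transform_within_open[where S = "{0<..}"]) (use 3 in auto)
  qed
qed

text \<open>The two squares make this cut-off continuously differentiable.\<close>

definition step_down :: "real \<Rightarrow> real" where
  "step_down x = (max 0 (1 - (max 0 x)\<^sup>2))\<^sup>2"

lemma step_down_simps: "x \<le> 0 \<Longrightarrow> step_down x = 1" "1 \<le> x \<Longrightarrow> step_down x = 0"
proof -
  show "step_down x = 0" if "1 \<le> x"
  proof -
    have "1 \<le> (max 0 x)\<^sup>2" using that by (intro one_le_power) auto
    then show ?thesis by (simp add: step_down_def)
  qed
qed (simp add: step_down_def)

lemma step_down_range: "0 \<le> step_down x" "step_down x \<le> 1"
  by (auto simp: step_down_def intro!: power_le_one)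

lemma DERIV_step_down:
  "(step_down has_real_derivative 2 * max 0 (1 - (max 0 x)\<^sup>2) * (0 - 2 * max 0 x)) (at x)"
  unfolding step_down_def[abs_def]
  by (rule DERIV_chain2[OF DERIV_ramp_square]) (intro DERIV_diff DERIV_const DERIV_ramp_square)

text \<open>A sup-convolution with the penalty \<open>k * \<bar>s - s'\<bar>\<close> in time and
  \<open>k\<close> times the squared distance to \<open>xh\<close> in space is a
  \<open>k\<close>-Lipschitz function of time; the square absorbs the values at other points.
  Polynomials approximate it from above, and semicontinuity at the points over \<open>xh\<close>
  identifies the limit.\<close>

lemma usc_smooth_majorant:
  fixes w :: "real \<Rightarrow> 'a::real_normed_vector \<Rightarrow> real"
  assumes T: "0 \<le> T" and xh: "xh \<in> \<Omega>"
    and bnd: "\<And>s y. s \<in> {0..T} \<Longrightarrow> y \<in> \<Omega> \<Longrightarrow> \<bar>w s y\<bar> \<le> W"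
    and usc: "\<And>s c. s \<in> {0..T} \<Longrightarrow> w s xh < c \<Longrightarrow>
      \<exists>d>0. \<forall>s'\<in>{0..T}. \<forall>y\<in>\<Omega>. \<bar>s' - s\<bar> < d \<longrightarrow> norm (y - xh) < d \<longrightarrow> w s' y < c"
  obtains b b' :: "nat \<Rightarrow> real \<Rightarrow> real" where
    "\<And>k s. (b k has_real_derivative b' k s) (at s)" "\<And>k. continuous_on UNIV (b' k)"
    "\<And>k s y. s \<in> {0..T} \<Longrightarrow> y \<in> \<Omega> \<Longrightarrow> w s y \<le> b k s + real k * (norm (y - xh))\<^sup>2"
    "\<And>s. s \<in> {0..T} \<Longrightarrow> (\<lambda>k. b k s) \<longlonglongrightarrow> w s xh"
    "\<And>k s. s \<in> {0..T} \<Longrightarrow> \<bar>b k s\<bar> \<le> W + 2"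
proof -
  define A where "A = {0..T} \<times> \<Omega>"
  define \<phi> where "\<phi> k s z = w (fst z) (snd z) - real k * \<bar>s - fst z\<bar> - real k * (norm (snd z - xh))\<^sup>2"
    for k :: nat and s z
  define U where "U k s = (SUP z\<in>A. \<phi> k s z)" for k s
  have A: "(s, xh) \<in> A" if "s \<in> {0..T}" for s using that xh by (simp add: A_def)
  have Ane: "A \<noteq> {}" using A[of 0] T by auto
  have wA: "\<bar>w (fst z) (snd z)\<bar> \<le> W" if "z \<in> A" for z
    using that bnd[of "fst z" "snd z"] by (auto simp: A_def)
  have \<phi>W: "\<phi> k s z \<le> W" if "z \<in> A" for k s z
  proof -
    have "0 \<le> real k * \<bar>s - fst z\<bar>" "0 \<le> real k * (norm (snd z - xh))\<^sup>2" by simp_all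
    then show ?thesis using wA[OF that] unfolding \<phi>_def by linarith
  qed
  have bdd: "bdd_above (\<phi> k s ` A)" for k s using \<phi>W by (intro bdd_aboveI2) blast
  have \<phi>U: "\<phi> k s z \<le> U k s" if "z \<in> A" for k s z unfolding U_def by (rule cSUP_upper[OF that bdd])
  have Ule: "U k s \<le> c" if "\<And>z. z \<in> A \<Longrightarrow> \<phi> k s z \<le> c" for k s c
    unfolding U_def by (rule cSUP_least[OF Ane that])
  have Uge: "w s y - real k * (norm (y - xh))\<^sup>2 \<le> U k s" if "s \<in> {0..T}" "y \<in> \<Omega>" for k s y
    using \<phi>U[of "(s, y)" k s] that by (simp add: \<phi>_def A_def)
  have UW: "U k s \<le> W" for k s using \<phi>W by (intro Ule)
  have lip: "U k s \<le> U k s' + real k * \<bar>s - s'\<bar>" for k s s'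
  proof (rule Ule)
    fix z assume z: "z \<in> A"
    have "real k * \<bar>s' - fst z\<bar> \<le> real k * (\<bar>s - fst z\<bar> + \<bar>s - s'\<bar>)" by (intro mult_left_mono) auto
    then show "\<phi> k s z \<le> U k s' + real k * \<bar>s - s'\<bar>"
      using \<phi>U[OF z, of k s'] unfolding \<phi>_def by (simp add: algebra_simps)
  qed
  have "continuous_on {0..T} (U k)" for k
  proof (rule lipschitz_on_continuous_on)
    show "(real k)-lipschitz_on {0..T} (U k)"
    proof (rule lipschitz_onI)
      fix s s' :: real
      show "dist (U k s) (U k s') \<le> real k * dist s s'"
        using lip[of k s s'] lip[of k s' s] by (simp add: dist_real_def abs_le_iff abs_minus_commute)
    qed simp
  qed
  \<comment> \<open>Raising the function by the same amount as the permitted approximation error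
    keeps the polynomial above \<open>U k\<close>.\<close>
  then have "continuous_on {0..T} (\<lambda>s. U k s + 1 / real (Suc k))" for k by (intro continuous_intros)
  then have "\<exists>g. real_polynomial_function g \<and> (\<forall>s\<in>{0..T}. \<bar>(U k s + 1 / real (Suc k)) - g s\<bar> < 1 / real (Suc k))" for k
    using Stone_Weierstrass_real_polynomial_function[of "{0..T}" "\<lambda>s. U k s + 1 / real (Suc k)" "1 / real (Suc k)"]
    by (metis compact_Icc of_nat_0_less_iff zero_less_Suc zero_less_divide_1_iff)
  then obtain b where b: "\<And>k. real_polynomial_function (b k)"
      "\<And>k s. s \<in> {0..T} \<Longrightarrow> \<bar>(U k s + 1 / real (Suc k)) - b k s\<bar> < 1 / real (Suc k)"
    by metis
  have "\<exists>p'. real_polynomial_function p' \<and> (\<forall>x. (b k has_real_derivative p' x) (at x))" for k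
    using has_real_derivative_polynomial_function[OF b(1)] .
  then obtain b' where b': "\<And>k. real_polynomial_function (b' k)" "\<And>k s. (b k has_real_derivative b' k s) (at s)"
    by metis
  have bU: "U k s \<le> b k s" "b k s \<le> U k s + 2 / real (Suc k)" if "s \<in> {0..T}" for k s
    using b(2)[OF that, of k] by (auto simp: abs_less_iff)
  show ?thesis
  proof (rule that[of b b'])
    show "continuous_on UNIV (b' k)" for k
      using b'(1) by (intro continuous_at_imp_continuous_on ballI continuous_real_polymonial_function)
    show "w s y \<le> b k s + real k * (norm (y - xh))\<^sup>2" if "s \<in> {0..T}" "y \<in> \<Omega>" for k s y
      using Uge[OF that, of k] bU(1)[OF that(1), of k] by simp
    show "\<bar>b k s\<bar> \<le> W + 2" if s: "s \<in> {0..T}" for k s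
    proof -
      have "- W \<le> w s xh" using bnd[OF s xh] by simp
      moreover have "w s xh \<le> U k s" using Uge[OF s xh, of k] by simp
      moreover have "2 / real (Suc k) \<le> 2" by (simp add: divide_le_eq)
      ultimately show ?thesis using bU[OF s, of k] UW[of k s] by (simp add: abs_le_iff)
    qed
    show "(\<lambda>k. b k s) \<longlonglongrightarrow> w s xh" if s: "s \<in> {0..T}" for s
    proof (rule order_tendstoI)
      fix c assume "c < w s xh"
      then show "eventually (\<lambda>k. c < b k s) sequentially"
      proof (intro always_eventually allI)
        fix k
        have "w s xh \<le> U k s" using Uge[OF s xh, of k] by simp
        then show "c < b k s" using bU(1)[OF s, of k] \<open>c < w s xh\<close> by linarith
      qed
    next
      fix c assume c: "w s xh < c"
      define c' where "c' = (w s xh + c) / 2"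
      have c': "w s xh < c'" "c' < c" using c by (auto simp: c'_def field_simps)
      obtain d where d: "0 < d" "\<And>s' y. s' \<in> {0..T} \<Longrightarrow> y \<in> \<Omega> \<Longrightarrow> \<bar>s' - s\<bar> < d \<Longrightarrow> norm (y - xh) < d \<Longrightarrow> w s' y < c'"
        using usc[OF s c'(1)] by blast
      \<comment> \<open>Outside the neighbourhood given by semicontinuity the combined penalty is at
        least \<open>k * e\<close>, whether the time or the space distance is large; for large
        \<open>k\<close> this exceeds the range of \<open>w\<close>.\<close>
      define e where "e = min d (d\<^sup>2)"
      have e: "0 < e" using d by (simp add: e_def)
      have "filterlim (\<lambda>k. real k * e) at_top sequentially"
        using e by (intro filterlim_at_top_mult_tendsto_pos[OF tendsto_const] filterlim_real_sequentially) 
      then have "eventually (\<lambda>k. W - c' \<le> real k * e) sequentially" by (simp add: filterlim_at_top)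
      moreover have "(\<lambda>k. c' + 2 / real (Suc k)) \<longlonglongrightarrow> c' + 0"
        by (intro tendsto_intros LIMSEQ_Suc[OF lim_const_over_n])
      then have "eventually (\<lambda>k. c' + 2 / real (Suc k) < c) sequentially"
        using c'(2) by (intro order_tendstoD(2)) auto
      ultimately show "eventually (\<lambda>k. b k s < c) sequentially"
      proof eventually_elim
        case (elim k)
        have "U k s \<le> c'"
        proof (rule Ule)
          fix z assume z: "z \<in> A"
          show "\<phi> k s z \<le> c'"
          proof (cases "\<bar>fst z - s\<bar> < d \<and> norm (snd z - xh) < d")
            case True
            then have "w (fst z) (snd z) < c'" using d(2) z by (auto simp: A_def)
            moreover have "0 \<le> real k * \<bar>s - fst z\<bar>" "0 \<le> real k * (norm (snd z - xh))\<^sup>2" by simp_all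
            ultimately show ?thesis unfolding \<phi>_def by linarith
          next
            case False
            have "e \<le> \<bar>s - fst z\<bar> + (norm (snd z - xh))\<^sup>2"
            proof (cases "\<bar>fst z - s\<bar> < d")
              case True
              then have "d\<^sup>2 \<le> (norm (snd z - xh))\<^sup>2" using False d by (intro power_mono) auto
              then show ?thesis unfolding e_def by linarith
            next
              case False
              moreover have "0 \<le> (norm (snd z - xh))\<^sup>2" by simp
              ultimately show ?thesis unfolding e_def by linarith
            qed
            then have "real k * e \<le> real k * (\<bar>s - fst z\<bar> + (norm (snd z - xh))\<^sup>2)" by (intro mult_left_mono) auto
            then show ?thesis using elim(1) wA[OF z] unfolding \<phi>_def by (simp add: algebra_simps)
          qed
        qed
        then show ?case using bU(2)[OF s, of k] elim(2) by linarith
      qed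
    qed
  qed (rule b')
qed

section \<open>Sub- and supersolutions in a common form\<close>

text \<open>A form shared by \<open>u\<close> with \<open>F\<close> and by \<open>- v\<close> with
  the reflected nonlinearity, so that the doubling argument treats two functions of the same kind.
  Requiring integrability down to 0 replaces the limit in \<open>K0\<close> by an integral.\<close>

definition touch_test ::
  "real \<Rightarrow> real \<Rightarrow> (real^'n) set \<Rightarrow> (real \<Rightarrow> real^'n \<Rightarrow> real \<Rightarrow> real^'n \<Rightarrow> real^'n^'n \<Rightarrow> real)
    \<Rightarrow> (real \<Rightarrow> real^'n \<Rightarrow> real) \<Rightarrow> bool" where
  "touch_test \<alpha> T \<Omega> G u \<longleftrightarrow>
     (\<forall>t\<in>{0<..T}. \<forall>x\<in>\<Omega>. \<forall>\<psi>.
        C12 T \<Omega> \<psi> \<longrightarrow> continuous_on ({0..T} \<times> \<Omega>) (\<lambda>(s, z). \<psi> s z) \<longrightarrow>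
        (\<forall>s\<in>{0..T}. \<forall>z\<in>\<Omega>. u s z - \<psi> s z \<le> u t x - \<psi> t x) \<longrightarrow>
        set_integrable lborel {0<..<t} (K_integrand \<alpha> (\<lambda>s. \<psi> s x) t) \<longrightarrow>
        J_op \<alpha> (\<lambda>s. \<psi> s x) t + K_op \<alpha> 0 t (\<lambda>s. \<psi> s x) t
          + G t x (u t x) (grad (\<psi> t) x) (hessian (\<psi> t) x) \<le> 0)"

lemma subsolution_touch_test:
  "viscosity_subsolution \<alpha> T \<Omega> F u \<Longrightarrow> touch_test \<alpha> T \<Omega> F u"
  unfolding viscosity_subsolution_def touch_test_def by (metis K0_eq)

lemma supersolution_touch_test:
  assumes \<Omega>: "open \<Omega>" and v: "viscosity_supersolution \<alpha> T \<Omega> F v"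
  shows "touch_test \<alpha> T \<Omega> (\<lambda>t x w p X. - F t x (- w) (- p) (- X)) (\<lambda>t x. - v t x)"
  unfolding touch_test_def
proof (intro ballI allI impI)
  fix t x \<psi> assume t: "t \<in> {0<..T}" and x: "x \<in> \<Omega>" and \<psi>: "C12 T \<Omega> \<psi>"
    and cont: "continuous_on ({0..T} \<times> \<Omega>) (\<lambda>(s, z). \<psi> s z)"
    and max: "\<forall>s\<in>{0..T}. \<forall>z\<in>\<Omega>. - v s z - \<psi> s z \<le> - v t x - \<psi> t x"
    and int: "set_integrable lborel {0<..<t} (K_integrand \<alpha> (\<lambda>s. \<psi> s x) t)"
  note m = C12_uminus[OF \<Omega> \<psi>]
  have "continuous_on ({0..T} \<times> \<Omega>) (\<lambda>(s, z). - \<psi> s z)"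
    using continuous_on_minus[OF cont] by (simp add: case_prod_unfold)
  moreover have "\<forall>s\<in>{0..T}. \<forall>z\<in>\<Omega>. v s z - - \<psi> s z \<ge> v t x - - \<psi> t x"
    using max by (metis (no_types, opaque_lifting) diff_minus_eq_add minus_diff_eq neg_le_iff_le uminus_add_conv_diff diff_conv_add_uminus)
  ultimately have "J_op \<alpha> (\<lambda>s. - \<psi> s x) t + K0 \<alpha> (\<lambda>s. - \<psi> s x) t
      + F t x (v t x) (grad (\<lambda>x. - \<psi> t x) x) (hessian (\<lambda>x. - \<psi> t x) x) \<ge> 0"
    using v t x m(1) unfolding viscosity_supersolution_def by blast
  moreover have "set_integrable lborel {0<..<t} (K_integrand \<alpha> (\<lambda>s. - \<psi> s x) t)"
    using int unfolding K_integrand_uminus set_integrable_def by simp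
  then have "K0 \<alpha> (\<lambda>s. - \<psi> s x) t = - K_op \<alpha> 0 t (\<lambda>s. \<psi> s x) t"
    by (simp add: K0_eq K_op_uminus)
  ultimately show "J_op \<alpha> (\<lambda>s. \<psi> s x) t + K_op \<alpha> 0 t (\<lambda>s. \<psi> s x) t
      + - F t x (- (- v t x)) (- grad (\<psi> t) x) (- hessian (\<psi> t) x) \<le> 0"
    using m(2,3)[OF t x] by (simp add: J_op_uminus)
qed

text \<open>A touching parabola is valid only near \<open>th\<close>, while the nonlocal term sees
  the whole past; the best test value in the past is \<open>u\<close> itself, which is what
  \<open>g\<close> contains. The test functions \<open>\<psi> k\<close> equal a penalised parabola
  near \<open>th\<close> and are blended by \<open>\<theta> k\<close> into smooth majorants of
  \<open>u\<close> for times before \<open>th - \<rho>\<close>. They converge to \<open>g\<close>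
  over \<open>xh\<close> with a uniform Lipschitz bound at \<open>th\<close>, so the operators
  converge, while gradient and Hessian at the touching point never change.\<close>

lemma touch_test_quadratic:
  fixes u :: "real \<Rightarrow> real^'n \<Rightarrow> real" and X :: "real^'n^'n"
  assumes \<alpha>: "0 < \<alpha>" "\<alpha> < 1"
    and \<Omega>: "bounded \<Omega>"
    and usc: "usc_on ({0..T} \<times> \<Omega>) (\<lambda>(t, x). u t x)"
    and bnd: "\<And>t x. t \<in> {0..T} \<Longrightarrow> x \<in> \<Omega> \<Longrightarrow> \<bar>u t x\<bar> \<le> M0"
    and test: "touch_test \<alpha> T \<Omega> G u"
    and th: "th \<in> {0<..T}" and xh: "xh \<in> \<Omega>" and X: "transpose X = X"
    and \<rho>: "0 < \<rho>" "\<rho> < r" "\<rho> < th"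
    and touch: "\<And>s y. s \<in> {0..T} \<Longrightarrow> y \<in> \<Omega> \<Longrightarrow> \<bar>s - th\<bar> < r \<Longrightarrow> norm (y - xh) < r \<Longrightarrow>
       u s y \<le> u th xh + a * (s - th) + c * (s - th)\<^sup>2 + ((s - th) *\<^sub>R m + p) \<bullet> (y - xh)
          + (y - xh) \<bullet> (X *v (y - xh)) / 2"
    and g: "\<And>s. g s = (if s \<le> th - \<rho> then u s xh else u th xh + a * (s - th) + c * (s - th)\<^sup>2)"
  shows "set_integrable lborel {0<..<th} (K_integrand \<alpha> g th)"
    and "J_op \<alpha> g th + K_op \<alpha> 0 th g th + G th xh (u th xh) p X \<le> 0"
proof -
  define P where "P s y = u th xh + a * (s - th) + c * (s - th)\<^sup>2 + ((s - th) *\<^sub>R m + p) \<bullet> (y - xh)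
          + (y - xh) \<bullet> (X *v (y - xh)) / 2" for s y
  have M0: "0 \<le> M0" using bnd[of th xh] th xh by force
  have r: "0 < r" using \<rho> by simp
  have contP: "continuous_on S (\<lambda>z. P (fst z) (snd z))" for S
    unfolding P_def by (intro continuous_intros bounded_linear.continuous_on[OF matrix_vector_mul_bounded_linear]) auto
  have "bounded ((\<lambda>z. P (fst z) (snd z)) ` ({0..T} \<times> closure \<Omega>))"
    using \<Omega> by (intro compact_imp_bounded compact_continuous_image contP compact_Times) auto
  then obtain B where B: "\<And>s y. s \<in> {0..T} \<Longrightarrow> y \<in> closure \<Omega> \<Longrightarrow> \<bar>P s y\<bar> \<le> B"
    unfolding bounded_iff by fastforce
  have B: "\<bar>P s y\<bar> \<le> B" if "s \<in> {0..T}" "y \<in> \<Omega>" for s y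
    using B[OF that(1)] that(2) closure_subset by blast
  have B0: "0 \<le> B" using B[of th xh] th xh by force
  \<comment> \<open>At time distance \<open>r\<close> the quadratic penalty, and at space distance
    \<open>r\<close> the quartic one, must each exceed \<open>M0 + B\<close>, the largest possible
    difference between \<open>u\<close> and the polynomial.\<close>
  define C where "C = (M0 + B) * (1 / r\<^sup>2 + 1 / r ^ 4)"
  have C0: "0 \<le> C" using M0 B0 r by (simp add: C_def)
  have C: "M0 + B \<le> C * r\<^sup>2" "M0 + B \<le> C * r ^ 4"
  proof -
    have "(M0 + B) * 1 \<le> (M0 + B) * ((1 / r\<^sup>2 + 1 / r ^ 4) * r\<^sup>2)"
      using M0 B0 r by (intro mult_left_mono) (auto simp: distrib_right)
    then show "M0 + B \<le> C * r\<^sup>2" by (simp add: C_def mult.assoc)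
    have "(M0 + B) * 1 \<le> (M0 + B) * ((1 / r\<^sup>2 + 1 / r ^ 4) * r ^ 4)"
      using M0 B0 r by (intro mult_left_mono) (auto simp: distrib_right)
    then show "M0 + B \<le> C * r ^ 4" by (simp add: C_def mult.assoc)
  qed
  \<comment> \<open>The time penalty acts only after \<open>th\<close>. Times before
    \<open>th\<close> lie within \<open>\<rho> < r\<close> where \<open>Q\<close> is compared with
    \<open>u\<close>, and the past values of \<open>Q\<close> over \<open>xh\<close>, which enter
    \<open>K_op\<close>, remain those of the parabola.\<close>
  define Q where "Q s y = P s y + C * (max 0 (s - th))\<^sup>2 + C * (norm (y - xh)) ^ 4" for s y
  have uQ: "u s y \<le> Q s y" if "s \<in> {0..T}" "y \<in> \<Omega>" "th - \<rho> \<le> s" for s y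
  proof (cases "s - th < r \<and> norm (y - xh) < r")
    case True
    then have "u s y \<le> P s y" unfolding P_def using that \<rho> by (intro touch) auto
    moreover have "0 \<le> C * (max 0 (s - th))\<^sup>2" "0 \<le> C * (norm (y - xh)) ^ 4" using C0 by auto
    ultimately show ?thesis by (simp add: Q_def)
  next
    case False
    then have "M0 + B \<le> C * (max 0 (s - th))\<^sup>2 + C * (norm (y - xh)) ^ 4"
    proof (cases "s - th < r")
      case True
      then have "C * r ^ 4 \<le> C * (norm (y - xh)) ^ 4" using False C0 r by (intro mult_left_mono power_mono) auto
      moreover have "0 \<le> C * (max 0 (s - th))\<^sup>2" using C0 by simp
      ultimately show ?thesis using C(2) by linarith
    next
      case False
      then have "C * r\<^sup>2 \<le> C * (max 0 (s - th))\<^sup>2" using C0 r by (intro mult_left_mono power_mono) auto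
      moreover have "0 \<le> C * (norm (y - xh)) ^ 4" using C0 by simp
      ultimately show ?thesis using C(1) by linarith
    qed
    moreover have "u s y \<le> M0" "- B \<le> P s y" using bnd[OF that(1,2)] B[OF that(1,2)] by auto
    ultimately show ?thesis unfolding Q_def by linarith
  qed
  define w where "w s y = u s y - Q s y" for s y
  have contQ: "continuous_on S (\<lambda>z. Q (fst z) (snd z))" for S
    unfolding Q_def by (intro continuous_intros contP)
  have "bounded ((\<lambda>z. Q (fst z) (snd z)) ` ({0..T} \<times> closure \<Omega>))"
    using \<Omega> by (intro compact_imp_bounded compact_continuous_image contQ compact_Times) auto
  then obtain B2 where B2: "\<And>s y. s \<in> {0..T} \<Longrightarrow> y \<in> closure \<Omega> \<Longrightarrow> \<bar>Q s y\<bar> \<le> B2"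
    unfolding bounded_iff by fastforce
  have B2: "\<bar>Q s y\<bar> \<le> B2" if "s \<in> {0..T}" "y \<in> \<Omega>" for s y
    using B2[OF that(1)] that(2) closure_subset by blast
  have wbnd: "\<bar>w s y\<bar> \<le> M0 + B2" if "s \<in> {0..T}" "y \<in> \<Omega>" for s y
    using bnd[OF that] B2[OF that] by (simp add: w_def)
  have uscw: "\<exists>d>0. \<forall>s'\<in>{0..T}. \<forall>y\<in>\<Omega>. \<bar>s' - s\<bar> < d \<longrightarrow> norm (y - xh) < d \<longrightarrow> w s' y < e"
    if s: "s \<in> {0..T}" and e: "w s xh < e" for s e
  proof -
    define \<delta> where "\<delta> = (e - w s xh) / 2"
    have \<delta>: "0 < \<delta>" using e by (simp add: \<delta>_def)
    obtain d1 where d1: "0 < d1" "\<And>z'. z' \<in> {0..T} \<times> \<Omega> \<Longrightarrow> dist z' (s, xh) < d1 \<Longrightarrow> (case z' of (t, x) \<Rightarrow> u t x) < u s xh + \<delta>"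
      by (rule usc_onD[OF usc, of "(s, xh)" "u s xh + \<delta>"]) (use s xh \<delta> in auto)
    have "isCont (\<lambda>z. Q (fst z) (snd z)) (s, xh)"
      using contQ[of UNIV] continuous_on_eq_continuous_at open_UNIV by blast
    then obtain d2 where d2: "0 < d2" "\<And>z'. dist z' (s, xh) < d2 \<Longrightarrow> dist (Q (fst z') (snd z')) (Q s xh) < \<delta>"
      using \<delta> unfolding continuous_at_eps_delta by (metis fst_conv snd_conv)
    show ?thesis
    proof (intro exI[of _ "min d1 d2 / 2"] conjI ballI impI)
      fix s' y assume s': "s' \<in> {0..T}" "y \<in> \<Omega>" "\<bar>s' - s\<bar> < min d1 d2 / 2" "norm (y - xh) < min d1 d2 / 2"
      have "dist (s', y) (s, xh) \<le> \<bar>s' - s\<bar> + norm (y - xh)"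
        using norm_Pair_le[of "s' - s" "y - xh"] by (simp add: dist_norm)
      then have dd: "dist (s', y) (s, xh) < d1" "dist (s', y) (s, xh) < d2" using s' by auto
      have "u s' y < u s xh + \<delta>" using d1(2)[OF _ dd(1)] s' by auto
      moreover have "Q s xh - \<delta> < Q s' y" using d2(2)[OF dd(2)] by (simp add: dist_real_def abs_less_iff)
      ultimately show "w s' y < e" by (simp add: w_def \<delta>_def field_simps)
    qed (use d1 d2 in auto)
  qed
  have T: "0 \<le> T" using th by auto
  obtain b b' :: "nat \<Rightarrow> real \<Rightarrow> real" where
    db: "\<And>k s. (b k has_real_derivative b' k s) (at s)" "\<And>k. continuous_on UNIV (b' k)"
    and bw: "\<And>k s y. s \<in> {0..T} \<Longrightarrow> y \<in> \<Omega> \<Longrightarrow> w s y \<le> b k s + real k * (norm (y - xh))\<^sup>2"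
    and blim: "\<And>s. s \<in> {0..T} \<Longrightarrow> (\<lambda>k. b k s) \<longlonglongrightarrow> w s xh"
    and bB: "\<And>k s. s \<in> {0..T} \<Longrightarrow> \<bar>b k s\<bar> \<le> (M0 + B2) + 2"
    using usc_smooth_majorant[OF T xh wbnd uscw] by blast
  \<comment> \<open>This choice makes \<open>\<theta> k\<close> vanish from
    \<open>th - \<rho> / 2\<close> onwards for every \<open>k\<close>, so all test functions agree
    near \<open>th\<close> in time over \<open>xh\<close>.\<close>
  obtain k0 :: nat where k0: "2 / \<rho> < real k0" using reals_Archimedean2 by blast
  define \<theta> where "\<theta> k s = step_down (real (k + k0) * (s - (th - \<rho>)))" for k s
  define \<theta>' where "\<theta>' k s = 2 * max 0 (1 - (max 0 (real (k + k0) * (s - (th - \<rho>))))\<^sup>2)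
      * (0 - 2 * max 0 (real (k + k0) * (s - (th - \<rho>)))) * real (k + k0)" for k s
  have d\<theta>: "(\<theta> k has_real_derivative \<theta>' k s) (at s)" for k s
    unfolding \<theta>_def[abs_def] \<theta>'_def
    by (rule DERIV_chain2[OF DERIV_step_down]) (auto intro!: derivative_eq_intros)
  have c\<theta>': "continuous_on UNIV (\<theta>' k)" for k
    unfolding \<theta>'_def by (intro continuous_intros)
  have \<theta>1: "\<theta> k s = 1" if "s \<le> th - \<rho>" for k s
    unfolding \<theta>_def using that by (intro step_down_simps mult_nonneg_nonpos) auto
  have \<theta>0: "\<theta> k s = 0" if "1 \<le> real (k + k0) * (s - (th - \<rho>))" for k s
    unfolding \<theta>_def using that by (rule step_down_simps)
  have \<theta>half: "\<theta> k s = 0" if "th - \<rho> / 2 \<le> s" for k s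
  proof (rule \<theta>0)
    have "1 \<le> real k0 * (\<rho> / 2)" using k0 \<rho>(1) by (simp add: field_simps)
    also have "\<dots> \<le> real (k + k0) * (s - (th - \<rho>))" using that \<rho>(1) by (intro mult_mono) auto
    finally show "1 \<le> real (k + k0) * (s - (th - \<rho>))" .
  qed
  have \<theta>range: "0 \<le> \<theta> k s" "\<theta> k s \<le> 1" for k s unfolding \<theta>_def by (rule step_down_range)+
  have \<theta>lim: "(\<lambda>k. \<theta> k s) \<longlonglongrightarrow> (if s \<le> th - \<rho> then 1 else 0)" for s
  proof (cases "s \<le> th - \<rho>")
    case False
    obtain K :: nat where K: "1 / (s - (th - \<rho>)) < real K" using reals_Archimedean2 by blast
    have "eventually (\<lambda>k. \<theta> k s = 0) sequentially"
    proof (rule eventually_sequentiallyI[of K])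
      fix k assume "K \<le> k"
      then have "real K * (s - (th - \<rho>)) \<le> real (k + k0) * (s - (th - \<rho>))"
        using False by (intro mult_right_mono) auto
      moreover have "1 \<le> real K * (s - (th - \<rho>))"
        using False K by (simp add: pos_divide_less_eq)
      ultimately show "\<theta> k s = 0" by (intro \<theta>0) linarith
    qed
    then show ?thesis using False by (simp add: tendsto_eventually)
  qed (simp add: \<theta>1)
  define A where "A k s = u th xh + a * (s - th) + c * (s - th)\<^sup>2 + C * (max 0 (s - th))\<^sup>2 + \<theta> k s * b k s" for k s
  define A' where "A' k s = a + 2 * c * (s - th) + C * (2 * max 0 (s - th)) + (\<theta>' k s * b k s + \<theta> k s * b' k s)" for k s
  define ck where "ck k s = real k * \<theta> k s" for k s
  define \<psi> where "\<psi> k s y = Q s y + \<theta> k s * (b k s + real k * (norm (y - xh))\<^sup>2)" for k s y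
  have \<psi>eq: "\<psi> k s y = A k s + ((s - th) *\<^sub>R m + p) \<bullet> (y - xh) + (y - xh) \<bullet> (X *v (y - xh)) / 2
      + ck k s * (norm (y - xh))\<^sup>2 + C * (norm (y - xh)) ^ 4" for k s y
    unfolding \<psi>_def Q_def P_def A_def ck_def by (simp add: algebra_simps)
  have dA: "(A k has_real_derivative A' k s) (at s)" for k s
    unfolding A_def[abs_def] A'_def
    by (rule DERIV_cong, rule derivative_intros derivative_intros db d\<theta>
        DERIV_chain2[OF DERIV_ramp_square] | simp)+
  have cb: "continuous_on UNIV (b k)" "continuous_on UNIV (\<theta> k)" for k
    by (rule DERIV_continuous_on, rule has_field_derivative_at_within, rule db d\<theta>)+
  have cA': "continuous_on UNIV (A' k)" for k
    unfolding A'_def by (intro continuous_intros cb db c\<theta>')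
  have dck: "(ck k has_real_derivative real k * \<theta>' k s) (at s)" for k s
    unfolding ck_def[abs_def] by (rule DERIV_cmult[OF d\<theta>])
  have cck': "continuous_on UNIV (\<lambda>s. real k * \<theta>' k s)" for k by (intro continuous_intros c\<theta>')
  have d\<tau>: "((\<lambda>s. s - th) has_real_derivative 1) (at s)" for s by (auto intro!: derivative_eq_intros)
  note C12 = C12_quartic[OF X \<psi>eq dA cA' dck cck' d\<tau>]
  have \<theta>th: "\<theta> k th = 0" for k using \<theta>half[of th k] \<rho>(1) by simp
  have Qth: "Q th xh = u th xh" by (simp add: Q_def P_def)
  have \<psi>th: "\<psi> k th xh = u th xh" for k by (simp add: \<psi>_def \<theta>th Qth)
  \<comment> \<open>After \<open>th - \<rho>\<close> the difference \<open>w\<close> is nonpositive,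
    so multiplying it by \<open>\<theta> k s \<le> 1\<close> can only increase it; this keeps the
    blended function above \<open>u\<close> in the transition zone.\<close>
  have u\<psi>: "u s y \<le> \<psi> k s y" if "s \<in> {0..T}" "y \<in> \<Omega>" for k s y
  proof (cases "s \<le> th - \<rho>")
    case True
    then show ?thesis using bw[OF that, of k] by (simp add: \<psi>_def \<theta>1 w_def)
  next
    case False
    define e where "e = b k s + real k * (norm (y - xh))\<^sup>2"
    have "w s y \<le> 0" using uQ[OF that] False by (simp add: w_def)
    then have "w s y \<le> \<theta> k s * w s y" using \<theta>range[of k s] mult_right_mono_neg[of "\<theta> k s" 1 "w s y"] by simp
    also have "\<dots> \<le> \<theta> k s * e" using bw[OF that, of k] \<theta>range by (intro mult_left_mono) (auto simp: e_def)
    finally show ?thesis by (simp add: \<psi>_def w_def e_def)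
  qed
  have gth: "g th = u th xh" using \<rho> by (simp add: g)
  have lim: "(\<lambda>k. \<psi> k s xh) \<longlonglongrightarrow> g s" if s: "s \<in> {0..th}" for s
  proof -
    have "(\<lambda>k. Q s xh + \<theta> k s * b k s) \<longlonglongrightarrow> Q s xh + (if s \<le> th - \<rho> then 1 else 0) * w s xh"
      using s th by (intro tendsto_intros \<theta>lim blim) auto
    moreover have "Q s xh + (if s \<le> th - \<rho> then 1 else 0) * w s xh = g s"
      using s by (auto simp: g w_def Q_def P_def)
    ultimately show ?thesis by (simp add: \<psi>_def)
  qed
  have c\<psi>: "continuous_on {0..th} (\<lambda>s. \<psi> k s xh)" for k
    using continuous_on_compose2[OF C12(2)[of k], of "{0..th}" "\<lambda>s. (s, xh)"] by (simp add: continuous_intros)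
  \<comment> \<open>The first entry is the Lipschitz bound of the parabola on the last stretch
    before \<open>th\<close>. Earlier times are at distance at least \<open>\<rho> / 2\<close>,
    where the uniform bound divided by this distance suffices.\<close>
  define L where "L = max (\<bar>a\<bar> + \<bar>c\<bar> * th) ((M0 + (B2 + (M0 + B2 + 2))) / (\<rho> / 2))"
  have lip: "\<bar>\<psi> k th xh - \<psi> k s xh\<bar> \<le> L * (th - s)" if s: "s \<in> {0..th}" for k s
  proof (cases "th - \<rho> / 2 \<le> s")
    case True
    have "\<psi> k s xh = u th xh + a * (s - th) + c * (s - th)\<^sup>2"
      using s by (simp add: \<psi>_def \<theta>half[OF True] Q_def P_def)
    then have "\<psi> k th xh - \<psi> k s xh = (a + c * (s - th)) * (th - s)"
      unfolding \<psi>th by (simp add: power2_eq_square algebra_simps)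
    then have "\<bar>\<psi> k th xh - \<psi> k s xh\<bar> = \<bar>a + c * (s - th)\<bar> * (th - s)"
      using s by (simp add: abs_mult)
    also have "\<dots> \<le> L * (th - s)"
    proof (rule mult_right_mono)
      have "\<bar>a + c * (s - th)\<bar> \<le> \<bar>a\<bar> + \<bar>c\<bar> * \<bar>s - th\<bar>" by (metis abs_mult abs_triangle_ineq)
      also have "\<dots> \<le> \<bar>a\<bar> + \<bar>c\<bar> * th" using s by (intro add_left_mono mult_left_mono) auto
      finally show "\<bar>a + c * (s - th)\<bar> \<le> L" by (simp add: L_def)
    qed (use s in auto)
    finally show ?thesis .
  next
    case False
    have sT: "s \<in> {0..T}" using s th by auto
    have "\<bar>\<theta> k s * b k s\<bar> \<le> 1 * (M0 + B2 + 2)"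
      unfolding abs_mult using \<theta>range[of k s] bB[OF sT, of k] by (intro mult_mono) auto
    then have "\<bar>\<psi> k s xh\<bar> \<le> B2 + (M0 + B2 + 2)"
      using B2[OF sT xh] unfolding \<psi>_def by simp
    then have "\<bar>\<psi> k th xh - \<psi> k s xh\<bar> \<le> M0 + (B2 + (M0 + B2 + 2))"
      using bnd[of th xh] th xh unfolding \<psi>th by auto
    also have "\<dots> = (M0 + (B2 + (M0 + B2 + 2))) / (\<rho> / 2) * (\<rho> / 2)" using \<rho> by simp
    also have "\<dots> \<le> L * (th - s)"
    proof (rule mult_mono)
      have "0 \<le> B2" using B2[OF sT xh] by simp
      then have "0 \<le> (M0 + (B2 + (M0 + B2 + 2))) / (\<rho> / 2)" using \<rho>(1) M0 by (intro divide_nonneg_nonneg) auto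
      then show "0 \<le> L" unfolding L_def by linarith
    qed (use False \<rho> in \<open>auto simp: L_def\<close>)
    finally show ?thesis .
  qed
  have th0: "0 < th" using th by simp
  note JK = J_K_op_tendsto[of \<alpha> th "\<lambda>k s. \<psi> k s xh" L g, OF \<alpha> th0 c\<psi> lip lim]
  show "set_integrable lborel {0<..<th} (K_integrand \<alpha> g th)" by (rule JK(2))
  have le: "J_op \<alpha> (\<lambda>s. \<psi> k s xh) th + K_op \<alpha> 0 th (\<lambda>s. \<psi> k s xh) th \<le> - G th xh (u th xh) p X" for k
  proof -
    have gr: "grad (\<psi> k th) xh = p" unfolding C12(3) by simp
    have he: "hessian (\<psi> k th) xh = X"
      unfolding C12(4) by (simp add: ck_def \<theta>th outer_def vec_eq_iff)
    have "continuous_on ({0..T} \<times> \<Omega>) (\<lambda>(s, z). \<psi> k s z)"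
      using C12(2)[of k] continuous_on_subset by blast
    then have "J_op \<alpha> (\<lambda>s. \<psi> k s xh) th + K_op \<alpha> 0 th (\<lambda>s. \<psi> k s xh) th
          + G th xh (u th xh) (grad (\<psi> k th) xh) (hessian (\<psi> k th) xh) \<le> 0"
      using test[unfolded touch_test_def, rule_format, OF th xh C12(1)[of T \<Omega> k]] u\<psi> JK(1) \<psi>th by simp
    then show ?thesis unfolding gr he by simp
  qed
  have "J_op \<alpha> g th + K_op \<alpha> 0 th g th \<le> - G th xh (u th xh) p X"
    by (rule tendsto_upperbound[OF JK(3)]) (use le in auto)
  then show "J_op \<alpha> g th + K_op \<alpha> 0 th g th + G th xh (u th xh) p X \<le> 0" by simp
qed

section \<open>Nonlocal terms on the half-line\<close>

text \<open>Past the initial time the extended increment is constant, and the tail of the kernel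
  integrates to \<open>t powr (- \<alpha>) / \<alpha>\<close>; this is exactly the contribution of
  \<open>J_op\<close>. Integrals belonging to different times thereby live on the same half-line and
  can be added under one integral sign.\<close>

lemma J_K_op_half_line:
  assumes \<alpha>: "0 < \<alpha>" "\<alpha> < 1" and t: "0 < t"
    and int: "set_integrable lborel {0<..<t} (K_integrand \<alpha> f t)"
  shows "set_integrable lborel {0<..} (\<lambda>\<tau>. (f t - f (max (t - \<tau>) 0)) / \<tau> powr (\<alpha> + 1))"
    and "J_op \<alpha> f t + K_op \<alpha> 0 t f t
      = \<alpha> / Gamma (1 - \<alpha>) * (LINT \<tau>:{0<..}|lborel. (f t - f (max (t - \<tau>) 0)) / \<tau> powr (\<alpha> + 1))"
proof -
  define g1 where "g1 \<tau> = indicator {0<..<t} \<tau> *\<^sub>R K_integrand \<alpha> f t \<tau>" for \<tau>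
  define g2 where "g2 \<tau> = (f t - f 0) * (indicator {t<..} \<tau> *\<^sub>R (1 / \<tau> powr (\<alpha> + 1)))" for \<tau>
  define g3 where "g3 \<tau> = ((f t - f 0) / t powr (\<alpha> + 1)) * indicator {t} \<tau>" for \<tau>
  note tail = set_integrable_powr_tail[OF \<alpha>(1) t]
  have eq: "indicator {0<..} \<tau> *\<^sub>R ((f t - f (max (t - \<tau>) 0)) / \<tau> powr (\<alpha> + 1)) = g1 \<tau> + g2 \<tau> + g3 \<tau>" for \<tau>
    using t by (auto simp: g1_def g2_def g3_def K_integrand_def indicator_def max_def)
  have i1: "integrable lborel g1" using int by (simp add: set_integrable_def g1_def[abs_def])
  have i2: "integrable lborel g2" using tail(1) unfolding set_integrable_def g2_def[abs_def] by (rule integrable_mult_right)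
  have i3: "integrable lborel g3" unfolding g3_def by (intro integrable_mult_right integrable_real_indicator) auto
  have v2: "integral\<^sup>L lborel g2 = (f t - f 0) * (t powr (- \<alpha>) / \<alpha>)"
    unfolding g2_def[abs_def] integral_mult_right_zero tail(2)[unfolded set_lebesgue_integral_def] ..
  have v3: "integral\<^sup>L lborel g3 = 0" by (simp add: g3_def[abs_def])
  show "set_integrable lborel {0<..} (\<lambda>\<tau>. (f t - f (max (t - \<tau>) 0)) / \<tau> powr (\<alpha> + 1))"
    unfolding set_integrable_def eq by (intro Bochner_Integration.integrable_add i1 i2 i3)
  have "(LINT \<tau>:{0<..}|lborel. (f t - f (max (t - \<tau>) 0)) / \<tau> powr (\<alpha> + 1))
      = integral\<^sup>L lborel g1 + (f t - f 0) * (t powr (- \<alpha>) / \<alpha>)"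
    unfolding set_lebesgue_integral_def eq using i1 i2 i3 v2 v3 by simp
  moreover have "J_op \<alpha> f t = \<alpha> / Gamma (1 - \<alpha>) * ((f t - f 0) * (t powr (- \<alpha>) / \<alpha>))"
    using \<alpha> t by (simp add: J_op_def powr_minus_divide divide_simps)
  moreover have "K_op \<alpha> 0 t f t = \<alpha> / Gamma (1 - \<alpha>) * integral\<^sup>L lborel g1"
    by (simp add: K_op_def set_lebesgue_integral_def g1_def[abs_def])
  ultimately show "J_op \<alpha> f t + K_op \<alpha> 0 t f t
      = \<alpha> / Gamma (1 - \<alpha>) * (LINT \<tau>:{0<..}|lborel. (f t - f (max (t - \<tau>) 0)) / \<tau> powr (\<alpha> + 1))"
    by (simp only: distrib_left)
qed

lemma set_integrable_min_powr:
  fixes \<alpha> :: real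
  assumes \<alpha>: "0 < \<alpha>" "\<alpha> < 1"
  shows "set_integrable lborel {0<..} (\<lambda>\<tau>. min \<tau> 1 / \<tau> powr (\<alpha> + 1))"
  unfolding set_integrable_def
proof (rule Bochner_Integration.integrable_bound)
  let ?w = "\<lambda>\<tau>. indicator {0<..<2} \<tau> *\<^sub>R \<tau> powr (- \<alpha>) + indicator {1<..} \<tau> *\<^sub>R (1 / \<tau> powr (\<alpha> + 1))"
  show "integrable lborel ?w"
    using set_integrable_powr_near_0(1)[OF \<alpha>(2), of 2] set_integrable_powr_tail(1)[OF \<alpha>(1), of 1]
    unfolding set_integrable_def by (intro Bochner_Integration.integrable_add) auto
  show "(\<lambda>\<tau>::real. indicator {0<..} \<tau> *\<^sub>R (min \<tau> 1 / \<tau> powr (\<alpha> + 1))) \<in> borel_measurable lborel"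
    by measurable
  show "AE \<tau> in lborel. norm (indicator {0<..} \<tau> *\<^sub>R (min \<tau> 1 / \<tau> powr (\<alpha> + 1))) \<le> norm (?w \<tau>)"
  proof (rule AE_I2)
    fix \<tau> :: real
    have "\<tau> / \<tau> powr (\<alpha> + 1) = \<tau> powr (- \<alpha>)" if "0 < \<tau>"
      using that by (simp add: powr_add powr_minus_divide)
    then show "norm (indicator {0<..} \<tau> *\<^sub>R (min \<tau> 1 / \<tau> powr (\<alpha> + 1))) \<le> norm (?w \<tau>)"
      by (auto simp: indicator_def min_def)
  qed
qed

text \<open>Adding the integrable lower bound and the error term makes the integrands nonnegative,
  so that Fatou's lemma applies. The error integrates to
  \<open>E n * \<rho> n powr (- \<alpha>) / \<alpha>\<close> and vanishes in the limit.
  Semicontinuity provides only lower limits of the increments, which is the direction needed here,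
  and the integrability of the limit is part of the outcome.\<close>

lemma increments_fatou:
  fixes d :: "nat \<Rightarrow> real \<Rightarrow> real"
  assumes \<alpha>: "0 < \<alpha>" "\<alpha> < 1" and C: "0 \<le> C"
    and int: "\<And>n. set_integrable lborel {0<..} (\<lambda>\<tau>. d n \<tau> / \<tau> powr (\<alpha> + 1))"
    and E: "\<And>n. 0 \<le> E n" "\<And>n. 0 < \<rho> n" "(\<lambda>n. E n * \<rho> n powr (- \<alpha>)) \<longlonglongrightarrow> 0"
    and lower: "\<And>n \<tau>. 0 < \<tau> \<Longrightarrow> - (C * min \<tau> 1) - E n * indicator {\<rho> n<..} \<tau> \<le> d n \<tau>"
    and le: "\<And>n. (LINT \<tau>:{0<..}|lborel. d n \<tau> / \<tau> powr (\<alpha> + 1)) \<le> b n" and b: "b \<longlonglongrightarrow> B"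
    and lim: "\<And>\<tau> c. 0 < \<tau> \<Longrightarrow> c < f \<tau> \<Longrightarrow> eventually (\<lambda>n. c < d n \<tau>) sequentially"
    and flower: "\<And>\<tau>. 0 < \<tau> \<Longrightarrow> - (C * min \<tau> 1) \<le> f \<tau>"
    and meas: "(\<lambda>\<tau>. indicator {0<..} \<tau> *\<^sub>R f \<tau>) \<in> borel_measurable borel"
  shows "set_integrable lborel {0<..} (\<lambda>\<tau>. f \<tau> / \<tau> powr (\<alpha> + 1))"
    and "(LINT \<tau>:{0<..}|lborel. f \<tau> / \<tau> powr (\<alpha> + 1)) \<le> B"
proof -
  define w where "w \<tau> = C * (indicator {0<..} \<tau> *\<^sub>R (min \<tau> 1 / \<tau> powr (\<alpha> + 1)))" for \<tau> :: real
  define W where "W = integral\<^sup>L lborel w"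
  have iw: "integrable lborel w"
    using set_integrable_min_powr[OF \<alpha>] unfolding set_integrable_def w_def[abs_def] by (rule integrable_mult_right)
  define e where "e n \<tau> = E n * (indicator {\<rho> n<..} \<tau> *\<^sub>R (1 / \<tau> powr (\<alpha> + 1)))" for n \<tau>
  note tail = set_integrable_powr_tail[OF \<alpha>(1) E(2)]
  have ie: "integrable lborel (e n)" for n using tail(1)[of n] unfolding set_integrable_def e_def[abs_def] by (rule integrable_mult_right)
  have ve: "integral\<^sup>L lborel (e n) = E n * \<rho> n powr (- \<alpha>) / \<alpha>" for n
    unfolding e_def[abs_def] integral_mult_right_zero tail(2)[unfolded set_lebesgue_integral_def] by simp
  define D where "D n \<tau> = indicator {0<..} \<tau> *\<^sub>R (d n \<tau> / \<tau> powr (\<alpha> + 1))" for n \<tau>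
  have iD: "integrable lborel (D n)" for n using int[of n] by (simp add: set_integrable_def D_def[abs_def])
  have vD: "integral\<^sup>L lborel (D n) \<le> b n" for n using le[of n] by (simp add: set_lebesgue_integral_def D_def[abs_def])
  define G where "G n \<tau> = D n \<tau> + w \<tau> + e n \<tau>" for n \<tau>
  define g where "g \<tau> = indicator {0<..} \<tau> *\<^sub>R (f \<tau> / \<tau> powr (\<alpha> + 1)) + w \<tau>" for \<tau>
  have G0: "0 \<le> G n \<tau>" for n \<tau>
  proof (cases "0 < \<tau>")
    case True
    have "G n \<tau> = (d n \<tau> + C * min \<tau> 1 + E n * indicator {\<rho> n<..} \<tau>) / \<tau> powr (\<alpha> + 1)"
      using True by (simp add: G_def D_def w_def e_def add_divide_distrib)
    then show ?thesis using lower[OF True, of n] by simp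
  next
    case False
    then show ?thesis using E(2)[of n] by (simp add: G_def D_def w_def e_def)
  qed
  have g0: "0 \<le> g \<tau>" for \<tau>
  proof (cases "0 < \<tau>")
    case True
    have "g \<tau> = (f \<tau> + C * min \<tau> 1) / \<tau> powr (\<alpha> + 1)"
      using True by (simp add: g_def w_def add_divide_distrib)
    then show ?thesis using flower[OF True] by simp
  qed (simp add: g_def w_def)
  have iG: "integrable lborel (G n)" for n
    unfolding G_def[abs_def] by (intro Bochner_Integration.integrable_add iD iw ie)
  have vG: "integral\<^sup>L lborel (G n) \<le> b n + W + E n * \<rho> n powr (- \<alpha>) / \<alpha>" for n
    unfolding G_def[abs_def] using iD iw ie vD[of n] by (simp add: W_def ve)
  have measg: "g \<in> borel_measurable lborel"
  proof -
    have "(\<lambda>\<tau>. (indicator {0<..} \<tau> *\<^sub>R f \<tau>) / \<tau> powr (\<alpha> + 1) + w \<tau>) \<in> borel_measurable borel"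
      using meas borel_measurable_integrable[OF iw] by measurable
    then show ?thesis by (simp add: g_def[abs_def])
  qed
  have liminf: "ennreal (g \<tau>) \<le> liminf (\<lambda>n. ennreal (G n \<tau>))" for \<tau>
  proof (cases "0 < \<tau>")
    case True
    show ?thesis
      unfolding le_Liminf_iff
    proof (intro allI impI)
      fix y assume y: "y < ennreal (g \<tau>)"
      then have yr: "y = ennreal (enn2real y)" "enn2real y < g \<tau>"
      proof -
        show "y = ennreal (enn2real y)" using y by (metis ennreal_enn2real less_top_ennreal less_trans ennreal_less_top)
        then show "enn2real y < g \<tau>" using y g0[of \<tau>] by (metis enn2real_nonneg ennreal_less_iff)
      qed
      define c where "c = (enn2real y - w \<tau>) * \<tau> powr (\<alpha> + 1)"
      have p: "0 < \<tau> powr (\<alpha> + 1)" using True by simp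
      have "c < f \<tau>" using yr(2) p True by (simp add: c_def g_def field_simps)
      from lim[OF True this] show "eventually (\<lambda>n. y < ennreal (G n \<tau>)) sequentially"
      proof eventually_elim
        case (elim n)
        have "enn2real y < D n \<tau> + w \<tau>" using elim p True by (simp add: c_def D_def field_simps)
        also have "\<dots> \<le> G n \<tau>" using E(1)[of n] by (simp add: G_def e_def)
        finally show ?case using yr(1) by (metis enn2real_nonneg ennreal_less_iff)
      qed
    qed
  next
    case False
    then have "g \<tau> = 0" by (simp add: g_def w_def)
    then show ?thesis by simp
  qed
  have "(\<integral>\<^sup>+\<tau>. ennreal (g \<tau>) \<partial>lborel) \<le> (\<integral>\<^sup>+\<tau>. liminf (\<lambda>n. ennreal (G n \<tau>)) \<partial>lborel)"
    by (intro nn_integral_mono liminf)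
  also have "\<dots> \<le> liminf (\<lambda>n. \<integral>\<^sup>+\<tau>. ennreal (G n \<tau>) \<partial>lborel)"
    using borel_measurable_integrable[OF iG]
    by (intro nn_integral_liminf measurable_compose[OF _ measurable_ennreal])
  also have "\<dots> = liminf (\<lambda>n. ennreal (integral\<^sup>L lborel (G n)))"
    using nn_integral_eq_integral[OF iG] G0 by simp
  also have "\<dots> \<le> liminf (\<lambda>n. ennreal (b n + W + E n * \<rho> n powr (- \<alpha>) / \<alpha>))"
    by (intro Liminf_mono always_eventually allI ennreal_leI vG)
  also have "\<dots> = ennreal (B + W)"
  proof (rule lim_imp_Liminf)
    have "(\<lambda>n. b n + W + E n * \<rho> n powr (- \<alpha>) / \<alpha>) \<longlonglongrightarrow> B + W + 0 / \<alpha>"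
      using \<alpha> by (intro tendsto_intros b E(3)) auto
    then show "(\<lambda>n. ennreal (b n + W + E n * \<rho> n powr (- \<alpha>) / \<alpha>)) \<longlonglongrightarrow> ennreal (B + W)"
      by (intro tendsto_ennrealI) simp
  qed simp
  finally have nn: "(\<integral>\<^sup>+\<tau>. ennreal (g \<tau>) \<partial>lborel) \<le> ennreal (B + W)" .
  have BW: "0 \<le> B + W"
  proof (rule tendsto_lowerbound)
    show "(\<lambda>n. b n + W + E n * \<rho> n powr (- \<alpha>) / \<alpha>) \<longlonglongrightarrow> B + W"
      using tendsto_add[OF tendsto_add[OF b tendsto_const[of W]] tendsto_divide[OF E(3) tendsto_const[of \<alpha>]]] \<alpha> by simp
    show "eventually (\<lambda>n. 0 \<le> b n + W + E n * \<rho> n powr (- \<alpha>) / \<alpha>) sequentially"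
      using order_trans[OF integral_nonneg_AE[OF AE_I2[OF G0]] vG] by (intro always_eventually) auto
  qed simp
  have ig: "integrable lborel g"
    by (rule integrableI_nonneg) (use measg g0 le_less_trans[OF nn ennreal_less_top] in auto)
  have vg: "integral\<^sup>L lborel g \<le> B + W"
    using nn nn_integral_eq_integral[OF ig] g0 BW by simp
  have feq: "indicator {0<..} \<tau> *\<^sub>R (f \<tau> / \<tau> powr (\<alpha> + 1)) = g \<tau> - w \<tau>" for \<tau> by (simp add: g_def)
  show "set_integrable lborel {0<..} (\<lambda>\<tau>. f \<tau> / \<tau> powr (\<alpha> + 1))"
    unfolding set_integrable_def feq by (intro Bochner_Integration.integrable_diff ig iw)
  show "(LINT \<tau>:{0<..}|lborel. f \<tau> / \<tau> powr (\<alpha> + 1)) \<le> B"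
    unfolding set_lebesgue_integral_def feq using vg ig iw by (simp add: W_def)
qed

section \<open>Sup-convolutions in space and time\<close>

lemma usc_on_seq_ge:
  fixes f :: "'a::metric_space \<Rightarrow> real"
  assumes usc: "usc_on S f" and zn: "\<And>n. zn n \<in> S" "zn \<longlonglongrightarrow> z" "z \<in> S"
    and ge: "\<And>n. a n \<le> f (zn n)" "a \<longlonglongrightarrow> a0"
  shows "a0 \<le> f z"
proof (rule field_le_epsilon)
  fix e :: real assume "0 < e"
  then have "f z < f z + e" by simp
  then obtain d where d: "0 < d" "\<And>z'. z' \<in> S \<Longrightarrow> dist z' z < d \<Longrightarrow> f z' < f z + e"
    using usc_onD[OF usc zn(3)] by metis
  have "eventually (\<lambda>n. a n \<le> f z + e) sequentially"
    using tendstoD[OF zn(2) d(1)]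
  proof eventually_elim
    case (elim n)
    then show ?case using d(2)[OF zn(1) elim] ge(1)[of n] by simp
  qed
  then show "a0 \<le> f z + e" by (rule tendsto_upperbound[OF ge(2)]) simp
qed

lemma usc_on_attains_sup:
  fixes f g :: "'a::metric_space \<Rightarrow> real"
  assumes usc: "usc_on S f" and K: "compact K" "K \<noteq> {}" "K \<subseteq> S"
    and g: "continuous_on K g" and bnd: "\<And>z. z \<in> K \<Longrightarrow> f z + g z \<le> B"
  obtains z where "z \<in> K" "\<And>y. y \<in> K \<Longrightarrow> f y + g y \<le> f z + g z"
proof -
  define s where "s = (SUP z\<in>K. f z + g z)"
  have bdd: "bdd_above ((\<lambda>z. f z + g z) ` K)" using bnd by (intro bdd_aboveI2) auto
  have "\<exists>z\<in>K. s - 1 / real (Suc n) < f z + g z" for n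
  proof -
    have "s - 1 / real (Suc n) < s" by simp
    then show ?thesis unfolding s_def by (subst (asm) less_cSUP_iff[OF K(2) bdd]) 
  qed
  then obtain zn where zn: "\<And>n. zn n \<in> K" "\<And>n. s - 1 / real (Suc n) < f (zn n) + g (zn n)" by metis
  obtain z k where z: "z \<in> K" "strict_mono (k :: nat \<Rightarrow> nat)" "(zn \<circ> k) \<longlonglongrightarrow> z"
    using K(1) zn(1) unfolding compact_def by meson
  have gz: "(\<lambda>n. g ((zn \<circ> k) n)) \<longlonglongrightarrow> g z"
    using zn(1) by (intro continuous_on_tendsto_compose[OF g z(3,1)]) auto
  have "(\<lambda>n. s - 1 / real (Suc n)) \<longlonglongrightarrow> s - 0"
    by (intro tendsto_intros LIMSEQ_Suc[OF lim_const_over_n])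
  then have sl: "(\<lambda>n. s - 1 / real (Suc (k n))) \<longlonglongrightarrow> s"
    using LIMSEQ_subseq_LIMSEQ[OF _ z(2)] by (auto simp: o_def)
  have "s - g z \<le> f z"
  proof (rule usc_on_seq_ge[OF usc _ z(3)])
    show "(\<lambda>n. s - 1 / real (Suc (k n)) - g ((zn \<circ> k) n)) \<longlonglongrightarrow> s - g z"
      by (intro tendsto_intros sl gz)
    show "s - 1 / real (Suc (k n)) - g ((zn \<circ> k) n) \<le> f ((zn \<circ> k) n)" for n
      using zn(2)[of "k n"] by simp
  qed (use zn(1) z(1) K(3) in auto)
  moreover have "f y + g y \<le> s" if "y \<in> K" for y unfolding s_def by (rule cSUP_upper[OF that bdd])
  ultimately show ?thesis using that[OF z(1)] by fastforce
qed

lemma usc_imp_borel_measurable: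
  fixes f :: "real \<Rightarrow> real"
  assumes usc: "\<And>t c. t \<in> S \<Longrightarrow> f t < c \<Longrightarrow> \<exists>d>0. \<forall>t'\<in>S. \<bar>t' - t\<bar> < d \<longrightarrow> f t' < c"
  shows "f \<in> borel_measurable (restrict_space borel S)"
  unfolding borel_measurable_iff_less
proof
  fix a
  have "openin (top_of_set S) {t \<in> S. f t < a}"
    unfolding openin_euclidean_subtopology_iff
    using usc by (auto simp: dist_real_def)
  then obtain V where "open V" "{t \<in> S. f t < a} = S \<inter> V" by (auto simp: openin_open)
  then show "{w \<in> space (restrict_space borel S). f w < a} \<in> sets (restrict_space borel S)"
    by (auto simp: space_restrict_space sets_restrict_space)
qed

lemma norm_sq_convex_comb:
  fixes a b p :: "'a::real_inner"
  shows "(norm ((1 - t) *\<^sub>R a + t *\<^sub>R b - p))\<^sup>2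
    = (1 - t) * (norm (a - p))\<^sup>2 + t * (norm (b - p))\<^sup>2 - t * (1 - t) * (norm (a - b))\<^sup>2"
  by (simp add: power2_norm_eq_inner inner_add_left inner_add_right inner_diff_left inner_diff_right inner_commute algebra_simps)

section \<open>The sup-convolution in space and the sup-convolution in space and time\<close>

locale sup_conv_data =
  fixes T \<epsilon> M0 :: real and \<Omega> :: "(real^'n) set" and u :: "real \<Rightarrow> real^'n \<Rightarrow> real"
  assumes T: "0 < T" and eps: "0 < \<epsilon>" and \<Omega>: "bounded \<Omega>" "\<Omega> \<noteq> {}"
    and usc: "usc_on ({0..T} \<times> \<Omega>) (\<lambda>(t, x). u t x)"
    and bnd: "\<And>t x. t \<in> {0..T} \<Longrightarrow> x \<in> \<Omega> \<Longrightarrow> \<bar>u t x\<bar> \<le> M0"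
begin

abbreviation "U t x \<equiv> sup_conv \<epsilon> \<Omega> u t x"

text \<open>At this distance the spatial penalty equals \<open>2 * M0\<close>, the largest possible
  oscillation of \<open>u\<close>, so no point farther away can do better than the centre. For
  \<open>M0 = M\<^sup>2 / 2\<close> with \<open>0 \<le> M\<close> it is the radius
  \<open>M * sqrt \<epsilon>\<close> of the theorem.\<close>

definition "rad = sqrt (2 * M0 * \<epsilon>)"

text \<open>Only the competitor is confined to \<open>{0..T} \<times> \<Omega>\<close>, whereas
  \<open>z\<close> ranges over the whole space. The regularised function is therefore semiconvex on
  full balls around a maximum, also when the maximum occurs at the final time.\<close>

definition hat :: "real \<Rightarrow> real \<times> (real^'n) \<Rightarrow> real" where
  "hat \<kappa> z = (SUP z'\<in>{0..T} \<times> \<Omega>. u (fst z') (snd z') - inverse \<epsilon> * (norm (snd z - snd z'))\<^sup>2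
      - (fst z - fst z')\<^sup>2 / \<kappa>)"

lemma M0: "0 \<le> M0"
  using bnd[of 0] T \<Omega>(2) by fastforce

lemma rad: "0 \<le> rad" "rad\<^sup>2 = 2 * M0 * \<epsilon>"
  using M0 eps by (auto simp: rad_def)

lemma U_upper:
  assumes "t \<in> {0..T}" "x' \<in> \<Omega>"
  shows "u t x' - inverse \<epsilon> * (norm (x - x'))\<^sup>2 \<le> U t x"
  unfolding sup_conv_def
proof (rule cSUP_upper[OF assms(2)])
  show "bdd_above ((\<lambda>x'. u t x' - inverse \<epsilon> * (norm (x - x'))\<^sup>2) ` \<Omega>)"
  proof (intro bdd_aboveI2)
    fix x' assume "x' \<in> \<Omega>"
    then have "u t x' \<le> M0" using bnd[OF assms(1)] by fastforce
    moreover have "0 \<le> inverse \<epsilon> * (norm (x - x'))\<^sup>2" using eps by simp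
    ultimately show "u t x' - inverse \<epsilon> * (norm (x - x'))\<^sup>2 \<le> M0" by linarith
  qed
qed

lemma U_ge: "t \<in> {0..T} \<Longrightarrow> x \<in> \<Omega> \<Longrightarrow> u t x \<le> U t x"
  using U_upper[of t x x] by simp

lemma U_le_M0:
  assumes "t \<in> {0..T}"
  shows "U t x \<le> M0"
  unfolding sup_conv_def
proof (rule cSUP_least[OF \<Omega>(2)])
  fix x' assume "x' \<in> \<Omega>"
  then have "u t x' \<le> M0" using bnd[OF assms(1)] by fastforce
  moreover have "0 \<le> inverse \<epsilon> * (norm (x - x'))\<^sup>2" using eps by simp
  ultimately show "u t x' - inverse \<epsilon> * (norm (x - x'))\<^sup>2 \<le> M0" by linarith
qed

lemma U_bnd: "t \<in> {0..T} \<Longrightarrow> x \<in> \<Omega> \<Longrightarrow> \<bar>U t x\<bar> \<le> M0"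
  using U_le_M0[of t x] U_ge[of t x] bnd[of t x] by auto

lemma far_penalty:
  assumes "t \<in> {0..T}" "x \<in> \<Omega>" "x' \<in> \<Omega>" "x' \<notin> cball x rad"
  shows "u t x' - inverse \<epsilon> * (norm (x - x'))\<^sup>2 \<le> u t x"
proof -
  have "rad < norm (x - x')" using assms(4) by (simp add: dist_norm)
  then have "rad\<^sup>2 \<le> (norm (x - x'))\<^sup>2" using rad(1) by (intro power_mono) auto
  then have "2 * M0 \<le> inverse \<epsilon> * (norm (x - x'))\<^sup>2" using eps by (simp add: rad(2) field_simps)
  then show ?thesis using bnd[OF assms(1,3)] bnd[OF assms(1,2)] by linarith
qed

lemma hat_upper:
  assumes "0 < \<kappa>" "t' \<in> {0..T}" "x' \<in> \<Omega>"
  shows "u t' x' - inverse \<epsilon> * (norm (x - x'))\<^sup>2 - (t - t')\<^sup>2 / \<kappa> \<le> hat \<kappa> (t, x)"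
proof -
  have "u (fst z') (snd z') - inverse \<epsilon> * (norm (x - snd z'))\<^sup>2 - (t - fst z')\<^sup>2 / \<kappa> \<le> M0"
    if "z' \<in> {0..T} \<times> \<Omega>" for z'
  proof -
    have "u (fst z') (snd z') \<le> M0" using bnd[of "fst z'" "snd z'"] that by auto
    moreover have "0 \<le> inverse \<epsilon> * (norm (x - snd z'))\<^sup>2" "0 \<le> (t - fst z')\<^sup>2 / \<kappa>" using eps assms by simp_all
    ultimately show ?thesis by linarith
  qed
  then have "bdd_above ((\<lambda>z'. u (fst z') (snd z') - inverse \<epsilon> * (norm (x - snd z'))\<^sup>2 - (t - fst z')\<^sup>2 / \<kappa>) ` ({0..T} \<times> \<Omega>))"
    by (intro bdd_aboveI2)
  from cSUP_upper[OF _ this, of "(t', x')"] show ?thesis unfolding hat_def using assms by simp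
qed

lemma hat_least:
  assumes "\<And>t' x'. t' \<in> {0..T} \<Longrightarrow> x' \<in> \<Omega> \<Longrightarrow> u t' x' - inverse \<epsilon> * (norm (x - x'))\<^sup>2 - (t - t')\<^sup>2 / \<kappa> \<le> c"
  shows "hat \<kappa> (t, x) \<le> c"
  unfolding hat_def using T \<Omega>(2) assms by (intro cSUP_least) auto

lemma hat_ge_U:
  assumes "0 < \<kappa>" "t' \<in> {0..T}"
  shows "U t' x - (t - t')\<^sup>2 / \<kappa> \<le> hat \<kappa> (t, x)"
proof -
  have "U t' x \<le> hat \<kappa> (t, x) + (t - t')\<^sup>2 / \<kappa>"
    unfolding sup_conv_def
  proof (rule cSUP_least[OF \<Omega>(2)])
    fix x' assume "x' \<in> \<Omega>"
    from hat_upper[OF assms this, of x t]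
    show "u t' x' - inverse \<epsilon> * (norm (x - x'))\<^sup>2 \<le> hat \<kappa> (t, x) + (t - t')\<^sup>2 / \<kappa>" by simp
  qed
  then show ?thesis by simp
qed

text \<open>Restriction to the compact set \<open>{0..T} \<times> cball x rad\<close> loses nothing
  by \<open>far_penalty\<close>. A maximiser in both variables also maximises in space at its own
  time, which leads from \<open>hat\<close> back to the sup-convolution in space alone.\<close>

lemma hat_attained:
  assumes \<kappa>: "0 < \<kappa>" and x: "cball x rad \<subseteq> \<Omega>"
  obtains t' x' where "t' \<in> {0..T}" "x' \<in> cball x rad"
    "hat \<kappa> (t, x) = u t' x' - inverse \<epsilon> * (norm (x - x'))\<^sup>2 - (t - t')\<^sup>2 / \<kappa>"
    "U t' x = u t' x' - inverse \<epsilon> * (norm (x - x'))\<^sup>2"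
proof -
  have x\<Omega>: "x \<in> \<Omega>" using x rad(1) by auto
  define g where "g z = - inverse \<epsilon> * (norm (x - snd z))\<^sup>2 - (t - fst z)\<^sup>2 / \<kappa>" for z :: "real \<times> (real^'n)"
  have "compact ({0..T} \<times> cball x rad)" by (intro compact_Times) auto
  moreover have "{0..T} \<times> cball x rad \<noteq> {}" using T rad(1) by auto
  moreover have "{0..T} \<times> cball x rad \<subseteq> {0..T} \<times> \<Omega>" using x by auto
  moreover have "continuous_on ({0..T} \<times> cball x rad) g" unfolding g_def using \<kappa> by (intro continuous_intros) auto
  moreover have "(case z of (t, x) \<Rightarrow> u t x) + g z \<le> M0" if z: "z \<in> {0..T} \<times> cball x rad" for z
  proof -
    have "u (fst z) (snd z) \<le> M0" using bnd[of "fst z" "snd z"] z x by (auto simp: subset_iff)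
    moreover have "0 \<le> inverse \<epsilon> * (norm (x - snd z))\<^sup>2" "0 \<le> (t - fst z)\<^sup>2 / \<kappa>" using eps \<kappa> by simp_all
    ultimately show ?thesis unfolding g_def by (simp add: case_prod_unfold)
  qed
  ultimately obtain z where z: "z \<in> {0..T} \<times> cball x rad"
     "\<And>y. y \<in> {0..T} \<times> cball x rad \<Longrightarrow> (case y of (t, x) \<Rightarrow> u t x) + g y \<le> (case z of (t, x) \<Rightarrow> u t x) + g z"
    using usc_on_attains_sup[OF usc] by metis
  obtain t' x' where zz: "z = (t', x')" by (cases z)
  define m where "m = u t' x' - inverse \<epsilon> * (norm (x - x'))\<^sup>2 - (t - t')\<^sup>2 / \<kappa>"
  have le: "u s y - inverse \<epsilon> * (norm (x - y))\<^sup>2 - (t - s)\<^sup>2 / \<kappa> \<le> m" if "s \<in> {0..T}" "y \<in> \<Omega>" for s y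
  proof (cases "y \<in> cball x rad")
    case True
    then show ?thesis using z(2)[of "(s, y)"] that by (simp add: zz g_def m_def)
  next
    case False
    have "u s x - (t - s)\<^sup>2 / \<kappa> \<le> m" using z(2)[of "(s, x)"] that rad(1) by (simp add: zz g_def m_def)
    then show ?thesis using far_penalty[OF that(1) x\<Omega> that(2) False] by simp
  qed
  have tx: "t' \<in> {0..T}" "x' \<in> cball x rad" using z(1) zz by auto
  have hm: "hat \<kappa> (t, x) = m"
    using hat_upper[OF \<kappa> tx(1), of x' x t] tx(2) x by (intro antisym hat_least le) (auto simp: m_def)
  moreover have "U t' x = u t' x' - inverse \<epsilon> * (norm (x - x'))\<^sup>2"
  proof (rule antisym)
    show "U t' x \<le> u t' x' - inverse \<epsilon> * (norm (x - x'))\<^sup>2"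
      using hat_ge_U[OF \<kappa> tx(1), of x t] hm by (simp add: m_def)
  qed (use U_upper[OF tx(1)] tx(2) x in auto)
  ultimately show ?thesis using that[OF tx] by (simp add: m_def)
qed

lemma U_attained:
  assumes x: "cball x rad \<subseteq> \<Omega>" and t: "t \<in> {0..T}"
  obtains x' where "x' \<in> cball x rad" "U t x = u t x' - inverse \<epsilon> * (norm (x - x'))\<^sup>2"
proof -
  have x\<Omega>: "x \<in> \<Omega>" using x rad(1) by auto
  define g where "g z = - inverse \<epsilon> * (norm (x - snd z))\<^sup>2" for z :: "real \<times> (real^'n)"
  have "compact ({t} \<times> cball x rad)" by (intro compact_Times) auto
  moreover have "{t} \<times> cball x rad \<noteq> {}" using rad(1) by auto
  moreover have "{t} \<times> cball x rad \<subseteq> {0..T} \<times> \<Omega>" using x t by auto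
  moreover have "continuous_on ({t} \<times> cball x rad) g" unfolding g_def by (intro continuous_intros)
  moreover have "(case z of (t, x) \<Rightarrow> u t x) + g z \<le> M0" if z: "z \<in> {t} \<times> cball x rad" for z
  proof -
    have "u (fst z) (snd z) \<le> M0" using bnd[of "fst z" "snd z"] z x t by (auto simp: subset_iff)
    moreover have "0 \<le> inverse \<epsilon> * (norm (x - snd z))\<^sup>2" using eps by simp_all
    ultimately show ?thesis unfolding g_def by (simp add: case_prod_unfold)
  qed
  ultimately obtain z where z: "z \<in> {t} \<times> cball x rad"
     "\<And>y. y \<in> {t} \<times> cball x rad \<Longrightarrow> (case y of (t, x) \<Rightarrow> u t x) + g y \<le> (case z of (t, x) \<Rightarrow> u t x) + g z"
    using usc_on_attains_sup[OF usc] by metis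
  obtain x' where zz: "z = (t, x')" "x' \<in> cball x rad" using z(1) by auto
  define m where "m = u t x' - inverse \<epsilon> * (norm (x - x'))\<^sup>2"
  have le: "u t y - inverse \<epsilon> * (norm (x - y))\<^sup>2 \<le> m" if "y \<in> \<Omega>" for y
  proof (cases "y \<in> cball x rad")
    case True
    then show ?thesis using z(2)[of "(t, y)"] that by (simp add: zz g_def m_def)
  next
    case False
    have "u t x \<le> m" using z(2)[of "(t, x)"] rad(1) by (simp add: zz g_def m_def)
    then show ?thesis using far_penalty[OF t x\<Omega> that False] by simp
  qed
  have "U t x = m"
  proof (rule antisym)
    show "U t x \<le> m" unfolding sup_conv_def by (rule cSUP_least[OF \<Omega>(2) le])
  qed (use U_upper[OF t, of x' x] zz(2) x in \<open>auto simp: m_def\<close>)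
  then show ?thesis using that[OF zz(2)] by (simp add: m_def)
qed

text \<open>Maximisers along a violating sequence have to accumulate inside \<open>\<Omega>\<close>.
  The excess of \<open>r\<close> over \<open>rad\<close> keeps the balls around all centres close to
  \<open>xh\<close> within one compact ball of \<open>\<Omega>\<close>.\<close>

lemma U_usc:
  assumes x: "cball xh r \<subseteq> \<Omega>" and r: "rad < r" and t: "t \<in> {0..T}" and c: "U t xh < c"
  shows "\<exists>d>0. \<forall>t'\<in>{0..T}. \<forall>x. \<bar>t' - t\<bar> < d \<longrightarrow> norm (x - xh) < d \<longrightarrow> U t' x < c"
proof (rule ccontr)
  assume "\<not> ?thesis"
  then have neg: "\<exists>t'\<in>{0..T}. \<exists>x. \<bar>t' - t\<bar> < d \<and> norm (x - xh) < d \<and> c \<le> U t' x" if "0 < d" for d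
    using that by force
  define dn where "dn n = (r - rad) / real (Suc n)" for n
  have dn: "0 < dn n" "dn n \<le> r - rad" for n using r divide_left_mono[of 1 "real (Suc n)" "r - rad"] by (auto simp: dn_def)
  have dn0: "dn \<longlonglongrightarrow> 0" unfolding dn_def by (intro LIMSEQ_Suc[OF lim_const_over_n])
  have "\<exists>t' x x'. t' \<in> {0..T} \<and> \<bar>t' - t\<bar> < dn n \<and> norm (x - xh) < dn n \<and> x' \<in> cball xh r \<and>
      c \<le> u t' x' - inverse \<epsilon> * (norm (x - x'))\<^sup>2" for n
  proof -
    obtain t' x where tx: "t' \<in> {0..T}" "\<bar>t' - t\<bar> < dn n" "norm (x - xh) < dn n" "c \<le> U t' x"
      using neg[OF dn(1)] by blast
    have sub: "cball x rad \<subseteq> cball xh r"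
    proof
      fix y assume "y \<in> cball x rad"
      then show "y \<in> cball xh r" using tx(3) dn(2)[of n] dist_triangle[of xh y x]
        by (simp add: dist_norm norm_minus_commute)
    qed
    then have "cball x rad \<subseteq> \<Omega>" using assms(1) by (rule order_trans)
    then obtain x' where x': "x' \<in> cball x rad" "U t' x = u t' x' - inverse \<epsilon> * (norm (x - x'))\<^sup>2"
      by (rule U_attained[OF _ tx(1)])
    then have "x' \<in> cball xh r" using sub by blast
    then show ?thesis using tx x'(2) by auto
  qed
  then obtain tn xn yn where n: "\<And>n. tn n \<in> {0..T}" "\<And>n. \<bar>tn n - t\<bar> < dn n" "\<And>n. norm (xn n - xh) < dn n"
      "\<And>n. yn n \<in> cball xh r" "\<And>n. c \<le> u (tn n) (yn n) - inverse \<epsilon> * (norm (xn n - yn n))\<^sup>2"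
    by metis
  obtain y k where y: "y \<in> cball xh r" "strict_mono (k :: nat \<Rightarrow> nat)" "(yn \<circ> k) \<longlonglongrightarrow> y"
    using compact_cball[of xh r] n(4) unfolding compact_def by meson
  have dk: "(\<lambda>n. dn (k n)) \<longlonglongrightarrow> 0" using LIMSEQ_subseq_LIMSEQ[OF dn0 y(2)] by (simp add: o_def)
  have "(\<lambda>n. tn (k n) - t) \<longlonglongrightarrow> 0" by (rule Lim_null_comparison[OF _ dk]) (use n(2) in \<open>auto intro!: always_eventually less_imp_le\<close>)
  then have tk: "(\<lambda>n. tn (k n)) \<longlonglongrightarrow> t" by (simp add: LIM_zero_iff)
  have "(\<lambda>n. xn (k n) - xh) \<longlonglongrightarrow> 0" by (rule Lim_null_comparison[OF _ dk]) (use n(3) in \<open>auto intro!: always_eventually less_imp_le\<close>)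
  then have xk: "(\<lambda>n. xn (k n)) \<longlonglongrightarrow> xh" by (simp add: LIM_zero_iff)
  have yk: "(\<lambda>n. yn (k n)) \<longlonglongrightarrow> y" using y(3) by (simp add: o_def)
  have "c + inverse \<epsilon> * (norm (xh - y))\<^sup>2 \<le> (case (t, y) of (t, x) \<Rightarrow> u t x)"
  proof (rule usc_on_seq_ge[OF usc, where zn = "\<lambda>n. (tn (k n), yn (k n))"])
    show "(\<lambda>n. (tn (k n), yn (k n))) \<longlonglongrightarrow> (t, y)" by (intro tendsto_intros tk yk)
    show "(\<lambda>n. c + inverse \<epsilon> * (norm (xn (k n) - yn (k n)))\<^sup>2) \<longlonglongrightarrow> c + inverse \<epsilon> * (norm (xh - y))\<^sup>2"
      by (intro tendsto_intros xk yk)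
    show "c + inverse \<epsilon> * (norm (xn (k m) - yn (k m)))\<^sup>2 \<le> (case (tn (k m), yn (k m)) of (t, x) \<Rightarrow> u t x)" for m
      using n(5)[of "k m"] by simp
  qed (use n(1,4) x y(1) t in auto)
  then show False using U_upper[OF t, of y xh] y(1) x c by auto
qed

lemma U_measurable:
  assumes "cball x r \<subseteq> \<Omega>" "rad < r"
  shows "(\<lambda>t. U t x) \<in> borel_measurable (restrict_space borel {0..T})"
proof (rule usc_imp_borel_measurable)
  fix t c assume "t \<in> {0..T}" "U t x < c"
  from U_usc[OF assms this] obtain d where "0 < d"
    "\<And>t' y. t' \<in> {0..T} \<Longrightarrow> \<bar>t' - t\<bar> < d \<Longrightarrow> norm (y - x) < d \<Longrightarrow> U t' y < c" by blast
  then show "\<exists>d>0. \<forall>t'\<in>{0..T}. \<bar>t' - t\<bar> < d \<longrightarrow> U t' x < c" by (intro exI[of _ d]) auto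
qed

text \<open>Each member of the supremum becomes affine in \<open>z\<close> after the two squares are
  added. The centre \<open>zc\<close> is free because moving it changes the sum only by an affine
  function.\<close>

lemma hat_convex:
  assumes \<kappa>: "0 < \<kappa>"
  shows "convex_on UNIV (\<lambda>z. hat \<kappa> z + inverse \<epsilon> * (norm (snd z - snd zc))\<^sup>2 + (fst z - fst zc)\<^sup>2 / \<kappa>)"
    (is "convex_on UNIV ?h")
proof (rule convex_onI)
  fix \<theta> :: real and a b :: "real \<times> (real^'n)" assume \<theta>: "0 < \<theta>" "\<theta> < 1"
  define z where "z = (1 - \<theta>) *\<^sub>R a + \<theta> *\<^sub>R b"
  have x: "(norm (snd z - p))\<^sup>2 = (1 - \<theta>) * (norm (snd a - p))\<^sup>2 + \<theta> * (norm (snd b - p))\<^sup>2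
      - \<theta> * (1 - \<theta>) * (norm (snd a - snd b))\<^sup>2" for p
    unfolding z_def by (simp add: norm_sq_convex_comb)
  have t: "(fst z - p)\<^sup>2 = (1 - \<theta>) * (fst a - p)\<^sup>2 + \<theta> * (fst b - p)\<^sup>2 - \<theta> * (1 - \<theta>) * (fst a - fst b)\<^sup>2" for p
    using norm_sq_convex_comb[of \<theta> "fst a" "fst b" p] unfolding z_def by simp
  define q where "q z = inverse \<epsilon> * (norm (snd z - snd zc))\<^sup>2 + (fst z - fst zc)\<^sup>2 / \<kappa>" for z :: "real \<times> (real^'n)"
  have "hat \<kappa> (fst z, snd z) \<le> (1 - \<theta>) * (hat \<kappa> a + q a) + \<theta> * (hat \<kappa> b + q b) - q z"
  proof (rule hat_least)
    fix t' x' assume tx: "t' \<in> {0..T}" "x' \<in> \<Omega>"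
    define A where "A z = u t' x' - inverse \<epsilon> * (norm (snd z - x'))\<^sup>2 - (fst z - t')\<^sup>2 / \<kappa> + q z" for z
    have "A z = (1 - \<theta>) * A a + \<theta> * A b"
      unfolding A_def q_def x t by (simp add: add_divide_distrib diff_divide_distrib algebra_simps)
    also have "\<dots> \<le> (1 - \<theta>) * (hat \<kappa> a + q a) + \<theta> * (hat \<kappa> b + q b)"
      using \<theta> hat_upper[OF \<kappa> tx, of "snd a" "fst a"] hat_upper[OF \<kappa> tx, of "snd b" "fst b"]
      by (intro add_mono mult_left_mono) (auto simp: A_def)
    finally show "u t' x' - inverse \<epsilon> * (norm (snd z - x'))\<^sup>2 - (fst z - t')\<^sup>2 / \<kappa>
        \<le> (1 - \<theta>) * (hat \<kappa> a + q a) + \<theta> * (hat \<kappa> b + q b) - q z"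
      by (simp add: A_def)
  qed
  then show "?h ((1 - \<theta>) *\<^sub>R a + \<theta> *\<^sub>R b) \<le> (1 - \<theta>) * ?h a + \<theta> * ?h b"
    unfolding z_def[symmetric] q_def by (simp add: algebra_simps)
qed simp

text \<open>All members of the supremum share a Lipschitz constant on bounded sets, as
  \<open>\<Omega>\<close> and the time interval are bounded. The constant depends on
  \<open>\<kappa>\<close>, so any error measured by it must be made small after
  \<open>\<kappa>\<close> has been fixed.\<close>

lemma hat_lipschitz:
  assumes \<kappa>: "0 < \<kappa>" and R: "0 \<le> R"
  obtains L where "0 \<le> L" "\<And>z w. norm z \<le> R \<Longrightarrow> norm w \<le> R \<Longrightarrow> \<bar>hat \<kappa> z - hat \<kappa> w\<bar> \<le> L * norm (z - w)"
proof -
  obtain B where B: "0 < B" "\<And>x. x \<in> \<Omega> \<Longrightarrow> norm x \<le> B" using \<Omega>(1) bounded_pos by blast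
  define L where "L = inverse \<epsilon> * (2 * R + 2 * B) + (2 * R + 2 * T) / \<kappa>"
  have L0: "0 \<le> L" using eps \<kappa> R B T by (simp add: L_def)
  have sq: "(norm (x - p))\<^sup>2 - (norm (y - p))\<^sup>2 \<le> norm (x - y) * (2 * R + 2 * B')"
    if "norm x \<le> R" "norm y \<le> R" "norm p \<le> B'" for x y p :: "'b::real_inner" and B'
  proof -
    have "(norm (x - p))\<^sup>2 - (norm (y - p))\<^sup>2 = (x - y) \<bullet> (x + y - 2 *\<^sub>R p)"
      by (simp add: power2_norm_eq_inner inner_diff_left inner_diff_right inner_add_right inner_commute)
    also have "\<dots> \<le> norm (x - y) * norm (x + y - 2 *\<^sub>R p)" by (rule norm_cauchy_schwarz)
    also have "\<dots> \<le> norm (x - y) * (2 * R + 2 * B')"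
    proof (rule mult_left_mono)
      have "norm (x + y - 2 *\<^sub>R p) \<le> norm x + norm y + norm (2 *\<^sub>R p)"
        using norm_triangle_ineq4[of "x + y" "2 *\<^sub>R p"] norm_triangle_ineq[of x y] by linarith
      then show "norm (x + y - 2 *\<^sub>R p) \<le> 2 * R + 2 * B'" using that by simp
    qed simp
    finally show ?thesis .
  qed
  have le: "hat \<kappa> z \<le> hat \<kappa> w + L * norm (z - w)" if zw: "norm z \<le> R" "norm w \<le> R" for z w
  proof -
    have n: "norm (fst z) \<le> R" "norm (snd z) \<le> R" "norm (fst w) \<le> R" "norm (snd w) \<le> R"
      using zw norm_fst_le[of "fst z" "snd z"] norm_snd_le[of "snd z" "fst z"]
        norm_fst_le[of "fst w" "snd w"] norm_snd_le[of "snd w" "fst w"] by simp_all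
    have d: "norm (fst w - fst z) \<le> norm (z - w)" "norm (snd w - snd z) \<le> norm (z - w)"
      using norm_fst_le[of "fst (z - w)" "snd (z - w)"] norm_snd_le[of "snd (z - w)" "fst (z - w)"]
      by (simp_all add: norm_minus_commute del: fst_diff snd_diff) (simp_all add: norm_minus_commute)
    have "hat \<kappa> (fst z, snd z) \<le> hat \<kappa> (fst w, snd w) + L * norm (z - w)"
    proof (rule hat_least)
      fix t' x' assume tx: "t' \<in> {0..T}" "x' \<in> \<Omega>"
      have "(norm (snd w - x'))\<^sup>2 - (norm (snd z - x'))\<^sup>2 \<le> norm (snd w - snd z) * (2 * R + 2 * B)"
        using n B(2)[OF tx(2)] by (intro sq)
      also have "\<dots> \<le> norm (z - w) * (2 * R + 2 * B)" using d R B by (intro mult_right_mono) auto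
      finally have 1: "inverse \<epsilon> * ((norm (snd w - x'))\<^sup>2 - (norm (snd z - x'))\<^sup>2) \<le> inverse \<epsilon> * (norm (z - w) * (2 * R + 2 * B))"
        using eps by (intro mult_left_mono) auto
      have "(norm (fst w - t'))\<^sup>2 - (norm (fst z - t'))\<^sup>2 \<le> norm (fst w - fst z) * (2 * R + 2 * T)"
        using n tx(1) by (intro sq) auto
      also have "\<dots> \<le> norm (z - w) * (2 * R + 2 * T)" using d R T by (intro mult_right_mono) auto
      finally have 2: "((fst w - t')\<^sup>2 - (fst z - t')\<^sup>2) / \<kappa> \<le> norm (z - w) * (2 * R + 2 * T) / \<kappa>"
        using \<kappa> by (intro divide_right_mono) auto
      show "u t' x' - inverse \<epsilon> * (norm (snd z - x'))\<^sup>2 - (fst z - t')\<^sup>2 / \<kappa> \<le> hat \<kappa> (fst w, snd w) + L * norm (z - w)"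
        using hat_upper[OF \<kappa> tx, of "snd w" "fst w"] 1 2
        unfolding L_def by (simp add: algebra_simps diff_divide_distrib add_divide_distrib)
    qed
    then show ?thesis by simp
  qed
  show ?thesis
  proof (rule that[OF L0])
    fix z w :: "real \<times> (real^'n)" assume "norm z \<le> R" "norm w \<le> R"
    then show "\<bar>hat \<kappa> z - hat \<kappa> w\<bar> \<le> L * norm (z - w)"
      using le[of z w] le[of w z] by (simp add: abs_le_iff norm_minus_commute)
  qed
qed

text \<open>Moving the point and its optimal competitor by the same vector leaves both penalties
  unchanged. In this way a bound for \<open>hat\<close> near \<open>(t, x)\<close> becomes a bound
  for \<open>u\<close> near \<open>(t', x')\<close>.\<close>

lemma hat_shift:
  assumes \<kappa>: "0 < \<kappa>" and h: "hat \<kappa> (t, x) = u t' x' - inverse \<epsilon> * (norm (x - x'))\<^sup>2 - (t - t')\<^sup>2 / \<kappa>"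
    and "t' + \<theta> \<in> {0..T}" "x' + \<xi> \<in> \<Omega>"
  shows "u (t' + \<theta>) (x' + \<xi>) - u t' x' \<le> hat \<kappa> (t + \<theta>, x + \<xi>) - hat \<kappa> (t, x)"
  using hat_upper[OF \<kappa> assms(3,4), of "x + \<xi>" "t + \<theta>"] h by simp

end

section \<open>Doubling of variables at a strict maximum\<close>

text \<open>The model situation: \<open>u2\<close> stands for \<open>- v\<close>, the test function
  is quadratic without a mixed time-space term, and \<open>\<gamma>\<close> quantifies the
  strictness of the maximum. The gap \<open>r0 < r - rad\<close> keeps all balls over which the
  sup-convolutions are attained inside \<open>\<Omega>\<close>.\<close>

locale doubled_data = A: sup_conv_data T \<epsilon> M0 \<Omega> u1 + B: sup_conv_data T \<epsilon> M0 \<Omega> u2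
  for T \<epsilon> M0 :: real and \<Omega> :: "(real^'n) set" and u1 u2 :: "real \<Rightarrow> real^'n \<Rightarrow> real" +
  fixes tb r r0 \<gamma> a c :: real and xb yb P1 P2 :: "real^'n"
    and N :: "(real^'n) \<times> (real^'n) \<Rightarrow> (real^'n) \<times> (real^'n) \<Rightarrow> real"
  assumes tb: "tb \<in> {0<..T}"
    and r0: "0 < r0" "r0 < r - A.rad" and balls: "cball xb r \<subseteq> \<Omega>" "cball yb r \<subseteq> \<Omega>"
    and N: "bilinear N" "\<And>w z. N w z = N z w" and \<gamma>: "0 < \<gamma>"
    and strict: "\<And>t x y. t \<in> {0..T} \<Longrightarrow> \<bar>t - tb\<bar> \<le> r0 \<Longrightarrow> norm (x - xb) \<le> r0 \<Longrightarrow> norm (y - yb) \<le> r0 \<Longrightarrow>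
      A.U t x + B.U t y
        - (a * (t - tb) + c * (t - tb)\<^sup>2 + P1 \<bullet> (x - xb) + P2 \<bullet> (y - yb) + N (x - xb, y - yb) (x - xb, y - yb) / 2)
      \<le> A.U tb xb + B.U tb yb - \<gamma> * ((t - tb)\<^sup>2 + (norm (x - xb))\<^sup>2 + (norm (y - yb))\<^sup>2)"
begin

definition Q :: "real \<Rightarrow> real^'n \<Rightarrow> real^'n \<Rightarrow> real" where
  "Q t x y = a * (t - tb) + c * (t - tb)\<^sup>2 + P1 \<bullet> (x - xb) + P2 \<bullet> (y - yb)
    + N (x - xb, y - yb) (x - xb, y - yb) / 2"

definition "peak = A.U tb xb + B.U tb yb"

lemma rad_eq: "B.rad = A.rad"
  by (simp add: A.rad_def B.rad_def)

lemma near_ball: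
  assumes "norm (x - xb) \<le> r0"
  shows "cball x (r - r0) \<subseteq> \<Omega>" "cball x A.rad \<subseteq> \<Omega>"
proof -
  show "cball x (r - r0) \<subseteq> \<Omega>"
  proof (rule order_trans[OF _ balls(1)], rule subsetI)
    fix y assume "y \<in> cball x (r - r0)"
    then show "y \<in> cball xb r" using assms dist_triangle[of xb y x] by (simp add: dist_norm norm_minus_commute)
  qed
  then show "cball x A.rad \<subseteq> \<Omega>" using r0 subset_cball[of A.rad "r - r0" x] by auto
qed

lemma near_ball':
  assumes "norm (y - yb) \<le> r0"
  shows "cball y (r - r0) \<subseteq> \<Omega>" "cball y A.rad \<subseteq> \<Omega>"
proof -
  show "cball y (r - r0) \<subseteq> \<Omega>"
  proof (rule order_trans[OF _ balls(2)], rule subsetI)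
    fix z assume "z \<in> cball y (r - r0)"
    then show "z \<in> cball yb r" using assms dist_triangle[of yb z y] by (simp add: dist_norm norm_minus_commute)
  qed
  then show "cball y A.rad \<subseteq> \<Omega>" using r0 subset_cball[of A.rad "r - r0" y] by auto
qed

lemma continuous_on_Q:
  assumes "continuous_on S t" "continuous_on S x" "continuous_on S y"
  shows "continuous_on S (\<lambda>z. Q (t z) (x z) (y z))"
proof -
  interpret bounded_bilinear N using N(1) by (simp add: bilinear_conv_bounded_bilinear)
  show ?thesis unfolding Q_def by (intro continuous_intros continuous_on assms) auto
qed

text \<open>Compactness: a sequence of near-maximisers with vanishing penalty parameter has all its
  times collapsing to one time in \<open>{0..T}\<close>, and its limit attains the peak, hence is
  the strict maximum. Semicontinuity bounds each of the two values from above and near-maximality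
  bounds their sum from below, so both values converge separately. The times \<open>t\<close> and
  \<open>s\<close> may lie outside \<open>{0..T}\<close>.\<close>

lemma near_maximisers_close:
  assumes \<delta>: "0 < \<delta>"
  obtains \<kappa> \<eta> where "0 < \<kappa>" "0 < \<eta>"
    "\<And>t s t' s' x y. t' \<in> {0..T} \<Longrightarrow> s' \<in> {0..T} \<Longrightarrow> \<bar>t - tb\<bar> \<le> r0 \<Longrightarrow> \<bar>s - tb\<bar> \<le> r0 \<Longrightarrow>
      norm (x - xb) \<le> r0 \<Longrightarrow> norm (y - yb) \<le> r0 \<Longrightarrow>
      peak - \<eta> \<le> A.U t' x - (t - t')\<^sup>2 / \<kappa> + (B.U s' y - (s - s')\<^sup>2 / \<kappa>) - Q t x y - (t - s)\<^sup>2 / \<kappa> \<Longrightarrow>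
      \<bar>t - tb\<bar> < \<delta> \<and> \<bar>s - tb\<bar> < \<delta> \<and> \<bar>t' - tb\<bar> < \<delta> \<and> \<bar>s' - tb\<bar> < \<delta> \<and> norm (x - xb) < \<delta> \<and> norm (y - yb) < \<delta>
      \<and> \<bar>A.U t' x - A.U tb xb\<bar> < \<delta> \<and> \<bar>B.U s' y - B.U tb yb\<bar> < \<delta>"
proof (rule ccontr)
  assume neg: "\<not> thesis"
  \<comment> \<open>Failure of the claim is exploited with the same small number as penalty
    parameter and as tolerance.\<close>
  define e where "e n = 1 / real (Suc n)" for n
  have e: "0 < e n" "e \<longlonglongrightarrow> 0" for n
    unfolding e_def by (simp, rule LIMSEQ_Suc[OF lim_const_over_n])
  define close where "close w \<longleftrightarrow> (case w of (t, s, t', s', x, y) \<Rightarrow>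
      \<bar>t - tb\<bar> < \<delta> \<and> \<bar>s - tb\<bar> < \<delta> \<and> \<bar>t' - tb\<bar> < \<delta> \<and> \<bar>s' - tb\<bar> < \<delta> \<and> norm (x - xb) < \<delta> \<and> norm (y - yb) < \<delta>
      \<and> \<bar>A.U t' x - A.U tb xb\<bar> < \<delta> \<and> \<bar>B.U s' y - B.U tb yb\<bar> < \<delta>)" for w
  define box where "box = {tb - r0..tb + r0} \<times> {tb - r0..tb + r0} \<times> {0..T} \<times> {0..T} \<times> cball xb r0 \<times> cball yb r0"
  define bad where "bad n w \<longleftrightarrow> w \<in> box \<and> \<not> close w \<and> (case w of (t, s, t', s', x, y) \<Rightarrow>
     peak - e n \<le> A.U t' x - (t - t')\<^sup>2 / e n + (B.U s' y - (s - s')\<^sup>2 / e n) - Q t x y - (t - s)\<^sup>2 / e n)" for n w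
  have ex: "\<exists>w. bad n w" for n
  proof (rule ccontr)
    assume contra: "\<not> ?thesis"
    show False
    proof (rule notE[OF neg], rule that[OF e(1)[of n] e(1)[of n]])
      fix t s t' s' x y
      assume "t' \<in> {0..T}" "s' \<in> {0..T}" "\<bar>t - tb\<bar> \<le> r0" "\<bar>s - tb\<bar> \<le> r0"
        "norm (x - xb) \<le> r0" "norm (y - yb) \<le> r0"
        and ge: "peak - e n \<le> A.U t' x - (t - t')\<^sup>2 / e n + (B.U s' y - (s - s')\<^sup>2 / e n) - Q t x y - (t - s)\<^sup>2 / e n"
      then have "(t, s, t', s', x, y) \<in> box"
        by (auto simp: box_def dist_norm norm_minus_commute)
      moreover have "\<not> bad n (t, s, t', s', x, y)" using contra by blast
      ultimately have "close (t, s, t', s', x, y)" using ge unfolding bad_def case_prod_conv by blast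
      then show "\<bar>t - tb\<bar> < \<delta> \<and> \<bar>s - tb\<bar> < \<delta> \<and> \<bar>t' - tb\<bar> < \<delta> \<and> \<bar>s' - tb\<bar> < \<delta> \<and> norm (x - xb) < \<delta> \<and> norm (y - yb) < \<delta>
          \<and> \<bar>A.U t' x - A.U tb xb\<bar> < \<delta> \<and> \<bar>B.U s' y - B.U tb yb\<bar> < \<delta>"
        by (simp add: close_def)
    qed
  qed
  define w where "w n = (SOME v. bad n v)" for n
  have bw: "bad n (w n)" for n unfolding w_def by (rule someI_ex[OF ex])
  have w: "w n \<in> box" "\<not> close (w n)" for n
    using bw[of n] unfolding bad_def by blast+
  note wge = bw[unfolded bad_def, THEN conjunct2, THEN conjunct2]
  have "compact box" unfolding box_def by (intro compact_Times compact_Icc compact_cball)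
  then obtain wl k where wl: "wl \<in> box" "strict_mono (k :: nat \<Rightarrow> nat)" "(w \<circ> k) \<longlonglongrightarrow> wl"
    using w(1) unfolding compact_def by meson
  define t s t' s' x y where "t n = fst (w (k n))" and "s n = fst (snd (w (k n)))"
    and "t' n = fst (snd (snd (w (k n))))" and "s' n = fst (snd (snd (snd (w (k n)))))"
    and "x n = fst (snd (snd (snd (snd (w (k n))))))" and "y n = snd (snd (snd (snd (snd (w (k n))))))" for n
  note defs = t_def s_def t'_def s'_def x_def y_def
  define ek where "ek = (\<lambda>n. e (k n))"
  have ek: "0 < ek n" "ek \<longlonglongrightarrow> 0" for n
    using e LIMSEQ_subseq_LIMSEQ[OF e(2) wl(2)] by (auto simp: ek_def o_def)
  have inbox: "\<bar>t n - tb\<bar> \<le> r0" "\<bar>s n - tb\<bar> \<le> r0" "t' n \<in> {0..T}" "s' n \<in> {0..T}"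
      "norm (x n - xb) \<le> r0" "norm (y n - yb) \<le> r0" for n
    using w(1)[of "k n"] unfolding box_def defs by (auto simp: dist_norm norm_minus_commute)
  have ge: "peak - ek n \<le> A.U (t' n) (x n) - (t n - t' n)\<^sup>2 / ek n + (B.U (s' n) (y n) - (s n - s' n)\<^sup>2 / ek n)
      - Q (t n) (x n) (y n) - (t n - s n)\<^sup>2 / ek n" for n
    using wge[of "k n"] unfolding defs ek_def by (simp add: case_prod_unfold)
  obtain tl sl tl' sl' xl yl where wleq: "wl = (tl, sl, tl', sl', xl, yl)" by (metis prod_cases6)
  have lims0: "(\<lambda>n. w (k n)) \<longlonglongrightarrow> (tl, sl, tl', sl', xl, yl)" using wl(3) wleq by (simp add: o_def)
  have lims: "t \<longlonglongrightarrow> tl" "s \<longlonglongrightarrow> sl" "t' \<longlonglongrightarrow> tl'" "s' \<longlonglongrightarrow> sl'" "x \<longlonglongrightarrow> xl" "y \<longlonglongrightarrow> yl"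
    unfolding defs
    using tendsto_fst[OF lims0] tendsto_snd[OF lims0]
      tendsto_fst[OF tendsto_snd[OF lims0]] tendsto_snd[OF tendsto_snd[OF lims0]]
      tendsto_fst[OF tendsto_snd[OF tendsto_snd[OF lims0]]] tendsto_snd[OF tendsto_snd[OF tendsto_snd[OF lims0]]]
      tendsto_fst[OF tendsto_snd[OF tendsto_snd[OF tendsto_snd[OF lims0]]]]
      tendsto_snd[OF tendsto_snd[OF tendsto_snd[OF tendsto_snd[OF lims0]]]]
      tendsto_fst[OF tendsto_snd[OF tendsto_snd[OF tendsto_snd[OF tendsto_snd[OF lims0]]]]]
      tendsto_snd[OF tendsto_snd[OF tendsto_snd[OF tendsto_snd[OF tendsto_snd[OF lims0]]]]]
    by simp_all
  have lbox: "\<bar>tl - tb\<bar> \<le> r0" "tl' \<in> {0..T}" "sl' \<in> {0..T}" "norm (xl - xb) \<le> r0" "norm (yl - yb) \<le> r0"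
    using wl(1) unfolding wleq box_def by (auto simp: dist_norm norm_minus_commute)
  have Qlim: "(\<lambda>n. Q (t n) (x n) (y n)) \<longlonglongrightarrow> Q tl xl yl"
  proof -
    have "continuous_on UNIV (\<lambda>z. Q (fst z) (fst (snd z)) (snd (snd z)))" by (intro continuous_on_Q continuous_intros)
    from continuous_on_tendsto_compose[OF this, of "\<lambda>n. (t n, x n, y n)" "(tl, xl, yl)"]
    show ?thesis using lims by (simp add: tendsto_Pair)
  qed
  have Ux: "A.U (t' n) (x n) \<le> M0" "B.U (s' n) (y n) \<le> M0" for n
    using inbox A.U_le_M0 B.U_le_M0 by blast+
  have pen: "(t n - t' n)\<^sup>2 + (s n - s' n)\<^sup>2 + (t n - s n)\<^sup>2 \<le> ek n * (2 * M0 - Q (t n) (x n) (y n) - peak + ek n)" for n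
  proof -
    have "((t n - t' n)\<^sup>2 + (s n - s' n)\<^sup>2 + (t n - s n)\<^sup>2) / ek n \<le> 2 * M0 - Q (t n) (x n) (y n) - peak + ek n"
      using ge[of n] Ux[of n] by (simp add: add_divide_distrib)
    then show ?thesis using ek(1)[of n] by (simp add: pos_divide_le_eq mult.commute)
  qed
  have lim0: "(\<lambda>n. ek n * (2 * M0 - Q (t n) (x n) (y n) - peak + ek n)) \<longlonglongrightarrow> 0 * (2 * M0 - Q tl xl yl - peak + 0)"
    by (intro tendsto_intros ek Qlim)
  have "(\<lambda>n. (t n - t' n)\<^sup>2 + (s n - s' n)\<^sup>2 + (t n - s n)\<^sup>2) \<longlonglongrightarrow> (tl - tl')\<^sup>2 + (sl - sl')\<^sup>2 + (tl - sl)\<^sup>2"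
    by (intro tendsto_intros lims)
  then have "(tl - tl')\<^sup>2 + (sl - sl')\<^sup>2 + (tl - sl)\<^sup>2 \<le> 0 * (2 * M0 - Q tl xl yl - peak + 0)"
    by (rule LIMSEQ_le[OF _ lim0]) (use pen in auto)
  then have "(tl - tl')\<^sup>2 = 0 \<and> (sl - sl')\<^sup>2 = 0 \<and> (tl - sl)\<^sup>2 = 0"
    using zero_le_power2[of "tl - tl'"] zero_le_power2[of "sl - sl'"] zero_le_power2[of "tl - sl"] by linarith
  then have same: "tl' = tl" "sl' = tl" "sl = tl" by auto
  have usc1: "eventually (\<lambda>n. A.U (t' n) (x n) < e) sequentially" if "A.U tl xl < e" for e
  proof -
    have "A.rad < r - r0" using r0 by simp
    from A.U_usc[OF near_ball(1)[OF lbox(4)] this, of tl e] lbox(2) same that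
    obtain d where d: "0 < d" "\<And>t' x. t' \<in> {0..T} \<Longrightarrow> \<bar>t' - tl\<bar> < d \<Longrightarrow> norm (x - xl) < d \<Longrightarrow> A.U t' x < e" by auto
    show ?thesis
      using tendstoD[OF lims(3) d(1)] tendstoD[OF lims(5) d(1)]
      by eventually_elim (use d(2) inbox same in \<open>auto simp: dist_norm\<close>)
  qed
  have usc2: "eventually (\<lambda>n. B.U (s' n) (y n) < e) sequentially" if "B.U tl yl < e" for e
  proof -
    have "B.rad < r - r0" using r0 rad_eq by simp
    from B.U_usc[OF near_ball'(1)[OF lbox(5)] this, of tl e] lbox(2) same that
    obtain d where d: "0 < d" "\<And>t' x. t' \<in> {0..T} \<Longrightarrow> \<bar>t' - tl\<bar> < d \<Longrightarrow> norm (x - yl) < d \<Longrightarrow> B.U t' x < e" by auto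
    show ?thesis
      using tendstoD[OF lims(4) d(1)] tendstoD[OF lims(6) d(1)]
      by eventually_elim (use d(2) inbox same in \<open>auto simp: dist_norm\<close>)
  qed
  have ge': "peak - ek n \<le> A.U (t' n) (x n) + B.U (s' n) (y n) - Q (t n) (x n) (y n)" for n
  proof -
    have "0 \<le> (t n - t' n)\<^sup>2 / ek n" "0 \<le> (s n - s' n)\<^sup>2 / ek n" "0 \<le> (t n - s n)\<^sup>2 / ek n"
      using ek(1)[of n] by auto
    then show ?thesis using ge[of n] by linarith
  qed
  have "peak \<le> A.U tl xl + B.U tl yl - Q tl xl yl"
  proof (rule field_le_epsilon)
    fix e :: real assume e0: "0 < e"
    have "eventually (\<lambda>n. A.U (t' n) (x n) < A.U tl xl + e / 2) sequentially"
      "eventually (\<lambda>n. B.U (s' n) (y n) < B.U tl yl + e / 2) sequentially"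
      using e0 by (auto intro!: usc1 usc2)
    then have "eventually (\<lambda>n. peak - ek n \<le> A.U tl xl + B.U tl yl + e - Q (t n) (x n) (y n)) sequentially"
    proof eventually_elim
      case (elim n)
      then show ?case using ge'[of n] by simp
    qed
    then have "peak - 0 \<le> A.U tl xl + B.U tl yl + e - Q tl xl yl"
      by (intro tendsto_le[OF _ tendsto_diff[OF tendsto_const Qlim] tendsto_diff[OF tendsto_const ek(2)]]) auto
    then show "peak \<le> A.U tl xl + B.U tl yl - Q tl xl yl + e" by simp
  qed
  moreover have "A.U tl xl + B.U tl yl - Q tl xl yl
      \<le> peak - \<gamma> * ((tl - tb)\<^sup>2 + (norm (xl - xb))\<^sup>2 + (norm (yl - yb))\<^sup>2)"
    unfolding Q_def peak_def using lbox same by (intro strict) auto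
  ultimately have "\<gamma> * ((tl - tb)\<^sup>2 + (norm (xl - xb))\<^sup>2 + (norm (yl - yb))\<^sup>2) \<le> 0" by linarith
  then have "(tl - tb)\<^sup>2 + (norm (xl - xb))\<^sup>2 + (norm (yl - yb))\<^sup>2 \<le> 0" using \<gamma> by (simp add: mult_le_0_iff)
  then have "(tl - tb)\<^sup>2 = 0 \<and> (norm (xl - xb))\<^sup>2 = 0 \<and> (norm (yl - yb))\<^sup>2 = 0"
    using zero_le_power2[of "tl - tb"] zero_le_power2[of "norm (xl - xb)"] zero_le_power2[of "norm (yl - yb)"] by linarith
  then have bar: "tl = tb" "xl = xb" "yl = yb" by auto
  interpret bN: bounded_bilinear N using N(1) by (simp add: bilinear_conv_bounded_bilinear)
  have Q0: "Q tb xb yb = 0" by (simp add: Q_def bN.zero_left flip: zero_prod_def)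
  have "eventually (\<lambda>n. ek n < \<delta> / 4) sequentially" using ek(2) \<delta> by (intro order_tendstoD(2)) auto
  moreover have "eventually (\<lambda>n. - (\<delta> / 4) < Q (t n) (x n) (y n)) sequentially"
    using Qlim \<delta> unfolding bar Q0 by (intro order_tendstoD(1)) auto
  moreover have "eventually (\<lambda>n. A.U (t' n) (x n) < A.U tb xb + \<delta> / 4) sequentially"
      "eventually (\<lambda>n. B.U (s' n) (y n) < B.U tb yb + \<delta> / 4) sequentially"
    using \<delta> usc1 usc2 unfolding bar by auto
  moreover note tendstoD[OF lims(1) \<delta>] tendstoD[OF lims(2) \<delta>] tendstoD[OF lims(3) \<delta>]
    tendstoD[OF lims(4) \<delta>] tendstoD[OF lims(5) \<delta>] tendstoD[OF lims(6) \<delta>]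
  ultimately have "eventually (\<lambda>n. close (w (k n))) sequentially"
  proof eventually_elim
    case (elim n)
    have "A.U tb xb - \<delta> < A.U (t' n) (x n)" "B.U tb yb - \<delta> < B.U (s' n) (y n)"
      using ge'[of n] elim(1-4) \<delta> unfolding peak_def by linarith+
    moreover have "A.U (t' n) (x n) < A.U tb xb + \<delta>" "B.U (s' n) (y n) < B.U tb yb + \<delta>"
      using elim(3,4) \<delta> by linarith+
    ultimately have "\<bar>A.U (t' n) (x n) - A.U tb xb\<bar> < \<delta>" "\<bar>B.U (s' n) (y n) - B.U tb yb\<bar> < \<delta>"
      by (auto simp: abs_less_iff)
    then show ?case
      using elim(5-10) unfolding close_def defs case_prod_unfold by (simp add: bar same dist_norm)
  qed
  then show False using w(2) by (auto dest: eventually_happens)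
qed

end

section \<open>Transfer of touching paraboloids to the original function\<close>

text \<open>This puts an abstract quadratic polynomial in time and space into the coordinates in
  which \<open>touch_test_quadratic\<close> expects a touching polynomial.\<close>

lemma quadratic_time_space_split:
  fixes \<mu> :: "real \<times> (real^'n) \<Rightarrow> real" and \<beta> :: "real \<times> (real^'n) \<Rightarrow> real \<times> (real^'n) \<Rightarrow> real"
  assumes \<mu>: "linear \<mu>" and \<beta>: "bilinear \<beta>" "\<And>y z. \<beta> y z = \<beta> z y"
  obtains m p and X :: "real^'n^'n" where "transpose X = X" "\<And>\<xi>. p \<bullet> \<xi> = \<mu> (0, \<xi>)"
    "\<And>\<xi>. \<xi> \<bullet> (X *v \<xi>) = \<beta> (0, \<xi>) (0, \<xi>)"
    "\<And>\<theta> \<xi>. \<mu> (\<theta>, \<xi>) + \<beta> (\<theta>, \<xi>) (\<theta>, \<xi>) / 2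
      = \<mu> (1, 0) * \<theta> + \<beta> (1, 0) (1, 0) / 2 * \<theta>\<^sup>2 + (\<theta> *\<^sub>R m + p) \<bullet> \<xi> + \<xi> \<bullet> (X *v \<xi>) / 2"
proof -
  interpret b: bounded_bilinear \<beta> using \<beta>(1) by (simp add: bilinear_conv_bounded_bilinear)
  have pair: "(\<theta>, \<xi>) = \<theta> *\<^sub>R (1, 0) + (0, \<xi>)" for \<theta> and \<xi> :: "real^'n" by simp
  have lp: "linear (\<lambda>\<xi>. (0::real, \<xi>))" by (rule linearI) simp_all
  have l0: "linear (\<lambda>\<xi>. \<mu> (0, \<xi>))"
    using linear_compose[OF lp \<mu>] by (simp add: o_def)
  have l1: "linear (\<lambda>\<xi>. \<beta> (1, 0) (0, \<xi>))"
    using linear_compose[OF lp bounded_linear.linear[OF b.bounded_linear_right]] by (simp add: o_def)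
  define p where "p = adjoint (\<lambda>\<xi>. \<mu> (0, \<xi>)) 1"
  define m where "m = adjoint (\<lambda>\<xi>. \<beta> (1, 0) (0, \<xi>)) 1"
  define X :: "real^'n^'n" where "X = (\<chi> i j. \<beta> (0, axis i 1) (0, axis j 1))"
  have p: "p \<bullet> \<xi> = \<mu> (0, \<xi>)" for \<xi>
    using adjoint_works[OF l0, of \<xi> 1] by (simp add: p_def inner_commute)
  have m: "m \<bullet> \<xi> = \<beta> (1, 0) (0, \<xi>)" for \<xi>
    using adjoint_works[OF l1, of \<xi> 1] by (simp add: m_def inner_commute)
  have expand: "(0::real, \<xi>) = (\<Sum>i\<in>UNIV. (\<xi> $ i) *\<^sub>R (0, axis i 1))" for \<xi> :: "real^'n"
  proof -
    have "(\<Sum>i\<in>UNIV. (\<xi> $ i) *\<^sub>R (0::real, axis i (1::real))) = (0, \<Sum>i\<in>UNIV. (\<xi> $ i) *\<^sub>R axis i 1)"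
      by (simp add: prod_eq_iff fst_sum snd_sum)
    then show ?thesis using basis_expansion[of \<xi>] by (simp add: scalar_mult_eq_scaleR)
  qed
  have X: "\<xi> \<bullet> (X *v \<zeta>) = \<beta> (0, \<xi>) (0, \<zeta>)" for \<xi> \<zeta>
  proof -
    have "\<beta> (0, \<xi>) (0, \<zeta>) = (\<Sum>i\<in>UNIV. \<xi> $ i * (\<Sum>j\<in>UNIV. \<zeta> $ j * \<beta> (0, axis i 1) (0, axis j 1)))"
      by (subst expand[of \<xi>], subst expand[of \<zeta>], simp add: b.sum_left b.sum_right b.scaleR_left
          b.scaleR_right sum_distrib_left mult_ac del: scaleR_Pair, rule sum.swap)
    then show ?thesis by (simp add: X_def inner_vec_def matrix_vector_mult_def mult.commute)
  qed
  have "transpose X = X" by (simp add: X_def transpose_def \<beta>(2))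
  moreover have "\<mu> (\<theta>, \<xi>) + \<beta> (\<theta>, \<xi>) (\<theta>, \<xi>) / 2
      = \<mu> (1, 0) * \<theta> + \<beta> (1, 0) (1, 0) / 2 * \<theta>\<^sup>2 + (\<theta> *\<^sub>R m + p) \<bullet> \<xi> + \<xi> \<bullet> (X *v \<xi>) / 2" for \<theta> \<xi>
  proof -
    have "\<mu> (\<theta>, \<xi>) = \<theta> * \<mu> (1, 0) + \<mu> (0, \<xi>)"
      by (subst pair) (simp only: linear_add[OF \<mu>] linear_scale[OF \<mu>] real_scaleR_def)
    moreover have "\<beta> (\<theta>, \<xi>) (\<theta>, \<xi>) = \<theta>\<^sup>2 * \<beta> (1, 0) (1, 0) + 2 * \<theta> * \<beta> (1, 0) (0, \<xi>) + \<beta> (0, \<xi>) (0, \<xi>)"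
      unfolding pair[of \<theta> \<xi>] b.add_left b.add_right b.scaleR_left b.scaleR_right
      by (simp add: \<beta>(2)[of "(0, \<xi>)" "(1, 0)"] power2_eq_square algebra_simps)
    ultimately show ?thesis by (simp add: inner_add_left p m X add_divide_distrib power2_eq_square algebra_simps)
  qed
  ultimately show ?thesis using that p X by blast
qed

context sup_conv_data
begin

text \<open>The paraboloid above \<open>h\<close> at \<open>z1\<close> is first freed from the
  squares that made \<open>hat\<close> convex and then moved by \<open>hat_shift\<close> to the
  point \<open>(t', x')\<close> where \<open>hat\<close> is attained. The last conclusion is
  \<open>hat_shift\<close> for a pure shift back in time; it compares increments far outside the
  touching ball.\<close>

lemma touching_transfer:
  fixes b :: "real \<times> (real^'n) \<Rightarrow> real \<times> (real^'n) \<Rightarrow> real"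
  assumes \<kappa>: "0 < \<kappa>" and r: "0 < r" and z1: "dist zs z1 < r / 2" and \<Omega>1: "cball (snd z1) rad \<subseteq> \<Omega>"
    and \<mu>: "linear \<mu>" and b: "bilinear b" "\<And>y z. b y z = b z y"
    and h: "\<And>z. h z = hat \<kappa> z + inverse \<epsilon> * (norm (snd z - snd zc))\<^sup>2 + (fst z - fst zc)\<^sup>2 / \<kappa>"
    and touch: "\<And>y. y \<in> ball zs r \<Longrightarrow> h y \<le> h z1 + \<mu> (y - z1) + b (y - z1) (y - z1) / 2 + 8 * \<eta> * (norm (y - z1))\<^sup>2"
  obtains t' x' m p and X :: "real^'n^'n" where "t' \<in> {0..T}" "x' \<in> cball (snd z1) rad"
    "U t' (snd z1) = u t' x' - inverse \<epsilon> * (norm (snd z1 - x'))\<^sup>2"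
    "hat \<kappa> z1 = U t' (snd z1) - (fst z1 - t')\<^sup>2 / \<kappa>"
    "transpose X = X" "\<And>\<xi>. - (2 * inverse \<epsilon>) * (norm \<xi>)\<^sup>2 \<le> \<xi> \<bullet> (X *v \<xi>)"
    "\<And>\<xi>. \<xi> \<bullet> (X *v \<xi>) = b (0, \<xi>) (0, \<xi>) + 16 * \<eta> * (norm \<xi>)\<^sup>2 - 2 * inverse \<epsilon> * (norm \<xi>)\<^sup>2"
    "\<And>\<xi>. p \<bullet> \<xi> = \<mu> (0, \<xi>) - 2 * inverse \<epsilon> * ((snd z1 - snd zc) \<bullet> \<xi>)"
    "\<And>s y. s \<in> {0..T} \<Longrightarrow> y \<in> \<Omega> \<Longrightarrow> \<bar>s - t'\<bar> < r / 4 \<Longrightarrow> norm (y - x') < r / 4 \<Longrightarrow>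
      u s y \<le> u t' x' + (\<mu> (1, 0) - 2 / \<kappa> * (fst z1 - fst zc)) * (s - t')
        + (b (1, 0) (1, 0) / 2 + 8 * \<eta> - 1 / \<kappa>) * (s - t')\<^sup>2
        + ((s - t') *\<^sub>R m + p) \<bullet> (y - x') + (y - x') \<bullet> (X *v (y - x')) / 2"
    "\<And>\<tau>. t' - \<tau> \<in> {0..T} \<Longrightarrow> hat \<kappa> z1 - hat \<kappa> (z1 - \<tau> *\<^sub>R (1, 0)) \<le> u t' x' - u (t' - \<tau>) x'"
proof -
  interpret bb: bounded_bilinear b using b(1) by (simp add: bilinear_conv_bounded_bilinear)
  define B where "B y z = 2 * inverse \<epsilon> * (snd y \<bullet> snd z) + 2 / \<kappa> * (fst y * fst z)" for y z :: "real \<times> (real^'n)"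
  define \<beta> where "\<beta> y z = b y z + 16 * \<eta> * (y \<bullet> z) - B y z" for y z
  define \<nu> where "\<nu> y = \<mu> y - B (z1 - zc) y" for y
  have lin\<nu>: "linear \<nu>"
    unfolding \<nu>_def B_def
    by (rule linearI) (simp_all add: linear_add[OF \<mu>] linear_scale[OF \<mu>] inner_add_right algebra_simps)
  have sym: "\<beta> y z = \<beta> z y" for y z by (simp add: \<beta>_def B_def b(2)[of y z] inner_commute)
  have lin\<beta>: "linear (\<lambda>z. \<beta> y z)" for y
    unfolding \<beta>_def B_def
    by (rule linearI) (simp_all add: bb.add_right bb.scaleR_right inner_add_right algebra_simps add_divide_distrib)
  have "(\<lambda>y. \<beta> y z) = (\<lambda>y. \<beta> z y)" for z by (simp add: sym[of _ z])
  then have bil: "bilinear \<beta>" unfolding bilinear_def using lin\<beta> by simp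
  obtain m p and X :: "real^'n^'n" where X: "transpose X = X" and p: "\<And>\<xi>. p \<bullet> \<xi> = \<nu> (0, \<xi>)"
    and Xq: "\<And>\<xi>. \<xi> \<bullet> (X *v \<xi>) = \<beta> (0, \<xi>) (0, \<xi>)"
    and q: "\<And>\<theta> \<xi>. \<nu> (\<theta>, \<xi>) + \<beta> (\<theta>, \<xi>) (\<theta>, \<xi>) / 2
      = \<nu> (1, 0) * \<theta> + \<beta> (1, 0) (1, 0) / 2 * \<theta>\<^sup>2 + (\<theta> *\<^sub>R m + p) \<bullet> \<xi> + \<xi> \<bullet> (X *v \<xi>) / 2"
    by (rule quadratic_time_space_split[OF lin\<nu> bil sym]) (rule that)
  have inball: "z1 + v \<in> ball zs r" if "norm v < r / 2" for v
  proof -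
    have "dist zs (z1 + v) \<le> dist zs z1 + norm v" using dist_triangle[of zs "z1 + v" z1] by (simp add: dist_norm)
    then show ?thesis using z1 that by simp
  qed
  have hat_touch: "hat \<kappa> (z1 + v) \<le> hat \<kappa> z1 + \<nu> v + \<beta> v v / 2" if "norm v < r / 2" for v
  proof -
    define g where "g = z1 - zc"
    have hB: "h z = hat \<kappa> z + B (z - zc) (z - zc) / 2" for z
      unfolding h B_def by (simp add: power2_norm_eq_inner power2_eq_square[of "fst z - fst zc"] add_divide_distrib)
    have "B (g + v) (g + v) = B g g + 2 * B g v + B v v"
      unfolding B_def by (simp add: inner_add_left inner_add_right inner_commute algebra_simps)
    moreover have "z1 + v - zc = g + v" by (simp add: g_def)
    ultimately have "h (z1 + v) = hat \<kappa> (z1 + v) + (B g g + 2 * B g v + B v v) / 2" unfolding hB by (simp only:)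
    moreover have "h z1 = hat \<kappa> z1 + B g g / 2" unfolding hB g_def ..
    moreover have "h (z1 + v) \<le> h z1 + \<mu> v + b v v / 2 + 8 * \<eta> * (norm v)\<^sup>2" using touch[OF inball[OF that]] by simp
    ultimately show ?thesis
      unfolding \<nu>_def \<beta>_def g_def[symmetric] by (simp add: power2_norm_eq_inner field_simps)
  qed
  \<comment> \<open>Second differences of the convex \<open>h\<close> at \<open>z1\<close> are
    nonnegative and, by touching, at most this form; rescaling to length \<open>r / 4\<close> keeps
    both points in the ball. Subtracting the convexifying square is then what leaves the lower bound
    \<open>- 2 / \<epsilon>\<close> for the matrices.\<close>
  have b_lower: "0 \<le> b v v + 16 * \<eta> * (norm v)\<^sup>2" for v
  proof (cases "v = 0")
    case False
    define w where "w = (r / (4 * norm v)) *\<^sub>R v"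
    have nw: "norm w < r / 2" using False r by (simp add: w_def)
    have "0 \<le> second_diff h w z1"
      using convex_second_diff_nonneg[OF hat_convex[OF \<kappa>, of zc]] unfolding h[abs_def] .
    also have "\<dots> \<le> b w w + 16 * \<eta> * (norm w)\<^sup>2"
      using touch[OF inball[OF nw]] touch[OF inball[of "- w"]] nw
      by (simp add: second_diff_def linear_neg[OF \<mu>] bb.minus_left bb.minus_right)
    also have "\<dots> = (r / (4 * norm v))\<^sup>2 * (b v v + 16 * \<eta> * (norm v)\<^sup>2)"
      unfolding w_def bb.scaleR_left bb.scaleR_right norm_scaleR power_mult_distrib power2_abs
      by (simp add: power2_eq_square algebra_simps)
    finally have le: "0 \<le> (r / (4 * norm v))\<^sup>2 * (b v v + 16 * \<eta> * (norm v)\<^sup>2)" .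
    have "0 < (r / (4 * norm v))\<^sup>2" using False r by simp
    then show ?thesis using le by (simp only: zero_le_mult_iff) linarith
  qed (simp add: bb.zero_left)
  obtain t' x' where tx: "t' \<in> {0..T}" "x' \<in> cball (snd z1) rad"
    and hat: "hat \<kappa> (fst z1, snd z1) = u t' x' - inverse \<epsilon> * (norm (snd z1 - x'))\<^sup>2 - (fst z1 - t')\<^sup>2 / \<kappa>"
    and U: "U t' (snd z1) = u t' x' - inverse \<epsilon> * (norm (snd z1 - x'))\<^sup>2"
    by (rule hat_attained[OF \<kappa> \<Omega>1])
  have x'\<Omega>: "x' \<in> \<Omega>" using tx(2) \<Omega>1 by blast
  show ?thesis
  proof (rule that[OF tx U])
    show "hat \<kappa> z1 = U t' (snd z1) - (fst z1 - t')\<^sup>2 / \<kappa>" using hat U by simp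
    show "transpose X = X" by (rule X)
    show Xb: "\<xi> \<bullet> (X *v \<xi>) = b (0, \<xi>) (0, \<xi>) + 16 * \<eta> * (norm \<xi>)\<^sup>2 - 2 * inverse \<epsilon> * (norm \<xi>)\<^sup>2" for \<xi>
      unfolding Xq \<beta>_def B_def by (simp add: power2_norm_eq_inner)
    show "- (2 * inverse \<epsilon>) * (norm \<xi>)\<^sup>2 \<le> \<xi> \<bullet> (X *v \<xi>)" for \<xi>
      unfolding Xb using b_lower[of "(0, \<xi>)"] by simp
    show "p \<bullet> \<xi> = \<mu> (0, \<xi>) - 2 * inverse \<epsilon> * ((snd z1 - snd zc) \<bullet> \<xi>)" for \<xi>
      unfolding p \<nu>_def B_def by simp
    show "hat \<kappa> z1 - hat \<kappa> (z1 - \<tau> *\<^sub>R (1, 0)) \<le> u t' x' - u (t' - \<tau>) x'" if "t' - \<tau> \<in> {0..T}" for \<tau>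
    proof -
      have "u (t' + (- \<tau>)) (x' + 0) - u t' x' \<le> hat \<kappa> (fst z1 + (- \<tau>), snd z1 + 0) - hat \<kappa> (fst z1, snd z1)"
        by (rule hat_shift[OF \<kappa> hat]) (use that x'\<Omega> in auto)
      moreover have "z1 - \<tau> *\<^sub>R (1, 0) = (fst z1 + (- \<tau>), snd z1 + 0)" by (simp add: prod_eq_iff)
      ultimately show ?thesis by simp
    qed
    fix s y assume s: "s \<in> {0..T}" and y: "y \<in> \<Omega>" and near: "\<bar>s - t'\<bar> < r / 4" "norm (y - x') < r / 4"
    define v where "v = (s - t', y - x')"
    have "norm v \<le> \<bar>s - t'\<bar> + norm (y - x')" unfolding v_def using norm_Pair_le[of "s - t'" "y - x'"] by simp
    then have nv: "norm v < r / 2" using near by simp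
    have "u (t' + (s - t')) (x' + (y - x')) - u t' x' \<le> hat \<kappa> (fst z1 + (s - t'), snd z1 + (y - x')) - hat \<kappa> (fst z1, snd z1)"
      by (rule hat_shift[OF \<kappa> hat]) (use s y in auto)
    moreover have "(fst z1 + (s - t'), snd z1 + (y - x')) = z1 + v" by (simp add: v_def prod_eq_iff)
    ultimately have "u s y - u t' x' \<le> \<nu> v + \<beta> v v / 2" using hat_touch[OF nv] by simp
    moreover have "\<nu> (1, 0) = \<mu> (1, 0) - 2 / \<kappa> * (fst z1 - fst zc)" by (simp add: \<nu>_def B_def)
    moreover have "\<beta> (1, 0) (1, 0) / 2 = b (1, 0) (1, 0) / 2 + 8 * \<eta> - 1 / \<kappa>"
      by (simp add: \<beta>_def B_def add_divide_distrib diff_divide_distrib)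
    ultimately show "u s y \<le> u t' x' + (\<mu> (1, 0) - 2 / \<kappa> * (fst z1 - fst zc)) * (s - t')
        + (b (1, 0) (1, 0) / 2 + 8 * \<eta> - 1 / \<kappa>) * (s - t')\<^sup>2
        + ((s - t') *\<^sub>R m + p) \<bullet> (y - x') + (y - x') \<bullet> (X *v (y - x')) / 2"
      unfolding v_def q by simp
  qed
qed

end

lemma norm_le_of_inner_le:
  fixes v :: "'a::real_inner"
  assumes "\<And>\<xi>. v \<bullet> \<xi> \<le> k * norm \<xi>" "0 \<le> k"
  shows "norm v \<le> k"
  using assms(1)[of v] assms(2) by (cases "v = 0") (auto simp: dot_square_norm power2_eq_square)

text \<open>The quantity is \<open>L * r powr (1 - \<alpha>)\<close>, a positive power of
  \<open>r\<close>. It measures the integrated error of the increments.\<close>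

lemma small_powr_exists:
  fixes L \<delta> \<alpha> :: real
  assumes "0 \<le> L" "0 < \<delta>" "\<alpha> < 1"
  obtains r0 where "0 < r0" "\<And>r. 0 < r \<Longrightarrow> r < r0 \<Longrightarrow> L * r * r powr (- \<alpha>) \<le> \<delta>"
proof
  let ?r0 = "(\<delta> / (L + 1)) powr (1 / (1 - \<alpha>))"
  show "0 < ?r0" using assms by simp
  fix r :: real assume r: "0 < r" "r < ?r0"
  have "r powr (1 - \<alpha>) \<le> ?r0 powr (1 - \<alpha>)" using r assms by (intro powr_mono2) auto
  also have "\<dots> = \<delta> / (L + 1)" using assms by (simp add: powr_powr)
  finally have "L * r powr (1 - \<alpha>) \<le> L * (\<delta> / (L + 1))" using assms by (intro mult_left_mono) auto
  also have "\<dots> \<le> \<delta>" using assms by (simp add: divide_le_eq algebra_simps)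
  finally have "L * r powr (1 - \<alpha>) \<le> \<delta>" .
  moreover have "r * r powr (- \<alpha>) = r powr (1 - \<alpha>)" using r by (simp add: powr_diff powr_minus_divide)
  ultimately show "L * r * r powr (- \<alpha>) \<le> \<delta>" by (simp add: mult.assoc)
qed

context doubled_data
begin

text \<open>\<open>(t', x')\<close> and \<open>(s', y')\<close> are the contact points of \<open>u1\<close> and \<open>u2\<close> in a step of
  fineness \<open>\<delta>\<close>. The function \<open>d\<close> is the sum of the backward time increments of the two test functions.
  They equal those of \<open>u1\<close> and \<open>u2\<close> for \<open>\<tau> \<ge> \<delta>\<close>, and the maximality bounds them below up to an error of size \<open>E\<close>
  on \<open>\<tau> > \<rho>\<close>.\<close>

definition "step_data \<alpha> G1 G2 C K \<delta> t' s' x y x' y' p1 p2 X1 X2 d \<rho> E \<longleftrightarrow>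
  t' \<in> {0<..T} \<and> s' \<in> {0<..T} \<and> \<bar>t' - tb\<bar> < \<delta> \<and> \<bar>s' - tb\<bar> < \<delta> \<and> norm (x - xb) < \<delta> \<and> norm (y - yb) < \<delta> \<and>
  x' \<in> cball x A.rad \<and> y' \<in> cball y A.rad \<and>
  A.U t' x = u1 t' x' - inverse \<epsilon> * (norm (x - x'))\<^sup>2 \<and> B.U s' y = u2 s' y' - inverse \<epsilon> * (norm (y - y'))\<^sup>2 \<and>
  \<bar>A.U t' x - A.U tb xb\<bar> < \<delta> \<and> \<bar>B.U s' y - B.U tb yb\<bar> < \<delta> \<and>
  transpose X1 = X1 \<and> transpose X2 = X2 \<and>
  (\<forall>\<xi>. - (2 * inverse \<epsilon>) * (norm \<xi>)\<^sup>2 \<le> \<xi> \<bullet> (X1 *v \<xi>)) \<and>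
  (\<forall>\<xi>. - (2 * inverse \<epsilon>) * (norm \<xi>)\<^sup>2 \<le> \<xi> \<bullet> (X2 *v \<xi>)) \<and>
  (\<forall>\<xi> \<zeta>. \<xi> \<bullet> (X1 *v \<xi>) + \<zeta> \<bullet> (X2 *v \<zeta>) \<le> N (\<xi>, \<zeta>) (\<xi>, \<zeta>) + 16 * \<delta> * ((norm \<xi>)\<^sup>2 + (norm \<zeta>)\<^sup>2)) \<and>
  norm (p1 - P1) \<le> K * \<delta> \<and> norm (p2 - P2) \<le> K * \<delta> \<and>
  set_integrable lborel {0<..} (\<lambda>\<tau>. d \<tau> / \<tau> powr (\<alpha> + 1)) \<and>
  \<alpha> / Gamma (1 - \<alpha>) * (LINT \<tau>:{0<..}|lborel. d \<tau> / \<tau> powr (\<alpha> + 1))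
    + G1 t' x' (u1 t' x') p1 X1 + G2 s' y' (u2 s' y') p2 X2 \<le> 0 \<and>
  0 \<le> E \<and> 0 < \<rho> \<and> E * \<rho> powr (- \<alpha>) \<le> \<delta> \<and>
  (\<forall>\<tau>>0. - (C * min \<tau> 1) - E * indicator {\<rho><..} \<tau> \<le> d \<tau>) \<and>
  (\<forall>\<tau>\<ge>\<delta>. d \<tau> = (u1 t' x' - u1 (max (t' - \<tau>) 0) x') + (u2 s' y' - u2 (max (s' - \<tau>) 0) y'))"

text \<open>\<open>C\<close> and \<open>K\<close> are independent of \<open>\<delta>\<close> and of
  the penalty parameter chosen from it, as the passage to the limit requires. In \<open>C\<close>,
  the last term turns the crude bound \<open>- 4 * M0\<close>, used for
  \<open>\<tau> > R / 4\<close>, into a multiple of \<open>min \<tau> 1\<close>; the others dominate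
  the sums of the time slopes and curvatures. In \<open>K\<close>, the part \<open>2 * CN\<close>
  stems from displacing the spatial point by at most \<open>2 * \<delta>\<close> inside
  \<open>N\<close>, and 4 counts the remaining errors of size \<open>\<delta>\<close>.\<close>

lemma step_exists:
  assumes \<alpha>: "0 < \<alpha>" "\<alpha> < 1"
    and CN: "0 \<le> CN" "\<And>w z. \<bar>N w z\<bar> \<le> CN * (norm w * norm z)"
    and R: "R = min (min r0 1) tb" and \<delta>: "0 < \<delta>" "\<delta> \<le> R / 16"
    and C: "C = \<bar>a\<bar> + 3 * \<bar>c\<bar> + 23 + 16 * M0 / R" and K: "K = 2 * CN + 4"
    and test1: "touch_test \<alpha> T \<Omega> G1 u1" and test2: "touch_test \<alpha> T \<Omega> G2 u2"
  shows "\<exists>t' s' x y x' y' p1 p2 X1 X2 d \<rho> E.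
    step_data \<alpha> G1 G2 C K \<delta> t' s' x y x' y' p1 p2 X1 X2 d \<rho> E"
proof -
  obtain \<kappa> \<eta>0 where \<kappa>: "0 < \<kappa>" and \<eta>0: "0 < \<eta>0" and loc0:
    "\<And>t s t' s' x y. t' \<in> {0..T} \<Longrightarrow> s' \<in> {0..T} \<Longrightarrow> \<bar>t - tb\<bar> \<le> r0 \<Longrightarrow> \<bar>s - tb\<bar> \<le> r0 \<Longrightarrow>
      norm (x - xb) \<le> r0 \<Longrightarrow> norm (y - yb) \<le> r0 \<Longrightarrow>
      peak - \<eta>0 \<le> A.U t' x - (t - t')\<^sup>2 / \<kappa> + (B.U s' y - (s - s')\<^sup>2 / \<kappa>) - Q t x y - (t - s)\<^sup>2 / \<kappa> \<Longrightarrow>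
      \<bar>t - tb\<bar> < \<delta> \<and> \<bar>s - tb\<bar> < \<delta> \<and> \<bar>t' - tb\<bar> < \<delta> \<and> \<bar>s' - tb\<bar> < \<delta> \<and> norm (x - xb) < \<delta> \<and> norm (y - yb) < \<delta>
      \<and> \<bar>A.U t' x - A.U tb xb\<bar> < \<delta> \<and> \<bar>B.U s' y - B.U tb yb\<bar> < \<delta>"
    using near_maximisers_close[OF \<delta>(1)] by blast
  interpret bN: bounded_bilinear N using N(1) by (simp add: bilinear_conv_bounded_bilinear)
  have R0: "0 < R" "R \<le> 1" "R \<le> r0" "R \<le> tb" using r0 tb by (auto simp: R)

  \<comment> \<open>The penalised maximum problem in doubled variables\<close>
  define i where "i = inverse \<epsilon>"
  have i0: "0 < i" using A.eps by (simp add: i_def)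
  define zb where "zb = ((tb, xb), (tb, yb))"
  \<comment> \<open>\<open>Bq z z / 2\<close> is the sum of the squares that make the hats convex.
    They enter both \<open>h1\<close>, \<open>h2\<close> and \<open>\<Theta>\<close>, so
    \<open>h1 + h2 - \<Theta>\<close> is the penalised function \<open>W\<close>. There
    \<open>Q\<close> takes its time from the first group, and the penalty ties the second time to
    it.\<close>
  define Bq where "Bq z w = 2 * i * (snd z \<bullet> snd w) + 2 / \<kappa> * (fst z * fst w)" for z w :: "real \<times> (real^'n)"
  define S where "S z w = 2 * c * (fst (fst z) * fst (fst w))
      + N (snd (fst z), snd (snd z)) (snd (fst w), snd (snd w))
      + 2 / \<kappa> * ((fst (fst z) - fst (snd z)) * (fst (fst w) - fst (snd w)))
      + Bq (fst z) (fst w) + Bq (snd z) (snd w)" for z w :: "(real \<times> (real^'n)) \<times> (real \<times> (real^'n))"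
  define l where "l = ((a, P1), (0::real, P2))"
  define \<Theta> where "\<Theta> z = l \<bullet> (z - zb) + S (z - zb) (z - zb) / 2" for z
  define h1 where "h1 z = A.hat \<kappa> z + inverse \<epsilon> * (norm (snd z - snd (fst zb)))\<^sup>2 + (fst z - fst (fst zb))\<^sup>2 / \<kappa>" for z
  define h2 where "h2 z = B.hat \<kappa> z + inverse \<epsilon> * (norm (snd z - snd (snd zb)))\<^sup>2 + (fst z - fst (snd zb))\<^sup>2 / \<kappa>" for z
  define W where "W z = A.hat \<kappa> (fst z) + B.hat \<kappa> (snd z) - Q (fst (fst z)) (snd (fst z)) (snd (snd z))
      - (fst (fst z) - fst (snd z))\<^sup>2 / \<kappa>" for z
  have Ssym: "S z w = S w z" for z w
    unfolding S_def Bq_def by (simp add: N(2)[of "(snd (fst z), snd (snd z))"] inner_commute mult.commute)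
  have linS: "linear (\<lambda>w. S z w)" for z
  proof -
    have "linear (\<lambda>w :: (real \<times> (real^'n)) \<times> (real \<times> (real^'n)). N v (snd (fst w), snd (snd w)))"
      for v :: "(real^'n) \<times> (real^'n)"
    proof -
      have "linear (\<lambda>w :: (real \<times> (real^'n)) \<times> (real \<times> (real^'n)). (snd (fst w), snd (snd w)))"
        by (rule linearI) simp_all
      from linear_compose[OF this bounded_linear.linear[OF bN.bounded_linear_right[of v]]]
      show ?thesis by (simp add: o_def)
    qed
    from linear_add[OF this] linear_scale[OF this] show ?thesis
      unfolding S_def Bq_def
      by (intro linearI) (simp_all add: inner_add_right algebra_simps add_divide_distrib diff_divide_distrib)
  qed
  have "(\<lambda>z. S z w) = (\<lambda>z. S w z)" for w by (simp add: Ssym[of _ w])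
  then have bilS: "bilinear S" unfolding bilinear_def using linS by simp
  have hW: "h1 (fst z) + h2 (snd z) - \<Theta> z = W z" for z
  proof -
    obtain t x s y where z: "z = ((t, x), (s, y))" by (metis prod.collapse)
    have n: "(norm (x - xb))\<^sup>2 = (x - xb) \<bullet> (x - xb)" "(norm (y - yb))\<^sup>2 = (y - yb) \<bullet> (y - yb)"
      by (simp_all only: power2_norm_eq_inner)
    have m: "t - tb - (s - tb) = t - s" by simp
    show ?thesis
      unfolding h1_def h2_def \<Theta>_def W_def l_def zb_def S_def Bq_def Q_def i_def z
      by (simp add: n m power2_eq_square[of "t - tb"] power2_eq_square[of "s - tb"] power2_eq_square[of "t - s"]
          add_divide_distrib del: real_inner_1_right)
  qed
  have pw: "\<bar>fst (fst z) - tb\<bar> \<le> dist zb z" "norm (snd (fst z) - xb) \<le> dist zb z"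
      "\<bar>fst (snd z) - tb\<bar> \<le> dist zb z" "norm (snd (snd z) - yb) \<le> dist zb z" for z
    using dist_fst_le[of zb z] dist_snd_le[of zb z] dist_fst_le[of "fst zb" "fst z"] dist_snd_le[of "fst zb" "fst z"]
      dist_fst_le[of "snd zb" "snd z"] dist_snd_le[of "snd zb" "snd z"]
    by (auto simp: zb_def dist_norm norm_minus_commute abs_minus_commute)
  have dsum: "dist zb z \<le> \<bar>fst (fst z) - tb\<bar> + norm (snd (fst z) - xb) + (\<bar>fst (snd z) - tb\<bar> + norm (snd (snd z) - yb))" for z
  proof -
    obtain t x s y where z: "z = ((t, x), (s, y))" by (metis prod.collapse)
    have "dist zb z = norm ((t - tb, x - xb), (s - tb, y - yb))"
      by (subst dist_commute) (simp add: z zb_def dist_norm)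
    also have "\<dots> \<le> norm (t - tb, x - xb) + norm (s - tb, y - yb)" by (rule norm_Pair_le)
    also have "norm (t - tb, x - xb) \<le> \<bar>t - tb\<bar> + norm (x - xb)" using norm_Pair_le[of "t - tb" "x - xb"] by simp
    also have "norm (s - tb, y - yb) \<le> \<bar>s - tb\<bar> + norm (y - yb)" using norm_Pair_le[of "s - tb" "y - yb"] by simp
    finally show ?thesis by (simp add: z)
  qed
  have loc: "\<bar>fst (fst z) - tb\<bar> < \<delta> \<and> \<bar>fst (snd z) - tb\<bar> < \<delta> \<and> \<bar>t' - tb\<bar> < \<delta> \<and> \<bar>s' - tb\<bar> < \<delta>
      \<and> norm (snd (fst z) - xb) < \<delta> \<and> norm (snd (snd z) - yb) < \<delta>
      \<and> \<bar>A.U t' (snd (fst z)) - A.U tb xb\<bar> < \<delta> \<and> \<bar>B.U s' (snd (snd z)) - B.U tb yb\<bar> < \<delta>"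
    if z: "dist zb z \<le> R" "peak - \<eta>0 \<le> W z" and t': "t' \<in> {0..T}" "s' \<in> {0..T}"
      and hat: "A.hat \<kappa> (fst z) = A.U t' (snd (fst z)) - (fst (fst z) - t')\<^sup>2 / \<kappa>"
      "B.hat \<kappa> (snd z) = B.U s' (snd (snd z)) - (fst (snd z) - s')\<^sup>2 / \<kappa>" for z t' s'
    by (rule loc0[OF t']) (use pw[of z] z R0 hat in \<open>auto simp: W_def\<close>)
  have att: "\<exists>t' s'. t' \<in> {0..T} \<and> s' \<in> {0..T} \<and> A.hat \<kappa> (fst z) = A.U t' (snd (fst z)) - (fst (fst z) - t')\<^sup>2 / \<kappa>
      \<and> B.hat \<kappa> (snd z) = B.U s' (snd (snd z)) - (fst (snd z) - s')\<^sup>2 / \<kappa>" if z: "dist zb z \<le> R" for z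
  proof -
    have n: "norm (snd (fst z) - xb) \<le> r0" "norm (snd (snd z) - yb) \<le> r0" using pw[of z] z R0 by linarith+
    obtain t' x' where "t' \<in> {0..T}" and
      "A.hat \<kappa> (fst (fst z), snd (fst z)) = u1 t' x' - inverse \<epsilon> * (norm (snd (fst z) - x'))\<^sup>2 - (fst (fst z) - t')\<^sup>2 / \<kappa>"
      "A.U t' (snd (fst z)) = u1 t' x' - inverse \<epsilon> * (norm (snd (fst z) - x'))\<^sup>2"
      by (rule A.hat_attained[OF \<kappa> near_ball(2)[OF n(1)]])
    moreover obtain s' y' where "s' \<in> {0..T}" and
      "B.hat \<kappa> (fst (snd z), snd (snd z)) = u2 s' y' - inverse \<epsilon> * (norm (snd (snd z) - y'))\<^sup>2 - (fst (snd z) - s')\<^sup>2 / \<kappa>"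
      "B.U s' (snd (snd z)) = u2 s' y' - inverse \<epsilon> * (norm (snd (snd z) - y'))\<^sup>2"
      by (rule B.hat_attained[OF \<kappa> near_ball'(2)[OF n(2)]])
    ultimately show ?thesis by (intro exI[of _ t'] exI[of _ s']) simp
  qed
  have Wb: "peak \<le> W zb"
    using A.hat_ge_U[OF \<kappa>, of tb xb tb] B.hat_ge_U[OF \<kappa>, of tb yb tb] tb
    by (simp add: W_def zb_def peak_def Q_def bN.zero_left flip: zero_prod_def)
  \<comment> \<open>Near-maximisers are confined by \<open>loc\<close> to distance at most
    \<open>4 * \<delta>\<close>, which is at most \<open>R / 4\<close>, so the sphere of radius
    \<open>R\<close> contains none.\<close>
  have sphere: "h1 (fst z) + h2 (snd z) - \<Theta> z < h1 (fst zb) + h2 (snd zb) - \<Theta> zb" if eqR: "dist zb z = R" for z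
  proof (rule ccontr)
    assume "\<not> ?thesis"
    then have ge: "peak - \<eta>0 \<le> W z" using Wb \<eta>0 unfolding hW by linarith
    obtain t' s' where "t' \<in> {0..T}" "s' \<in> {0..T}" "A.hat \<kappa> (fst z) = A.U t' (snd (fst z)) - (fst (fst z) - t')\<^sup>2 / \<kappa>"
      "B.hat \<kappa> (snd z) = B.U s' (snd (snd z)) - (fst (snd z) - s')\<^sup>2 / \<kappa>" using att[OF eq_refl[OF eqR]] by blast
    from loc[OF eq_refl[OF eqR] ge this] have "dist zb z \<le> 4 * \<delta>" using dsum[of z] by simp
    then show False using that \<delta> R0 by simp
  qed
  \<comment> \<open>As \<open>R \<le> 1\<close>, such a tilt costs at most half of the tolerance
    \<open>\<eta>0\<close> at the contact point. The other half is spent on moving from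
    \<open>zs\<close> to the pair of touching points, by continuity of \<open>W\<close>.\<close>
  define \<eta> where "\<eta> = min \<delta> (\<eta>0 / 2)"
  have \<eta>: "0 < \<eta>" "\<eta> \<le> \<delta>" "\<eta> \<le> \<eta>0 / 2" using \<delta> \<eta>0 by (auto simp: \<eta>_def)
  have conv1: "convex_on UNIV h1" and conv2: "convex_on UNIV h2"
    unfolding h1_def[abs_def] h2_def[abs_def] by (rule A.hat_convex[OF \<kappa>] B.hat_convex[OF \<kappa>])+
  obtain zs q p b1 b2 where zs: "dist zb zs < R" and q: "norm q \<le> \<eta>" and
    top: "\<And>z. z \<in> cball zb R \<Longrightarrow> h1 (fst z) + h2 (snd z) - \<Theta> z + q \<bullet> z \<le> h1 (fst zs) + h2 (snd zs) - \<Theta> zs + q \<bullet> zs"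
    and p: "\<And>y. p \<bullet> y = l \<bullet> y + S (zs - zb) y - q \<bullet> y"
    and b1: "bilinear b1" "\<And>y z. b1 y z = b1 z y" and b2: "bilinear b2" "\<And>y z. b2 y z = b2 z y"
    and bS: "\<And>y. b1 (fst y) (fst y) + b2 (snd y) (snd y) \<le> S y y"
    and touch: "\<And>\<eta>' r0. 0 < \<eta>' \<Longrightarrow> 0 < r0 \<Longrightarrow> \<exists>r z1 z2. 0 < r \<and> r < r0 \<and>
      dist (fst zs) z1 < r / 2 \<and> dist (snd zs) z2 < r / 2 \<and>
      (\<forall>y\<in>ball (fst zs) r. h1 y \<le> h1 z1 + (fst p \<bullet> (y - z1) + b1 (z1 - fst zs) (y - z1)
          + 16 * \<eta>' * ((z1 - fst zs) \<bullet> (y - z1))) + b1 (y - z1) (y - z1) / 2 + 8 * \<eta>' * (norm (y - z1))\<^sup>2) \<and>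
      (\<forall>y\<in>ball (snd zs) r. h2 y \<le> h2 z2 + (snd p \<bullet> (y - z2) + b2 (z2 - snd zs) (y - z2)
          + 16 * \<eta>' * ((z2 - snd zs) \<bullet> (y - z2))) + b2 (y - z2) (y - z2) / 2 + 8 * \<eta>' * (norm (y - z2))\<^sup>2)"
    by (rule contact_touching_split[OF conv1 conv2 bilS Ssym \<Theta>_def R0(1) sphere \<eta>(1)], assumption, rule that, assumption+)
  have topW: "W z + q \<bullet> z \<le> W zs + q \<bullet> zs" if "dist zb z \<le> R" for z
    using top[of z] that unfolding hW by simp
  have Wzs: "peak - \<eta>0 / 2 \<le> W zs"
  proof -
    have "q \<bullet> (zs - zb) \<le> norm q * norm (zs - zb)" by (rule norm_cauchy_schwarz)
    also have "\<dots> \<le> (\<eta>0 / 2) * 1"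
      using q \<eta> zs R0 by (intro mult_mono) (auto simp: dist_norm norm_minus_commute)
    finally show ?thesis using topW[of zb] Wb R0 by (simp add: inner_diff_right)
  qed
  have contW: "continuous_on UNIV W"
  proof -
    have "continuous_on UNIV (\<lambda>z. h1 (fst z) + h2 (snd z) - \<Theta> z)"
    proof -
      interpret bS: bounded_bilinear S using bilS by (simp add: bilinear_conv_bounded_bilinear)
      have ch: "continuous_on UNIV h1" "continuous_on UNIV h2" using conv1 conv2 by (auto intro: convex_on_continuous)
      have "continuous_on UNIV (\<lambda>z :: (real \<times> (real^'n)) \<times> (real \<times> (real^'n)). h1 (fst z))"
        by (rule continuous_on_compose2[OF ch(1) continuous_on_fst[OF continuous_on_id] subset_UNIV])
      moreover have "continuous_on UNIV (\<lambda>z :: (real \<times> (real^'n)) \<times> (real \<times> (real^'n)). h2 (snd z))"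
        by (rule continuous_on_compose2[OF ch(2) continuous_on_snd[OF continuous_on_id] subset_UNIV])
      ultimately show ?thesis unfolding \<Theta>_def
        by (intro continuous_on_add continuous_on_diff bS.continuous_on continuous_on_divide
            continuous_on_inner continuous_on_const continuous_on_id) auto
    qed
    then show ?thesis unfolding hW .
  qed
  obtain rW where rW: "0 < rW" "\<And>z. dist z zs < rW \<Longrightarrow> W zs - \<eta>0 / 2 < W z"
  proof -
    have "isCont W zs" using contW continuous_on_eq_continuous_at open_UNIV by blast
    then have "(W \<longlongrightarrow> W zs) (nhds zs)" by (simp add: isCont_def tendsto_at_iff_tendsto_nhds)
    then have "eventually (\<lambda>z. W zs - \<eta>0 / 2 < W z) (nhds zs)" using \<eta>0 by (intro order_tendstoD(1)) auto
    then show ?thesis using that unfolding eventually_nhds_metric by blast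
  qed

  \<comment> \<open>Choice of the touching radius\<close>
  obtain L1 where L1: "0 \<le> L1" "\<And>z w. norm z \<le> norm (fst zb) + 4 \<Longrightarrow> norm w \<le> norm (fst zb) + 4 \<Longrightarrow> \<bar>A.hat \<kappa> z - A.hat \<kappa> w\<bar> \<le> L1 * norm (z - w)"
    using A.hat_lipschitz[OF \<kappa>, of "norm (fst zb) + 4"] by auto
  obtain L2 where L2: "0 \<le> L2" "\<And>z w. norm z \<le> norm (snd zb) + 4 \<Longrightarrow> norm w \<le> norm (snd zb) + 4 \<Longrightarrow> \<bar>B.hat \<kappa> z - B.hat \<kappa> w\<bar> \<le> L2 * norm (z - w)"
    using B.hat_lipschitz[OF \<kappa>, of "norm (snd zb) + 4"] by auto
  define L where "L = L1 + L2"
  have L0: "0 \<le> L" using L1 L2 by (simp add: L_def)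
  obtain B1 where B1: "\<And>y z. norm (b1 y z) \<le> norm y * norm z * B1" "0 < B1"
    using bounded_bilinear.pos_bounded b1(1) unfolding bilinear_conv_bounded_bilinear by blast
  obtain B2 where B2: "\<And>y z. norm (b2 y z) \<le> norm y * norm z * B2" "0 < B2"
    using bounded_bilinear.pos_bounded b2(1) unfolding bilinear_conv_bounded_bilinear by blast
  \<comment> \<open>The factor 16 pays for using the scale \<open>r / 16\<close> in the error term,
    since \<open>16 powr \<alpha> \<le> 16\<close>.\<close>
  obtain rE where rE: "0 < rE" "\<And>r. 0 < r \<Longrightarrow> r < rE \<Longrightarrow> (16 * L) * r * r powr (- \<alpha>) \<le> \<delta>"
    using small_powr_exists[of "16 * L" \<delta> \<alpha>] L0 \<delta> \<alpha> by auto
  \<comment> \<open>The radius is chosen last, after \<open>\<kappa>\<close>, the Lipschitz constant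
    \<open>L\<close> and the bounds \<open>B1\<close>, \<open>B2\<close> of the forms, none of which
    is controlled as \<open>\<delta> \<rightarrow> 0\<close>. The entries in turn serve the
    localisation, the near-maximality of the touching points, the error of the increments, the
    gradient of the spatial square, the slope of the time square, and the forms \<open>b1\<close>
    and \<open>b2\<close>.\<close>
  define r1 where "r1 = Min {\<delta> / 2, rW, rE, \<delta> / (2 * i), \<delta> * \<kappa> / 2, \<delta> / (B1 + B2)}"
  have r1: "0 < r1" unfolding r1_def using \<delta> rW rE i0 \<kappa> B1 B2 by simp
  obtain r z1 z2 where r: "0 < r" "r < r1" and z1: "dist (fst zs) z1 < r / 2" and z2: "dist (snd zs) z2 < r / 2"
    and touch1: "\<And>y. y\<in>ball (fst zs) r \<Longrightarrow> h1 y \<le> h1 z1 + (fst p \<bullet> (y - z1) + b1 (z1 - fst zs) (y - z1)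
          + 16 * \<delta> * ((z1 - fst zs) \<bullet> (y - z1))) + b1 (y - z1) (y - z1) / 2 + 8 * \<delta> * (norm (y - z1))\<^sup>2"
    and touch2: "\<And>y. y\<in>ball (snd zs) r \<Longrightarrow> h2 y \<le> h2 z2 + (snd p \<bullet> (y - z2) + b2 (z2 - snd zs) (y - z2)
          + 16 * \<delta> * ((z2 - snd zs) \<bullet> (y - z2))) + b2 (y - z2) (y - z2) / 2 + 8 * \<delta> * (norm (y - z2))\<^sup>2"
    using touch[OF \<delta>(1) r1] by blast
  have rb: "r < \<delta> / 2" "r < rW" "r < rE" "r < \<delta> / (2 * i)" "r < \<delta> * \<kappa> / 2" "r < \<delta> / (B1 + B2)"
    using r(2) unfolding r1_def by auto
  define z where "z = (z1, z2)"
  have zzs: "dist z zs < r"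
    using z1 z2 norm_Pair_le[of "z1 - fst zs" "z2 - snd zs"]
    by (cases zs) (simp add: z_def dist_norm norm_minus_commute)
  have Wz: "peak - \<eta>0 \<le> W z" using rW(2)[of z] zzs rb(2) Wzs by simp
  have loczs: "\<bar>fst (fst zs) - tb\<bar> < \<delta> \<and> \<bar>fst (snd zs) - tb\<bar> < \<delta> \<and> norm (snd (fst zs) - xb) < \<delta> \<and> norm (snd (snd zs) - yb) < \<delta>"
  proof -
    have le: "dist zb zs \<le> R" using zs by simp
    obtain t' s' where "t' \<in> {0..T}" "s' \<in> {0..T}" "A.hat \<kappa> (fst zs) = A.U t' (snd (fst zs)) - (fst (fst zs) - t')\<^sup>2 / \<kappa>"
      "B.hat \<kappa> (snd zs) = B.U s' (snd (snd zs)) - (fst (snd zs) - s')\<^sup>2 / \<kappa>" using att[OF le] by blast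
    from loc[OF le _ this] Wzs \<eta>0 show ?thesis by simp
  qed
  then have zs4: "dist zb zs < 4 * \<delta>" using dsum[of zs] by simp
  have zR: "dist zb z \<le> R" using zs4 zzs rb(1) \<delta> dist_triangle[of zb z zs] by (simp add: dist_commute)
  have nx: "norm (snd z1 - xb) \<le> r0" "norm (snd z2 - yb) \<le> r0" using pw[of z] zR R0 by (auto simp: z_def)
  have balls1: "cball (snd z1) A.rad \<subseteq> \<Omega>" "cball (snd z2) B.rad \<subseteq> \<Omega>"
    using near_ball(2)[OF nx(1)] near_ball'(2)[OF nx(2)] by simp_all
  define \<mu>1 where "\<mu>1 y = fst p \<bullet> y + b1 (z1 - fst zs) y + 16 * \<delta> * ((z1 - fst zs) \<bullet> y)" for y
  define \<mu>2 where "\<mu>2 y = snd p \<bullet> y + b2 (z2 - snd zs) y + 16 * \<delta> * ((z2 - snd zs) \<bullet> y)" for y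
  interpret bb1: bounded_bilinear b1 using b1(1) by (simp add: bilinear_conv_bounded_bilinear)
  interpret bb2: bounded_bilinear b2 using b2(1) by (simp add: bilinear_conv_bounded_bilinear)
  have lin: "linear \<mu>1" "linear \<mu>2"
    unfolding \<mu>1_def \<mu>2_def
    by (rule linearI; simp add: inner_add_right bb1.add_right bb1.scaleR_right bb2.add_right bb2.scaleR_right algebra_simps)+
  obtain t' x' m1 p1 and X1 :: "real^'n^'n" where t': "t' \<in> {0..T}" and x': "x' \<in> cball (snd z1) A.rad"
    and U1: "A.U t' (snd z1) = u1 t' x' - inverse \<epsilon> * (norm (snd z1 - x'))\<^sup>2"
    and hat1: "A.hat \<kappa> z1 = A.U t' (snd z1) - (fst z1 - t')\<^sup>2 / \<kappa>"
    and X1: "transpose X1 = X1" "\<And>\<xi>. - (2 * inverse \<epsilon>) * (norm \<xi>)\<^sup>2 \<le> \<xi> \<bullet> (X1 *v \<xi>)"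
      "\<And>\<xi>. \<xi> \<bullet> (X1 *v \<xi>) = b1 (0, \<xi>) (0, \<xi>) + 16 * \<delta> * (norm \<xi>)\<^sup>2 - 2 * inverse \<epsilon> * (norm \<xi>)\<^sup>2"
    and p1: "\<And>\<xi>. p1 \<bullet> \<xi> = \<mu>1 (0, \<xi>) - 2 * inverse \<epsilon> * ((snd z1 - snd (fst zb)) \<bullet> \<xi>)"
    and tou1: "\<And>s y. s \<in> {0..T} \<Longrightarrow> y \<in> \<Omega> \<Longrightarrow> \<bar>s - t'\<bar> < r / 4 \<Longrightarrow> norm (y - x') < r / 4 \<Longrightarrow>
      u1 s y \<le> u1 t' x' + (\<mu>1 (1, 0) - 2 / \<kappa> * (fst z1 - fst (fst zb))) * (s - t')
        + (b1 (1, 0) (1, 0) / 2 + 8 * \<delta> - 1 / \<kappa>) * (s - t')\<^sup>2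
        + ((s - t') *\<^sub>R m1 + p1) \<bullet> (y - x') + (y - x') \<bullet> (X1 *v (y - x')) / 2"
    and sh1: "\<And>\<tau>. t' - \<tau> \<in> {0..T} \<Longrightarrow> A.hat \<kappa> z1 - A.hat \<kappa> (z1 - \<tau> *\<^sub>R (1, 0)) \<le> u1 t' x' - u1 (t' - \<tau>) x'"
    by (rule A.touching_transfer[OF \<kappa> r(1) z1 balls1(1) lin(1) b1 h1_def touch1[folded \<mu>1_def]], assumption, rule that, assumption+)
  obtain s' y' m2 p2 and X2 :: "real^'n^'n" where s': "s' \<in> {0..T}" and y': "y' \<in> cball (snd z2) B.rad"
    and U2: "B.U s' (snd z2) = u2 s' y' - inverse \<epsilon> * (norm (snd z2 - y'))\<^sup>2"
    and hat2: "B.hat \<kappa> z2 = B.U s' (snd z2) - (fst z2 - s')\<^sup>2 / \<kappa>"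
    and X2: "transpose X2 = X2" "\<And>\<xi>. - (2 * inverse \<epsilon>) * (norm \<xi>)\<^sup>2 \<le> \<xi> \<bullet> (X2 *v \<xi>)"
      "\<And>\<xi>. \<xi> \<bullet> (X2 *v \<xi>) = b2 (0, \<xi>) (0, \<xi>) + 16 * \<delta> * (norm \<xi>)\<^sup>2 - 2 * inverse \<epsilon> * (norm \<xi>)\<^sup>2"
    and p2: "\<And>\<xi>. p2 \<bullet> \<xi> = \<mu>2 (0, \<xi>) - 2 * inverse \<epsilon> * ((snd z2 - snd (snd zb)) \<bullet> \<xi>)"
    and tou2: "\<And>s y. s \<in> {0..T} \<Longrightarrow> y \<in> \<Omega> \<Longrightarrow> \<bar>s - s'\<bar> < r / 4 \<Longrightarrow> norm (y - y') < r / 4 \<Longrightarrow>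
      u2 s y \<le> u2 s' y' + (\<mu>2 (1, 0) - 2 / \<kappa> * (fst z2 - fst (snd zb))) * (s - s')
        + (b2 (1, 0) (1, 0) / 2 + 8 * \<delta> - 1 / \<kappa>) * (s - s')\<^sup>2
        + ((s - s') *\<^sub>R m2 + p2) \<bullet> (y - y') + (y - y') \<bullet> (X2 *v (y - y')) / 2"
    and sh2: "\<And>\<tau>. s' - \<tau> \<in> {0..T} \<Longrightarrow> B.hat \<kappa> z2 - B.hat \<kappa> (z2 - \<tau> *\<^sub>R (1, 0)) \<le> u2 s' y' - u2 (s' - \<tau>) y'"
    by (rule B.touching_transfer[OF \<kappa> r(1) z2 balls1(2) lin(2) b2 h2_def touch2[folded \<mu>2_def]], assumption, rule that, assumption+)
  have locz: "\<bar>fst z1 - tb\<bar> < \<delta> \<and> \<bar>fst z2 - tb\<bar> < \<delta> \<and> \<bar>t' - tb\<bar> < \<delta> \<and> \<bar>s' - tb\<bar> < \<delta>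
      \<and> norm (snd z1 - xb) < \<delta> \<and> norm (snd z2 - yb) < \<delta>
      \<and> \<bar>A.U t' (snd z1) - A.U tb xb\<bar> < \<delta> \<and> \<bar>B.U s' (snd z2) - B.U tb yb\<bar> < \<delta>"
    using loc[OF zR Wz t' s'] hat1 hat2 by (simp add: z_def)
  have \<delta>1: "\<delta> \<le> 1 / 16" using \<delta> R0 by simp
  have r1: "r < 1 / 32" using rb(1) \<delta>1 by simp
  have e1: "\<bar>fst z1 - fst (fst zs)\<bar> \<le> r / 2" "norm (snd z1 - snd (fst zs)) \<le> r / 2" "norm (z1 - fst zs) \<le> r / 2"
    using z1 dist_fst_le[of "fst zs" z1] dist_snd_le[of "fst zs" z1] by (auto simp: dist_norm norm_minus_commute abs_minus_commute)
  have e2: "\<bar>fst z2 - fst (snd zs)\<bar> \<le> r / 2" "norm (snd z2 - snd (snd zs)) \<le> r / 2" "norm (z2 - snd zs) \<le> r / 2"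
    using z2 dist_fst_le[of "snd zs" z2] dist_snd_le[of "snd zs" z2] by (auto simp: dist_norm norm_minus_commute abs_minus_commute)
  have ri: "2 * i * (r / 2) \<le> \<delta>" using rb(4) i0 mult_pos_pos[OF i0 r(1)] by (simp add: pos_less_divide_eq algebra_simps)
  have r\<kappa>: "2 / \<kappa> * r \<le> \<delta>" using rb(5) \<kappa> by (simp add: field_simps)
  have rB: "(B1 + B2) * r \<le> \<delta>" using rb(6) B1(2) B2(2) by (simp add: pos_less_divide_eq mult.commute)
  have rB1: "r / 2 * B1 \<le> \<delta>" "r / 2 * B2 \<le> \<delta>"
    using rB mult_pos_pos[OF B1(2) r(1)] mult_pos_pos[OF B2(2) r(1)] r(1) by (simp_all add: algebra_simps)
  have r16: "16 * \<delta> * (r / 2) \<le> \<delta>" using mult_left_mono[of r "1 / 8" \<delta>] r1 \<delta>(1) by simp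

  \<comment> \<open>Gradients and spatial Hessians at the touching points\<close>
  define v where "v = (snd (fst zs) - xb, snd (snd zs) - yb)"
  have nv: "norm v \<le> 2 * \<delta>"
    using norm_Pair_le[of "snd (fst zs) - xb" "snd (snd zs) - yb"] loczs by (simp add: v_def)
  \<comment> \<open>The slope of the convexifying square is added at \<open>zs\<close> and
    subtracted at \<open>z1\<close>; only the displacement between the two points survives, and
    \<open>r\<close> was chosen to make it harmless. The same happens for the second
    function.\<close>
  have np: "norm (p1 - P1) \<le> K * \<delta>"
  proof (rule norm_le_of_inner_le)
    fix \<xi> :: "real^'n"
    have ip: "(z1 - fst zs) \<bullet> (0, \<xi>) = (snd z1 - snd (fst zs)) \<bullet> \<xi>" by (simp add: inner_prod_def)
    have "fst p \<bullet> (0, \<xi>) = p \<bullet> ((0, \<xi>), 0)" by (simp add: inner_prod_def)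
    also have "\<dots> = P1 \<bullet> \<xi> + N v (\<xi>, 0) + 2 * i * ((snd (fst zs) - xb) \<bullet> \<xi>) - fst q \<bullet> (0, \<xi>)"
      unfolding p l_def S_def Bq_def v_def zb_def by (simp add: inner_prod_def)
    finally have "(p1 - P1) \<bullet> \<xi> = N v (\<xi>, 0) + 2 * i * ((snd (fst zs) - snd z1) \<bullet> \<xi>) + b1 (z1 - fst zs) (0, \<xi>)
        + 16 * \<delta> * ((snd z1 - snd (fst zs)) \<bullet> \<xi>) - fst q \<bullet> (0, \<xi>)"
      unfolding inner_diff_left[of p1] p1 \<mu>1_def i_def zb_def ip
      by (simp add: inner_diff_left algebra_simps)
    moreover have "N v (\<xi>, 0) \<le> 2 * CN * \<delta> * norm \<xi>"
    proof -
      have "N v (\<xi>, 0) \<le> CN * (norm v * norm \<xi>)" using CN(2)[of v "(\<xi>, 0)"] by simp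
      also have "\<dots> \<le> CN * (2 * \<delta> * norm \<xi>)" using nv CN(1) by (intro mult_left_mono mult_right_mono) auto
      finally show ?thesis by simp
    qed
    moreover have "2 * i * ((snd (fst zs) - snd z1) \<bullet> \<xi>) \<le> \<delta> * norm \<xi>"
    proof -
      have "(snd (fst zs) - snd z1) \<bullet> \<xi> \<le> norm (snd (fst zs) - snd z1) * norm \<xi>" by (rule norm_cauchy_schwarz)
      also have "\<dots> \<le> (r / 2) * norm \<xi>" using e1(2) by (intro mult_right_mono) (auto simp: norm_minus_commute)
      finally have "2 * i * ((snd (fst zs) - snd z1) \<bullet> \<xi>) \<le> 2 * i * ((r / 2) * norm \<xi>)" using i0 by (intro mult_left_mono) auto
      also have "\<dots> = (2 * i * (r / 2)) * norm \<xi>" by simp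
      also have "\<dots> \<le> \<delta> * norm \<xi>" by (rule mult_right_mono[OF ri norm_ge_zero])
      finally show ?thesis .
    qed
    moreover have "b1 (z1 - fst zs) (0, \<xi>) \<le> \<delta> * norm \<xi>"
    proof -
      have "b1 (z1 - fst zs) (0, \<xi>) \<le> norm (z1 - fst zs) * norm \<xi> * B1" using B1(1)[of "z1 - fst zs" "(0, \<xi>)"] by simp
      also have "\<dots> \<le> r / 2 * norm \<xi> * B1" using e1(3) B1(2) by (intro mult_right_mono) auto
      also have "\<dots> = (r / 2 * B1) * norm \<xi>" by simp
      also have "\<dots> \<le> \<delta> * norm \<xi>" by (rule mult_right_mono[OF rB1(1) norm_ge_zero])
      finally show ?thesis .
    qed
    moreover have "16 * \<delta> * ((snd z1 - snd (fst zs)) \<bullet> \<xi>) \<le> \<delta> * norm \<xi>"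
    proof -
      have "(snd z1 - snd (fst zs)) \<bullet> \<xi> \<le> norm (snd z1 - snd (fst zs)) * norm \<xi>" by (rule norm_cauchy_schwarz)
      also have "\<dots> \<le> (r / 2) * norm \<xi>" using e1(2) by (intro mult_right_mono) auto
      finally have "16 * \<delta> * ((snd z1 - snd (fst zs)) \<bullet> \<xi>) \<le> 16 * \<delta> * ((r / 2) * norm \<xi>)" using \<delta> by (intro mult_left_mono) auto
      also have "\<dots> = (16 * \<delta> * (r / 2)) * norm \<xi>" by simp
      also have "\<dots> \<le> \<delta> * norm \<xi>" by (rule mult_right_mono[OF r16 norm_ge_zero])
      finally show ?thesis .
    qed
    moreover have "- (fst q \<bullet> (0, \<xi>)) \<le> \<delta> * norm \<xi>"
    proof -
      have "- (fst q \<bullet> (0, \<xi>)) \<le> norm (fst q) * norm ((0::real), \<xi>)" using Cauchy_Schwarz_ineq2[of "fst q" "(0, \<xi>)"] by linarith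
      also have "\<dots> \<le> \<delta> * norm \<xi>" using q \<eta>(2) \<delta>(1) norm_fst_le[of "fst q" "snd q"] by (intro mult_mono) auto
      finally show ?thesis .
    qed
    ultimately have "(p1 - P1) \<bullet> \<xi> \<le> 2 * CN * \<delta> * norm \<xi> + 4 * (\<delta> * norm \<xi>)" by linarith
    then show "(p1 - P1) \<bullet> \<xi> \<le> K * \<delta> * norm \<xi>" by (simp add: K algebra_simps)
  qed (use CN(1) \<delta> K in simp)
  have np2: "norm (p2 - P2) \<le> K * \<delta>"
  proof (rule norm_le_of_inner_le)
    fix \<xi> :: "real^'n"
    have ip: "(z2 - snd zs) \<bullet> (0, \<xi>) = (snd z2 - snd (snd zs)) \<bullet> \<xi>" by (simp add: inner_prod_def)
    have "snd p \<bullet> (0, \<xi>) = p \<bullet> (0, (0, \<xi>))" by (simp add: inner_prod_def)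
    also have "\<dots> = P2 \<bullet> \<xi> + N v (0, \<xi>) + 2 * i * ((snd (snd zs) - yb) \<bullet> \<xi>) - snd q \<bullet> (0, \<xi>)"
      unfolding p l_def S_def Bq_def v_def zb_def by (simp add: inner_prod_def)
    finally have "(p2 - P2) \<bullet> \<xi> = N v (0, \<xi>) + 2 * i * ((snd (snd zs) - snd z2) \<bullet> \<xi>) + b2 (z2 - snd zs) (0, \<xi>)
        + 16 * \<delta> * ((snd z2 - snd (snd zs)) \<bullet> \<xi>) - snd q \<bullet> (0, \<xi>)"
      unfolding inner_diff_left[of p2] p2 \<mu>2_def i_def zb_def ip
      by (simp add: inner_diff_left algebra_simps)
    moreover have "N v (0, \<xi>) \<le> 2 * CN * \<delta> * norm \<xi>"
    proof -
      have "N v (0, \<xi>) \<le> CN * (norm v * norm \<xi>)" using CN(2)[of v "(0, \<xi>)"] by simp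
      also have "\<dots> \<le> CN * (2 * \<delta> * norm \<xi>)" using nv CN(1) by (intro mult_left_mono mult_right_mono) auto
      finally show ?thesis by simp
    qed
    moreover have "2 * i * ((snd (snd zs) - snd z2) \<bullet> \<xi>) \<le> \<delta> * norm \<xi>"
    proof -
      have "(snd (snd zs) - snd z2) \<bullet> \<xi> \<le> norm (snd (snd zs) - snd z2) * norm \<xi>" by (rule norm_cauchy_schwarz)
      also have "\<dots> \<le> (r / 2) * norm \<xi>" using e2(2) by (intro mult_right_mono) (auto simp: norm_minus_commute)
      finally have "2 * i * ((snd (snd zs) - snd z2) \<bullet> \<xi>) \<le> 2 * i * ((r / 2) * norm \<xi>)" using i0 by (intro mult_left_mono) auto
      also have "\<dots> = (2 * i * (r / 2)) * norm \<xi>" by simp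
      also have "\<dots> \<le> \<delta> * norm \<xi>" by (rule mult_right_mono[OF ri norm_ge_zero])
      finally show ?thesis .
    qed
    moreover have "b2 (z2 - snd zs) (0, \<xi>) \<le> \<delta> * norm \<xi>"
    proof -
      have "b2 (z2 - snd zs) (0, \<xi>) \<le> norm (z2 - snd zs) * norm \<xi> * B2" using B2(1)[of "z2 - snd zs" "(0, \<xi>)"] by simp
      also have "\<dots> \<le> r / 2 * norm \<xi> * B2" using e2(3) B2(2) by (intro mult_right_mono) auto
      also have "\<dots> = (r / 2 * B2) * norm \<xi>" by simp
      also have "\<dots> \<le> \<delta> * norm \<xi>" by (rule mult_right_mono[OF rB1(2) norm_ge_zero])
      finally show ?thesis .
    qed
    moreover have "16 * \<delta> * ((snd z2 - snd (snd zs)) \<bullet> \<xi>) \<le> \<delta> * norm \<xi>"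
    proof -
      have "(snd z2 - snd (snd zs)) \<bullet> \<xi> \<le> norm (snd z2 - snd (snd zs)) * norm \<xi>" by (rule norm_cauchy_schwarz)
      also have "\<dots> \<le> (r / 2) * norm \<xi>" using e2(2) by (intro mult_right_mono) auto
      finally have "16 * \<delta> * ((snd z2 - snd (snd zs)) \<bullet> \<xi>) \<le> 16 * \<delta> * ((r / 2) * norm \<xi>)" using \<delta> by (intro mult_left_mono) auto
      also have "\<dots> = (16 * \<delta> * (r / 2)) * norm \<xi>" by simp
      also have "\<dots> \<le> \<delta> * norm \<xi>" by (rule mult_right_mono[OF r16 norm_ge_zero])
      finally show ?thesis .
    qed
    moreover have "- (snd q \<bullet> (0, \<xi>)) \<le> \<delta> * norm \<xi>"
    proof -
      have "- (snd q \<bullet> (0, \<xi>)) \<le> norm (snd q) * norm ((0::real), \<xi>)" using Cauchy_Schwarz_ineq2[of "snd q" "(0, \<xi>)"] by linarith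
      also have "\<dots> \<le> \<delta> * norm \<xi>" using q \<eta>(2) \<delta>(1) norm_snd_le[of "snd q" "fst q"] by (intro mult_mono) auto
      finally show ?thesis .
    qed
    ultimately have "(p2 - P2) \<bullet> \<xi> \<le> 2 * CN * \<delta> * norm \<xi> + 4 * (\<delta> * norm \<xi>)" by linarith
    then show "(p2 - P2) \<bullet> \<xi> \<le> K * \<delta> * norm \<xi>" by (simp add: K algebra_simps)
  qed (use CN(1) \<delta> K in simp)
  \<comment> \<open>On purely spatial directions \<open>S\<close> does not see the time penalty, and
    its two spatial squares cancel against those subtracted in \<open>X1\<close> and
    \<open>X2\<close>.\<close>
  have XY: "\<xi> \<bullet> (X1 *v \<xi>) + \<zeta> \<bullet> (X2 *v \<zeta>) \<le> N (\<xi>, \<zeta>) (\<xi>, \<zeta>) + 16 * \<delta> * ((norm \<xi>)\<^sup>2 + (norm \<zeta>)\<^sup>2)" for \<xi> \<zeta>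
  proof -
    have "b1 (0, \<xi>) (0, \<xi>) + b2 (0, \<zeta>) (0, \<zeta>) \<le> N (\<xi>, \<zeta>) (\<xi>, \<zeta>) + 2 * i * (norm \<xi>)\<^sup>2 + 2 * i * (norm \<zeta>)\<^sup>2"
      using bS[of "((0, \<xi>), (0, \<zeta>))"] by (simp add: S_def Bq_def power2_norm_eq_inner)
    then show ?thesis unfolding X1(3) X2(3) i_def by (simp add: algebra_simps)
  qed

  \<comment> \<open>Sums of the time slopes and of the time curvatures\<close>
  \<comment> \<open>The direction that moves both times together. The penalty between the times is
    constant along it, and the terms with \<open>1 / \<kappa>\<close> from the convexifying squares
    cancel, for the slopes up to an error at most \<open>\<delta>\<close>. This gives bounds for the
    sums that are free of \<open>\<kappa>\<close>.\<close>
  define ee where "ee = ((1::real, 0::real^'n), (1::real, 0::real^'n))"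
  define A1 where "A1 = \<mu>1 (1, 0) - 2 / \<kappa> * (fst z1 - fst (fst zb))"
  define A2 where "A2 = \<mu>2 (1, 0) - 2 / \<kappa> * (fst z2 - fst (snd zb))"
  define C1 where "C1 = b1 (1, 0) (1, 0) / 2 + 8 * \<delta> - 1 / \<kappa>"
  define C2 where "C2 = b2 (1, 0) (1, 0) / 2 + 8 * \<delta> - 1 / \<kappa>"
  have nee: "norm ee \<le> 2" using norm_Pair_le[of "(1::real, 0::real^'n)" "(1::real, 0::real^'n)"] by (simp add: ee_def)
  have qee: "\<bar>q \<bullet> ee\<bar> \<le> 2 * \<delta>"
  proof -
    have "\<bar>q \<bullet> ee\<bar> \<le> norm q * norm ee" by (rule Cauchy_Schwarz_ineq2)
    also have "\<dots> \<le> \<delta> * 2" using q \<eta>(2) nee \<delta> by (intro mult_mono) auto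
    finally show ?thesis by simp
  qed
  have sumA: "\<bar>A1 + A2\<bar> \<le> \<bar>a\<bar> + 2 * \<bar>c\<bar> + 20"
  proof -
    have ip: "(z1 - fst zs) \<bullet> (1, 0) = fst z1 - fst (fst zs)" "(z2 - snd zs) \<bullet> (1, 0) = fst z2 - fst (snd zs)"
      by (simp_all add: inner_prod_def)
    have "p \<bullet> ee = fst p \<bullet> (1, 0) + snd p \<bullet> (1, 0)" by (simp add: inner_prod_def ee_def)
    moreover have "p \<bullet> ee = a + 2 * c * (fst (fst zs) - tb)
        + (2 / \<kappa> * (fst (fst zs) - tb) + 2 / \<kappa> * (fst (snd zs) - tb)) - q \<bullet> ee"
      unfolding p l_def S_def Bq_def zb_def ee_def by (simp add: bN.zero_right flip: zero_prod_def)
    ultimately have eq: "A1 + A2 = a + 2 * c * (fst (fst zs) - tb) + 2 / \<kappa> * ((fst (fst zs) - fst z1) + (fst (snd zs) - fst z2))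
        + b1 (z1 - fst zs) (1, 0) + b2 (z2 - snd zs) (1, 0)
        + 16 * \<delta> * (fst z1 - fst (fst zs)) + 16 * \<delta> * (fst z2 - fst (snd zs)) - q \<bullet> ee"
      unfolding A1_def A2_def \<mu>1_def \<mu>2_def zb_def ip
      by (simp add: right_diff_distrib distrib_left)
    have f1: "\<bar>2 * c * (fst (fst zs) - tb)\<bar> \<le> 2 * \<bar>c\<bar> * 1"
      unfolding abs_mult using loczs \<delta>1 by (intro mult_mono) auto
    have f2: "\<bar>2 / \<kappa> * ((fst (fst zs) - fst z1) + (fst (snd zs) - fst z2))\<bar> \<le> \<delta>"
    proof -
      have "\<bar>2 / \<kappa> * ((fst (fst zs) - fst z1) + (fst (snd zs) - fst z2))\<bar> \<le> 2 / \<kappa> * r"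
        unfolding abs_mult
      proof (rule mult_mono)
        show "\<bar>(fst (fst zs) - fst z1) + (fst (snd zs) - fst z2)\<bar> \<le> r" using e1(1) e2(1) by linarith
      qed (use \<kappa> in auto)
      then show ?thesis using r\<kappa> by linarith
    qed
    have f3: "\<bar>b1 (z1 - fst zs) (1, 0)\<bar> \<le> \<delta>"
    proof -
      have "\<bar>b1 (z1 - fst zs) (1, 0)\<bar> \<le> norm (z1 - fst zs) * B1" using B1(1)[of "z1 - fst zs" "(1, 0)"] by simp
      also have "\<dots> \<le> r / 2 * B1" using e1(3) B1(2) by (intro mult_right_mono) auto
      finally show ?thesis using rB1(1) by linarith
    qed
    have f4: "\<bar>b2 (z2 - snd zs) (1, 0)\<bar> \<le> \<delta>"
    proof -
      have "\<bar>b2 (z2 - snd zs) (1, 0)\<bar> \<le> norm (z2 - snd zs) * B2" using B2(1)[of "z2 - snd zs" "(1, 0)"] by simp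
      also have "\<dots> \<le> r / 2 * B2" using e2(3) B2(2) by (intro mult_right_mono) auto
      finally show ?thesis using rB1(2) by linarith
    qed
    have f5: "\<bar>16 * \<delta> * (fst z1 - fst (fst zs))\<bar> \<le> 16 * \<delta> * (r / 2)" "\<bar>16 * \<delta> * (fst z2 - fst (snd zs))\<bar> \<le> 16 * \<delta> * (r / 2)"
      unfolding abs_mult using e1(1) e2(1) \<delta>(1) by (auto intro!: mult_left_mono)
    note upper = f1[THEN abs_le_D1] f2[THEN abs_le_D1] f3[THEN abs_le_D1] f4[THEN abs_le_D1]
      f5(1)[THEN abs_le_D1] f5(2)[THEN abs_le_D1] qee[THEN abs_le_D2] abs_ge_self[of a]
    note lower = f1[THEN abs_le_D2] f2[THEN abs_le_D2] f3[THEN abs_le_D2] f4[THEN abs_le_D2]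
      f5(1)[THEN abs_le_D2] f5(2)[THEN abs_le_D2] qee[THEN abs_le_D1] abs_ge_minus_self[of a]
    show ?thesis
    proof (rule abs_leI)
      show "A1 + A2 \<le> \<bar>a\<bar> + 2 * \<bar>c\<bar> + 20" using eq upper r16 \<delta>1 by linarith
      show "- (A1 + A2) \<le> \<bar>a\<bar> + 2 * \<bar>c\<bar> + 20" using eq lower r16 \<delta>1 by linarith
    qed
  qed
  have sumC: "C1 + C2 \<le> \<bar>c\<bar> + 1"
  proof -
    have "b1 (1, 0) (1, 0) + b2 (1, 0) (1, 0) \<le> 2 * c + 4 / \<kappa>"
      using bS[of ee] by (simp add: S_def Bq_def ee_def bN.zero_right flip: zero_prod_def)
    then have "C1 + C2 \<le> c + 16 * \<delta>" unfolding C1_def C2_def by (simp add: field_simps)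
    then show ?thesis using \<delta>1 by linarith
  qed

  \<comment> \<open>A lower bound for the increments with a uniform constant\<close>
  have C0: "0 \<le> 16 * M0 / R" using A.M0 R0 by simp
  have quad: "- (C * min \<tau> 1) \<le> (A1 * \<tau> - C1 * \<tau>\<^sup>2) + (A2 * \<tau> - C2 * \<tau>\<^sup>2)" if \<tau>: "0 < \<tau>" "\<tau> \<le> 1" for \<tau>
  proof -
    have "- (\<bar>a\<bar> + 2 * \<bar>c\<bar> + 20) * \<tau> \<le> (A1 + A2) * \<tau>" using sumA \<tau> by (intro mult_right_mono) auto
    moreover have "(C1 + C2) * \<tau>\<^sup>2 \<le> (\<bar>c\<bar> + 1) * \<tau>"
    proof -
      have "\<tau>\<^sup>2 \<le> \<tau>" using \<tau> by (simp add: power2_eq_square mult_left_le)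
      have "(C1 + C2) * \<tau>\<^sup>2 \<le> (\<bar>c\<bar> + 1) * \<tau>\<^sup>2" using sumC by (intro mult_right_mono) auto
      also have "\<dots> \<le> (\<bar>c\<bar> + 1) * \<tau>" using \<open>\<tau>\<^sup>2 \<le> \<tau>\<close> by (intro mult_left_mono) auto
      finally show ?thesis .
    qed
    moreover have "(\<bar>a\<bar> + 3 * \<bar>c\<bar> + 23) * \<tau> \<le> C * \<tau>" using C0 \<tau> unfolding C by (intro mult_right_mono) auto
    ultimately show ?thesis using \<tau> by (simp add: min_def algebra_simps)
  qed
  \<comment> \<open>Four values of the hats are moved from the contact point \<open>zs\<close> to
    the touching points \<open>z1\<close> and \<open>z2\<close>, each at a cost of
    \<open>L1 * (r / 2)\<close> or \<open>L2 * (r / 2)\<close>; the total is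
    \<open>L * r\<close>.\<close>
  define E where "E = L * r"
  have E0: "0 \<le> E" using L0 r(1) by (simp add: E_def)
  have bound: "- (C * min \<tau> 1) - E \<le> (u1 t' x' - u1 (max (t' - \<tau>) 0) x') + (u2 s' y' - u2 (max (s' - \<tau>) 0) y')"
    if \<tau>: "0 < \<tau>" for \<tau>
  proof (cases "\<tau> \<le> R / 4")
    case True
    have ts: "0 \<le> t' - \<tau>" "0 \<le> s' - \<tau>" using locz True \<delta> R0 by linarith+
    then have D: "A.hat \<kappa> z1 - A.hat \<kappa> (z1 - \<tau> *\<^sub>R (1, 0)) \<le> u1 t' x' - u1 (max (t' - \<tau>) 0) x'"
      "B.hat \<kappa> z2 - B.hat \<kappa> (z2 - \<tau> *\<^sub>R (1, 0)) \<le> u2 s' y' - u2 (max (s' - \<tau>) 0) y'"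
      using sh1[of \<tau>] sh2[of \<tau>] t' s' \<tau> by (auto simp: max_def)
    \<comment> \<open>Both times are moved back by \<open>\<tau>\<close>, so the penalty is the same
      at \<open>w\<close> and \<open>zs\<close>. The maximality of \<open>zs\<close> then bounds the
      sum of the increments of the hats from below by the increment of \<open>Q\<close> and the
      tilt.\<close>
    define w where "w = zs - \<tau> *\<^sub>R ee"
    have nt: "norm (\<tau> *\<^sub>R (1::real, 0::real^'n)) \<le> 1" using True \<tau> R0 by simp
    have nrm: "norm (fst zs) \<le> norm (fst zb) + 1" "norm (snd zs) \<le> norm (snd zb) + 1"
      using dist_fst_le[of zb zs] dist_snd_le[of zb zs] zs R0 norm_triangle_ineq2[of "fst zs" "fst zb"]
        norm_triangle_ineq2[of "snd zs" "snd zb"] by (auto simp: dist_norm norm_minus_commute)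
    have nrm1: "norm z1 \<le> norm (fst zb) + 2" "norm z2 \<le> norm (snd zb) + 2"
      using nrm e1(3) e2(3) r1 norm_triangle_ineq2[of z1 "fst zs"] norm_triangle_ineq2[of z2 "snd zs"] by linarith+
    have nrm2: "norm (z1 - \<tau> *\<^sub>R (1, 0)) \<le> norm (fst zb) + 4" "norm (z2 - \<tau> *\<^sub>R (1, 0)) \<le> norm (snd zb) + 4"
      "norm (fst zs - \<tau> *\<^sub>R (1, 0)) \<le> norm (fst zb) + 4" "norm (snd zs - \<tau> *\<^sub>R (1, 0)) \<le> norm (snd zb) + 4"
      using nrm nrm1 nt norm_triangle_ineq4[of z1 "\<tau> *\<^sub>R (1, 0)"] norm_triangle_ineq4[of z2 "\<tau> *\<^sub>R (1, 0)"]
        norm_triangle_ineq4[of "fst zs" "\<tau> *\<^sub>R (1, 0)"] norm_triangle_ineq4[of "snd zs" "\<tau> *\<^sub>R (1, 0)"] by linarith+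
    have l1: "\<bar>A.hat \<kappa> z1 - A.hat \<kappa> (fst zs)\<bar> \<le> L1 * (r / 2)"
      "\<bar>A.hat \<kappa> (z1 - \<tau> *\<^sub>R (1, 0)) - A.hat \<kappa> (fst zs - \<tau> *\<^sub>R (1, 0))\<bar> \<le> L1 * (r / 2)"
      using L1(2)[of z1 "fst zs"] L1(2)[of "z1 - \<tau> *\<^sub>R (1, 0)" "fst zs - \<tau> *\<^sub>R (1, 0)"] nrm nrm1 nrm2
        mult_left_mono[OF e1(3) L1(1)] by auto
    have l2: "\<bar>B.hat \<kappa> z2 - B.hat \<kappa> (snd zs)\<bar> \<le> L2 * (r / 2)"
      "\<bar>B.hat \<kappa> (z2 - \<tau> *\<^sub>R (1, 0)) - B.hat \<kappa> (snd zs - \<tau> *\<^sub>R (1, 0))\<bar> \<le> L2 * (r / 2)"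
      using L2(2)[of z2 "snd zs"] L2(2)[of "z2 - \<tau> *\<^sub>R (1, 0)" "snd zs - \<tau> *\<^sub>R (1, 0)"] nrm nrm1 nrm2
        mult_left_mono[OF e2(3) L2(1)] by auto
    have "dist zb w \<le> R"
    proof -
      have "dist zb w \<le> dist zb zs + norm (\<tau> *\<^sub>R ee)" using dist_triangle[of zb w zs] by (simp add: w_def dist_norm)
      also have "norm (\<tau> *\<^sub>R ee) \<le> R / 4 * 2"
        unfolding norm_scaleR using True \<tau> nee R0 by (intro mult_mono) auto
      finally show ?thesis using zs4 \<delta> R0 by linarith
    qed
    then have "W w + q \<bullet> w \<le> W zs + q \<bullet> zs" by (rule topW)
    then have Wd: "- (\<tau> * (q \<bullet> ee)) \<le> W zs - W w" by (simp add: w_def inner_diff_right)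
    have comp: "fst w = fst zs - \<tau> *\<^sub>R (1, 0)" "snd w = snd zs - \<tau> *\<^sub>R (1, 0)"
      "fst (fst w) = fst (fst zs) - \<tau>" "fst (snd w) = fst (snd zs) - \<tau>"
      "snd (fst w) = snd (fst zs)" "snd (snd w) = snd (snd zs)" by (simp_all add: w_def ee_def)
    define \<sigma> where "\<sigma> = fst (fst zs) - tb"
    have "W zs - W w = (A.hat \<kappa> (fst zs) - A.hat \<kappa> (fst zs - \<tau> *\<^sub>R (1, 0))) + (B.hat \<kappa> (snd zs) - B.hat \<kappa> (snd zs - \<tau> *\<^sub>R (1, 0)))
        - (a * \<tau> + c * (2 * \<sigma> * \<tau> - \<tau>\<^sup>2))"
      unfolding W_def comp Q_def \<sigma>_def by (simp add: power2_eq_square algebra_simps)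
    then have hats: "(a * \<tau> + c * (2 * \<sigma> * \<tau> - \<tau>\<^sup>2)) - \<tau> * (q \<bullet> ee) \<le> (A.hat \<kappa> (fst zs) - A.hat \<kappa> (fst zs - \<tau> *\<^sub>R (1, 0)))
        + (B.hat \<kappa> (snd zs) - B.hat \<kappa> (snd zs - \<tau> *\<^sub>R (1, 0)))" using Wd by linarith
    have "- (\<bar>a\<bar> + 3 * \<bar>c\<bar> + 23) * \<tau> \<le> (a + c * (2 * \<sigma> - \<tau>) - q \<bullet> ee) * \<tau>"
    proof (rule mult_right_mono)
      have "\<bar>c * (2 * \<sigma> - \<tau>)\<bar> \<le> \<bar>c\<bar> * 3"
        unfolding abs_mult using loczs \<delta>1 True \<tau> R0 by (intro mult_left_mono) (auto simp: \<sigma>_def)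
      then show "- (\<bar>a\<bar> + 3 * \<bar>c\<bar> + 23) \<le> a + c * (2 * \<sigma> - \<tau>) - q \<bullet> ee" using qee \<delta>1 by linarith
    qed (use \<tau> in simp)
    moreover have "(a + c * (2 * \<sigma> - \<tau>) - q \<bullet> ee) * \<tau> = (a * \<tau> + c * (2 * \<sigma> * \<tau> - \<tau>\<^sup>2)) - \<tau> * (q \<bullet> ee)"
      by (simp add: power2_eq_square algebra_simps)
    moreover have "(\<bar>a\<bar> + 3 * \<bar>c\<bar> + 23) * \<tau> \<le> C * min \<tau> 1"
      using C0 \<tau> True R0 unfolding C by (auto simp: min_def intro!: mult_right_mono)
    moreover have "E = L1 * (r / 2) + L1 * (r / 2) + (L2 * (r / 2) + L2 * (r / 2))" by (simp add: E_def L_def algebra_simps)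
    ultimately show ?thesis
      using D l1(1)[THEN abs_le_D2] l1(2)[THEN abs_le_D1] l2(1)[THEN abs_le_D2] l2(2)[THEN abs_le_D1] hats by linarith
  next
    case False
    have x'\<Omega>: "x' \<in> \<Omega>" "y' \<in> \<Omega>" using x' y' balls1 by blast+
    have m: "max (t' - \<tau>) 0 \<in> {0..T}" "max (s' - \<tau>) 0 \<in> {0..T}" using t' s' \<tau> by auto
    have "- (4 * M0) \<le> (u1 t' x' - u1 (max (t' - \<tau>) 0) x') + (u2 s' y' - u2 (max (s' - \<tau>) 0) y')"
      using A.bnd[OF t' x'\<Omega>(1)] A.bnd[OF m(1) x'\<Omega>(1)] B.bnd[OF s' x'\<Omega>(2)] B.bnd[OF m(2) x'\<Omega>(2)] by linarith
    moreover have "4 * M0 \<le> C * min \<tau> 1"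
    proof -
      have "4 * M0 = 16 * M0 / R * (R / 4)" using R0 by simp
      also have "\<dots> \<le> C * min \<tau> 1" using C0 False R0 unfolding C by (intro mult_mono) auto
      finally show ?thesis .
    qed
    ultimately show ?thesis using E0 by linarith
  qed

  \<comment> \<open>The test functions and the integrated inequality\<close>
  have tp: "t' \<in> {0<..T}" "s' \<in> {0<..T}" using locz \<delta> R0 t' s' by auto
  have x'\<Omega>: "x' \<in> \<Omega>" "y' \<in> \<Omega>" using x' y' balls1 by blast+
  \<comment> \<open>The parabolas are used only for the last \<open>r / 8\<close> before the contact
    times: strictly inside the touching radius \<open>r / 4\<close> and away from the initial
    time.\<close>
  have rr: "0 < r / 8" "r / 8 < r / 4" "r / 8 < t'" "r / 8 < s'" using r(1) rb(1) locz \<delta> R0 by auto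
  define g1 where "g1 s = (if s \<le> t' - r / 8 then u1 s x' else u1 t' x' + A1 * (s - t') + C1 * (s - t')\<^sup>2)" for s
  define g2 where "g2 s = (if s \<le> s' - r / 8 then u2 s y' else u2 s' y' + A2 * (s - s') + C2 * (s - s')\<^sup>2)" for s
  have J1: "set_integrable lborel {0<..<t'} (K_integrand \<alpha> g1 t')"
    "J_op \<alpha> g1 t' + K_op \<alpha> 0 t' g1 t' + G1 t' x' (u1 t' x') p1 X1 \<le> 0"
    by (rule touch_test_quadratic[OF \<alpha> A.\<Omega>(1) A.usc A.bnd test1 tp(1) x'\<Omega>(1) X1(1) rr(1-3)
        tou1[folded A1_def C1_def] g1_def], assumption+)+
  have J2: "set_integrable lborel {0<..<s'} (K_integrand \<alpha> g2 s')"
    "J_op \<alpha> g2 s' + K_op \<alpha> 0 s' g2 s' + G2 s' y' (u2 s' y') p2 X2 \<le> 0"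
    by (rule touch_test_quadratic[OF \<alpha> B.\<Omega>(1) B.usc B.bnd test2 tp(2) x'\<Omega>(2) X2(1) rr(1,2,4)
        tou2[folded A2_def C2_def] g2_def], assumption+)+
  have tp0: "0 < t'" "0 < s'" using tp by auto
  note H1 = J_K_op_half_line[OF \<alpha> tp0(1) J1(1)] and H2 = J_K_op_half_line[OF \<alpha> tp0(2) J2(1)]
  define d where "d \<tau> = (g1 t' - g1 (max (t' - \<tau>) 0)) + (g2 s' - g2 (max (s' - \<tau>) 0))" for \<tau>
  have dint: "set_integrable lborel {0<..} (\<lambda>\<tau>. d \<tau> / \<tau> powr (\<alpha> + 1))"
    unfolding d_def add_divide_distrib by (intro set_integral_add(1) H1(1) H2(1))
  have "\<alpha> / Gamma (1 - \<alpha>) * (LINT \<tau>:{0<..}|lborel. d \<tau> / \<tau> powr (\<alpha> + 1))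
      = (J_op \<alpha> g1 t' + K_op \<alpha> 0 t' g1 t') + (J_op \<alpha> g2 s' + K_op \<alpha> 0 s' g2 s')"
    unfolding d_def add_divide_distrib set_integral_add(2)[OF H1(1) H2(1)] H1(2) H2(2) by (simp add: distrib_left)
  then have dle: "\<alpha> / Gamma (1 - \<alpha>) * (LINT \<tau>:{0<..}|lborel. d \<tau> / \<tau> powr (\<alpha> + 1))
    + G1 t' x' (u1 t' x') p1 X1 + G2 s' y' (u2 s' y') p2 X2 \<le> 0" using J1(2) J2(2) by linarith
  have gt: "g1 t' = u1 t' x'" "g2 s' = u2 s' y'" using rr(1) by (auto simp: g1_def g2_def)
  have dfar: "d \<tau> = (u1 t' x' - u1 (max (t' - \<tau>) 0) x') + (u2 s' y' - u2 (max (s' - \<tau>) 0) y')" if "r / 8 \<le> \<tau>" for \<tau>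
    unfolding d_def gt using that rr by (simp add: g1_def g2_def)
  have dnear: "d \<tau> = (A1 * \<tau> - C1 * \<tau>\<^sup>2) + (A2 * \<tau> - C2 * \<tau>\<^sup>2)" if "0 < \<tau>" "\<tau> < r / 8" for \<tau>
    unfolding d_def gt using that rr by (simp add: g1_def g2_def)
  \<comment> \<open>The threshold is \<open>r / 16\<close> and not \<open>r / 8\<close>: at
    \<open>\<tau> = r / 8\<close> the increments are already those of \<open>u1\<close> and
    \<open>u2\<close>, and the open half-line starting at \<open>r / 8\<close> would miss this
    point.\<close>
  have dlow: "- (C * min \<tau> 1) - E * indicator {r / 16<..} \<tau> \<le> d \<tau>" if \<tau>: "0 < \<tau>" for \<tau>
  proof (cases "\<tau> < r / 8")
    case True
    have "- (C * min \<tau> 1) \<le> d \<tau>" using quad[OF \<tau>] dnear[OF \<tau> True] True r1 by simp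
    moreover have "0 \<le> E * indicator {r / 16<..} \<tau>" using E0 by simp
    ultimately show ?thesis by linarith
  next
    case False
    then have "indicator {r / 16<..} \<tau> = (1::real)" using r(1) by (auto simp: indicator_def)
    then show ?thesis using bound[OF \<tau>] dfar[of \<tau>] False by simp
  qed
  have Ele: "E * (r / 16) powr (- \<alpha>) \<le> \<delta>"
  proof -
    have "(r / 16) powr (- \<alpha>) = r powr (- \<alpha>) * 16 powr \<alpha>"
      using r(1) by (simp add: powr_divide powr_minus_divide)
    also have "\<dots> \<le> r powr (- \<alpha>) * 16"
      using powr_mono[of \<alpha> 1 "16::real"] \<alpha> by (intro mult_left_mono) auto
    finally have "E * (r / 16) powr (- \<alpha>) \<le> E * (r powr (- \<alpha>) * 16)" using E0 by (intro mult_left_mono)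
    also have "\<dots> = (16 * L) * r * r powr (- \<alpha>)" by (simp add: E_def)
    also have "\<dots> \<le> \<delta>" by (rule rE(2)[OF r(1) rb(3)])
    finally show ?thesis .
  qed
  have "step_data \<alpha> G1 G2 C K \<delta> t' s' (snd z1) (snd z2) x' y' p1 p2 X1 X2 d (r / 16) E"
    unfolding step_data_def
    using tp locz x' y' U1 U2 X1(1,2) X2(1,2) XY np np2 dint dle E0 r(1) Ele dlow dfar rb(1) \<delta>(1)
    by simp
  then show ?thesis by blast
qed

end

section \<open>Limits of symmetric matrices and the inequality at a strict maximum\<close>

text \<open>Polarisation on sums and differences of basis vectors bounds the entries by the
  quadratic form. This supplies compactness once the form is bounded from both sides.\<close>

lemma sym_matrix_norm_le:
  fixes X :: "real^'n^'n"
  assumes X: "transpose X = X" and B: "\<And>\<xi>. \<bar>\<xi> \<bullet> (X *v \<xi>)\<bar> \<le> B * (norm \<xi>)\<^sup>2" "0 \<le> B"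
  shows "norm X \<le> real CARD('n) * (real CARD('n) * (2 * B))"
proof -
  have entry: "\<bar>X $ i $ j\<bar> \<le> 2 * B" for i j
  proof -
    let ?e = "axis i (1::real)" and ?f = "axis j (1::real)"
    have ef: "?e \<bullet> (X *v ?f) = X $ i $ j"
      by (simp add: inner_axis' matrix_vector_mult_basis column_def)
    have "4 * (?e \<bullet> (X *v ?f)) = (?e + ?f) \<bullet> (X *v (?e + ?f)) - (?e - ?f) \<bullet> (X *v (?e - ?f))"
      using sym_dot[OF X, of ?f ?e]
      by (simp add: matrix_vector_right_distrib matrix_vector_mult_diff_distrib inner_add_left inner_add_right inner_diff_left inner_diff_right)
    moreover have "\<bar>(?e + ?f) \<bullet> (X *v (?e + ?f))\<bar> \<le> B * 4"
    proof -
      have "norm (?e + ?f) \<le> 2" using norm_triangle_ineq[of ?e ?f] by simp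
      then have "(norm (?e + ?f))\<^sup>2 \<le> 2\<^sup>2" by (intro power_mono) auto
      then show ?thesis using B(1)[of "?e + ?f"] mult_left_mono[OF _ B(2), of "(norm (?e + ?f))\<^sup>2" 4] by simp
    qed
    moreover have "\<bar>(?e - ?f) \<bullet> (X *v (?e - ?f))\<bar> \<le> B * 4"
    proof -
      have "norm (?e - ?f) \<le> 2" using norm_triangle_ineq4[of ?e ?f] by simp
      then have "(norm (?e - ?f))\<^sup>2 \<le> 2\<^sup>2" by (intro power_mono) auto
      then show ?thesis using B(1)[of "?e - ?f"] mult_left_mono[OF _ B(2), of "(norm (?e - ?f))\<^sup>2" 4] by simp
    qed
    ultimately show ?thesis unfolding ef by linarith
  qed
  have "norm (X $ i) \<le> real CARD('n) * (2 * B)" for i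
  proof -
    have "norm (X $ i) \<le> (\<Sum>j\<in>UNIV. \<bar>X $ i $ j\<bar>)" by (rule norm_le_l1_cart)
    also have "\<dots> \<le> real CARD('n) * (2 * B)" using sum_bounded_above[of UNIV "\<lambda>j. \<bar>X $ i $ j\<bar>" "2 * B"] entry by simp
    finally show ?thesis .
  qed
  then have "(\<Sum>i\<in>UNIV. norm (X $ i)) \<le> real CARD('n) * (real CARD('n) * (2 * B))"
    using sum_bounded_above[of UNIV "\<lambda>i. norm (X $ i)" "real CARD('n) * (2 * B)"] by simp
  moreover have "norm X \<le> (\<Sum>i\<in>UNIV. norm (X $ i))"
    unfolding norm_vec_def by (rule L2_set_le_sum) simp
  ultimately show ?thesis by linarith
qed

lemma tendsto_of_rate:
  fixes g :: "nat \<Rightarrow> 'a::real_normed_vector"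
  assumes "e \<longlonglongrightarrow> 0" "\<And>n. norm (g n - l) \<le> B * e n"
  shows "g \<longlonglongrightarrow> l"
proof -
  have "(\<lambda>n. B * e n) \<longlonglongrightarrow> B * 0" by (intro tendsto_intros assms(1))
  then have "(\<lambda>n. g n - l) \<longlonglongrightarrow> 0"
    using assms(2) by (intro Lim_null_comparison[of "\<lambda>n. g n - l" "\<lambda>n. B * e n"]) auto
  then show ?thesis by (simp add: LIM_zero_iff)
qed

lemma tendsto_subseq: "strict_mono k \<Longrightarrow> g \<longlonglongrightarrow> l \<Longrightarrow> (\<lambda>n. g (k n)) \<longlonglongrightarrow> l"
  using LIMSEQ_subseq_LIMSEQ[of g l k] by (simp add: o_def)

lemma tendsto_quadratic_form:
  fixes X :: "nat \<Rightarrow> real^'n^'n"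
  assumes "X \<longlonglongrightarrow> Y"
  shows "(\<lambda>n. \<xi> \<bullet> (X n *v \<xi>)) \<longlonglongrightarrow> \<xi> \<bullet> (Y *v \<xi>)"
  unfolding matrix_vector_mult_def inner_vec_def using assms
  by (auto intro!: tendsto_intros tendsto_vec_nth)

lemma transpose_limit:
  fixes X :: "nat \<Rightarrow> real^'n^'n"
  assumes "X \<longlonglongrightarrow> Y" "\<And>n. transpose (X n) = X n"
  shows "transpose Y = Y"
proof -
  have "Y $ i $ j = Y $ j $ i" for i j
  proof (rule LIMSEQ_unique)
    show "(\<lambda>n. X n $ i $ j) \<longlonglongrightarrow> Y $ i $ j" by (intro tendsto_vec_nth assms(1))
    have "X n $ i $ j = X n $ j $ i" for n using arg_cong[OF assms(2)[of n], of "\<lambda>M. M $ i $ j"] by (simp add: transpose_def)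
    then show "(\<lambda>n. X n $ i $ j) \<longlonglongrightarrow> Y $ j $ i" using tendsto_vec_nth[OF tendsto_vec_nth[OF assms(1), of j], of i] by simp
  qed
  then show ?thesis by (simp add: vec_eq_iff transpose_def)
qed

context doubled_data
begin

text \<open>Steps of fineness tending to 0 are combined with compactness of the matrices and of the
  points where the sup-convolutions are attained. These points only accumulate somewhere in the
  closed balls of radius \<open>rad\<close>, which is the origin of the minimum and maximum over
  balls in the theorem. Fatou's lemma handles the nonlocal part, continuity the remaining
  terms.\<close>

lemma limit_exists:
  assumes \<alpha>: "0 < \<alpha>" "\<alpha> < 1"
    and test1: "touch_test \<alpha> T \<Omega> G1 u1" and test2: "touch_test \<alpha> T \<Omega> G2 u2"
    and cont1: "continuous_on ({0<..T} \<times> \<Omega> \<times> UNIV \<times> UNIV \<times> sym_mats) (\<lambda>(t, x, w, p, X). G1 t x w p X)"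
    and cont2: "continuous_on ({0<..T} \<times> \<Omega> \<times> UNIV \<times> UNIV \<times> sym_mats) (\<lambda>(t, x, w, p, X). G2 t x w p X)"
    and mono1: "\<And>t x p X w1 w2. t \<in> {0<..T} \<Longrightarrow> x \<in> \<Omega> \<Longrightarrow> X \<in> sym_mats \<Longrightarrow> w1 \<ge> w2 \<Longrightarrow> G1 t x w1 p X \<ge> G1 t x w2 p X"
    and mono2: "\<And>t x p X w1 w2. t \<in> {0<..T} \<Longrightarrow> x \<in> \<Omega> \<Longrightarrow> X \<in> sym_mats \<Longrightarrow> w1 \<ge> w2 \<Longrightarrow> G2 t x w1 p X \<ge> G2 t x w2 p X"
    and f: "f = (\<lambda>t. A.U t xb + B.U t yb)"
  shows "\<exists>X1\<in>sym_mats. \<exists>X2\<in>sym_mats. \<exists>x'\<in>cball xb A.rad. \<exists>y'\<in>cball yb A.rad.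
    (\<forall>\<xi>. - (2 * inverse \<epsilon>) * (norm \<xi>)\<^sup>2 \<le> \<xi> \<bullet> (X1 *v \<xi>)) \<and>
    (\<forall>\<xi>. - (2 * inverse \<epsilon>) * (norm \<xi>)\<^sup>2 \<le> \<xi> \<bullet> (X2 *v \<xi>)) \<and>
    (\<forall>\<xi> \<zeta>. \<xi> \<bullet> (X1 *v \<xi>) + \<zeta> \<bullet> (X2 *v \<zeta>) \<le> N (\<xi>, \<zeta>) (\<xi>, \<zeta>)) \<and>
    set_integrable lborel {0<..} (\<lambda>\<tau>. (f tb - f (max (tb - \<tau>) 0)) / \<tau> powr (\<alpha> + 1)) \<and>
    \<alpha> / Gamma (1 - \<alpha>) * (LINT \<tau>:{0<..}|lborel. (f tb - f (max (tb - \<tau>) 0)) / \<tau> powr (\<alpha> + 1))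
      + G1 tb x' (A.U tb xb) P1 X1 + G2 tb y' (B.U tb yb) P2 X2 \<le> 0"
proof -
  interpret bN: bounded_bilinear N using N(1) by (simp add: bilinear_conv_bounded_bilinear)
  obtain CN where CN0: "0 < CN" "\<And>w z. norm (N w z) \<le> norm w * norm z * CN" using bN.pos_bounded by blast
  have CN: "0 \<le> CN" "\<bar>N w z\<bar> \<le> CN * (norm w * norm z)" for w z
    using CN0(1) CN0(2)[of w z] by (simp_all add: mult.commute)
  define R where "R = min (min r0 1) tb"
  have R0: "0 < R" "R \<le> 1" "R \<le> r0" "R \<le> tb" using r0 tb by (auto simp: R_def)
  define C where "C = \<bar>a\<bar> + 3 * \<bar>c\<bar> + 23 + 16 * M0 / R"
  define K where "K = 2 * CN + 4"
  define dl where "dl n = R / 16 / real (Suc n)" for n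
  have dl: "0 < dl n" "dl n \<le> R / 16" for n
    using R0 divide_left_mono[of 1 "real (Suc n)" "R / 16"] by (auto simp: dl_def)
  have dl0: "dl \<longlonglongrightarrow> 0" unfolding dl_def by (rule LIMSEQ_Suc[OF lim_const_over_n])
  have "\<forall>n. \<exists>t' s' x y x' y' p1 p2 X1 X2 d \<rho> E. step_data \<alpha> G1 G2 C K (dl n) t' s' x y x' y' p1 p2 X1 X2 d \<rho> E"
    by (intro allI step_exists[OF \<alpha> CN R_def dl C_def K_def test1 test2])
  then obtain t' s' x y x' y' p1 p2 X1 X2 d \<rho> E where
    SD: "\<And>n. step_data \<alpha> G1 G2 C K (dl n) (t' n) (s' n) (x n) (y n) (x' n) (y' n) (p1 n) (p2 n) (X1 n) (X2 n) (d n) (\<rho> n) (E n)"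
    by metis
  note sd = SD[unfolded step_data_def]
  have tin: "t' n \<in> {0<..T}" "s' n \<in> {0<..T}" for n using sd[of n] by blast+
  have close: "\<bar>t' n - tb\<bar> < dl n" "\<bar>s' n - tb\<bar> < dl n" "norm (x n - xb) < dl n" "norm (y n - yb) < dl n" for n
    using sd[of n] by blast+
  have xin: "x' n \<in> cball (x n) A.rad" "y' n \<in> cball (y n) A.rad" for n using sd[of n] by blast+
  have Ueq: "A.U (t' n) (x n) = u1 (t' n) (x' n) - inverse \<epsilon> * (norm (x n - x' n))\<^sup>2"
     "B.U (s' n) (y n) = u2 (s' n) (y' n) - inverse \<epsilon> * (norm (y n - y' n))\<^sup>2" for n using sd[of n] by blast+
  have Ucl: "\<bar>A.U (t' n) (x n) - A.U tb xb\<bar> < dl n" "\<bar>B.U (s' n) (y n) - B.U tb yb\<bar> < dl n" for n using sd[of n] by blast+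
  have Xs: "transpose (X1 n) = X1 n" "transpose (X2 n) = X2 n" for n using sd[of n] by blast+
  have Xl: "- (2 * inverse \<epsilon>) * (norm \<xi>)\<^sup>2 \<le> \<xi> \<bullet> (X1 n *v \<xi>)" "- (2 * inverse \<epsilon>) * (norm \<xi>)\<^sup>2 \<le> \<xi> \<bullet> (X2 n *v \<xi>)" for n \<xi>
    using sd[of n] by blast+
  have Xu: "\<xi> \<bullet> (X1 n *v \<xi>) + \<zeta> \<bullet> (X2 n *v \<zeta>) \<le> N (\<xi>, \<zeta>) (\<xi>, \<zeta>) + 16 * dl n * ((norm \<xi>)\<^sup>2 + (norm \<zeta>)\<^sup>2)" for n \<xi> \<zeta>
    using sd[of n] by blast
  have pcl: "norm (p1 n - P1) \<le> K * dl n" "norm (p2 n - P2) \<le> K * dl n" for n using sd[of n] by blast+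
  have dint: "set_integrable lborel {0<..} (\<lambda>\<tau>. d n \<tau> / \<tau> powr (\<alpha> + 1))" for n using sd[of n] by blast
  have dle: "\<alpha> / Gamma (1 - \<alpha>) * (LINT \<tau>:{0<..}|lborel. d n \<tau> / \<tau> powr (\<alpha> + 1))
    + G1 (t' n) (x' n) (u1 (t' n) (x' n)) (p1 n) (X1 n) + G2 (s' n) (y' n) (u2 (s' n) (y' n)) (p2 n) (X2 n) \<le> 0" for n
    using sd[of n] by blast
  have E: "0 \<le> E n" "0 < \<rho> n" "E n * \<rho> n powr (- \<alpha>) \<le> dl n" for n using sd[of n] by blast+
  have dlow: "- (C * min \<tau> 1) - E n * indicator {\<rho> n<..} \<tau> \<le> d n \<tau>" if "0 < \<tau>" for n \<tau> using sd[of n] that by blast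
  have dfar: "d n \<tau> = (u1 (t' n) (x' n) - u1 (max (t' n - \<tau>) 0) (x' n)) + (u2 (s' n) (y' n) - u2 (max (s' n - \<tau>) 0) (y' n))"
    if "dl n \<le> \<tau>" for n \<tau> using sd[of n] that by blast
  have near: "norm (x n - xb) \<le> r0" "norm (y n - yb) \<le> r0" for n using close[of n] dl(2)[of n] R0 by linarith+
  have x'\<Omega>: "x' n \<in> \<Omega>" "y' n \<in> \<Omega>" for n using xin[of n] near_ball(2)[OF near(1)] near_ball'(2)[OF near(2)] by blast+
  note cvg = tendsto_of_rate[OF dl0]
  have lim: "t' \<longlonglongrightarrow> tb" "s' \<longlonglongrightarrow> tb" "x \<longlonglongrightarrow> xb" "y \<longlonglongrightarrow> yb" "p1 \<longlonglongrightarrow> P1" "p2 \<longlonglongrightarrow> P2"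
      "(\<lambda>n. A.U (t' n) (x n)) \<longlonglongrightarrow> A.U tb xb" "(\<lambda>n. B.U (s' n) (y n)) \<longlonglongrightarrow> B.U tb yb"
    using close Ucl by (auto intro!: cvg[where B = 1] cvg[OF pcl(1)] cvg[OF pcl(2)] less_imp_le)
  define i where "i = inverse \<epsilon>"
  have i0: "0 < i" using A.eps by (simp add: i_def)
  define Bx where "Bx = CN + 1 + 2 * i"
  have Bx0: "0 \<le> Bx" using CN i0 by (simp add: Bx_def)
  have Xabs: "\<bar>\<xi> \<bullet> (X1 n *v \<xi>)\<bar> \<le> Bx * (norm \<xi>)\<^sup>2" "\<bar>\<xi> \<bullet> (X2 n *v \<xi>)\<bar> \<le> Bx * (norm \<xi>)\<^sup>2" for n \<xi>
  proof -
    have d16: "16 * dl n * (norm \<xi>)\<^sup>2 \<le> 1 * (norm \<xi>)\<^sup>2" using dl(2)[of n] R0 by (intro mult_right_mono) auto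
    have "\<xi> \<bullet> (X1 n *v \<xi>) \<le> CN * (norm \<xi>)\<^sup>2 + (norm \<xi>)\<^sup>2"
      using Xu[of \<xi> n 0] CN(2)[of "(\<xi>, 0)" "(\<xi>, 0)"] d16 by (simp add: power2_eq_square)
    moreover have "\<xi> \<bullet> (X2 n *v \<xi>) \<le> CN * (norm \<xi>)\<^sup>2 + (norm \<xi>)\<^sup>2"
      using Xu[of 0 n \<xi>] CN(2)[of "(0, \<xi>)" "(0, \<xi>)"] d16 by (simp add: power2_eq_square)
    moreover have "Bx * (norm \<xi>)\<^sup>2 = CN * (norm \<xi>)\<^sup>2 + (norm \<xi>)\<^sup>2 + 2 * i * (norm \<xi>)\<^sup>2" by (simp add: Bx_def algebra_simps)
    moreover have "0 \<le> CN * (norm \<xi>)\<^sup>2" "0 \<le> 2 * i * (norm \<xi>)\<^sup>2" "0 \<le> (norm \<xi>)\<^sup>2" using CN i0 by simp_all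
    moreover have "- (2 * i * (norm \<xi>)\<^sup>2) \<le> \<xi> \<bullet> (X1 n *v \<xi>)" "- (2 * i * (norm \<xi>)\<^sup>2) \<le> \<xi> \<bullet> (X2 n *v \<xi>)"
      using Xl[of \<xi> n] by (simp_all add: i_def)
    ultimately show "\<bar>\<xi> \<bullet> (X1 n *v \<xi>)\<bar> \<le> Bx * (norm \<xi>)\<^sup>2" "\<bar>\<xi> \<bullet> (X2 n *v \<xi>)\<bar> \<le> Bx * (norm \<xi>)\<^sup>2"
      by (intro abs_leI; linarith)+
  qed
  define BX where "BX = real CARD('n) * (real CARD('n) * (2 * Bx))"
  have Xn: "norm (X1 n) \<le> BX" "norm (X2 n) \<le> BX" for n
    unfolding BX_def by (rule sym_matrix_norm_le[OF _ _ Bx0]; rule Xs Xabs)+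
  have xn: "x' n \<in> cball xb (A.rad + 1)" "y' n \<in> cball yb (A.rad + 1)" for n
    using xin[of n] close[of n] dl(2)[of n] R0 dist_triangle[of xb "x' n" "x n"] dist_triangle[of yb "y' n" "y n"]
    by (auto simp: dist_norm norm_minus_commute)
  define q where "q n = (x' n, y' n, X1 n, X2 n)" for n
  have "q n \<in> cball xb (A.rad + 1) \<times> cball yb (A.rad + 1) \<times> cball 0 BX \<times> cball 0 BX" for n
    using xn[of n] Xn[of n] by (simp add: q_def)
  moreover have "compact (cball xb (A.rad + 1) \<times> cball yb (A.rad + 1) \<times> cball (0::real^'n^'n) BX \<times> cball (0::real^'n^'n) BX)"
    by (intro compact_Times compact_cball)
  ultimately obtain ql k where k: "strict_mono (k :: nat \<Rightarrow> nat)" and ql: "(q \<circ> k) \<longlonglongrightarrow> ql"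
    unfolding compact_def by meson
  obtain xl yl Y1 Y2 where qleq: "ql = (xl, yl, Y1, Y2)" by (metis prod_cases4)
  have qlim: "(\<lambda>n. q (k n)) \<longlonglongrightarrow> (xl, yl, Y1, Y2)" using ql qleq by (simp add: o_def)
  have l: "(\<lambda>n. x' (k n)) \<longlonglongrightarrow> xl" "(\<lambda>n. y' (k n)) \<longlonglongrightarrow> yl" "(\<lambda>n. X1 (k n)) \<longlonglongrightarrow> Y1" "(\<lambda>n. X2 (k n)) \<longlonglongrightarrow> Y2"
    using tendsto_fst[OF qlim] tendsto_fst[OF tendsto_snd[OF qlim]] tendsto_fst[OF tendsto_snd[OF tendsto_snd[OF qlim]]]
      tendsto_snd[OF tendsto_snd[OF tendsto_snd[OF qlim]]] by (simp_all add: q_def)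
  note sub = tendsto_subseq[OF k]
  have evk: "eventually (\<lambda>n. P (k n)) sequentially" if "eventually P sequentially" for P
    using filterlim_subseq[OF k] that by (simp add: filterlim_iff)
  have xl: "xl \<in> cball xb A.rad" "yl \<in> cball yb A.rad"
  proof -
    have "dist xb xl \<le> A.rad"
      by (rule LIMSEQ_le_const2[OF tendsto_dist[OF sub[OF lim(3)] l(1)]]) (use xin in auto)
    moreover have "dist yb yl \<le> A.rad"
      by (rule LIMSEQ_le_const2[OF tendsto_dist[OF sub[OF lim(4)] l(2)]]) (use xin in auto)
    ultimately show "xl \<in> cball xb A.rad" "yl \<in> cball yb A.rad" by simp_all
  qed
  have Ysym: "transpose Y1 = Y1" "transpose Y2 = Y2"
    by (rule transpose_limit[OF l(3)], rule Xs) (rule transpose_limit[OF l(4)], rule Xs)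
  have Yl: "- (2 * inverse \<epsilon>) * (norm \<xi>)\<^sup>2 \<le> \<xi> \<bullet> (Y1 *v \<xi>)" "- (2 * inverse \<epsilon>) * (norm \<xi>)\<^sup>2 \<le> \<xi> \<bullet> (Y2 *v \<xi>)" for \<xi>
    by (rule LIMSEQ_le_const[OF tendsto_quadratic_form[OF l(3)]], use Xl in blast)
      (rule LIMSEQ_le_const[OF tendsto_quadratic_form[OF l(4)]], use Xl in blast)
  have Yu: "\<xi> \<bullet> (Y1 *v \<xi>) + \<zeta> \<bullet> (Y2 *v \<zeta>) \<le> N (\<xi>, \<zeta>) (\<xi>, \<zeta>)" for \<xi> \<zeta>
  proof -
    have "(\<lambda>n. N (\<xi>, \<zeta>) (\<xi>, \<zeta>) + 16 * dl (k n) * ((norm \<xi>)\<^sup>2 + (norm \<zeta>)\<^sup>2)) \<longlonglongrightarrow> N (\<xi>, \<zeta>) (\<xi>, \<zeta>) + 16 * 0 * ((norm \<xi>)\<^sup>2 + (norm \<zeta>)\<^sup>2)"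
      by (intro tendsto_intros sub[OF dl0])
    from LIMSEQ_le[OF tendsto_add[OF tendsto_quadratic_form[OF l(3)] tendsto_quadratic_form[OF l(4)]] this] Xu
    show ?thesis by auto
  qed
  have xb\<Omega>: "cball xb A.rad \<subseteq> \<Omega>" "cball yb A.rad \<subseteq> \<Omega>" using near_ball(2)[of xb] near_ball'(2)[of yb] r0 by simp_all
  have G1lim: "(\<lambda>n. G1 (t' (k n)) (x' (k n)) (A.U (t' (k n)) (x (k n))) (p1 (k n)) (X1 (k n))) \<longlonglongrightarrow> G1 tb xl (A.U tb xb) P1 Y1"
  proof -
    have "(\<lambda>n. (t' (k n), x' (k n), A.U (t' (k n)) (x (k n)), p1 (k n), X1 (k n))) \<longlonglongrightarrow> (tb, xl, A.U tb xb, P1, Y1)"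
      by (intro tendsto_Pair sub[OF lim(1)] l sub[OF lim(7)] sub[OF lim(5)])
    from continuous_on_tendsto_compose[OF cont1 this] show ?thesis
      using tb xl xb\<Omega> Ysym tin x'\<Omega> Xs by (auto simp: sym_mats_def)
  qed
  have G2lim: "(\<lambda>n. G2 (s' (k n)) (y' (k n)) (B.U (s' (k n)) (y (k n))) (p2 (k n)) (X2 (k n))) \<longlonglongrightarrow> G2 tb yl (B.U tb yb) P2 Y2"
  proof -
    have "(\<lambda>n. (s' (k n), y' (k n), B.U (s' (k n)) (y (k n)), p2 (k n), X2 (k n))) \<longlonglongrightarrow> (tb, yl, B.U tb yb, P2, Y2)"
      by (intro tendsto_Pair sub[OF lim(2)] l sub[OF lim(8)] sub[OF lim(6)])
    from continuous_on_tendsto_compose[OF cont2 this] show ?thesis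
      using tb xl xb\<Omega> Ysym tin x'\<Omega> Xs by (auto simp: sym_mats_def)
  qed
  define g where "g = Gamma (1 - \<alpha>) / \<alpha>"
  have g0: "0 < g" using \<alpha> by (simp add: g_def Gamma_real_pos)
  define bb where "bb n = - g * (G1 (t' (k n)) (x' (k n)) (A.U (t' (k n)) (x (k n))) (p1 (k n)) (X1 (k n))
      + G2 (s' (k n)) (y' (k n)) (B.U (s' (k n)) (y (k n))) (p2 (k n)) (X2 (k n)))" for n
  define BB where "BB = - g * (G1 tb xl (A.U tb xb) P1 Y1 + G2 tb yl (B.U tb yb) P2 Y2)"
  have bblim: "bb \<longlonglongrightarrow> BB" unfolding bb_def BB_def by (intro tendsto_intros G1lim G2lim)
  \<comment> \<open>The equation is satisfied with the value of \<open>u1\<close> at its contact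
    point, which exceeds that of the sup-convolution by the penalty. Monotonicity in
    \<open>w\<close> allows the smaller value, whose limit is known.\<close>
  have Uu: "A.U (t' n) (x n) \<le> u1 (t' n) (x' n)" "B.U (s' n) (y n) \<le> u2 (s' n) (y' n)" for n
    unfolding Ueq using A.eps by simp_all
  have m1: "G1 (t' m) (x' m) (A.U (t' m) (x m)) (p1 m) (X1 m) \<le> G1 (t' m) (x' m) (u1 (t' m) (x' m)) (p1 m) (X1 m)" for m
    by (rule mono1[OF tin(1) x'\<Omega>(1) _ Uu(1)]) (simp add: sym_mats_def Xs)
  have m2: "G2 (s' m) (y' m) (B.U (s' m) (y m)) (p2 m) (X2 m) \<le> G2 (s' m) (y' m) (u2 (s' m) (y' m)) (p2 m) (X2 m)" for m
    by (rule mono2[OF tin(2) x'\<Omega>(2) _ Uu(2)]) (simp add: sym_mats_def Xs)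
  have dbb: "(LINT \<tau>:{0<..}|lborel. d (k n) \<tau> / \<tau> powr (\<alpha> + 1)) \<le> bb n" for n
  proof -
    have "(1 / g) * (LINT \<tau>:{0<..}|lborel. d (k n) \<tau> / \<tau> powr (\<alpha> + 1)) \<le> (1 / g) * bb n"
      using dle[of "k n"] m1[of "k n"] m2[of "k n"] g0 by (simp add: bb_def g_def)
    then show ?thesis using g0 by (simp add: divide_le_cancel)
  qed
  have Elim: "(\<lambda>n. E (k n) * \<rho> (k n) powr (- \<alpha>)) \<longlonglongrightarrow> 0"
    by (rule Lim_null_comparison[OF _ sub[OF dl0]]) (use E in \<open>auto intro!: always_eventually\<close>)
  define ff where "ff \<tau> = f tb - f (max (tb - \<tau>) 0)" for \<tau>
  have tbT: "max (tb - \<tau>) 0 \<in> {0..T}" if "0 < \<tau>" for \<tau> using tb that by auto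
  have xbin: "xb \<in> \<Omega>" "yb \<in> \<Omega>" using xb\<Omega> A.rad(1) by auto
  \<comment> \<open>For small \<open>\<tau>\<close> the bound is the strict maximum condition at the
    spatial points \<open>xb\<close> and \<open>yb\<close> and the earlier time; for the others it
    follows from boundedness. The constant \<open>C\<close> of the steps serves here as
    well.\<close>
  have flow: "- (C * min \<tau> 1) \<le> ff \<tau>" if \<tau>: "0 < \<tau>" for \<tau>
  proof -
    have C16: "0 \<le> 16 * M0 / R" using A.M0 R0 by simp
    show ?thesis
    proof (cases "\<tau> \<le> R")
      case True
      have "A.U (tb - \<tau>) xb + B.U (tb - \<tau>) yb - (a * (tb - \<tau> - tb) + c * (tb - \<tau> - tb)\<^sup>2 + P1 \<bullet> (xb - xb) + P2 \<bullet> (yb - yb)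
          + N (xb - xb, yb - yb) (xb - xb, yb - yb) / 2)
        \<le> A.U tb xb + B.U tb yb - \<gamma> * ((tb - \<tau> - tb)\<^sup>2 + (norm (xb - xb))\<^sup>2 + (norm (yb - yb))\<^sup>2)"
        by (rule strict) (use \<tau> True R0 tb in auto)
      moreover have "0 \<le> \<gamma> * \<tau>\<^sup>2" using \<gamma> by simp
      ultimately have "a * \<tau> - c * \<tau>\<^sup>2 \<le> ff \<tau>"
        using \<tau> True R0 by (simp add: ff_def f bN.zero_left flip: zero_prod_def)
      moreover have "- (\<bar>a\<bar> + \<bar>c\<bar>) * \<tau> \<le> a * \<tau> - c * \<tau>\<^sup>2"
      proof -
        have "c * \<tau>\<^sup>2 \<le> \<bar>c\<bar> * \<tau>" using \<tau> True R0 by (intro mult_mono) (auto simp: power2_eq_square mult_left_le)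
        moreover have "- \<bar>a\<bar> * \<tau> \<le> a * \<tau>" using \<tau> by (intro mult_right_mono) auto
        ultimately show ?thesis by (simp add: algebra_simps)
      qed
      moreover have "(\<bar>a\<bar> + \<bar>c\<bar>) * \<tau> \<le> C * min \<tau> 1"
        using \<tau> True R0 C16 unfolding C_def by (auto simp: min_def intro!: mult_right_mono)
      ultimately show ?thesis by linarith
    next
      case False
      have "- (4 * M0) \<le> ff \<tau>"
        using A.U_bnd[of tb xb] B.U_bnd[of tb yb] A.U_bnd[OF tbT[OF \<tau>] xbin(1)] B.U_bnd[OF tbT[OF \<tau>] xbin(2)] xbin tb
        unfolding ff_def f by auto
      moreover have "4 * M0 \<le> C * min \<tau> 1"
      proof -
        have "4 * M0 \<le> 16 * M0 / R * R" using R0 A.M0 by simp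
        also have "\<dots> \<le> C * min \<tau> 1" using C16 False R0 unfolding C_def by (intro mult_mono) auto
        finally show ?thesis .
      qed
      ultimately show ?thesis by linarith
    qed
  qed
  \<comment> \<open>Once \<open>dl n < \<tau>\<close>, the increments are those of \<open>u1\<close>
    and \<open>u2\<close> over their contact points. They dominate the increments of the
    sup-convolutions, because the same points compete in the suprema at the earlier times. There
    semicontinuity gives an upper bound, which is the side required.\<close>
  have dlim: "eventually (\<lambda>n. e < d (k n) \<tau>) sequentially" if \<tau>: "0 < \<tau>" and e: "e < ff \<tau>" for e \<tau>
  proof (rule evk)
    define \<sigma> where "\<sigma> = (ff \<tau> - e) / 4"
    have \<sigma>: "0 < \<sigma>" using e by (simp add: \<sigma>_def)
    define sl where "sl = max (tb - \<tau>) 0"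
    have sl: "sl \<in> {0..T}" using tbT[OF \<tau>] by (simp add: sl_def)
    have rr: "A.rad < r" using r0 by simp
    obtain d1 where d1: "0 < d1" "\<And>t' z. t' \<in> {0..T} \<Longrightarrow> \<bar>t' - sl\<bar> < d1 \<Longrightarrow> norm (z - xb) < d1 \<Longrightarrow> A.U t' z < A.U sl xb + \<sigma>"
      using A.U_usc[OF balls(1) rr sl less_add_same_cancel1[THEN iffD2, OF \<sigma>]] by blast
    obtain d2 where d2: "0 < d2" "\<And>t' z. t' \<in> {0..T} \<Longrightarrow> \<bar>t' - sl\<bar> < d2 \<Longrightarrow> norm (z - yb) < d2 \<Longrightarrow> B.U t' z < B.U sl yb + \<sigma>"
      using B.U_usc[OF balls(2) rr sl less_add_same_cancel1[THEN iffD2, OF \<sigma>]] by blast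
    have "eventually (\<lambda>n. dl n < min (min d1 d2) (min \<sigma> \<tau>)) sequentially"
      using dl0 d1(1) d2(1) \<sigma> \<tau> by (intro order_tendstoD(2)) auto
    then show "eventually (\<lambda>n. e < d n \<tau>) sequentially"
    proof eventually_elim
      case (elim n)
      have m: "max (t' n - \<tau>) 0 \<in> {0..T}" "max (s' n - \<tau>) 0 \<in> {0..T}" using tin[of n] \<tau> by auto
      have "\<bar>max (t' n - \<tau>) 0 - sl\<bar> < d1" "\<bar>max (s' n - \<tau>) 0 - sl\<bar> < d2"
        using close(1,2)[of n] elim unfolding sl_def by linarith+
      then have ub: "A.U (max (t' n - \<tau>) 0) (x n) < A.U sl xb + \<sigma>" "B.U (max (s' n - \<tau>) 0) (y n) < B.U sl yb + \<sigma>"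
        using d1(2)[OF m(1)] d2(2)[OF m(2)] close(3,4)[of n] elim by auto
      have "u1 (max (t' n - \<tau>) 0) (x' n) - inverse \<epsilon> * (norm (x n - x' n))\<^sup>2 \<le> A.U (max (t' n - \<tau>) 0) (x n)"
        "u2 (max (s' n - \<tau>) 0) (y' n) - inverse \<epsilon> * (norm (y n - y' n))\<^sup>2 \<le> B.U (max (s' n - \<tau>) 0) (y n)"
        by (rule A.U_upper[OF m(1) x'\<Omega>(1)] B.U_upper[OF m(2) x'\<Omega>(2)])+
      then have "A.U (t' n) (x n) - A.U (max (t' n - \<tau>) 0) (x n) + (B.U (s' n) (y n) - B.U (max (s' n - \<tau>) 0) (y n)) \<le> d n \<tau>"
        using dfar[of n \<tau>] elim Ueq[of n] by simp
      moreover have "A.U tb xb - \<sigma> < A.U (t' n) (x n)" "B.U tb yb - \<sigma> < B.U (s' n) (y n)"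
        using Ucl[of n] elim by linarith+
      moreover have "ff \<tau> = A.U tb xb - A.U sl xb + (B.U tb yb - B.U sl yb)" by (simp add: ff_def f sl_def)
      ultimately show "e < d n \<tau>" using ub unfolding \<sigma>_def by (simp add: field_simps)
    qed
  qed
  have fmeas: "f \<in> borel_measurable (restrict_space borel {0..T})"
    unfolding f using A.U_measurable[OF balls(1)] B.U_measurable[OF balls(2)] r0 rad_eq
    by (intro borel_measurable_add) auto
  have ffmeas: "(\<lambda>\<tau>. indicator {0<..} \<tau> *\<^sub>R ff \<tau>) \<in> borel_measurable borel"
  proof -
    have [measurable]: "(\<lambda>s. indicator {0..T} s *\<^sub>R f s) \<in> borel_measurable borel"
      using fmeas by (subst (asm) borel_measurable_restrict_space_iff) auto
    have "(\<lambda>\<tau>. indicator {0<..} \<tau> *\<^sub>R (f tb - (indicator {0..T} (max (tb - \<tau>) 0) *\<^sub>R f (max (tb - \<tau>) 0)))) \<in> borel_measurable borel"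
      by measurable
    also have "(\<lambda>\<tau>. indicator {0<..} \<tau> *\<^sub>R (f tb - (indicator {0..T} (max (tb - \<tau>) 0) *\<^sub>R f (max (tb - \<tau>) 0))))
       = (\<lambda>\<tau>. indicator {0<..} \<tau> *\<^sub>R ff \<tau>)"
      using tbT by (auto simp: fun_eq_iff ff_def indicator_def)
    finally show ?thesis .
  qed
  have C0: "0 \<le> C" using A.M0 R0 by (simp add: C_def)
  note F = increments_fatou[where d = "\<lambda>n. d (k n)" and E = "\<lambda>n. E (k n)" and \<rho> = "\<lambda>n. \<rho> (k n)" and f = ff,
      OF \<alpha> C0 dint E(1) E(2) Elim dlow dbb bblim dlim flow ffmeas]
  have "(LINT \<tau>:{0<..}|lborel. ff \<tau> / \<tau> powr (\<alpha> + 1)) \<le> BB" by (rule F(2))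
  then have "(1 / g) * (LINT \<tau>:{0<..}|lborel. ff \<tau> / \<tau> powr (\<alpha> + 1)) \<le> (1 / g) * BB" using g0 by (intro mult_left_mono) auto
  then have "\<alpha> / Gamma (1 - \<alpha>) * (LINT \<tau>:{0<..}|lborel. ff \<tau> / \<tau> powr (\<alpha> + 1))
      + G1 tb xl (A.U tb xb) P1 Y1 + G2 tb yl (B.U tb yb) P2 Y2 \<le> 0"
  proof -
    have "(1 / g) * BB = - (G1 tb xl (A.U tb xb) P1 Y1 + G2 tb yl (B.U tb yb) P2 Y2)" using g0 by (simp add: BB_def)
    moreover have "1 / g = \<alpha> / Gamma (1 - \<alpha>)" by (simp add: g_def)
    ultimately show ?thesis using \<open>(1 / g) * _ \<le> (1 / g) * BB\<close> by simp
  qed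
  moreover have "set_integrable lborel {0<..} (\<lambda>\<tau>. ff \<tau> / \<tau> powr (\<alpha> + 1))" by (rule F(1))
  ultimately show ?thesis
    using xl Ysym Yl Yu unfolding ff_def
    by (intro bexI[of _ Y1] bexI[of _ Y2] bexI[of _ xl] bexI[of _ yl]) (auto simp: sym_mats_def)
qed

end

section \<open>Quadratic majorants and passage to the limit\<close>

text \<open>The remainder is integrated along the segment to \<open>zb\<close> by the mean value
  inequality, for which \<open>S\<close> has to be convex. All derivatives are relative to
  \<open>S\<close>, so the expansion also covers the one-sided situation at the final time.\<close>

lemma second_order_taylor:
  fixes f :: "'e::real_normed_vector \<Rightarrow> real" and f' :: "'e \<Rightarrow> 'e \<Rightarrow>\<^sub>L real" and H :: "'e \<Rightarrow>\<^sub>L 'e \<Rightarrow>\<^sub>L real"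
  assumes S: "convex S" "zb \<in> S"
    and f': "\<And>z. z \<in> S \<Longrightarrow> (f has_derivative blinfun_apply (f' z)) (at z within S)"
    and H: "(f' has_derivative blinfun_apply H) (at zb within S)" and \<eta>: "0 < \<eta>"
  obtains r where "0 < r" "\<And>z. z \<in> S \<Longrightarrow> norm (z - zb) < r \<Longrightarrow>
    \<bar>f z - f zb - f' zb (z - zb) - H (z - zb) (z - zb) / 2\<bar> \<le> \<eta> * (norm (z - zb))\<^sup>2"
proof -
  obtain r where r: "0 < r" "\<And>z. z \<in> S \<Longrightarrow> norm (z - zb) < r \<Longrightarrow> norm (f' z - f' zb - H (z - zb)) \<le> \<eta> * norm (z - zb)"
    using H \<eta> unfolding has_derivative_within_alt by metis
  show ?thesis
  proof (rule that[OF r(1)])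
    fix z assume z: "z \<in> S" "norm (z - zb) < r"
    define h where "h = z - zb"
    define k where "k s = f (zb + s *\<^sub>R h) - s * f' zb h - s\<^sup>2 / 2 * H h h" for s :: real
    define k' where "k' s = f' (zb + s *\<^sub>R h) h - f' zb h - s * H h h" for s :: real
    have seg: "zb + s *\<^sub>R h \<in> S" if "s \<in> {0..1}" for s
    proof -
      have "(1 - s) *\<^sub>R zb + s *\<^sub>R z \<in> S" using that S z by (intro convexD) auto
      then show ?thesis by (simp add: h_def algebra_simps)
    qed
    have "norm (k 1 - k 0) \<le> \<eta> * (norm h)\<^sup>2 * norm (1 - 0 :: real)"
    proof (rule field_differentiable_bound[where S = "{0..1}" and f' = k'])
      fix s :: real assume s: "s \<in> {0..1}"
      have "((\<lambda>s. f (zb + s *\<^sub>R h)) has_derivative (\<lambda>y. f' (zb + s *\<^sub>R h) (y *\<^sub>R h))) (at s within {0..1})"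
        by (rule has_derivative_in_compose2[of S f "\<lambda>z. blinfun_apply (f' z)" "\<lambda>s. zb + s *\<^sub>R h"])
          (use f' seg s in \<open>auto intro!: derivative_eq_intros\<close>)
      then have "((\<lambda>s. f (zb + s *\<^sub>R h)) has_real_derivative f' (zb + s *\<^sub>R h) h) (at s within {0..1})"
        unfolding has_field_derivative_def by (simp add: blinfun.scaleR_right mult_commute_abs)
      then show "(k has_real_derivative k' s) (at s within {0..1})"
        unfolding k_def[abs_def] k'_def by (auto intro!: derivative_eq_intros)
      have "norm (s *\<^sub>R h) \<le> norm h" using s by (simp add: mult_left_le_one_le)
      then have "norm (f' (zb + s *\<^sub>R h) - f' zb - H (s *\<^sub>R h)) \<le> \<eta> * norm (s *\<^sub>R h)"
        using r(2)[OF seg[OF s]] z(2) by (simp add: h_def)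
      also have "\<dots> \<le> \<eta> * norm h" using \<open>norm (s *\<^sub>R h) \<le> norm h\<close> \<eta> by (intro mult_left_mono) auto
      finally have le: "norm (f' (zb + s *\<^sub>R h) - f' zb - H (s *\<^sub>R h)) \<le> \<eta> * norm h" .
      have "k' s = (f' (zb + s *\<^sub>R h) - f' zb - H (s *\<^sub>R h)) h"
        by (simp add: k'_def blinfun.diff_left blinfun.scaleR_left blinfun.scaleR_right)
      then have "norm (k' s) \<le> norm (f' (zb + s *\<^sub>R h) - f' zb - H (s *\<^sub>R h)) * norm h" using norm_blinfun by metis
      also have "\<dots> \<le> \<eta> * norm h * norm h" by (rule mult_right_mono[OF le norm_ge_zero])
      finally show "norm (k' s) \<le> \<eta> * (norm h)\<^sup>2" by (simp add: power2_eq_square mult.assoc)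
    qed auto
    moreover have "k 1 - k 0 = f z - f zb - f' zb h - H h h / 2" by (simp add: k_def h_def)
    ultimately show "\<bar>f z - f zb - f' zb (z - zb) - H (z - zb) (z - zb) / 2\<bar> \<le> \<eta> * (norm (z - zb))\<^sup>2"
      by (simp add: h_def)
  qed
qed

lemma sum_UNIV_Plus: "(\<Sum>k\<in>UNIV. g k) = (\<Sum>i\<in>UNIV. g (Inl i)) + (\<Sum>i\<in>UNIV. g (Inr i))"
  for g :: "'a::finite + 'b::finite \<Rightarrow> real"
  using sum.Plus[of UNIV UNIV g] by (simp add: o_def)

lemma inner_left_right: "v \<bullet> w = left v \<bullet> left w + right v \<bullet> right w"
  by (simp add: inner_vec_def sum_UNIV_Plus left_def right_def)

lemma block_diag_quadratic:
  "w \<bullet> (block_diag X Y *v w) = left w \<bullet> (X *v left w) + right w \<bullet> (Y *v right w)"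
proof -
  have "left (block_diag X Y *v w) = X *v left w" "right (block_diag X Y *v w) = Y *v right w"
    by (simp_all add: vec_eq_iff left_def right_def block_diag_def matrix_vector_mult_def sum_UNIV_Plus)
  then show ?thesis by (simp add: inner_left_right[of w "block_diag X Y *v w"])
qed

lemma linear_left_right: "linear left" "linear right"
  by (auto intro!: linearI simp: left_def right_def vec_eq_iff)

lemma left_join [simp]: "left (join x y) = x" and right_join [simp]: "right (join x y) = y"
  by (simp_all add: left_def right_def join_def vec_eq_iff)

text \<open>At a fixed time the spatial slice of the domain is open, so derivatives relative to
  \<open>{0..T} \<times> \<Omega> \<times> \<Omega>\<close> restrict to ordinary derivatives in
  space, including the times 0 and \<open>T\<close>. The coordinate space of joined vectors enters
  only through the linear map to pairs.\<close>

lemma C2_slice_derivatives: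
  fixes \<phi> :: "real \<Rightarrow> real^'n \<Rightarrow> real^'n \<Rightarrow> real"
    and f' :: "real \<times> (real^'n) \<times> (real^'n) \<Rightarrow> (real \<times> (real^'n) \<times> (real^'n)) \<Rightarrow>\<^sub>L real"
  assumes \<Omega>: "open \<Omega>" and t: "t \<in> {0..T}" and xy: "x \<in> \<Omega>" "y \<in> \<Omega>"
    and f': "\<And>z. z \<in> {0..T} \<times> \<Omega> \<times> \<Omega> \<Longrightarrow>
      ((\<lambda>(t, x, y). \<phi> t x y) has_derivative blinfun_apply (f' z)) (at z within {0..T} \<times> \<Omega> \<times> \<Omega>)"
    and H: "(f' has_derivative blinfun_apply H) (at (t, x, y) within {0..T} \<times> \<Omega> \<times> \<Omega>)"
  shows "grad (\<lambda>x. \<phi> t x y) x \<bullet> h = f' (t, x, y) (0, h, 0)"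
    and "grad (\<lambda>y. \<phi> t x y) y \<bullet> h = f' (t, x, y) (0, 0, h)"
    and "w \<bullet> (hessian_xy (\<phi> t) x y *v w) = H (0, left w, right w) (0, left w, right w)"
proof -
  have riesz: "\<exists>D. \<forall>h. l h = h \<bullet> D" if "linear l" for l :: "real^'k \<Rightarrow> real"
    using adjoint_works[OF that, of _ 1] by (intro exI[of _ "adjoint l 1"]) simp
  have "((\<lambda>x. \<phi> t x y) has_derivative (\<lambda>h. f' (t, x, y) (0, h, 0))) (at x within \<Omega>)"
    by (rule has_derivative_in_compose2[of "{0..T} \<times> \<Omega> \<times> \<Omega>" "\<lambda>(t, x, y). \<phi> t x y" "\<lambda>z. blinfun_apply (f' z)" "\<lambda>x. (t, x, y)", simplified])
      (use f' t xy in \<open>auto intro!: derivative_eq_intros\<close>)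
  then have d1: "((\<lambda>x. \<phi> t x y) has_derivative (\<lambda>h. f' (t, x, y) (0, h, 0))) (at x)"
    using at_within_open[OF xy(1) \<Omega>] by simp
  obtain D1 where D1: "\<And>h. f' (t, x, y) (0, h, 0) = h \<bullet> D1" using riesz[OF has_derivative_linear[OF d1]] by blast
  then have "grad (\<lambda>x. \<phi> t x y) x = D1" using d1 by (intro grad_eqI) (simp add: gderiv_def)
  then show "grad (\<lambda>x. \<phi> t x y) x \<bullet> h = f' (t, x, y) (0, h, 0)" by (simp add: D1 inner_commute)
  have "((\<lambda>y. \<phi> t x y) has_derivative (\<lambda>h. f' (t, x, y) (0, 0, h))) (at y within \<Omega>)"
    by (rule has_derivative_in_compose2[of "{0..T} \<times> \<Omega> \<times> \<Omega>" "\<lambda>(t, x, y). \<phi> t x y" "\<lambda>z. blinfun_apply (f' z)" "\<lambda>y. (t, x, y)", simplified])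
      (use f' t xy in \<open>auto intro!: derivative_eq_intros\<close>)
  then have d2: "((\<lambda>y. \<phi> t x y) has_derivative (\<lambda>h. f' (t, x, y) (0, 0, h))) (at y)"
    using at_within_open[OF xy(2) \<Omega>] by simp
  obtain D2 where D2: "\<And>h. f' (t, x, y) (0, 0, h) = h \<bullet> D2" using riesz[OF has_derivative_linear[OF d2]] by blast
  then have "grad (\<lambda>y. \<phi> t x y) y = D2" using d2 by (intro grad_eqI) (simp add: gderiv_def)
  then show "grad (\<lambda>y. \<phi> t x y) y \<bullet> h = f' (t, x, y) (0, 0, h)" by (simp add: D2 inner_commute)
  define W where "W = {w :: real^('n + 'n). left w \<in> \<Omega> \<and> right w \<in> \<Omega>}"
  define G where "G w = (0::real, left w, right w)" for w :: "real^('n + 'n)"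
  define P where "P w = (t, left w, right w)" for w :: "real^('n + 'n)"
  have bl: "bounded_linear left" "bounded_linear right" for x :: "real^'n"
    using linear_left_right by (simp_all add: linear_conv_bounded_linear)
  have "W = left -` \<Omega> \<inter> right -` \<Omega>" by (auto simp: W_def)
  then have Wopen: "open W"
    using \<Omega> bl by (auto intro!: open_Int open_vimage linear_continuous_on)
  have dP: "(P has_derivative G) (at w within A)" for w A
    unfolding P_def[abs_def] G_def[abs_def]
    by (intro has_derivative_Pair has_derivative_const bounded_linear.has_derivative[OF bl(1)] bounded_linear.has_derivative[OF bl(2)] has_derivative_ident)
  have linG: "linear G" by (rule has_derivative_linear[OF dP])
  have PW: "P ` W \<subseteq> {0..T} \<times> \<Omega> \<times> \<Omega>" using t by (auto simp: P_def W_def)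
  define F where "F w = \<phi> t (left w) (right w)" for w
  define Dv where "Dv w = (\<Sum>i\<in>Basis. f' (P w) (G i) *\<^sub>R i)" for w
  have linrep: "(\<Sum>i\<in>Basis. L (G i) *\<^sub>R i) \<bullet> v = L (G v)" for L :: "(real \<times> (real^'n) \<times> (real^'n)) \<Rightarrow>\<^sub>L real" and v
  proof -
    have "(\<Sum>i\<in>Basis. L (G i) *\<^sub>R i) \<bullet> v = (\<Sum>i\<in>Basis. (v \<bullet> i) * L (G i))"
      by (simp add: inner_sum_left inner_commute[of v] mult.commute)
    also have "\<dots> = L (G (\<Sum>i\<in>Basis. (v \<bullet> i) *\<^sub>R i))"
      by (simp add: linear_sum[OF linG] linear_scale[OF linG] blinfun.sum_right blinfun.scaleR_right)
    finally show ?thesis by (simp add: euclidean_representation)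
  qed
  have gF: "grad F w = Dv w" if w: "w \<in> W" for w
  proof (rule grad_eqI)
    have "((\<lambda>w. (\<lambda>(t, x, y). \<phi> t x y) (P w)) has_derivative (\<lambda>h. f' (P w) (G h))) (at w within W)"
      by (rule has_derivative_in_compose2[OF f' PW w dP])
    then have "(F has_derivative (\<lambda>h. f' (P w) (G h))) (at w)"
      using at_within_open[OF w Wopen] by (simp add: P_def F_def[abs_def])
    then show "GDERIV F w :> Dv w"
      unfolding gderiv_def Dv_def by (simp add: inner_commute[of _ "sum _ _"] linrep)
  qed
  define wb where "wb = join x y"
  have wb: "wb \<in> W" "P wb = (t, x, y)" using xy by (auto simp: W_def wb_def P_def)
  have "((\<lambda>w. f' (P w)) has_derivative (\<lambda>h. H (G h))) (at wb within W)"
    by (rule has_derivative_in_compose[OF dP]) (use has_derivative_subset[OF H PW] wb in simp)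
  then have dfP: "((\<lambda>w. f' (P w)) has_derivative (\<lambda>h. H (G h))) (at wb)"
    using at_within_open[OF wb(1) Wopen] by simp
  have "(Dv has_derivative (\<lambda>h. \<Sum>i\<in>Basis. H (G h) (G i) *\<^sub>R i)) (at wb)"
    unfolding Dv_def[abs_def]
    by (intro has_derivative_sum has_derivative_scaleR_left bounded_linear.has_derivative[OF blinfun.bounded_linear_left] dfP)
  then have dgrad: "(grad F has_derivative (\<lambda>h. \<Sum>i\<in>Basis. H (G h) (G i) *\<^sub>R i)) (at wb)"
    by (rule has_derivative_transform_within_open[OF _ Wopen wb(1)]) (simp add: gF)
  have mat: "matrix (\<lambda>h. \<Sum>i\<in>Basis. H (G h) (G i) *\<^sub>R i) *v h = (\<Sum>i\<in>Basis. H (G h) (G i) *\<^sub>R i)" for h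
    using fun_cong[OF matrix_vector_mul(2)[OF has_derivative_linear[OF dgrad]], of h] .
  have "hessian F wb = matrix (\<lambda>h. \<Sum>i\<in>Basis. H (G h) (G i) *\<^sub>R i)"
    by (rule hessian_eqI) (use dgrad in \<open>simp add: mat\<close>)
  then have "hessian_xy (\<phi> t) x y = matrix (\<lambda>h. \<Sum>i\<in>Basis. H (G h) (G i) *\<^sub>R i)"
    by (simp only: hessian_xy_def F_def[abs_def] wb_def)
  then have "hessian_xy (\<phi> t) x y *v w = (\<Sum>i\<in>Basis. H (G w) (G i) *\<^sub>R i)"
    by (simp only: mat)
  then show "w \<bullet> (hessian_xy (\<phi> t) x y *v w) = H (0, left w, right w) (0, left w, right w)"
    using linrep[of "H (G w)" w] by (simp add: inner_commute[of w] G_def)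
qed

lemma F_min_le:
  assumes "continuous_on (cball x r) (\<lambda>x'. F t x' w p X)" "0 \<le> r" "z \<in> cball x r"
  shows "F_min F r t x w p X \<le> F t z w p X"
proof -
  obtain y where y: "y \<in> cball x r" "\<And>z. z \<in> cball x r \<Longrightarrow> F t y w p X \<le> F t z w p X"
    using continuous_attains_inf[OF compact_cball _ assms(1)] assms(3) by blast
  then have "F_min F r t x w p X = F t y w p X"
    unfolding F_min_def by (intro Least_equality) auto
  then show ?thesis using y(2)[OF assms(3)] by simp
qed

lemma F_max_ge:
  assumes "continuous_on (cball x r) (\<lambda>x'. F t x' w p X)" "0 \<le> r" "z \<in> cball x r"
  shows "F t z w p X \<le> F_max F r t x w p X"
proof -
  obtain y where y: "y \<in> cball x r" "\<And>z. z \<in> cball x r \<Longrightarrow> F t z w p X \<le> F t y w p X"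
    using continuous_attains_sup[OF compact_cball _ assms(1)] assms(3) by blast
  then have "F_max F r t x w p X = F t y w p X"
    unfolding F_max_def by (intro Greatest_equality) auto
  then show ?thesis using y(2)[OF assms(3)] by simp
qed

text \<open>A segment from \<open>x\<close> to a point outside \<open>\<Omega>\<close> crosses the
  frontier.\<close>

lemma ball_infdist_frontier_subset:
  fixes x :: "'a::euclidean_space"
  assumes "x \<in> \<Omega>"
  shows "ball x (infdist x (frontier \<Omega>)) \<subseteq> \<Omega>"
proof
  fix y assume y: "y \<in> ball x (infdist x (frontier \<Omega>))"
  show "y \<in> \<Omega>"
  proof (rule ccontr)
    assume "y \<notin> \<Omega>"
    then have "closed_segment x y \<inter> frontier \<Omega> \<noteq> {}"
      using assms by (intro connected_Int_frontier) auto
    then obtain z where z: "z \<in> closed_segment x y" "z \<in> frontier \<Omega>" by blast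
    have "infdist x (frontier \<Omega>) \<le> dist x z" by (rule infdist_le[OF z(2)])
    also have "\<dots> \<le> dist x y" using dist_in_closed_segment(1)[OF z(1)] by (simp add: dist_commute)
    finally show False using y by simp
  qed
qed

lemma sup_conv_uminus: "sup_conv \<epsilon> \<Omega> (\<lambda>t x. - v t x) t x = - inf_conv \<epsilon> \<Omega> v t x"
proof -
  have "(\<lambda>x'. - v t x' - inverse \<epsilon> * (norm (x - x'))\<^sup>2) ` \<Omega>
      = uminus ` ((\<lambda>x'. v t x' + inverse \<epsilon> * (norm (x - x'))\<^sup>2) ` \<Omega>)"
    by (force simp: image_image)
  then show ?thesis unfolding sup_conv_def inf_conv_def Inf_real_def by (simp add: image_image)
qed

lemma lsc_on_imp_usc_on_uminus: "lsc_on S f \<Longrightarrow> usc_on S (\<lambda>z. - f z)"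
  unfolding lsc_on_def usc_on_def by (metis (no_types, lifting) Collect_cong minus_less_iff)


text \<open>A lower bound for each matrix and an upper bound for the sum of the two forms confine
  both matrices to a compact set. The number \<open>I\<close> stands for the nonlocal part, which is
  the same for all members of the sequence.\<close>

lemma sym_matrix_pair_limit:
  fixes X1 X2 :: "nat \<Rightarrow> real^'n^'n" and x y :: "nat \<Rightarrow> 'a::metric_space"
  assumes X: "\<And>n. X1 n \<in> sym_mats" "\<And>n. X2 n \<in> sym_mats"
    and lower: "\<And>n \<xi>. - L * (norm \<xi>)\<^sup>2 \<le> \<xi> \<bullet> (X1 n *v \<xi>)" "\<And>n \<xi>. - L * (norm \<xi>)\<^sup>2 \<le> \<xi> \<bullet> (X2 n *v \<xi>)"
    and upper: "\<And>n \<xi> \<zeta>. \<xi> \<bullet> (X1 n *v \<xi>) + \<zeta> \<bullet> (X2 n *v \<zeta>) \<le> q \<xi> \<zeta> + e n * ((norm \<xi>)\<^sup>2 + (norm \<zeta>)\<^sup>2)"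
    and q: "\<And>\<xi> \<zeta>. q \<xi> \<zeta> \<le> C * ((norm \<xi>)\<^sup>2 + (norm \<zeta>)\<^sup>2)"
    and e: "e \<longlonglongrightarrow> 0" "\<And>n. e n \<le> E"
    and K: "compact K1" "compact K2" "\<And>n. x n \<in> K1" "\<And>n. y n \<in> K2"
    and cont: "continuous_on (K1 \<times> sym_mats) (\<lambda>(x, X). g1 x X)" "continuous_on (K2 \<times> sym_mats) (\<lambda>(x, X). g2 x X)"
    and le: "\<And>n. I + g1 (x n) (X1 n) + g2 (y n) (X2 n) \<le> (0::real)"
  shows "\<exists>X\<in>sym_mats. \<exists>Y\<in>sym_mats. \<exists>x\<in>K1. \<exists>y\<in>K2.
    (\<forall>\<xi>. - L * (norm \<xi>)\<^sup>2 \<le> \<xi> \<bullet> (X *v \<xi>)) \<and> (\<forall>\<xi>. - L * (norm \<xi>)\<^sup>2 \<le> \<xi> \<bullet> (Y *v \<xi>)) \<and>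
    (\<forall>\<xi> \<zeta>. \<xi> \<bullet> (X *v \<xi>) + \<zeta> \<bullet> (Y *v \<zeta>) \<le> q \<xi> \<zeta>) \<and> I + g1 x X + g2 y Y \<le> 0"
proof -
  define D where "D = \<bar>C\<bar> + \<bar>E\<bar> + \<bar>L\<bar>"
  have D: "0 \<le> D" by (simp add: D_def)
  have up: "q \<xi> \<zeta> + e n * ((norm \<xi>)\<^sup>2 + (norm \<zeta>)\<^sup>2) \<le> (\<bar>C\<bar> + \<bar>E\<bar>) * ((norm \<xi>)\<^sup>2 + (norm \<zeta>)\<^sup>2)" for n \<xi> \<zeta>
  proof -
    have "C * ((norm \<xi>)\<^sup>2 + (norm \<zeta>)\<^sup>2) \<le> \<bar>C\<bar> * ((norm \<xi>)\<^sup>2 + (norm \<zeta>)\<^sup>2)" by (intro mult_right_mono) auto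
    moreover have "e n * ((norm \<xi>)\<^sup>2 + (norm \<zeta>)\<^sup>2) \<le> \<bar>E\<bar> * ((norm \<xi>)\<^sup>2 + (norm \<zeta>)\<^sup>2)"
      using e(2)[of n] by (intro mult_right_mono) auto
    ultimately show ?thesis using q[of \<xi> \<zeta>] by (simp add: distrib_right)
  qed
  have bound: "\<bar>s\<bar> \<le> D * (norm \<xi>)\<^sup>2" if "- L * (norm \<xi>)\<^sup>2 \<le> s" "s \<le> (\<bar>C\<bar> + \<bar>E\<bar>) * (norm \<xi>)\<^sup>2" for s and \<xi> :: "real^'n"
  proof -
    have "L * (norm \<xi>)\<^sup>2 \<le> \<bar>L\<bar> * (norm \<xi>)\<^sup>2" by (intro mult_right_mono) auto
    moreover have "0 \<le> (\<bar>C\<bar> + \<bar>E\<bar>) * (norm \<xi>)\<^sup>2" "0 \<le> \<bar>L\<bar> * (norm \<xi>)\<^sup>2" by simp_all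
    moreover have "D * (norm \<xi>)\<^sup>2 = (\<bar>C\<bar> + \<bar>E\<bar>) * (norm \<xi>)\<^sup>2 + \<bar>L\<bar> * (norm \<xi>)\<^sup>2" by (simp add: D_def distrib_right)
    ultimately show ?thesis using that by linarith
  qed
  define B where "B = real CARD('n) * (real CARD('n) * (2 * D))"
  have "\<xi> \<bullet> (X1 n *v \<xi>) \<le> (\<bar>C\<bar> + \<bar>E\<bar>) * (norm \<xi>)\<^sup>2" for n \<xi>
    using upper[of \<xi> n 0] up[of \<xi> 0 n] by simp
  then have "\<bar>\<xi> \<bullet> (X1 n *v \<xi>)\<bar> \<le> D * (norm \<xi>)\<^sup>2" for n \<xi>
    by (rule bound[OF lower(1)])
  then have B1: "X1 n \<in> cball 0 B" for n
    using sym_matrix_norm_le[of "X1 n" D] X(1)[of n] D by (simp add: B_def sym_mats_def)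
  have "\<xi> \<bullet> (X2 n *v \<xi>) \<le> (\<bar>C\<bar> + \<bar>E\<bar>) * (norm \<xi>)\<^sup>2" for n \<xi>
    using upper[of 0 n \<xi>] up[of 0 \<xi> n] by simp
  then have "\<bar>\<xi> \<bullet> (X2 n *v \<xi>)\<bar> \<le> D * (norm \<xi>)\<^sup>2" for n \<xi>
    by (rule bound[OF lower(2)])
  then have B2: "X2 n \<in> cball 0 B" for n
    using sym_matrix_norm_le[of "X2 n" D] X(2)[of n] D by (simp add: B_def sym_mats_def)
  have "seq_compact (K1 \<times> K2 \<times> (cball 0 B :: (real^'n^'n) set) \<times> (cball 0 B :: (real^'n^'n) set))"
    by (intro compact_imp_seq_compact compact_Times K compact_cball)
  moreover have "\<forall>n. (x n, y n, X1 n, X2 n) \<in> K1 \<times> K2 \<times> cball 0 B \<times> cball 0 B"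
    using K B1 B2 by blast
  ultimately obtain l k where l: "l \<in> K1 \<times> K2 \<times> (cball 0 B :: (real^'n^'n) set) \<times> (cball 0 B :: (real^'n^'n) set)" and k: "strict_mono k"
    and lim: "((\<lambda>n. (x n, y n, X1 n, X2 n)) \<circ> k) \<longlonglongrightarrow> l"
    by (rule seq_compactE) blast
  obtain xl yl X Y where leq: "l = (xl, yl, X, Y)" by (cases l)
  have xl: "(\<lambda>n. x (k n)) \<longlonglongrightarrow> xl" "(\<lambda>n. y (k n)) \<longlonglongrightarrow> yl"
    and Xl: "(\<lambda>n. X1 (k n)) \<longlonglongrightarrow> X" "(\<lambda>n. X2 (k n)) \<longlonglongrightarrow> Y"
    using tendsto_fst[OF lim] tendsto_fst[OF tendsto_snd[OF lim]] tendsto_fst[OF tendsto_snd[OF tendsto_snd[OF lim]]]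
      tendsto_snd[OF tendsto_snd[OF tendsto_snd[OF lim]]] by (simp_all add: o_def leq)
  have xyK: "xl \<in> K1" "yl \<in> K2" using l leq by auto
  have sym: "X \<in> sym_mats" "Y \<in> sym_mats"
    using transpose_limit[OF Xl(1)] transpose_limit[OF Xl(2)] X by (simp_all add: sym_mats_def)
  have g1: "(\<lambda>n. g1 (x (k n)) (X1 (k n))) \<longlonglongrightarrow> g1 xl X"
    using continuous_on_tendsto_compose[OF cont(1) tendsto_Pair[OF xl(1) Xl(1)]] xyK sym X K(3) by simp
  have g2: "(\<lambda>n. g2 (y (k n)) (X2 (k n))) \<longlonglongrightarrow> g2 yl Y"
    using continuous_on_tendsto_compose[OF cont(2) tendsto_Pair[OF xl(2) Xl(2)]] xyK sym X K(4) by simp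
  have "\<xi> \<bullet> (X *v \<xi>) + \<zeta> \<bullet> (Y *v \<zeta>) \<le> q \<xi> \<zeta>" for \<xi> \<zeta>
  proof (rule LIMSEQ_le)
    show "(\<lambda>n. \<xi> \<bullet> (X1 (k n) *v \<xi>) + \<zeta> \<bullet> (X2 (k n) *v \<zeta>)) \<longlonglongrightarrow> \<xi> \<bullet> (X *v \<xi>) + \<zeta> \<bullet> (Y *v \<zeta>)"
      by (intro tendsto_add tendsto_quadratic_form Xl)
    have "(\<lambda>n. q \<xi> \<zeta> + e (k n) * ((norm \<xi>)\<^sup>2 + (norm \<zeta>)\<^sup>2)) \<longlonglongrightarrow> q \<xi> \<zeta> + 0 * ((norm \<xi>)\<^sup>2 + (norm \<zeta>)\<^sup>2)"
      by (intro tendsto_intros tendsto_subseq[OF k e(1)])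
    then show "(\<lambda>n. q \<xi> \<zeta> + e (k n) * ((norm \<xi>)\<^sup>2 + (norm \<zeta>)\<^sup>2)) \<longlonglongrightarrow> q \<xi> \<zeta>" by simp
  qed (use upper in blast)
  moreover have "- L * (norm \<xi>)\<^sup>2 \<le> \<xi> \<bullet> (X *v \<xi>)" "- L * (norm \<xi>)\<^sup>2 \<le> \<xi> \<bullet> (Y *v \<xi>)" for \<xi>
    using LIMSEQ_le_const[OF tendsto_quadratic_form[OF Xl(1)], of "- L * (norm \<xi>)\<^sup>2" \<xi>]
      LIMSEQ_le_const[OF tendsto_quadratic_form[OF Xl(2)], of "- L * (norm \<xi>)\<^sup>2" \<xi>] lower by blast+
  moreover have "I + g1 xl X + g2 yl Y \<le> 0"
    by (rule LIMSEQ_le_const2[OF tendsto_add[OF tendsto_add[OF tendsto_const g1] g2]]) (use le in blast)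
  ultimately show ?thesis using sym xyK by blast
qed


lemma le_sup_sqrt:
  assumes "bounded ((\<lambda>(t, x). u t x) ` S)" "sqrt (2 * (SUP (t, x)\<in>S. \<bar>u t x\<bar>)) \<le> M" "(t, x) \<in> S"
  shows "\<bar>u t x :: real\<bar> \<le> M\<^sup>2 / 2"
proof -
  obtain B where "\<And>z. z \<in> S \<Longrightarrow> \<bar>case z of (t, x) \<Rightarrow> u t x\<bar> \<le> B"
    using assms(1) unfolding bounded_iff by fastforce
  then have "bdd_above ((\<lambda>(t, x). \<bar>u t x\<bar>) ` S)" by (intro bdd_aboveI2[of _ _ B]) (force simp: case_prod_unfold)
  then have "\<bar>u t x\<bar> \<le> (SUP (t, x)\<in>S. \<bar>u t x\<bar>)" using cSUP_upper[OF assms(3), of "\<lambda>(t, x). \<bar>u t x\<bar>"] by simp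
  moreover have "2 * (SUP (t, x)\<in>S. \<bar>u t x\<bar>) \<le> M\<^sup>2" by (rule sqrt_le_D[OF assms(2)])
  ultimately show ?thesis by simp
qed

lemma uminus_sym_mats: "X \<in> sym_mats \<Longrightarrow> - X \<in> sym_mats"
  by (simp add: sym_mats_def transpose_def vec_eq_iff)

lemma continuous_on_reflected:
  fixes F :: "real \<Rightarrow> real^'n \<Rightarrow> real \<Rightarrow> real^'n \<Rightarrow> real^'n^'n \<Rightarrow> real"
  assumes "continuous_on (S \<times> \<Omega> \<times> UNIV \<times> UNIV \<times> sym_mats) (\<lambda>(t, x, w, p, X). F t x w p X)"
  shows "continuous_on (S \<times> \<Omega> \<times> UNIV \<times> UNIV \<times> sym_mats) (\<lambda>(t, x, w, p, X). - F t x (- w) (- p) (- X))"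
proof -
  have "continuous_on (S \<times> \<Omega> \<times> UNIV \<times> UNIV \<times> sym_mats)
      (\<lambda>z. - (\<lambda>(t, x, w, p, X). F t x w p X) ((\<lambda>(t, x, w, p, X). (t, x, - w, - p, - X)) z))"
    by (intro continuous_on_minus continuous_on_compose2[OF assms])
      (auto simp: case_prod_unfold uminus_sym_mats intro!: continuous_intros)
  then show ?thesis by (simp add: case_prod_unfold)
qed


section \<open>Reduction of a general test function to a separated quadratic one\<close>

text \<open>The spatial block of the second differential, symmetrised so that it is a symmetric form
  with unchanged diagonal values. The coefficient 5 is composed of 2 for the Taylor remainder, 2 for
  the strictness that is to be created, and 1 for Young's inequality on the mixed terms.\<close>

definition majorant_form ::
  "((real \<times> 'e::real_inner) \<Rightarrow>\<^sub>L (real \<times> 'e) \<Rightarrow>\<^sub>L real) \<Rightarrow> real \<Rightarrow> 'e \<Rightarrow> 'e \<Rightarrow> real" where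
  "majorant_form H \<eta> w w' = (H (0, w) (0, w') + H (0, w') (0, w)) / 2 + 5 * \<eta> * (w \<bullet> w')"

lemma majorant_form_bilinear: "bilinear (majorant_form H \<eta>)"
proof -
  have "H z (0, a + b) = H z (0, a) + H z (0, b)" "H (0, a + b) z = H (0, a) z + H (0, b) z"
    "H z (0, k *\<^sub>R a) = k * H z (0, a)" "H (0, k *\<^sub>R a) z = k * H (0, a) z" for a b :: 'a and k z
    using blinfun.add_right[of "H z" "(0, a)" "(0, b)"] blinfun.add_left[of "H (0, a)" "H (0, b)" z]
      blinfun.add_right[of H "(0, a)" "(0, b)"] blinfun.scaleR_right[of "H z" k "(0, a)"]
      blinfun.scaleR_left[of k "H (0, a)" z] blinfun.scaleR_right[of H k "(0, a)"] by simp_all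
  then show ?thesis
    unfolding bilinear_def majorant_form_def
    by (intro conjI allI linearI; simp add: inner_add_left inner_add_right algebra_simps add_divide_distrib)
qed

lemma majorant_form_commute: "majorant_form H \<eta> w w' = majorant_form H \<eta> w' w"
  by (simp add: majorant_form_def inner_commute add.commute)

text \<open>The mixed time-space part of the second differential is absorbed by Young's inequality; this is
  what makes the majorant a sum of a function of time and a function of space.\<close>

lemma second_differential_le:
  fixes H :: "(real \<times> 'e::real_inner) \<Rightarrow>\<^sub>L (real \<times> 'e) \<Rightarrow>\<^sub>L real"
  assumes \<eta>: "0 < \<eta>"
  shows "H (\<tau>, w) (\<tau>, w) + 2 * \<eta> * (\<tau>\<^sup>2 + (norm w)\<^sup>2)
    \<le> 2 * ((norm H + (norm H)\<^sup>2 / \<eta>) / 2 + 2 * \<eta>) * \<tau>\<^sup>2 + majorant_form H \<eta> w w - 2 * \<eta> * (\<tau>\<^sup>2 + (norm w)\<^sup>2)"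
proof -
  have bd: "\<bar>H z z'\<bar> \<le> norm H * norm z * norm z'" for z z'
    using norm_blinfun[of "H z" z'] mult_right_mono[OF norm_blinfun[of H z] norm_ge_zero[of z']] by simp
  have n: "norm (\<tau>, 0 :: 'e) = \<bar>\<tau>\<bar>" "norm (0 :: real, w) = norm w" by (simp_all add: norm_Pair)
  have "H (\<tau>, w) (\<tau>, w) = H ((\<tau>, 0) + (0, w)) ((\<tau>, 0) + (0, w))" by simp
  also have "\<dots> = H (\<tau>, 0) (\<tau>, 0) + H (\<tau>, 0) (0, w) + H (0, w) (\<tau>, 0) + H (0, w) (0, w)"
    unfolding blinfun.add_left blinfun.add_right by simp
  finally have e: "H (\<tau>, w) (\<tau>, w) = H (\<tau>, 0) (\<tau>, 0) + H (\<tau>, 0) (0, w) + H (0, w) (\<tau>, 0) + H (0, w) (0, w)" .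
  have "\<bar>H (\<tau>, 0) (\<tau>, 0)\<bar> \<le> norm H * \<tau>\<^sup>2"
    using bd[of "(\<tau>, 0)" "(\<tau>, 0)"] unfolding n by (simp add: power2_eq_square mult.assoc)
  then have e1: "H (\<tau>, 0) (\<tau>, 0) \<le> norm H * \<tau>\<^sup>2" by (rule abs_le_D1)
  have e2: "H (\<tau>, 0) (0, w) \<le> norm H * \<bar>\<tau>\<bar> * norm w"
    using abs_le_D1[OF bd[of "(\<tau>, 0)" "(0, w)"]] unfolding n .
  have e3: "H (0, w) (\<tau>, 0) \<le> norm H * \<bar>\<tau>\<bar> * norm w"
    using abs_le_D1[OF bd[of "(0, w)" "(\<tau>, 0)"]] unfolding n by (simp add: mult.assoc mult.commute[of "norm w"])
  have "0 \<le> (norm H * \<bar>\<tau>\<bar> - \<eta> * norm w)\<^sup>2 / \<eta>" using \<eta> by simp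
  also have "\<dots> = (norm H)\<^sup>2 / \<eta> * \<tau>\<^sup>2 - 2 * (norm H * \<bar>\<tau>\<bar> * norm w) + \<eta> * (norm w)\<^sup>2"
    using \<eta> by (simp add: power2_diff power_mult_distrib field_simps power2_eq_square)
  finally have e4: "2 * (norm H * \<bar>\<tau>\<bar> * norm w) \<le> (norm H)\<^sup>2 / \<eta> * \<tau>\<^sup>2 + \<eta> * (norm w)\<^sup>2" by linarith
  have m: "majorant_form H \<eta> w w = H (0, w) (0, w) + 5 * \<eta> * (norm w)\<^sup>2"
    by (simp add: majorant_form_def power2_norm_eq_inner)
  have "2 * ((norm H + (norm H)\<^sup>2 / \<eta>) / 2 + 2 * \<eta>) * \<tau>\<^sup>2 = norm H * \<tau>\<^sup>2 + (norm H)\<^sup>2 / \<eta> * \<tau>\<^sup>2 + 4 * \<eta> * \<tau>\<^sup>2"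
    by (simp add: distrib_left distrib_right)
  then show ?thesis using e1 e2 e3 e4 unfolding e m distrib_left by linarith
qed

text \<open>The Taylor remainder \<open>\<eta>\<close> times the squared distance is absorbed by
  \<open>second_differential_le\<close>, which leaves a surplus of the same size; this surplus is
  the strictness of the new maximum. The price is a larger time curvature \<open>c\<close>, which
  grows as \<open>\<eta>\<close> tends to 0 but does not occur in the conclusion drawn from the
  model situation.\<close>

lemma doubled_data_of_C2:
  fixes \<phi> :: "real \<Rightarrow> real^'n \<Rightarrow> real^'n \<Rightarrow> real"
    and f' :: "real \<times> (real^'n) \<times> (real^'n) \<Rightarrow> (real \<times> (real^'n) \<times> (real^'n)) \<Rightarrow>\<^sub>L real"
  assumes A: "sup_conv_data T \<epsilon> M0 \<Omega> u1" and B: "sup_conv_data T \<epsilon> M0 \<Omega> u2"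
    and tb: "tb \<in> {0<..T}" and \<Omega>: "open \<Omega>"
    and r: "sqrt (2 * M0 * \<epsilon>) < r" "cball xb r \<subseteq> \<Omega>" "cball yb r \<subseteq> \<Omega>"
    and f': "\<And>z. z \<in> {0..T} \<times> \<Omega> \<times> \<Omega> \<Longrightarrow>
      ((\<lambda>(t, x, y). \<phi> t x y) has_derivative blinfun_apply (f' z)) (at z within {0..T} \<times> \<Omega> \<times> \<Omega>)"
    and H: "(f' has_derivative blinfun_apply H) (at (tb, xb, yb) within {0..T} \<times> \<Omega> \<times> \<Omega>)"
    and d: "0 < d" and max: "\<And>t x y. t \<in> {0..T} \<Longrightarrow> x \<in> ball xb d \<Longrightarrow> y \<in> ball yb d \<Longrightarrow>
      sup_conv \<epsilon> \<Omega> u1 t x + sup_conv \<epsilon> \<Omega> u2 t y - \<phi> t x y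
      \<le> sup_conv \<epsilon> \<Omega> u1 tb xb + sup_conv \<epsilon> \<Omega> u2 tb yb - \<phi> tb xb yb"
    and \<eta>: "0 < \<eta>"
  shows "\<exists>r0 c. doubled_data T \<epsilon> M0 \<Omega> u1 u2 tb r r0 \<eta> (f' (tb, xb, yb) (1, 0, 0)) c xb yb
    (grad (\<lambda>x. \<phi> tb x yb) xb) (grad (\<lambda>y. \<phi> tb xb y) yb) (majorant_form H \<eta>)"
proof -
  interpret A: sup_conv_data T \<epsilon> M0 \<Omega> u1 by (rule A)
  let ?rad = "sqrt (2 * M0 * \<epsilon>)" and ?zb = "(tb, xb, yb)"
  let ?P1 = "grad (\<lambda>x. \<phi> tb x yb) xb" and ?P2 = "grad (\<lambda>y. \<phi> tb xb y) yb"
  have rad0: "0 \<le> ?rad" using A.rad(1) by (simp add: A.rad_def)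
  have rpos: "0 < r" by (rule le_less_trans[OF rad0 r(1)])
  define d1 where "d1 = min d r"
  have d1: "0 < d1" "d1 \<le> d" "d1 \<le> r" using d rpos by (simp_all add: d1_def)
  have xyb: "xb \<in> \<Omega>" "yb \<in> \<Omega>" using r(2,3) rpos by auto
  define S where "S = {0..T} \<times> ball xb d1 \<times> ball yb d1"
  have sub: "S \<subseteq> {0..T} \<times> \<Omega> \<times> \<Omega>" using r(2,3) d1(3) by (force simp: S_def)
  have zb: "?zb \<in> S" using tb d1 by (simp add: S_def)
  have conv: "convex S" unfolding S_def by (intro convex_Times convex_ball) auto
  obtain d2 where d2: "0 < d2" "\<And>z. z \<in> S \<Longrightarrow> norm (z - ?zb) < d2 \<Longrightarrow>
      \<bar>(case z of (t, x, y) \<Rightarrow> \<phi> t x y) - (case ?zb of (t, x, y) \<Rightarrow> \<phi> t x y) - f' ?zb (z - ?zb) - H (z - ?zb) (z - ?zb) / 2\<bar>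
        \<le> \<eta> * (norm (z - ?zb))\<^sup>2"
  proof (rule second_order_taylor[OF conv zb _ _ \<eta>, of "\<lambda>(t, x, y). \<phi> t x y" f' H])
    show "((\<lambda>(t, x, y). \<phi> t x y) has_derivative blinfun_apply (f' z)) (at z within S)" if "z \<in> S" for z
      using has_derivative_subset[OF f' sub] that sub by blast
    show "(f' has_derivative blinfun_apply H) (at ?zb within S)" by (rule has_derivative_subset[OF H sub])
  qed (use that in blast)
  \<comment> \<open>The Taylor estimate holds within \<open>d2\<close> of the maximum point. The
    distance is at most the sum of three components of size \<open>r0\<close>, and
    \<open>r0 \<le> d2 / 4\<close> leaves a margin.\<close>
  define r0 where "r0 = min ((r - ?rad) / 2) (min (d1 / 2) (d2 / 4))"
  have r0: "0 < r0" "r0 < r - ?rad" "r0 < d1" "3 * r0 < d2" using d1 d2(1) r(1) by (auto simp: r0_def min_def)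
  define c where "c = (norm H + (norm H)\<^sup>2 / \<eta>) / 2 + 2 * \<eta>"
  have grads: "?P1 \<bullet> h = f' ?zb (0, h, 0)" "?P2 \<bullet> h = f' ?zb (0, 0, h)" for h
    using C2_slice_derivatives(1,2)[OF \<Omega> _ xyb f' H] tb by auto
  have strict: "sup_conv \<epsilon> \<Omega> u1 t x + sup_conv \<epsilon> \<Omega> u2 t y
      - (f' ?zb (1, 0, 0) * (t - tb) + c * (t - tb)\<^sup>2 + ?P1 \<bullet> (x - xb) + ?P2 \<bullet> (y - yb)
        + majorant_form H \<eta> (x - xb, y - yb) (x - xb, y - yb) / 2)
      \<le> sup_conv \<epsilon> \<Omega> u1 tb xb + sup_conv \<epsilon> \<Omega> u2 tb yb - \<eta> * ((t - tb)\<^sup>2 + (norm (x - xb))\<^sup>2 + (norm (y - yb))\<^sup>2)"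
    if t: "t \<in> {0..T}" and b: "\<bar>t - tb\<bar> \<le> r0" "norm (x - xb) \<le> r0" "norm (y - yb) \<le> r0" for t x y
  proof -
    let ?w = "(x - xb, y - yb)"
    let ?h = "(t - tb, ?w)"
    have inb: "x \<in> ball xb d1" "y \<in> ball yb d1" using b r0(3) by (simp_all add: dist_norm norm_minus_commute)
    have inS: "(t, x, y) \<in> S" using inb t by (simp add: S_def)
    have "norm ?h \<le> \<bar>t - tb\<bar> + norm ?w" using norm_Pair_le[of "t - tb" ?w] by simp
    also have "\<dots> \<le> \<bar>t - tb\<bar> + (norm (x - xb) + norm (y - yb))" by (intro add_left_mono norm_Pair_le)
    finally have small: "norm ?h < d2" using b r0(4) by linarith
    have nh: "(norm ?h)\<^sup>2 = (t - tb)\<^sup>2 + (norm ?w)\<^sup>2" by (simp add: norm_Pair)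
    have nw: "(norm ?w)\<^sup>2 = (norm (x - xb))\<^sup>2 + (norm (y - yb))\<^sup>2" by (simp add: norm_Pair)
    have "\<bar>\<phi> t x y - \<phi> tb xb yb - f' ?zb ?h - H ?h ?h / 2\<bar> \<le> \<eta> * (norm ?h)\<^sup>2"
      using d2(2)[OF inS] small by simp
    then have T1: "\<phi> t x y - \<phi> tb xb yb - f' ?zb ?h - H ?h ?h / 2 \<le> \<eta> * (norm ?h)\<^sup>2" by (rule abs_le_D1)
    have "?h = (t - tb) *\<^sub>R (1, 0, 0) + (0, x - xb, 0) + (0, 0, y - yb)" by simp
    then have "f' ?zb ?h = f' ?zb ((t - tb) *\<^sub>R (1, 0, 0) + (0, x - xb, 0) + (0, 0, y - yb))" by simp
    also have "\<dots> = f' ?zb (1, 0, 0) * (t - tb) + ?P1 \<bullet> (x - xb) + ?P2 \<bullet> (y - yb)"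
      unfolding blinfun.add_right blinfun.scaleR_right grads by simp
    finally have T2: "f' ?zb ?h = f' ?zb (1, 0, 0) * (t - tb) + ?P1 \<bullet> (x - xb) + ?P2 \<bullet> (y - yb)" .
    have T3: "H ?h ?h + 2 * (\<eta> * (norm ?h)\<^sup>2) \<le> 2 * (c * (t - tb)\<^sup>2) + majorant_form H \<eta> ?w ?w - 2 * (\<eta> * (norm ?h)\<^sup>2)"
      using second_differential_le[OF \<eta>, of H "t - tb" ?w] by (simp only: nh c_def mult.assoc)
    have T4: "sup_conv \<epsilon> \<Omega> u1 t x + sup_conv \<epsilon> \<Omega> u2 t y - \<phi> t x y
      \<le> sup_conv \<epsilon> \<Omega> u1 tb xb + sup_conv \<epsilon> \<Omega> u2 tb yb - \<phi> tb xb yb"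
      using inb d1(2) by (intro max t) auto
    have T5: "\<eta> * (norm ?h)\<^sup>2 = \<eta> * ((t - tb)\<^sup>2 + (norm (x - xb))\<^sup>2 + (norm (y - yb))\<^sup>2)"
      unfolding nh nw by (simp add: add.assoc)
    show ?thesis using T1 T2 T3 T4 T5 by linarith
  qed
  have "doubled_data T \<epsilon> M0 \<Omega> u1 u2 tb r r0 \<eta> (f' ?zb (1, 0, 0)) c xb yb ?P1 ?P2 (majorant_form H \<eta>)"
    by (intro doubled_data.intro doubled_data_axioms.intro A B majorant_form_bilinear majorant_form_commute)
      (use tb r0 r \<eta> strict in \<open>simp_all add: A.rad_def\<close>)
  then show ?thesis by blast
qed

text \<open>The margin \<open>1 / (n + 1)\<close> tends to 0. The majorant forms decrease to the
  spatial second differential, while the function \<open>f\<close>, and with it the nonlocal part,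
  does not depend on \<open>n\<close>; only the matrices and the points in the balls vary, and
  \<open>sym_matrix_pair_limit\<close> takes care of them.\<close>

lemma sup_conv_maximum_inequality:
  fixes \<phi> :: "real \<Rightarrow> real^'n \<Rightarrow> real^'n \<Rightarrow> real"
    and f' :: "real \<times> (real^'n) \<times> (real^'n) \<Rightarrow> (real \<times> (real^'n) \<times> (real^'n)) \<Rightarrow>\<^sub>L real"
  assumes A: "sup_conv_data T \<epsilon> M0 \<Omega> u1" and B: "sup_conv_data T \<epsilon> M0 \<Omega> u2"
    and tb: "tb \<in> {0<..T}" and \<Omega>: "open \<Omega>"
    and r: "sqrt (2 * M0 * \<epsilon>) < r" "cball xb r \<subseteq> \<Omega>" "cball yb r \<subseteq> \<Omega>"
    and f': "\<And>z. z \<in> {0..T} \<times> \<Omega> \<times> \<Omega> \<Longrightarrow>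
      ((\<lambda>(t, x, y). \<phi> t x y) has_derivative blinfun_apply (f' z)) (at z within {0..T} \<times> \<Omega> \<times> \<Omega>)"
    and H: "(f' has_derivative blinfun_apply H) (at (tb, xb, yb) within {0..T} \<times> \<Omega> \<times> \<Omega>)"
    and d: "0 < d" and max: "\<And>t x y. t \<in> {0..T} \<Longrightarrow> x \<in> ball xb d \<Longrightarrow> y \<in> ball yb d \<Longrightarrow>
      sup_conv \<epsilon> \<Omega> u1 t x + sup_conv \<epsilon> \<Omega> u2 t y - \<phi> t x y
      \<le> sup_conv \<epsilon> \<Omega> u1 tb xb + sup_conv \<epsilon> \<Omega> u2 tb yb - \<phi> tb xb yb"
    and \<alpha>: "0 < \<alpha>" "\<alpha> < 1"
    and test: "touch_test \<alpha> T \<Omega> G1 u1" "touch_test \<alpha> T \<Omega> G2 u2"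
    and cont1: "continuous_on ({0<..T} \<times> \<Omega> \<times> UNIV \<times> UNIV \<times> sym_mats) (\<lambda>(t, x, w, p, X). G1 t x w p X)"
    and cont2: "continuous_on ({0<..T} \<times> \<Omega> \<times> UNIV \<times> UNIV \<times> sym_mats) (\<lambda>(t, x, w, p, X). G2 t x w p X)"
    and mono1: "\<And>t x p X w1 w2. t \<in> {0<..T} \<Longrightarrow> x \<in> \<Omega> \<Longrightarrow> X \<in> sym_mats \<Longrightarrow> w1 \<ge> w2 \<Longrightarrow> G1 t x w1 p X \<ge> G1 t x w2 p X"
    and mono2: "\<And>t x p X w1 w2. t \<in> {0<..T} \<Longrightarrow> x \<in> \<Omega> \<Longrightarrow> X \<in> sym_mats \<Longrightarrow> w1 \<ge> w2 \<Longrightarrow> G2 t x w1 p X \<ge> G2 t x w2 p X"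
    and f: "f = (\<lambda>t. sup_conv \<epsilon> \<Omega> u1 t xb + sup_conv \<epsilon> \<Omega> u2 t yb)"
  shows "set_integrable lborel {0<..<tb} (K_integrand \<alpha> f tb)"
    and "\<exists>X\<in>sym_mats. \<exists>Y\<in>sym_mats. \<exists>x'\<in>cball xb (sqrt (2 * M0 * \<epsilon>)). \<exists>y'\<in>cball yb (sqrt (2 * M0 * \<epsilon>)).
      (\<forall>\<xi>. - (2 * inverse \<epsilon>) * (norm \<xi>)\<^sup>2 \<le> \<xi> \<bullet> (X *v \<xi>)) \<and>
      (\<forall>\<xi>. - (2 * inverse \<epsilon>) * (norm \<xi>)\<^sup>2 \<le> \<xi> \<bullet> (Y *v \<xi>)) \<and>
      (\<forall>\<xi> \<zeta>. \<xi> \<bullet> (X *v \<xi>) + \<zeta> \<bullet> (Y *v \<zeta>) \<le> H (0, \<xi>, \<zeta>) (0, \<xi>, \<zeta>)) \<and>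
      J_op \<alpha> f tb + K_op \<alpha> 0 tb f tb
        + G1 tb x' (sup_conv \<epsilon> \<Omega> u1 tb xb) (grad (\<lambda>x. \<phi> tb x yb) xb) X
        + G2 tb y' (sup_conv \<epsilon> \<Omega> u2 tb yb) (grad (\<lambda>y. \<phi> tb xb y) yb) Y \<le> 0"
proof -
  interpret A: sup_conv_data T \<epsilon> M0 \<Omega> u1 by (rule A)
  let ?rad = "sqrt (2 * M0 * \<epsilon>)"
  let ?P1 = "grad (\<lambda>x. \<phi> tb x yb) xb" and ?P2 = "grad (\<lambda>y. \<phi> tb xb y) yb"
  let ?g = "\<lambda>\<tau>. (f tb - f (max (tb - \<tau>) 0)) / \<tau> powr (\<alpha> + 1)"
  let ?I = "\<alpha> / Gamma (1 - \<alpha>) * (LINT \<tau>:{0<..}|lborel. ?g \<tau>)"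
  define e where "e n = 5 / real (Suc n)" for n
  have e: "e \<longlonglongrightarrow> 0" "\<And>n. e n \<le> 5" unfolding e_def
    by (rule LIMSEQ_Suc[OF lim_const_over_n]) (simp add: field_simps)
  define good where "good n X Y x' y' \<longleftrightarrow>
      (\<forall>\<xi>. - (2 * inverse \<epsilon>) * (norm \<xi>)\<^sup>2 \<le> \<xi> \<bullet> (X *v \<xi>)) \<and>
      (\<forall>\<xi>. - (2 * inverse \<epsilon>) * (norm \<xi>)\<^sup>2 \<le> \<xi> \<bullet> (Y *v \<xi>)) \<and>
      (\<forall>\<xi> \<zeta>. \<xi> \<bullet> (X *v \<xi>) + \<zeta> \<bullet> (Y *v \<zeta>) \<le> majorant_form H (1 / real (Suc n)) (\<xi>, \<zeta>) (\<xi>, \<zeta>)) \<and>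
      set_integrable lborel {0<..} ?g \<and>
      ?I + G1 tb x' (sup_conv \<epsilon> \<Omega> u1 tb xb) ?P1 X + G2 tb y' (sup_conv \<epsilon> \<Omega> u2 tb yb) ?P2 Y \<le> 0"
    for n X Y x' y'
  have ex: "\<forall>n. \<exists>X Y x' y'. X \<in> sym_mats \<and> Y \<in> sym_mats \<and> x' \<in> cball xb ?rad \<and> y' \<in> cball yb ?rad \<and> good n X Y x' y'"
  proof
    fix n
    have "0 < 1 / real (Suc n)" by simp
    from doubled_data_of_C2[OF A B tb \<Omega> r f' H d max this]
    obtain r0 c where D: "doubled_data T \<epsilon> M0 \<Omega> u1 u2 tb r r0 (1 / real (Suc n)) (f' (tb, xb, yb) (1, 0, 0)) c xb yb
      ?P1 ?P2 (majorant_form H (1 / real (Suc n)))" by blast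
    show "\<exists>X Y x' y'. X \<in> sym_mats \<and> Y \<in> sym_mats \<and> x' \<in> cball xb ?rad \<and> y' \<in> cball yb ?rad \<and> good n X Y x' y'"
      using doubled_data.limit_exists[OF D \<alpha> test cont1 cont2 mono1 mono2 f]
      unfolding good_def A.rad_def by blast
  qed
  obtain X Y x' y' where S: "\<And>n. X n \<in> sym_mats" "\<And>n. Y n \<in> sym_mats" "\<And>n. x' n \<in> cball xb ?rad" "\<And>n. y' n \<in> cball yb ?rad"
    and g: "\<And>n. good n (X n) (Y n) (x' n) (y' n)"
    using ex by metis
  note good = g[unfolded good_def]
  have int: "set_integrable lborel {0<..} ?g" using good[of 0] by blast
  have "set_integrable lborel {0<..<tb} ?g" by (rule set_integrable_subset[OF int]) auto
  also have "?this \<longleftrightarrow> set_integrable lborel {0<..<tb} (K_integrand \<alpha> f tb)"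
    by (intro set_integrable_cong) (auto simp: K_integrand_def max_def)
  finally show Kint: "set_integrable lborel {0<..<tb} (K_integrand \<alpha> f tb)" .
  have I: "J_op \<alpha> f tb + K_op \<alpha> 0 tb f tb = ?I" using J_K_op_half_line(2)[OF \<alpha> _ Kint] tb by simp
  have rsub: "cball xb ?rad \<subseteq> \<Omega>" "cball yb ?rad \<subseteq> \<Omega>" using r by auto
  have upper: "\<xi> \<bullet> (X n *v \<xi>) + \<zeta> \<bullet> (Y n *v \<zeta>) \<le> H (0, \<xi>, \<zeta>) (0, \<xi>, \<zeta>) + e n * ((norm \<xi>)\<^sup>2 + (norm \<zeta>)\<^sup>2)" for n \<xi> \<zeta>
  proof -
    have "majorant_form H (1 / real (Suc n)) (\<xi>, \<zeta>) (\<xi>, \<zeta>) = H (0, \<xi>, \<zeta>) (0, \<xi>, \<zeta>) + e n * ((norm \<xi>)\<^sup>2 + (norm \<zeta>)\<^sup>2)"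
      by (simp add: majorant_form_def e_def power2_norm_eq_inner)
    moreover have "\<xi> \<bullet> (X n *v \<xi>) + \<zeta> \<bullet> (Y n *v \<zeta>) \<le> majorant_form H (1 / real (Suc n)) (\<xi>, \<zeta>) (\<xi>, \<zeta>)"
      using good[of n] by blast
    ultimately show ?thesis by simp
  qed
  have Hb: "H (0, \<xi>, \<zeta>) (0, \<xi>, \<zeta>) \<le> norm H * ((norm \<xi>)\<^sup>2 + (norm \<zeta>)\<^sup>2)" for \<xi> \<zeta>
  proof -
    let ?z = "(0 :: real, \<xi>, \<zeta>)"
    have "H ?z ?z \<le> norm (H ?z) * norm ?z" 
      by (rule order_trans[OF abs_ge_self norm_blinfun[of "H ?z" ?z, unfolded real_norm_def]])
    also have "\<dots> \<le> norm H * norm ?z * norm ?z" by (intro mult_right_mono norm_blinfun norm_ge_zero)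
    also have "\<dots> = norm H * (norm ?z)\<^sup>2" by (simp only: power2_eq_square mult.assoc)
    also have "(norm ?z)\<^sup>2 = (norm \<xi>)\<^sup>2 + (norm \<zeta>)\<^sup>2" by (simp add: norm_Pair)
    finally show ?thesis .
  qed
  have c1: "continuous_on (cball xb ?rad \<times> sym_mats) (\<lambda>(x, X). G1 tb x (sup_conv \<epsilon> \<Omega> u1 tb xb) ?P1 X)"
    using continuous_on_compose2[OF cont1, of "cball xb ?rad \<times> sym_mats" "\<lambda>(x, X). (tb, x, sup_conv \<epsilon> \<Omega> u1 tb xb, ?P1, X)"]
      tb rsub(1) by (force simp: case_prod_unfold intro!: continuous_intros)
  have c2: "continuous_on (cball yb ?rad \<times> sym_mats) (\<lambda>(x, X). G2 tb x (sup_conv \<epsilon> \<Omega> u2 tb yb) ?P2 X)"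
    using continuous_on_compose2[OF cont2, of "cball yb ?rad \<times> sym_mats" "\<lambda>(x, X). (tb, x, sup_conv \<epsilon> \<Omega> u2 tb yb, ?P2, X)"]
      tb rsub(2) by (force simp: case_prod_unfold intro!: continuous_intros)
  show "\<exists>X\<in>sym_mats. \<exists>Y\<in>sym_mats. \<exists>x'\<in>cball xb (sqrt (2 * M0 * \<epsilon>)). \<exists>y'\<in>cball yb (sqrt (2 * M0 * \<epsilon>)).
      (\<forall>\<xi>. - (2 * inverse \<epsilon>) * (norm \<xi>)\<^sup>2 \<le> \<xi> \<bullet> (X *v \<xi>)) \<and>
      (\<forall>\<xi>. - (2 * inverse \<epsilon>) * (norm \<xi>)\<^sup>2 \<le> \<xi> \<bullet> (Y *v \<xi>)) \<and>
      (\<forall>\<xi> \<zeta>. \<xi> \<bullet> (X *v \<xi>) + \<zeta> \<bullet> (Y *v \<zeta>) \<le> H (0, \<xi>, \<zeta>) (0, \<xi>, \<zeta>)) \<and>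
      J_op \<alpha> f tb + K_op \<alpha> 0 tb f tb
        + G1 tb x' (sup_conv \<epsilon> \<Omega> u1 tb xb) (grad (\<lambda>x. \<phi> tb x yb) xb) X
        + G2 tb y' (sup_conv \<epsilon> \<Omega> u2 tb yb) (grad (\<lambda>y. \<phi> tb xb y) yb) Y \<le> 0"
    unfolding I
    by (rule sym_matrix_pair_limit[where e = e and C = "norm H" and E = 5, OF S(1,2) _ _ upper Hb e compact_cball compact_cball S(3,4) c1 c2])
      (use good in blast)+
qed

theorem lemma3p2:
  fixes T \<alpha> \<epsilon> M tb :: real
    and \<Omega> \<Omega>\<epsilon> :: "(real^'n) set"
    and F :: "real \<Rightarrow> real^'n \<Rightarrow> real \<Rightarrow> real^'n \<Rightarrow> real^'n^'n \<Rightarrow> real"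
    and u v :: "real \<Rightarrow> real^'n \<Rightarrow> real"
    and \<phi> :: "real \<Rightarrow> real^'n \<Rightarrow> real^'n \<Rightarrow> real"
    and xb yb :: "real^'n"
  assumes T: "T > 0"
    and \<alpha>: "0 < \<alpha>" "\<alpha> < 1"
    and \<Omega>: "open \<Omega>" "connected \<Omega>" "\<Omega> \<noteq> {}" "bounded \<Omega>"
    and F_cont: "continuous_on ({0<..T} \<times> \<Omega> \<times> UNIV \<times> UNIV \<times> sym_mats)
                   (\<lambda>(t, x, w, p, X). F t x w p X)"
    and F_mono: "\<And>t x p X w1 w2. t \<in> {0<..T} \<Longrightarrow> x \<in> \<Omega> \<Longrightarrow> X \<in> sym_mats \<Longrightarrow> w1 \<ge> w2
                   \<Longrightarrow> F t x w1 p X \<ge> F t x w2 p X"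
    and u_bdd: "bounded ((\<lambda>(t, x). u t x) ` ({0..T} \<times> \<Omega>))"
    and v_bdd: "bounded ((\<lambda>(t, x). v t x) ` ({0..T} \<times> \<Omega>))"
    and u_sub: "viscosity_subsolution \<alpha> T \<Omega> F u"
    and v_super: "viscosity_supersolution \<alpha> T \<Omega> F v"
    and \<phi>: "C2_on ({0..T} \<times> \<Omega> \<times> \<Omega>) (\<lambda>(t, x, y). \<phi> t x y)"
    and \<epsilon>: "\<epsilon> > 0"
    and M: "M = max (sqrt (2 * (SUP (t, x)\<in>{0..T} \<times> \<Omega>. \<bar>u t x\<bar>)))
                    (sqrt (2 * (SUP (t, x)\<in>{0..T} \<times> \<Omega>. \<bar>v t x\<bar>)))"
    and \<Omega>\<epsilon>: "\<Omega>\<epsilon> = {x \<in> \<Omega>. infdist x (frontier \<Omega>) > M * sqrt \<epsilon>}"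
    and bar: "tb \<in> {0<..T}" "xb \<in> \<Omega>\<epsilon>" "yb \<in> \<Omega>\<epsilon>"
    and max: "\<And>t x y. t \<in> {0..T} \<Longrightarrow> x \<in> closure \<Omega>\<epsilon> \<Longrightarrow> y \<in> closure \<Omega>\<epsilon> \<Longrightarrow>
                sup_conv \<epsilon> \<Omega> u t x - inf_conv \<epsilon> \<Omega> v t y - \<phi> t x y
                \<le> sup_conv \<epsilon> \<Omega> u tb xb - inf_conv \<epsilon> \<Omega> v tb yb - \<phi> tb xb yb"
  shows "\<exists>X\<in>sym_mats. \<exists>Y\<in>sym_mats.
      (- (2 / \<epsilon>)) *\<^sub>R block_diag (mat 1) (mat 1) \<preceq> block_diag X Y \<and>
      block_diag X Y \<preceq> hessian_xy (\<phi> tb) xb yb \<and>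
      K0_exists \<alpha> (\<lambda>t. sup_conv \<epsilon> \<Omega> u t xb - inf_conv \<epsilon> \<Omega> v t yb) tb \<and>
      J_op \<alpha> (\<lambda>t. sup_conv \<epsilon> \<Omega> u t xb) tb - J_op \<alpha> (\<lambda>t. inf_conv \<epsilon> \<Omega> v t yb) tb
        + K0 \<alpha> (\<lambda>t. sup_conv \<epsilon> \<Omega> u t xb - inf_conv \<epsilon> \<Omega> v t yb) tb
        + F_min F (M * sqrt \<epsilon>) tb xb (sup_conv \<epsilon> \<Omega> u tb xb)
            (grad (\<lambda>x. \<phi> tb x yb) xb) X
        - F_max F (M * sqrt \<epsilon>) tb yb (inf_conv \<epsilon> \<Omega> v tb yb)
            (- grad (\<lambda>y. \<phi> tb xb y) yb) (- Y)
        \<le> 0"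
proof -
  define R where "R = M * sqrt \<epsilon>"
  have M1: "sqrt (2 * (SUP (t, x)\<in>{0..T} \<times> \<Omega>. \<bar>u t x\<bar>)) \<le> M" "sqrt (2 * (SUP (t, x)\<in>{0..T} \<times> \<Omega>. \<bar>v t x\<bar>)) \<le> M"
    unfolding M by simp_all
  have ubd: "\<bar>u t x\<bar> \<le> M\<^sup>2 / 2" and vbd: "\<bar>v t x\<bar> \<le> M\<^sup>2 / 2" if "t \<in> {0..T}" "x \<in> \<Omega>" for t x
    using le_sup_sqrt[OF u_bdd M1(1)] le_sup_sqrt[OF v_bdd M1(2)] that by blast+
  obtain x0 where x0: "x0 \<in> \<Omega>" using \<Omega>(3) by blast
  have "0 \<le> (SUP (t, x)\<in>{0..T} \<times> \<Omega>. \<bar>u t x\<bar>)"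
  proof -
    obtain B where B: "\<And>z. z \<in> {0..T} \<times> \<Omega> \<Longrightarrow> \<bar>case z of (t, x) \<Rightarrow> u t x\<bar> \<le> B"
      using u_bdd unfolding bounded_iff by fastforce
    have "\<bar>u 0 x0\<bar> \<le> (SUP (t, x)\<in>{0..T} \<times> \<Omega>. \<bar>u t x\<bar>)"
      using cSUP_upper[of "(0, x0)" "{0..T} \<times> \<Omega>" "\<lambda>(t, x). \<bar>u t x\<bar>"] x0 T B
      by (force intro!: bdd_aboveI2[of _ _ B] simp: case_prod_unfold)
    then show ?thesis by linarith
  qed
  then have M0: "0 \<le> M" using M1(1) by (intro order_trans[OF _ M1(1)]) simp
  have R0: "0 \<le> R" using M0 \<epsilon> by (simp add: R_def)
  \<comment> \<open>\<open>M\<^sup>2 / 2\<close> bounds both functions and makes the radius of the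
    sup-convolutions equal to the radius of the balls in the theorem.\<close>
  have Req: "sqrt (2 * (M\<^sup>2 / 2) * \<epsilon>) = R" using M0 by (simp add: R_def real_sqrt_mult)
  have usc: "usc_on ({0..T} \<times> \<Omega>) (\<lambda>(t, x). u t x)" using u_sub by (simp add: viscosity_subsolution_def)
  have "lsc_on ({0..T} \<times> \<Omega>) (\<lambda>(t, x). v t x)" using v_super by (simp add: viscosity_supersolution_def)
  then have "usc_on ({0..T} \<times> \<Omega>) (\<lambda>z. - (\<lambda>(t, x). v t x) z)" by (rule lsc_on_imp_usc_on_uminus)
  then have lsc: "usc_on ({0..T} \<times> \<Omega>) (\<lambda>(t, x). - v t x)" by (simp add: case_prod_unfold)
  have A: "sup_conv_data T \<epsilon> (M\<^sup>2 / 2) \<Omega> u"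
    using T \<epsilon> \<Omega> usc ubd by unfold_locales auto
  have B: "sup_conv_data T \<epsilon> (M\<^sup>2 / 2) \<Omega> (\<lambda>t x. - v t x)"
    using T \<epsilon> \<Omega> lsc vbd by unfold_locales auto
  let ?D = "\<lambda>x. infdist x (frontier \<Omega>)"
  have xyb: "xb \<in> \<Omega>" "yb \<in> \<Omega>" "R < ?D xb" "R < ?D yb" using bar \<Omega>\<epsilon> by (auto simp: R_def)
  \<comment> \<open>The smaller excess of the two distances to the boundary over \<open>R\<close>.
    Points within \<open>d\<close> of \<open>xb\<close> or \<open>yb\<close> belong to
    \<open>\<Omega>\<epsilon>\<close>, so the maximum may be used on these balls, and half of
    \<open>d\<close> enlarges \<open>R\<close> to a radius whose closed balls still lie in
    \<open>\<Omega>\<close>.\<close>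
  define d where "d = min (?D xb - R) (?D yb - R)"
  have d: "0 < d" "R + d \<le> ?D xb" "R + d \<le> ?D yb" using xyb by (auto simp: d_def)
  define r where "r = R + d / 2"
  have r: "R < r" "cball xb r \<subseteq> \<Omega>" "cball yb r \<subseteq> \<Omega>"
    using d ball_infdist_frontier_subset[OF xyb(1)] ball_infdist_frontier_subset[OF xyb(2)] by (force simp: r_def)+
  have near: "z \<in> closure \<Omega>\<epsilon>" if z: "dist x z < d" and x: "x \<in> \<Omega>" "R + d \<le> ?D x" for x z
  proof -
    have "?D x \<le> ?D z + dist x z" by (rule infdist_triangle)
    then have "R < ?D z" using z x(2) by linarith
    moreover have "z \<in> \<Omega>" using ball_infdist_frontier_subset[OF x(1)] z x(2) R0 by (force simp: subset_iff)
    ultimately show ?thesis using closure_subset[of \<Omega>\<epsilon>] by (auto simp: \<Omega>\<epsilon> R_def)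
  qed
  obtain f' f'' where f': "\<And>z. z \<in> {0..T} \<times> \<Omega> \<times> \<Omega> \<Longrightarrow>
      ((\<lambda>(t, x, y). \<phi> t x y) has_derivative blinfun_apply (f' z)) (at z within {0..T} \<times> \<Omega> \<times> \<Omega>)"
    and f'': "\<And>z. z \<in> {0..T} \<times> \<Omega> \<times> \<Omega> \<Longrightarrow>
      (f' has_derivative blinfun_apply (f'' z)) (at z within {0..T} \<times> \<Omega> \<times> \<Omega>)"
    using \<phi> unfolding C2_on_def by blast
  have tb: "tb \<in> {0..T}" using bar by auto
  have H: "(f' has_derivative blinfun_apply (f'' (tb, xb, yb))) (at (tb, xb, yb) within {0..T} \<times> \<Omega> \<times> \<Omega>)"
    using f'' tb xyb by blast
  let ?P1 = "grad (\<lambda>x. \<phi> tb x yb) xb" and ?P2 = "grad (\<lambda>y. \<phi> tb xb y) yb"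
  define f where "f = (\<lambda>t. sup_conv \<epsilon> \<Omega> u t xb - inf_conv \<epsilon> \<Omega> v t yb)"
  have fs: "f = (\<lambda>t. sup_conv \<epsilon> \<Omega> u t xb + sup_conv \<epsilon> \<Omega> (\<lambda>t x. - v t x) t yb)"
    by (simp add: f_def sup_conv_uminus)
  have mx: "sup_conv \<epsilon> \<Omega> u t x + sup_conv \<epsilon> \<Omega> (\<lambda>t x. - v t x) t y - \<phi> t x y
      \<le> sup_conv \<epsilon> \<Omega> u tb xb + sup_conv \<epsilon> \<Omega> (\<lambda>t x. - v t x) tb yb - \<phi> tb xb yb"
    if "t \<in> {0..T}" "x \<in> ball xb d" "y \<in> ball yb d" for t x y
    using max[OF that(1) near[of xb x] near[of yb y]] that xyb d by (simp add: sup_conv_uminus)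
  note r' = r(1)[folded Req] r(2,3)
  have mono2: "- F t x (- w1) (- p) (- X) \<ge> - F t x (- w2) (- p) (- X)"
    if "t \<in> {0<..T}" "x \<in> \<Omega>" "X \<in> sym_mats" "w1 \<ge> w2" for t x p X w1 w2
    using F_mono[OF that(1,2) uminus_sym_mats[OF that(3)], of "- w1" "- w2" "- p"] that(4) by simp
  \<comment> \<open>The second function is \<open>- v\<close> with the reflected nonlinearity. Its
    gradient and matrix therefore reappear in \<open>F\<close> with opposite signs, as in the
    claim.\<close>
  note inequality = sup_conv_maximum_inequality[OF A B bar(1) \<Omega>(1) r' f' H d(1) mx \<alpha> subsolution_touch_test[OF u_sub]
    supersolution_touch_test[OF \<Omega>(1) v_super] F_cont continuous_on_reflected[OF F_cont] F_mono mono2 fs, unfolded Req]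
  have int: "set_integrable lborel {0<..<tb} (K_integrand \<alpha> f tb)"
    by (rule inequality(1)) assumption+
  have "\<exists>X\<in>sym_mats. \<exists>Y\<in>sym_mats. \<exists>x'\<in>cball xb R. \<exists>y'\<in>cball yb R.
      (\<forall>\<xi>. - (2 * inverse \<epsilon>) * (norm \<xi>)\<^sup>2 \<le> \<xi> \<bullet> (X *v \<xi>)) \<and>
      (\<forall>\<xi>. - (2 * inverse \<epsilon>) * (norm \<xi>)\<^sup>2 \<le> \<xi> \<bullet> (Y *v \<xi>)) \<and>
      (\<forall>\<xi> \<zeta>. \<xi> \<bullet> (X *v \<xi>) + \<zeta> \<bullet> (Y *v \<zeta>) \<le> f'' (tb, xb, yb) (0, \<xi>, \<zeta>) (0, \<xi>, \<zeta>)) \<and>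
      J_op \<alpha> f tb + K_op \<alpha> 0 tb f tb + F tb x' (sup_conv \<epsilon> \<Omega> u tb xb) ?P1 X
        + - F tb y' (- sup_conv \<epsilon> \<Omega> (\<lambda>t x. - v t x) tb yb) (- ?P2) (- Y) \<le> 0"
    by (rule inequality(2)) assumption+
  then obtain X Y x' y' where S: "X \<in> sym_mats" "Y \<in> sym_mats" "x' \<in> cball xb R" "y' \<in> cball yb R"
    and lower: "\<And>\<xi>. - (2 * inverse \<epsilon>) * (norm \<xi>)\<^sup>2 \<le> \<xi> \<bullet> (X *v \<xi>)" "\<And>\<xi>. - (2 * inverse \<epsilon>) * (norm \<xi>)\<^sup>2 \<le> \<xi> \<bullet> (Y *v \<xi>)"
    and upper: "\<And>\<xi> \<zeta>. \<xi> \<bullet> (X *v \<xi>) + \<zeta> \<bullet> (Y *v \<zeta>) \<le> f'' (tb, xb, yb) (0, \<xi>, \<zeta>) (0, \<xi>, \<zeta>)"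
    and le: "J_op \<alpha> f tb + K_op \<alpha> 0 tb f tb + F tb x' (sup_conv \<epsilon> \<Omega> u tb xb) ?P1 X
        + - F tb y' (- sup_conv \<epsilon> \<Omega> (\<lambda>t x. - v t x) tb yb) (- ?P2) (- Y) \<le> 0"
    by blast
  have rad: "sup_conv_data.rad \<epsilon> (M\<^sup>2 / 2) < r"
    unfolding sup_conv_data.rad_def[OF A] using r'(1) .
  have "f \<in> borel_measurable (restrict_space borel {0..T})"
    unfolding fs by (intro borel_measurable_add sup_conv_data.U_measurable[OF A r(2) rad] sup_conv_data.U_measurable[OF B r(3) rad])
  then have meas: "f \<in> borel_measurable (restrict_space borel {0..tb})"
    by (rule measurable_restrict_mono) (use bar(1) in auto)
  have Fc: "continuous_on (cball x R) (\<lambda>x'. F tb x' w p Z)" if "cball x r \<subseteq> \<Omega>" "Z \<in> sym_mats" for x w p Z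
    using continuous_on_compose2[OF F_cont, of "cball x R" "\<lambda>x'. (tb, x', w, p, Z)"] that bar(1) r(1)
    by (force intro!: continuous_intros)
  have Jeq: "J_op \<alpha> f tb = J_op \<alpha> (\<lambda>t. sup_conv \<epsilon> \<Omega> u t xb) tb - J_op \<alpha> (\<lambda>t. inf_conv \<epsilon> \<Omega> v t yb) tb"
    by (simp add: J_op_def f_def diff_divide_distrib)
  have "(- (2 / \<epsilon>)) *\<^sub>R block_diag (mat 1) (mat 1) \<preceq> block_diag X Y"
    unfolding loewner_le_def
  proof
    fix \<xi> :: "real^('n + 'n)"
    have "\<xi> \<bullet> (((- (2 / \<epsilon>)) *\<^sub>R block_diag (mat 1) (mat 1)) *v \<xi>) = - (2 / \<epsilon>) * (\<xi> \<bullet> (block_diag (mat 1) (mat 1) *v \<xi>))"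
      by (simp only: scaleR_matrix_vector_assoc[symmetric] inner_scaleR_right)
    also have "\<dots> = - (2 * inverse \<epsilon>) * (norm (left \<xi>))\<^sup>2 + - (2 * inverse \<epsilon>) * (norm (right \<xi>))\<^sup>2"
      by (simp add: block_diag_quadratic power2_norm_eq_inner divide_inverse distrib_left)
    also have "\<dots> \<le> \<xi> \<bullet> (block_diag X Y *v \<xi>)"
      unfolding block_diag_quadratic by (intro add_mono lower)
    finally show "\<xi> \<bullet> (((- (2 / \<epsilon>)) *\<^sub>R block_diag (mat 1) (mat 1)) *v \<xi>) \<le> \<xi> \<bullet> (block_diag X Y *v \<xi>)" .
  qed
  moreover have "block_diag X Y \<preceq> hessian_xy (\<phi> tb) xb yb"
    unfolding loewner_le_def
  proof
    fix \<xi> :: "real^('n + 'n)"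
    have "\<xi> \<bullet> (hessian_xy (\<phi> tb) xb yb *v \<xi>) = f'' (tb, xb, yb) (0, left \<xi>, right \<xi>) (0, left \<xi>, right \<xi>)"
      by (rule C2_slice_derivatives(3)[OF \<Omega>(1) tb xyb(1,2) f' H])
    then show "\<xi> \<bullet> (block_diag X Y *v \<xi>) \<le> \<xi> \<bullet> (hessian_xy (\<phi> tb) xb yb *v \<xi>)"
      using upper[of "left \<xi>" "right \<xi>"] by (simp only: block_diag_quadratic)
  qed
  moreover have "K0_exists \<alpha> f tb" by (rule K0_existsI[OF int meas])
  \<comment> \<open>The inequality is known with some points \<open>x'\<close> and \<open>y'\<close>
    of the closed balls; minimum and maximum over the balls only decrease its left-hand
    side.\<close>
  moreover have "J_op \<alpha> (\<lambda>t. sup_conv \<epsilon> \<Omega> u t xb) tb - J_op \<alpha> (\<lambda>t. inf_conv \<epsilon> \<Omega> v t yb) tb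
        + K0 \<alpha> f tb
        + F_min F R tb xb (sup_conv \<epsilon> \<Omega> u tb xb) ?P1 X
        - F_max F R tb yb (inf_conv \<epsilon> \<Omega> v tb yb) (- ?P2) (- Y) \<le> 0"
    using le F_min_le[of xb R F tb "sup_conv \<epsilon> \<Omega> u tb xb" ?P1 X x', OF Fc[OF r(2) S(1)] R0 S(3)]
      F_max_ge[of yb R F tb "inf_conv \<epsilon> \<Omega> v tb yb" "- ?P2" "- Y" y', OF Fc[OF r(3) uminus_sym_mats[OF S(2)]] R0 S(4)]
    unfolding K0_eq[OF int] Jeq sup_conv_uminus minus_minus by linarith
  ultimately show ?thesis using S(1,2) unfolding f_def R_def by blast
qed

end
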